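(* Let $V\in C^\infty([0,\infty))$ be real-valued and suppose that for some $\alpha>0$ one has $V(x)=-\tfrac14 x^{-2}[1+r(x)]$ for all $x\ge 1$, where $|r^{(k)}(x)|\le c_k x^{-\alpha-k}$ for all $x\ge 1$, $k\in\mathbb{N}_0$ (for some constants $c_k$). Assume that there exist no $E<0$ and no nontrivial $h\in L^2((0,\infty))\cap C^\infty([0,\infty))$ with $h'(0)=0$ and $-h''+Vh=Eh$. Assume moreover that $V^{(2j+1)}(0)=0$ for all $j\in\mathbb{N}_0$. Then there exist constants $C_k>0$ such that for all even $f,g\in\mathcal{S}(\mathbb{R})$ the solution $u$ of $\partial_t^2u(t,\cdot)+Au(t,\cdot)=0$, $u(0,\cdot)=f$, $\partial_tu(t,\cdot)|_{t=0}=g$ satisfies $$\|\nabla u(t,\cdot)\|_{H^k(\mathbb{R}_+)}\le C_k\left(\|f\|_{H^{1+k}(\mathbb{R}_+)}+\|g\|_{H^k(\mathbb{R}_+)}+\|g\|_{L^1(\mathbb{R}_+)}\right)$$ for all $t\ge0$ and $k\in\mathbb{N}_0$.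
   Context: $\mathbb{R}_+:=[0,\infty)$, $\mathbb{N}_0=\{0,1,2,\dots\}$; $\nabla=\partial_x$; $H^k(\mathbb{R}_+)$ is the standard $L^2$-based Sobolev space; $\mathcal{S}(\mathbb{R})$ is the Schwartz space, and its elements are restricted to $\mathbb{R}_+$ where appropriate. $Af:=-f''+Vf$ is the self-adjoint, nonnegative operator on $L^2(\mathbb{R}_+)$ with domain $\{f\in L^2(\mathbb{R}_+): f,f'\in AC_{loc}(\mathbb{R}_+),\ f'(0)=0,\ f''\in L^2(\mathbb{R}_+)\}$. The solution of the initial value problem is $u(t,\cdot)=\cos(t\sqrt A)f+\frac{\sin(t\sqrt A)}{\sqrt A}g$ (functional calculus). *)

theory Defs
  imports "HOL-Analysis.Analysis"
begin

section \<open>Derivatives and smooth functions of one real variable\<close>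

text \<open>
  Derivatives are taken within \<open>S\<close>, hence they are one-sided at the endpoint when \<open>S = {0..}\<close>.
  For \<open>x \<in> S\<close> they depend only on the values of \<open>f\<close> on \<open>S\<close>; values outside \<open>S\<close>
  are irrelevant.
\<close>

definition nth_deriv :: "real set \<Rightarrow> nat \<Rightarrow> (real \<Rightarrow> 'a::real_normed_vector) \<Rightarrow> real \<Rightarrow> 'a" where
  "nth_deriv S n = ((\<lambda>f x. vector_derivative f (at x within S)) ^^ n)"

definition smooth_on :: "real set \<Rightarrow> (real \<Rightarrow> 'a::real_normed_vector) \<Rightarrow> bool" where
  "smooth_on S f \<longleftrightarrow> (\<forall>n. \<forall>x\<in>S. nth_deriv S n f differentiable (at x within S))"

definition schwartz :: "(real \<Rightarrow> complex) set" where
  "schwartz = {f. smooth_on UNIV f \<and>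
     (\<forall>m n. \<exists>K. \<forall>x. \<bar>x\<bar> ^ m * cmod (nth_deriv UNIV n f x) \<le> K)}"

definition even_fun :: "(real \<Rightarrow> complex) \<Rightarrow> bool" where
  "even_fun f \<longleftrightarrow> (\<forall>x. f (- x) = f x)"


section \<open>Lebesgue and Sobolev spaces on the half-line\<close>

text \<open>
  Elements of \<open>L\<^sup>2(\<real>\<^sub>+)\<close> are represented by functions on \<open>\<real>\<close> of which only
  the values on \<open>{0..}\<close> matter; equality of elements is \<open>L2_eq\<close>, equality almost everywhere.
\<close>

abbreviation halfline :: "real measure" where
  "halfline \<equiv> lebesgue_on {0..}"

definition L2 :: "(real \<Rightarrow> complex) set" where
  "L2 = {f. f \<in> borel_measurable halfline \<and> integrable halfline (\<lambda>x. (cmod (f x))\<^sup>2)}"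

definition L2_eq :: "(real \<Rightarrow> complex) \<Rightarrow> (real \<Rightarrow> complex) \<Rightarrow> bool" where
  "L2_eq f g \<longleftrightarrow> (AE x in halfline. f x = g x)"

definition L2_inner :: "(real \<Rightarrow> complex) \<Rightarrow> (real \<Rightarrow> complex) \<Rightarrow> complex" where
  "L2_inner f g = (LINT x|halfline. f x * cnj (g x))"

definition L2_norm :: "(real \<Rightarrow> complex) \<Rightarrow> real" where
  "L2_norm f = sqrt (LINT x|halfline. (cmod (f x))\<^sup>2)"

definition L1_norm :: "(real \<Rightarrow> complex) \<Rightarrow> real" where
  "L1_norm f = (LINT x|halfline. cmod (f x))"

definition test_function :: "(real \<Rightarrow> complex) \<Rightarrow> bool" where
  "test_function \<phi> \<longleftrightarrow> smooth_on UNIV \<phi> \<and> (\<exists>a b. 0 < a \<and> (\<forall>x. x \<notin> {a..b} \<longrightarrow> \<phi> x = 0))"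

definition locally_integrable :: "(real \<Rightarrow> complex) \<Rightarrow> bool" where
  "locally_integrable f \<longleftrightarrow> (\<forall>a b. 0 < a \<longrightarrow> integrable (lebesgue_on {a..b}) f)"

definition has_weak_deriv :: "nat \<Rightarrow> (real \<Rightarrow> complex) \<Rightarrow> (real \<Rightarrow> complex) \<Rightarrow> bool" where
  "has_weak_deriv j f g \<longleftrightarrow> locally_integrable f \<and> locally_integrable g \<and>
     (\<forall>\<phi>. test_function \<phi> \<longrightarrow>
        (LINT x|halfline. f x * nth_deriv UNIV j \<phi> x) =
        (- 1) ^ j * (LINT x|halfline. g x * \<phi> x))"

definition sobolev :: "nat \<Rightarrow> (real \<Rightarrow> complex) set" where
  "sobolev k = {f \<in> L2. \<forall>j\<le>k. \<exists>g\<in>L2. has_weak_deriv j f g}"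

text \<open>
  Weak derivatives are unique up to null sets, so the choice below is immaterial for
  \<open>f \<in> sobolev k\<close>; the norm is meaningful only for such \<open>f\<close>.
\<close>

definition sobolev_norm :: "nat \<Rightarrow> (real \<Rightarrow> complex) \<Rightarrow> real" where
  "sobolev_norm k f = sqrt (\<Sum>j\<le>k. (L2_norm (SOME g. has_weak_deriv j f g))\<^sup>2)"


section \<open>The operator \<open>A f = - f'' + V f\<close>\<close>

definition AC_loc :: "(real \<Rightarrow> complex) \<Rightarrow> bool" where
  "AC_loc f \<longleftrightarrow> (\<forall>b>0. \<forall>\<epsilon>>0. \<exists>\<delta>>0. \<forall>(N::nat) s t.
     (\<forall>i<N. 0 \<le> s i \<and> s i \<le> t i \<and> t i \<le> b) \<and>
     disjoint_family_on (\<lambda>i. {s i<..<t i}) {..<N} \<and>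
     (\<Sum>i<N. t i - s i) < \<delta> \<longrightarrow>
     (\<Sum>i<N. cmod (f (t i) - f (s i))) < \<epsilon>)"

text \<open>
  Unbounded operators on \<open>L\<^sup>2(\<real>\<^sub>+)\<close> are represented by their graphs. In the following
  graph, \<open>F\<close> is the absolutely continuous representative of \<open>f\<close>, \<open>F1\<close> its derivative, which
  exists everywhere and is itself absolutely continuous, and \<open>F2\<close> its second derivative, which
  exists almost everywhere.
\<close>

definition schroedinger_op ::
    "(real \<Rightarrow> real) \<Rightarrow> ((real \<Rightarrow> complex) \<times> (real \<Rightarrow> complex)) set" where
  "schroedinger_op V = {(f, h). f \<in> L2 \<and> h \<in> L2 \<and>
     (\<exists>F F1 F2. L2_eq f F \<and> AC_loc F \<and> AC_loc F1 \<and>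
        (\<forall>x\<ge>0. (F has_vector_derivative F1 x) (at x within {0..})) \<and>
        F1 0 = 0 \<and>
        (AE x in halfline. (F1 has_vector_derivative F2 x) (at x within {0..})) \<and>
        F2 \<in> L2 \<and>
        L2_eq h (\<lambda>x. - F2 x + complex_of_real (V x) * F x))}"


section \<open>Spectral resolutions and functional calculus\<close>

definition orthogonal_projection :: "((real \<Rightarrow> complex) \<Rightarrow> (real \<Rightarrow> complex)) \<Rightarrow> bool" where
  "orthogonal_projection P \<longleftrightarrow>
     (\<forall>f\<in>L2. P f \<in> L2) \<and>
     (\<forall>f\<in>L2. \<forall>g\<in>L2. \<forall>a b.
        L2_eq (P (\<lambda>x. a * f x + b * g x)) (\<lambda>x. a * P f x + b * P g x)) \<and>
     (\<forall>f\<in>L2. L2_eq (P (P f)) (P f)) \<and>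
     (\<forall>f\<in>L2. \<forall>g\<in>L2. L2_inner (P f) g = L2_inner f (P g))"

definition projection_valued_measure ::
    "(real set \<Rightarrow> (real \<Rightarrow> complex) \<Rightarrow> (real \<Rightarrow> complex)) \<Rightarrow> bool" where
  "projection_valued_measure E \<longleftrightarrow>
     (\<forall>B\<in>sets borel. orthogonal_projection (E B)) \<and>
     (\<forall>f\<in>L2. L2_eq (E UNIV f) f) \<and>
     (\<forall>B f. range B \<subseteq> sets borel \<and> disjoint_family B \<and> f \<in> L2 \<longrightarrow>
        (\<lambda>n. L2_norm (\<lambda>x. E (\<Union>i. B i) f x - (\<Sum>i<n. E (B i) f x))) \<longlonglongrightarrow> 0)"

text \<open>The finite measure \<open>B \<mapsto> \<langle>E(B) f, f\<rangle> = \<parallel>E(B) f\<parallel>\<^sup>2\<close>.\<close>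

definition spectral_measure ::
    "(real set \<Rightarrow> (real \<Rightarrow> complex) \<Rightarrow> (real \<Rightarrow> complex)) \<Rightarrow> (real \<Rightarrow> complex) \<Rightarrow> real measure" where
  "spectral_measure E f = measure_of UNIV (sets borel) (\<lambda>B. ennreal ((L2_norm (E B f))\<^sup>2))"

text \<open>
  \<open>spectral_form E \<phi> f g\<close> is \<open>\<integral> \<phi>(l) d\<langle>E(l) f, g\<rangle>\<close>, the integral against the complex measure
  \<open>B \<mapsto> \<langle>E(B) f, g\<rangle>\<close> being written out by polarization (the inner product is
  linear in its first argument).
\<close>

definition spectral_form ::
    "(real set \<Rightarrow> (real \<Rightarrow> complex) \<Rightarrow> (real \<Rightarrow> complex)) \<Rightarrow> (real \<Rightarrow> real) \<Rightarrow>
     (real \<Rightarrow> complex) \<Rightarrow> (real \<Rightarrow> complex) \<Rightarrow> complex" where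
  "spectral_form E \<phi> f g =
     (\<Sum>k<4. \<i> ^ k * complex_of_real (LINT l|spectral_measure E (\<lambda>x. f x + \<i> ^ k * g x). \<phi> l)) / 4"

definition spectral_domain ::
    "(real set \<Rightarrow> (real \<Rightarrow> complex) \<Rightarrow> (real \<Rightarrow> complex)) \<Rightarrow> (real \<Rightarrow> real) \<Rightarrow> (real \<Rightarrow> complex) set" where
  "spectral_domain E \<phi> = {f \<in> L2. integrable (spectral_measure E f) (\<lambda>l. (\<phi> l)\<^sup>2)}"

text \<open>
  The graph of the operator \<open>\<integral> \<phi>(l) dE(l)\<close> for Borel measurable real-valued \<open>\<phi>\<close>. Since
  \<open>spectral_domain E \<phi>\<close> is dense, \<open>h\<close> is determined by \<open>f\<close> up to null sets; for bounded \<open>\<phi>\<close>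
  the domain is all of \<open>L2\<close>.
\<close>

definition spectral_integral ::
    "(real set \<Rightarrow> (real \<Rightarrow> complex) \<Rightarrow> (real \<Rightarrow> complex)) \<Rightarrow> (real \<Rightarrow> real) \<Rightarrow>
     ((real \<Rightarrow> complex) \<times> (real \<Rightarrow> complex)) set" where
  "spectral_integral E \<phi> = {(f, h). f \<in> spectral_domain E \<phi> \<and> h \<in> L2 \<and>
     (\<forall>g\<in>spectral_domain E \<phi>. L2_inner h g = spectral_form E \<phi> f g)}"

definition spectral_resolution ::
    "((real \<Rightarrow> complex) \<times> (real \<Rightarrow> complex)) set \<Rightarrow>
     (real set \<Rightarrow> (real \<Rightarrow> complex) \<Rightarrow> (real \<Rightarrow> complex)) \<Rightarrow> bool" where
  "spectral_resolution A E \<longleftrightarrow> projection_valued_measure E \<and> A = spectral_integral E (\<lambda>l. l)"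

text \<open>
  \<open>function_of_op A \<phi> f h\<close> states that \<open>h = \<phi>(A) f\<close>.  By the spectral theorem a self-adjoint \<open>A\<close>
  has a spectral resolution, and it is unique.
\<close>

definition function_of_op ::
    "((real \<Rightarrow> complex) \<times> (real \<Rightarrow> complex)) set \<Rightarrow> (real \<Rightarrow> real) \<Rightarrow>
     (real \<Rightarrow> complex) \<Rightarrow> (real \<Rightarrow> complex) \<Rightarrow> bool" where
  "function_of_op A \<phi> f h \<longleftrightarrow> (\<exists>E. spectral_resolution A E \<and> (f, h) \<in> spectral_integral E \<phi>)"

text \<open>
  \<open>u t = cos (t sqrt A) f + sin (t sqrt A) / sqrt A g\<close> for all \<open>t \<ge> 0\<close>. The function
  \<open>l \<mapsto> sin (t sqrt l) / sqrt l\<close> takes its limit value \<open>t\<close> at \<open>l = 0\<close>. For nonnegative \<open>A\<close> the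
  values at \<open>l < 0\<close> play no role.
\<close>

definition wave_solution ::
    "((real \<Rightarrow> complex) \<times> (real \<Rightarrow> complex)) set \<Rightarrow> (real \<Rightarrow> complex) \<Rightarrow> (real \<Rightarrow> complex) \<Rightarrow>
     (real \<Rightarrow> real \<Rightarrow> complex) \<Rightarrow> bool" where
  "wave_solution A f g u \<longleftrightarrow> (\<forall>t\<ge>0. \<exists>p q.
     function_of_op A (\<lambda>l. cos (t * sqrt l)) f p \<and>
     function_of_op A (\<lambda>l. if l = 0 then t else sin (t * sqrt l) / sqrt l) g q \<and>
     L2_eq (u t) (\<lambda>x. p x + q x))"

end

theory Submission imports Defs begin

text \<open>
  The estimate rests on energy identities and a low-energy bound and does not use the distorted
  Fourier transform. Because of the critical term \<open>- 1 / (4 x\<^sup>2)\<close>, a function \<open>f\<close> in the domain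
  with \<open>\<parallel>A f\<parallel> \<le> R\<^sup>-\<^sup>2 \<parallel>f\<parallel>\<close> satisfies \<open>\<parallel>f / (1 + x)\<parallel> \<le> C R powr (- 3/4) \<parallel>f\<parallel>\<close>: the quantity
  \<open>(\<bar>f\<bar>\<^sup>2 / 64 + \<bar>x f' - f / 2\<bar>\<^sup>2) / sqrt x\<close> is almost increasing in \<open>x\<close> and is small at some point
  between \<open>R\<close> and \<open>2 R\<close>. Interpolation with the energy identity bounds \<open>f\<close> in the supremum norm,
  hence by duality the spectral projection of \<open>g\<close> to \<open>\<bar>l\<bar> \<le> R\<^sup>-\<^sup>2\<close> by the \<open>L\<^sup>1\<close> norm of \<open>g\<close>.
  Summation over geometric blocks of the spectrum bounds \<open>q / (1 + x)\<close> in \<open>L\<^sup>2\<close> for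
  \<open>q = sin (t sqrt A) / sqrt A g\<close>, although \<open>q\<close> itself is not bounded uniformly in \<open>t\<close>.
  A derivative of the solution of order \<open>n \<ge> 1\<close> differs from \<open>\<plusminus> A\<^sup>n\<^sup>/\<^sup>2 q\<close>, respectively from the
  derivative of such a term, by lower-order terms whose coefficients are \<open>O (1 / (1 + x))\<close>, and the
  powers of \<open>A\<close> commute with the evolution.

  Negative energies need no separate argument: \<open>sqrt\<close> is an odd function here, so
  \<open>cos (t sqrt l)\<close> and \<open>sqrt \<bar>l\<bar> * (sin (t sqrt l) / sqrt l)\<close> are bounded by \<open>1\<close> also for \<open>l < 0\<close>.
\<close>

section \<open>Projection-valued measures\<close>

text \<open>The exponents come from one balance. The critical equation at zero energy has the
  solutions sqrt x and sqrt x * log x, so the quadratic quantity of the overview grows like x up to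
  logarithms. Division by sqrt x instead of x leaves a margin that absorbs the logarithm, the
  perturbation r and, by Cauchy-Schwarz, part of the source A f. The loss is the rate R^(-3/4) for
  the weighted norm, and it is affordable: interpolation gives R^(-3/8) for the supremum norm,
  duality gives R^(-3/8) for the projection of g, and the multiplier is of order R where |l| is of
  order R^(-2). A block of q thus has weighted norm of order R^(1 - 3/4 - 3/8) = R^(-1/8), which is
  summable over geometric R. What is needed of the functional calculus (existence, commutation with
  A, isometry, agreement with the given weak definition) rests on a single principle: an inequality
  between countably additive set functions may be checked on small cells of the spectrum, with an
  error that vanishes with the size of the cells.\<close>

definition sadd :: "(real set \<Rightarrow> real) \<Rightarrow> bool" where
  "sadd a \<longleftrightarrow> (\<forall>B::nat \<Rightarrow> real set. range B \<subseteq> sets borel \<longrightarrow> disjoint_family B \<longrightarrow>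
     (\<lambda>n. a (B n)) sums a (\<Union>n. B n))"

lemma saddD: "sadd a \<Longrightarrow> range B \<subseteq> sets borel \<Longrightarrow> disjoint_family B \<Longrightarrow> (\<lambda>n. a (B n)) sums a (\<Union>n. B n)"
  by (simp add: sadd_def)

lemma sadd_empty: assumes "sadd a" shows "a {} = 0"
proof -
  have "(\<lambda>n::nat. a {}) sums a (\<Union>n::nat. {})"
    using assms by (intro saddD) (auto simp: disjoint_family_on_def)
  then show ?thesis by (metis sums_summable summable_const_iff)
qed

lemma sadd_add: "sadd a \<Longrightarrow> sadd b \<Longrightarrow> sadd (\<lambda>B. a B + b B)"
  by (simp add: sadd_def sums_add)
lemma sadd_diff: "sadd a \<Longrightarrow> sadd b \<Longrightarrow> sadd (\<lambda>B. a B - b B)"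
  by (simp add: sadd_def sums_diff)
lemma sadd_mult: "sadd a \<Longrightarrow> sadd (\<lambda>B. k * a B)"
  by (simp add: sadd_def sums_mult)
lemma sadd_zero: "sadd (\<lambda>B. 0)"
  by (simp add: sadd_def)

lemma partition_le:
  assumes a: "sadd a" and b: "sadd b"
    and C: "range C \<subseteq> sets borel" "disjoint_family C" "(\<Union>n. C n) = B"
    and le: "\<And>n::nat. a (C n) \<le> b (C n)"
  shows "a B \<le> b B"
proof -
  have "(\<lambda>n. a (C n)) sums a B" "(\<lambda>n. b (C n)) sums b B"
    using saddD[OF a C(1,2)] saddD[OF b C(1,2)] C(3) by simp_all
  then show ?thesis using sums_le[of "\<lambda>n. a (C n)" "\<lambda>n. b (C n)", OF le] by simp
qed

text \<open>Sorting the points of B by the integer parts of \<open>\<phi> l / \<eta>\<close> and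
  \<open>l / \<eta>\<close> gives countably many cells on which both functions vary by at most
  \<eta>. The local inequalities add up by countable additivity, the error becomes
  \<open>\<eta> * c B\<close>, and \<eta> tends to 0. The restriction \<open>\<eta> \<le> 1\<close>
  lets an application absorb quadratic error terms into \<open>\<eta> * c\<close>.\<close>

lemma cell_le:
  fixes \<phi> :: "real \<Rightarrow> real"
  assumes phi: "\<phi> \<in> borel_measurable borel" and a: "sadd a" and b: "sadd b" and c: "sadd c"
    and B: "B \<in> sets borel"
    and le: "\<And>\<eta> D l0. 0 < \<eta> \<Longrightarrow> \<eta> \<le> 1 \<Longrightarrow> D \<in> sets borel \<Longrightarrow> D \<subseteq> B \<Longrightarrow> l0 \<in> D \<Longrightarrow>
      (\<And>l. l \<in> D \<Longrightarrow> \<bar>\<phi> l - \<phi> l0\<bar> \<le> \<eta>) \<Longrightarrow> (\<And>l. l \<in> D \<Longrightarrow> \<bar>l - l0\<bar> \<le> \<eta>) \<Longrightarrow> a D \<le> b D + \<eta> * c D"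
  shows "a B \<le> b B"
proof -
  have *: "a B \<le> b B + \<eta> * c B" if eta: "0 < \<eta>" "\<eta> \<le> 1" for \<eta> :: real
  proof -
    \<comment> \<open>The pair of integers is coded as a natural number because \<open>sadd\<close>
      speaks of sequences of sets; codes that do not occur give empty cells.\<close>
    define \<kappa> where "\<kappa> l = to_nat (\<lfloor>\<phi> l / \<eta>\<rfloor>, \<lfloor>l / \<eta>\<rfloor>)" for l :: real
    define C where "C n = {l \<in> B. \<kappa> l = n}" for n
    have m: "{l \<in> B. \<lfloor>\<phi> l / \<eta>\<rfloor> = i \<and> \<lfloor>l / \<eta>\<rfloor> = j} \<in> sets borel" for i j :: int
    proof -
      have m1: "(\<lambda>l. \<lfloor>\<phi> l / \<eta>\<rfloor>) \<in> borel \<rightarrow>\<^sub>M count_space UNIV"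
        using phi by measurable
      have m2: "(\<lambda>l. \<lfloor>l / \<eta>\<rfloor>) \<in> borel \<rightarrow>\<^sub>M count_space UNIV"
        by measurable
      have "B \<inter> ((\<lambda>l. \<lfloor>\<phi> l / \<eta>\<rfloor>) -` {i} \<inter> space borel) \<inter> ((\<lambda>l. \<lfloor>l / \<eta>\<rfloor>) -` {j} \<inter> space borel) \<in> sets borel"
        using measurable_sets[OF m1, of "{i}"] measurable_sets[OF m2, of "{j}"] B by (intro sets.Int) auto
      also have "B \<inter> ((\<lambda>l. \<lfloor>\<phi> l / \<eta>\<rfloor>) -` {i} \<inter> space borel) \<inter> ((\<lambda>l. \<lfloor>l / \<eta>\<rfloor>) -` {j} \<inter> space borel)
         = {l \<in> B. \<lfloor>\<phi> l / \<eta>\<rfloor> = i \<and> \<lfloor>l / \<eta>\<rfloor> = j}" by auto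
      finally show ?thesis .
    qed
    have Cm: "C n \<in> sets borel" for n
    proof (cases "\<exists>l. \<kappa> l = n")
      case True
      then obtain l where "\<kappa> l = n" by blast
      then have "C n = {l' \<in> B. \<lfloor>\<phi> l' / \<eta>\<rfloor> = \<lfloor>\<phi> l / \<eta>\<rfloor> \<and> \<lfloor>l' / \<eta>\<rfloor> = \<lfloor>l / \<eta>\<rfloor>}"
        by (auto simp: C_def \<kappa>_def)
      then show ?thesis using m by simp
    next
      case False
      then have "C n = {}" by (auto simp: C_def)
      then show ?thesis by simp
    qed
    have fl: "\<bar>x - y\<bar> \<le> \<eta>" if "\<lfloor>x / \<eta>\<rfloor> = \<lfloor>y / \<eta>\<rfloor>" for x y :: real
    proof -
      have "\<bar>x / \<eta> - y / \<eta>\<bar> \<le> 1" using that by linarith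
      then have "\<bar>x - y\<bar> / \<eta> \<le> 1" using eta by (simp add: diff_divide_distrib[symmetric])
      then show ?thesis using eta by (simp add: field_simps)
    qed
    have "a (C n) \<le> b (C n) + \<eta> * c (C n)" for n
    proof (cases "C n = {}")
      case True
      then show ?thesis using a b c by (simp add: sadd_empty)
    next
      case False
      then obtain l0 where l0: "l0 \<in> C n" by blast
      show ?thesis
      proof (rule le[OF eta Cm _ l0])
        show "C n \<subseteq> B" by (auto simp: C_def)
      next
        fix l assume "l \<in> C n"
        then have "\<kappa> l = \<kappa> l0" using l0 by (simp add: C_def)
        then have "\<lfloor>\<phi> l / \<eta>\<rfloor> = \<lfloor>\<phi> l0 / \<eta>\<rfloor>" "\<lfloor>l / \<eta>\<rfloor> = \<lfloor>l0 / \<eta>\<rfloor>" by (auto simp: \<kappa>_def)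
        then show "\<bar>\<phi> l - \<phi> l0\<bar> \<le> \<eta>" "\<bar>l - l0\<bar> \<le> \<eta>" using fl by blast+
      qed
    qed
    then show ?thesis
      using Cm by (intro partition_le[OF a sadd_add[OF b sadd_mult[OF c, of \<eta>]], of C B])
        (auto simp: C_def disjoint_family_on_def)
  qed
  have "((\<lambda>\<eta>. b B + \<eta> * c B) \<longlongrightarrow> b B + 0 * c B) (at_right 0)"
    by (intro tendsto_intros)
  moreover have "eventually (\<lambda>\<eta>. a B \<le> b B + \<eta> * c B) (at_right (0::real))"
    using * by (auto simp: eventually_at_right_field intro!: exI[of _ 1])
  ultimately show ?thesis
    using tendsto_lowerbound[of "\<lambda>\<eta>. b B + \<eta> * c B" _ "at_right 0" "a B"] by simp
qed

section \<open>Abstract projection-valued measures on a real Hilbert space\<close>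

lemma norm4:
  fixes a b c d :: "'a::real_normed_vector"
  shows "norm (a + b + c - d) \<le> norm a + norm b + norm c + norm d"
  by norm

text \<open>Only real-valued multipliers occur, so a real Hilbert space is enough. The complex
  structure returns in \<open>spectral_integral_iff\<close>, where a weak identity is tested against
  both g and \<open>\<i>\<close> times g.\<close>

locale pvm =
  fixes P :: "real set \<Rightarrow> 'a::{real_inner, complete_space} \<Rightarrow> 'a"
  assumes P_linear: "B \<in> sets borel \<Longrightarrow> linear (P B)"
    and P_idem: "B \<in> sets borel \<Longrightarrow> P B (P B x) = P B x"
    and P_sym: "B \<in> sets borel \<Longrightarrow> inner (P B x) y = inner x (P B y)"
    and P_UNIV: "P UNIV x = x"
    and P_sums: "range C \<subseteq> sets borel \<Longrightarrow> disjoint_family C \<Longrightarrow> (\<lambda>n::nat. P (C n) x) sums P (\<Union>n. C n) x"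
begin

lemma P_add: "B \<in> sets borel \<Longrightarrow> P B (x + y) = P B x + P B y"
  using P_linear linear_add by blast
lemma P_diff: "B \<in> sets borel \<Longrightarrow> P B (x - y) = P B x - P B y"
  using P_linear linear_diff by blast
lemma P_scale: "B \<in> sets borel \<Longrightarrow> P B (k *\<^sub>R x) = k *\<^sub>R P B x"
  using P_linear linear_cmul by blast
lemma P_sum: "B \<in> sets borel \<Longrightarrow> P B (\<Sum>i\<in>I. f i) = (\<Sum>i\<in>I. P B (f i))"
  using P_linear linear_sum by blast

lemma P_empty: "P {} x = 0"
proof -
  have "(\<lambda>n::nat. P {} x) sums P (\<Union>n::nat. {}) x"
    by (intro P_sums) (auto simp: disjoint_family_on_def)
  then show ?thesis by (metis sums_summable summable_const_iff)
qed

lemma P_Un: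
  assumes "A \<in> sets borel" "B \<in> sets borel" "A \<inter> B = {}"
  shows "P (A \<union> B) x = P A x + P B x"
proof -
  define C where "C n = (if n = 0 then A else if n = 1 then B else {})" for n :: nat
  have U: "(\<Union>n. C n) = A \<union> B" by (auto simp: C_def split: if_splits)
  have "(\<lambda>n. P (C n) x) sums P (\<Union>n. C n) x"
    using assms by (intro P_sums) (auto simp: C_def disjoint_family_on_def)
  moreover have "(\<lambda>n. P (C n) x) sums (\<Sum>n\<in>{0,1}. P (C n) x)"
    by (rule sums_finite) (auto simp: C_def P_empty)
  ultimately have "P (\<Union>n. C n) x = (\<Sum>n\<in>{0,1}. P (C n) x)" by (rule sums_unique2)
  then show ?thesis by (simp add: U) (simp add: C_def)
qed

lemma norm_P2: "B \<in> sets borel \<Longrightarrow> (norm (P B x))\<^sup>2 = inner (P B x) x"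
  by (metis P_idem P_sym power2_norm_eq_inner)

lemma norm_P_le: assumes "B \<in> sets borel" shows "norm (P B x) \<le> norm x"
proof -
  have "(norm (P B x))\<^sup>2 \<le> norm (P B x) * norm x"
    using norm_P2[OF assms] norm_cauchy_schwarz by metis
  then show ?thesis by (cases "norm (P B x) = 0") (auto simp: power2_eq_square)
qed

lemma P_bounded_linear: assumes "B \<in> sets borel" shows "bounded_linear (P B)"
  using P_linear[OF assms] norm_P_le[OF assms]
  by (intro bounded_linear_intro[of _ 1]) (auto simp: P_add[OF assms] P_scale[OF assms])

text \<open>Disjoint projections are orthogonal because the sum of the two projections is a contraction.\<close>

lemma P_disjoint:
  assumes A: "A \<in> sets borel" and B: "B \<in> sets borel" and "A \<inter> B = {}"
  shows "P A (P B x) = 0"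
proof -
  have Q: "P (A \<union> B) (P B x) = P A (P B x) + P B x"
    using P_Un[OF assms] P_idem[OF B] by simp
  have "(norm (P (A \<union> B) (P B x)))\<^sup>2 = inner (P A (P B x)) (P B x) + inner (P B x) (P B x)"
    using norm_P2[of "A \<union> B" "P B x"] A B Q by (simp add: inner_add_left)
  also have "\<dots> = (norm (P A (P B x)))\<^sup>2 + (norm (P B x))\<^sup>2"
    using norm_P2[OF A, of "P B x"] by (simp add: power2_norm_eq_inner)
  finally have "(norm (P A (P B x)))\<^sup>2 + (norm (P B x))\<^sup>2 \<le> (norm (P B x))\<^sup>2"
    using norm_P_le[of "A \<union> B" "P B x"] A B by (metis norm_ge_zero power_mono sets.Un)
  then show ?thesis by simp
qed

text \<open>Multiplicativity is derived instead of assumed: B is split by A, then A by B, and the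
  products of projections of disjoint sets vanish by \<open>P_disjoint\<close>.\<close>

lemma P_Int:
  assumes A: "A \<in> sets borel" and B: "B \<in> sets borel"
  shows "P A (P B x) = P (A \<inter> B) x"
proof -
  have "P B x = P (A \<inter> B) x + P (B - A) x"
    using P_Un[of "A \<inter> B" "B - A" x] A B by (metis Int_Diff_disjoint Int_commute Un_Diff_Int inf_sup_aci(5) sets.Diff sets.Int)
  then have "P A (P B x) = P A (P (A \<inter> B) x)"
    using A B P_disjoint[of A "B - A" x] P_add[OF A, of "P (A \<inter> B) x" "P (B - A) x"] by simp
  also have "\<dots> = P (A \<inter> B) (P (A \<inter> B) x) + P (A - B) (P (A \<inter> B) x)"
    using P_Un[of "A \<inter> B" "A - B" "P (A \<inter> B) x"] A B by (metis Int_Diff_disjoint Un_Diff_Int inf_sup_aci(5) sets.Diff sets.Int)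
  also have "\<dots> = P (A \<inter> B) x"
  proof -
    have "(A - B) \<inter> (A \<inter> B) = {}" by blast
    then show ?thesis using A B P_disjoint[of "A - B" "A \<inter> B" x] P_idem[of "A \<inter> B" x] by simp
  qed
  finally show ?thesis .
qed

lemma sadd_inner: "sadd (\<lambda>B. inner (P B x) y)"
  unfolding sadd_def
proof (intro allI impI)
  fix B :: "nat \<Rightarrow> real set" assume B: "range B \<subseteq> sets borel" "disjoint_family B"
  show "(\<lambda>n. inner (P (B n) x) y) sums inner (P (\<Union>n. B n) x) y"
    using bounded_linear.sums[OF bounded_linear_inner_left P_sums[OF B]] .
qed

lemma sadd_cong: "sadd a \<Longrightarrow> (\<And>B. B \<in> sets borel \<Longrightarrow> a B = b B) \<Longrightarrow> sadd b"
  unfolding sadd_def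
proof (intro allI impI)
  fix B :: "nat \<Rightarrow> real set"
  assume *: "\<forall>B::nat\<Rightarrow>real set. range B \<subseteq> sets borel \<longrightarrow> disjoint_family B \<longrightarrow> (\<lambda>n. a (B n)) sums a (\<Union> (range B))"
   "\<And>B. B \<in> sets borel \<Longrightarrow> a B = b B" and B: "range B \<subseteq> sets borel" "disjoint_family B"
  have "\<Union>(range B) \<in> sets borel" "\<And>n. B n \<in> sets borel" using B by auto
  then show "(\<lambda>n. b (B n)) sums b (\<Union> (range B))" using * B by simp
qed

lemma sadd_norm2: "sadd (\<lambda>B. (norm (P B x))\<^sup>2)"
  by (rule sadd_cong[OF sadd_inner[of x x]]) (simp add: norm_P2)

definition M :: "'a \<Rightarrow> real measure" where
  "M x = measure_of UNIV (sets borel) (\<lambda>B. ennreal ((norm (P B x))\<^sup>2))"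

lemma space_M [simp]: "space (M x) = UNIV"
  unfolding M_def by (rule space_measure_of) auto
lemma sets_M [simp, measurable_cong]: "sets (M x) = sets borel"
proof -
  have "sets (M x) = sigma_sets UNIV (sets borel)"
    unfolding M_def by (rule sets_measure_of) auto
  then show ?thesis using sets.sigma_sets_eq[of borel] by simp
qed

lemma emeasure_M: assumes "B \<in> sets borel" shows "emeasure (M x) B = ennreal ((norm (P B x))\<^sup>2)"
proof (rule emeasure_measure_of[OF M_def])
  show "countably_additive (sets (M x)) (\<lambda>B. ennreal ((norm (P B x))\<^sup>2))"
  proof (rule countably_additiveI)
    fix A :: "nat \<Rightarrow> real set" assume "range A \<subseteq> sets (M x)" "disjoint_family A"
    then have "(\<lambda>n. (norm (P (A n) x))\<^sup>2) sums (norm (P (\<Union>n. A n) x))\<^sup>2"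
      using saddD[OF sadd_norm2] by simp
    then show "(\<Sum>i. ennreal ((norm (P (A i) x))\<^sup>2)) = ennreal ((norm (P (\<Union> (range A)) x))\<^sup>2)"
      by (subst suminf_ennreal_eq) auto
  qed
qed (use assms in \<open>auto simp: positive_def P_empty\<close>)

lemma finite_measure_M: "finite_measure (M x)"
  by (rule finite_measureI) (simp add: emeasure_M)

lemma measure_M: "B \<in> sets borel \<Longrightarrow> measure (M x) B = (norm (P B x))\<^sup>2"
  by (simp add: measure_def emeasure_M)

lemma M_P: assumes C: "C \<in> sets borel" shows "M (P C x) = density (M x) (indicator C)"
proof (rule measure_eqI)
  fix D assume "D \<in> sets (M (P C x))"
  then have D: "D \<in> sets borel" by simp
  have "emeasure (density (M x) (indicator C)) D = emeasure (M x) (C \<inter> D)"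
    using C D by (subst emeasure_density) (auto simp flip: indicator_inter_arith)
  then show "emeasure (M (P C x)) D = emeasure (density (M x) (indicator C)) D"
    using C D by (simp add: emeasure_M P_Int Int_commute)
qed simp

lemma M_scale: "M (k *\<^sub>R x) = density (M x) (\<lambda>_. ennreal (k\<^sup>2))"
proof (rule measure_eqI)
  fix D assume "D \<in> sets (M (k *\<^sub>R x))"
  then have D: "D \<in> sets borel" by simp
  show "emeasure (M (k *\<^sub>R x)) D = emeasure (density (M x) (\<lambda>_. ennreal (k\<^sup>2))) D"
    using D by (subst emeasure_density)
     (auto simp: emeasure_M P_scale nn_integral_cmult_indicator power_mult_distrib ennreal_mult)
qed simp

lemma integral_M_scale:
  fixes \<phi> :: "real \<Rightarrow> real"
  assumes "\<phi> \<in> borel_measurable borel"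
  shows "(LINT l|M (k *\<^sub>R x). \<phi> l) = k\<^sup>2 * (LINT l|M x. \<phi> l)"
  using assms by (simp add: M_scale integral_density)

lemma emeasure_M_add_le:
  assumes "B \<in> sets borel"
  shows "emeasure (M (x + y)) B \<le> 2 * emeasure (M x) B + 2 * emeasure (M y) B"
proof -
  have "(norm (P B x + P B y))\<^sup>2 \<le> 2 * (norm (P B x))\<^sup>2 + 2 * (norm (P B y))\<^sup>2"
  proof -
    have "norm (P B x + P B y) \<le> norm (P B x) + norm (P B y)" by (rule norm_triangle_ineq)
    then have "(norm (P B x + P B y))\<^sup>2 \<le> (norm (P B x) + norm (P B y))\<^sup>2" by (simp add: power_mono)
    also have "\<dots> \<le> 2 * (norm (P B x))\<^sup>2 + 2 * (norm (P B y))\<^sup>2"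
      using sum_squares_bound[of "norm (P B x)" "norm (P B y)"] by (simp add: power2_sum)
    finally show ?thesis .
  qed
  then have "ennreal ((norm (P B x + P B y))\<^sup>2) \<le> ennreal (2 * (norm (P B x))\<^sup>2 + 2 * (norm (P B y))\<^sup>2)"
    by (rule ennreal_leI)
  then show ?thesis
    using assms by (simp add: emeasure_M P_add ennreal_plus ennreal_mult)
qed

text \<open>\<open>M\<close> is quadratic in the vector, not additive; the factor 2 is the price of
  the cross term. The bound makes the domain of a multiplier closed under sums in
  \<open>dom_add\<close>.\<close>

lemma nn_integral_M_add_le:
  assumes "f \<in> borel_measurable borel"
  shows "(\<integral>\<^sup>+l. f l \<partial>M (x + y)) \<le> 2 * (\<integral>\<^sup>+l. f l \<partial>M x) + 2 * (\<integral>\<^sup>+l. f l \<partial>M y)"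
  using assms
proof (induction rule: borel_measurable_induct)
  case (cong f g)
  then have "f = g" by auto
  then show ?case using cong by simp
next
  case (set A)
  then show ?case using emeasure_M_add_le by simp
next
  case (mult u c)
  have "c * integral\<^sup>N (M (x+y)) u \<le> c * (2 * integral\<^sup>N (M x) u + 2 * integral\<^sup>N (M y) u)"
    using mult.IH by (rule mult_left_mono) simp
  then show ?case using mult by (simp add: nn_integral_cmult distrib_left mult.left_commute)
next
  case (add u v)
  have "integral\<^sup>N (M (x + y)) u + integral\<^sup>N (M (x + y)) v \<le>
      (2 * integral\<^sup>N (M x) u + 2 * integral\<^sup>N (M y) u) + (2 * integral\<^sup>N (M x) v + 2 * integral\<^sup>N (M y) v)"
    using add.IH by (rule add_mono)
  also have "\<dots> = 2 * (integral\<^sup>N (M x) u + integral\<^sup>N (M x) v) + 2 * (integral\<^sup>N (M y) u + integral\<^sup>N (M y) v)"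
    by (simp add: distrib_left add_ac)
  finally show ?case using add.hyps by (simp add: nn_integral_add add_ac)
next
  case (seq U)
  have eq: "integral\<^sup>N (M z) (SUP i. U i) = (SUP i. integral\<^sup>N (M z) (U i))" for z
  proof -
    have "Sup (range U) = (\<lambda>x. SUP i. U i x)" by (rule ext) (simp add: image_image)
    then show ?thesis using nn_integral_monotone_convergence_SUP[of U "M z"] seq.hyps by simp
  qed
  have le: "integral\<^sup>N (M z) (U i) \<le> (SUP i. integral\<^sup>N (M z) (U i))" for z i by (rule SUP_upper) simp
  show ?case unfolding eq
  proof (rule SUP_least)
    fix i
    have "integral\<^sup>N (M (x + y)) (U i) \<le> 2 * integral\<^sup>N (M x) (U i) + 2 * integral\<^sup>N (M y) (U i)"
      using seq by blast
    also have "\<dots> \<le> 2 * (SUP i. integral\<^sup>N (M x) (U i)) + 2 * (SUP i. integral\<^sup>N (M y) (U i))"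
      by (intro add_mono mult_left_mono le) auto
    finally show "integral\<^sup>N (M (x + y)) (U i) \<le> 2 * (SUP i. integral\<^sup>N (M x) (U i)) + 2 * (SUP i. integral\<^sup>N (M y) (U i))" .
  qed
qed

section \<open>Functional calculus by local comparison with scalars\<close>

text \<open>
  \<open>LC \<phi> f h\<close> encodes \<open>h = \<integral> \<phi>(l) dP(l) f\<close>, also for unbounded \<open>\<phi>\<close>, by local comparison with scalars
  instead of an integral.
\<close>

definition LC :: "(real \<Rightarrow> real) \<Rightarrow> 'a \<Rightarrow> 'a \<Rightarrow> bool" where
  "LC \<phi> f h \<longleftrightarrow> (\<forall>B\<in>sets borel. \<forall>c \<epsilon>. (\<forall>l\<in>B. \<bar>\<phi> l - c\<bar> \<le> \<epsilon>) \<longrightarrow> norm (P B h - c *\<^sub>R P B f) \<le> \<epsilon> * norm (P B f))"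

lemma LC_D:
  "LC \<phi> f h \<Longrightarrow> B \<in> sets borel \<Longrightarrow> (\<And>l. l \<in> B \<Longrightarrow> \<bar>\<phi> l - c\<bar> \<le> \<epsilon>) \<Longrightarrow> norm (P B h - c *\<^sub>R P B f) \<le> \<epsilon> * norm (P B f)"
  unfolding LC_def by blast

lemma LC_bound:
  "LC \<phi> f h \<Longrightarrow> B \<in> sets borel \<Longrightarrow> (\<And>l. l \<in> B \<Longrightarrow> \<bar>\<phi> l\<bar> \<le> K) \<Longrightarrow> norm (P B h) \<le> K * norm (P B f)"
  using LC_D[of \<phi> f h B 0 K] by simp

text \<open>On a cell where \<open>l\<close> and \<open>\<phi> l\<close> are almost constant, all operators act almost as scalars.\<close>

lemma LC_commute:
  assumes phi: "\<phi> \<in> borel_measurable borel" and K: "\<And>l. \<bar>\<phi> l\<bar> \<le> K"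
    and gh: "LC (\<lambda>l. l) g h" and gq: "LC \<phi> g q" and hq: "LC \<phi> h q'"
  shows "LC (\<lambda>l. l) q q'"
  unfolding LC_def
proof (intro ballI allI impI)
  fix B :: "real set" and c \<epsilon> :: real assume B: "B \<in> sets borel" and eps: "\<forall>l\<in>B. \<bar>l - c\<bar> \<le> \<epsilon>"
  show "norm (P B q' - c *\<^sub>R P B q) \<le> \<epsilon> * norm (P B q)"
  proof (cases "B = {}")
    case True then show ?thesis by (simp add: P_empty)
  next
    case False
    then have eps0: "0 \<le> \<epsilon>" using eps abs_ge_zero order_trans by blast
    have K0: "0 \<le> K" using K[of 0] by simp
    define k where "k = K + \<epsilon> + \<bar>c\<bar>"
    have k0: "k \<ge> 0" using eps0 K0 by (simp add: k_def)
    have "(\<lambda>B. (norm (P B (q' - c *\<^sub>R q)))\<^sup>2) B \<le> (\<lambda>B. \<epsilon>\<^sup>2 * (norm (P B q))\<^sup>2) B"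
    proof (rule cell_le[OF phi sadd_norm2 sadd_mult[OF sadd_norm2]
          sadd_add[OF sadd_mult[OF sadd_norm2[of q], of "\<epsilon>\<^sup>2"] sadd_add[OF sadd_mult[OF sadd_norm2[of h], of 4] sadd_mult[OF sadd_norm2[of g], of "4 * k\<^sup>2"]]] B])
      fix \<eta> l0 :: real and D assume eta: "0 < \<eta>" "\<eta> \<le> 1" and D: "D \<in> sets borel" "D \<subseteq> B" "l0 \<in> D"
        and osc: "\<And>l. l \<in> D \<Longrightarrow> \<bar>\<phi> l - \<phi> l0\<bar> \<le> \<eta>" "\<And>l. l \<in> D \<Longrightarrow> \<bar>l - l0\<bar> \<le> \<eta>"
      define a where "a = \<phi> l0"
      have aK: "\<bar>a\<bar> \<le> K" using K by (simp add: a_def)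
      have lc: "\<bar>l0 - c\<bar> \<le> \<epsilon>" using D eps by auto
      define G where "G = P D g" define H where "H = P D h" define Q where "Q = P D q" define Q' where "Q' = P D q'"
      define Z where "Z = norm H + k * norm G"
      have Z0: "Z \<ge> 0" using k0 by (simp add: Z_def)
      have e1: "norm (H - l0 *\<^sub>R G) \<le> \<eta> * norm G" unfolding H_def G_def by (rule LC_D[OF gh D(1) osc(2)])
      have e2: "norm (Q - a *\<^sub>R G) \<le> \<eta> * norm G" unfolding Q_def G_def a_def by (rule LC_D[OF gq D(1) osc(1)])
      have e3: "norm (Q' - a *\<^sub>R H) \<le> \<eta> * norm H" unfolding Q'_def H_def a_def by (rule LC_D[OF hq D(1) osc(1)])
      \<comment> \<open>The operator acts on the cell nearly as \<open>l0\<close>, the multiplier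
        nearly as \<open>a\<close>. Three of the four terms are errors of order \<eta>; the
        remaining one is at most \<epsilon> times the norm of \<open>a *\<^sub>R G\<close>, which is
        the norm of \<open>Q\<close> up to another error of order \<eta>.\<close>
      have "Q' - c *\<^sub>R Q = (Q' - a *\<^sub>R H) + a *\<^sub>R (H - l0 *\<^sub>R G) + (l0 - c) *\<^sub>R (a *\<^sub>R G) - c *\<^sub>R (Q - a *\<^sub>R G)"
        by (simp add: algebra_simps)
      then have "norm (Q' - c *\<^sub>R Q) \<le> norm (Q' - a *\<^sub>R H) + norm (a *\<^sub>R (H - l0 *\<^sub>R G)) + norm ((l0 - c) *\<^sub>R (a *\<^sub>R G)) + norm (c *\<^sub>R (Q - a *\<^sub>R G))"
        using norm4 by metis
      also have "\<dots> \<le> \<eta> * norm H + K * (\<eta> * norm G) + \<epsilon> * norm (a *\<^sub>R G) + \<bar>c\<bar> * (\<eta> * norm G)"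
        unfolding norm_scaleR[of a "H - _"] norm_scaleR[of "l0 - c"] norm_scaleR[of c]
        using e1 e2 e3 aK lc K0 by (intro add_mono mult_mono) auto
      also have "\<dots> \<le> \<eta> * norm H + K * (\<eta> * norm G) + \<epsilon> * (norm Q + \<eta> * norm G) + \<bar>c\<bar> * (\<eta> * norm G)"
        using e2 norm_triangle_sub[of "a *\<^sub>R G" Q] eps0 eta K0 by (intro add_mono mult_left_mono) (auto simp: norm_minus_commute)
      finally have "norm (Q' - c *\<^sub>R Q) \<le> \<epsilon> * norm Q + \<eta> * Z"
        by (simp add: Z_def k_def algebra_simps)
      then have "(norm (Q' - c *\<^sub>R Q))\<^sup>2 \<le> (\<epsilon> * norm Q + \<eta> * Z)\<^sup>2" by (simp add: power_mono)
      also have "\<dots> = \<epsilon>\<^sup>2 * (norm Q)\<^sup>2 + \<eta> * (2 * (\<epsilon> * norm Q) * Z + \<eta> * Z\<^sup>2)"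
        by (simp add: power2_eq_square algebra_simps)
      finally have *: "(norm (Q' - c *\<^sub>R Q))\<^sup>2 \<le> \<epsilon>\<^sup>2 * (norm Q)\<^sup>2 + \<eta> * (2 * (\<epsilon> * norm Q) * Z + \<eta> * Z\<^sup>2)" .
      have "2 * (\<epsilon> * norm Q) * Z + \<eta> * Z\<^sup>2 \<le> ((\<epsilon> * norm Q)\<^sup>2 + Z\<^sup>2) + 1 * Z\<^sup>2"
        using sum_squares_bound[of "\<epsilon> * norm Q" Z] eta by (intro add_mono mult_right_mono) auto
      also have "\<dots> = \<epsilon>\<^sup>2 * (norm Q)\<^sup>2 + 2 * Z\<^sup>2" by (simp add: power_mult_distrib)
      also have "\<dots> \<le> \<epsilon>\<^sup>2 * (norm Q)\<^sup>2 + (4 * (norm H)\<^sup>2 + 4 * k\<^sup>2 * (norm G)\<^sup>2)"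
        using sum_squares_bound[of "norm H" "k * norm G"] by (simp add: Z_def power2_sum power_mult_distrib)
      finally have "\<eta> * (2 * (\<epsilon> * norm Q) * Z + \<eta> * Z\<^sup>2) \<le> \<eta> * (\<epsilon>\<^sup>2 * (norm Q)\<^sup>2 + (4 * (norm H)\<^sup>2 + 4 * k\<^sup>2 * (norm G)\<^sup>2))"
        using eta by (intro mult_left_mono) auto
      with * have "(norm (Q' - c *\<^sub>R Q))\<^sup>2 \<le> \<epsilon>\<^sup>2 * (norm Q)\<^sup>2 + \<eta> * (\<epsilon>\<^sup>2 * (norm Q)\<^sup>2 + (4 * (norm H)\<^sup>2 + 4 * k\<^sup>2 * (norm G)\<^sup>2))"
        by linarith
      then show "(norm (P D (q' - c *\<^sub>R q)))\<^sup>2 \<le> \<epsilon>\<^sup>2 * (norm (P D q))\<^sup>2 + \<eta> * (\<epsilon>\<^sup>2 * (norm (P D q))\<^sup>2 + (4 * (norm (P D h))\<^sup>2 + 4 * k\<^sup>2 * (norm (P D g))\<^sup>2))"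
        using D by (simp add: Q_def Q'_def H_def G_def P_diff P_scale)
    qed
    then have "(norm (P B q' - c *\<^sub>R P B q))\<^sup>2 \<le> (\<epsilon> * norm (P B q))\<^sup>2"
      using B by (simp add: P_diff P_scale power_mult_distrib)
    then show ?thesis by (rule power2_le_imp_le) (use eps0 in simp)
  qed
qed

text \<open>The truncated multiplier vanishes off B, so h has no component there; on subsets of B it
  coincides with the identity function. This realizes A on the range of \<open>P B\<close>, in
  particular for bounded B.\<close>

lemma LC_P:
  assumes "B \<in> sets borel" and "LC (\<lambda>l. indicator B l * l) g h"
  shows "LC (\<lambda>l. l) (P B g) h" "P B h = h"
proof -
  have off: "P D h = 0" if "D \<in> sets borel" "D \<inter> B = {}" for D
    using LC_bound[OF assms(2) that(1), of 0] that(2) by (auto simp: indicator_def)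
  have dec: "P D h = P (D \<inter> B) h" if D: "D \<in> sets borel" for D
  proof -
    have "D = (D \<inter> B) \<union> (D - B)" by blast
    then have "P D h = P (D \<inter> B) h + P (D - B) h"
      using P_Un[of "D \<inter> B" "D - B" h] D assms(1) by auto
    then show ?thesis using off[of "D - B"] D assms(1) by auto
  qed
  show "P B h = h" using dec[of UNIV] by (simp add: P_UNIV)
  show "LC (\<lambda>l. l) (P B g) h"
    unfolding LC_def
  proof (intro ballI allI impI)
    fix D :: "real set" and c \<epsilon> :: real assume D: "D \<in> sets borel" and eps: "\<forall>l\<in>D. \<bar>l - c\<bar> \<le> \<epsilon>"
    have "norm (P (D \<inter> B) h - c *\<^sub>R P (D \<inter> B) g) \<le> \<epsilon> * norm (P (D \<inter> B) g)"
      using D assms(1) eps by (intro LC_D[OF assms(2)]) (auto simp: indicator_def)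
    then show "norm (P D h - c *\<^sub>R P D (P B g)) \<le> \<epsilon> * norm (P D (P B g))"
      using D assms(1) dec[OF D] by (simp add: P_Int)
  qed
qed

text \<open>Rounding \<phi> down to multiples of 1/m gives a step function, and boundedness of
  \<phi> leaves finitely many levels, so the corresponding operator is a finite sum of multiples of
  projections. The rounding error is the additional \<open>1 / m\<close>.\<close>

lemma LC_step:
  assumes phi: "\<phi> \<in> borel_measurable borel" and K: "\<And>l. \<bar>\<phi> l\<bar> \<le> K" and m: "0 < (m::real)"
  shows "\<exists>s. \<forall>B\<in>sets borel. \<forall>c \<epsilon>. (\<forall>l\<in>B. \<bar>\<phi> l - c\<bar> \<le> \<epsilon>) \<longrightarrow>
    norm (P B s - c *\<^sub>R P B f) \<le> (\<epsilon> + 1 / m) * norm (P B f)"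
proof -
  define C where "C k = {l. \<lfloor>m * \<phi> l\<rfloor> = k}" for k :: int
  have C: "C k \<in> sets borel" for k
  proof -
    have m1: "(\<lambda>l. \<lfloor>m * \<phi> l\<rfloor>) \<in> borel \<rightarrow>\<^sub>M count_space UNIV"
      using phi by measurable
    show ?thesis using measurable_sets[OF m1, of "{k}"] by (simp add: C_def vimage_def)
  qed
  define N where "N = \<lceil>m * K\<rceil> + 1"
  define s where "s = (\<Sum>k\<in>{-N..N}. (of_int k / m) *\<^sub>R P (C k) f)"
  have rng: "\<lfloor>m * \<phi> l\<rfloor> \<in> {-N..N}" for l
  proof -
    have "\<bar>m * \<phi> l\<bar> \<le> m * K" using K[of l] m by (simp add: abs_mult)
    then show ?thesis unfolding N_def by (simp; linarith)
  qed
  have Ps: "P D s = (of_int k / m) *\<^sub>R P D f" if D: "D \<in> sets borel" "D \<subseteq> C k" "D \<noteq> {}" for D k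
  proof -
    obtain l where "l \<in> D" using D by blast
    then have k: "k \<in> {-N..N}" using rng[of l] D by (auto simp: C_def)
    have "P D s = (\<Sum>j\<in>{-N..N}. (of_int j / m) *\<^sub>R P (D \<inter> C j) f)"
      unfolding s_def using D C by (simp add: P_sum P_scale P_Int)
    also have "\<dots> = (\<Sum>j\<in>{-N..N}. if j = k then (of_int k / m) *\<^sub>R P D f else 0)"
    proof (rule sum.cong)
      fix j assume "j \<in> {-N..N}"
      have "D \<inter> C j = (if j = k then D else {})" using D(2) by (auto simp: C_def)
      then show "(of_int j / m) *\<^sub>R P (D \<inter> C j) f = (if j = k then (of_int k / m) *\<^sub>R P D f else 0)"
        by (simp add: P_empty)
    qed simp
    also have "\<dots> = (of_int k / m) *\<^sub>R P D f" using k by simp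
    finally show ?thesis .
  qed
  show ?thesis
  proof (intro exI[of _ s] ballI allI impI)
    fix B :: "real set" and c \<epsilon> :: real assume B: "B \<in> sets borel" and eps: "\<forall>l\<in>B. \<bar>\<phi> l - c\<bar> \<le> \<epsilon>"
    show "norm (P B s - c *\<^sub>R P B f) \<le> (\<epsilon> + 1 / m) * norm (P B f)"
    proof (cases "B = {}")
      case True then show ?thesis by (simp add: P_empty)
    next
      case False
      then have eps0: "0 \<le> \<epsilon>" using eps abs_ge_zero order_trans by blast
      \<comment> \<open>The integer levels are reindexed by natural numbers; indices outside the
        range of \<open>to_nat\<close> receive the empty set, so nothing is counted twice.\<close>
      define E where "E i = (if i \<in> range (to_nat :: int \<Rightarrow> nat) then B \<inter> C (from_nat i) else {})" for i
      have "(\<lambda>B. (norm (P B (s - c *\<^sub>R f)))\<^sup>2) B \<le> (\<lambda>B. (\<epsilon> + 1 / m)\<^sup>2 * (norm (P B f))\<^sup>2) B"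
      proof (rule partition_le[OF sadd_norm2 sadd_mult[OF sadd_norm2], of E])
        show "range E \<subseteq> sets borel" using B C by (auto simp: E_def)
        show "disjoint_family E" by (auto simp: E_def disjoint_family_on_def C_def)
        show "(\<Union>n. E n) = B"
          by (auto simp: E_def C_def split: if_splits intro!: exI[of _ "to_nat \<lfloor>m * \<phi> _\<rfloor>"])
        fix i
        show "(norm (P (E i) (s - c *\<^sub>R f)))\<^sup>2 \<le> (\<epsilon> + 1 / m)\<^sup>2 * (norm (P (E i) f))\<^sup>2"
        proof (cases "E i = {}")
          case True then show ?thesis by (simp add: P_empty)
        next
          case ne: False
          define k where "k = (from_nat i :: int)"
          have Ei: "E i \<in> sets borel" "E i \<subseteq> C k" using B C by (auto simp: E_def k_def)
          obtain l where l: "l \<in> E i" using ne by blast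
          then have lB: "l \<in> B" "\<lfloor>m * \<phi> l\<rfloor> = k" by (auto simp: E_def k_def C_def split: if_splits)
          have "\<bar>of_int k - m * \<phi> l\<bar> \<le> 1" using lB(2) by linarith
          then have "\<bar>of_int k / m - \<phi> l\<bar> \<le> 1 / m" using m by (simp add: abs_le_iff field_simps)
          then have le: "\<bar>of_int k / m - c\<bar> \<le> \<epsilon> + 1 / m" using eps lB(1) by (smt (verit))
          have "norm (P (E i) (s - c *\<^sub>R f)) = norm ((of_int k / m - c) *\<^sub>R P (E i) f)"
            using Ps[OF Ei ne] Ei by (simp add: P_diff P_scale scaleR_diff_left)
          also have "\<dots> \<le> (\<epsilon> + 1 / m) * norm (P (E i) f)"
            unfolding norm_scaleR using le by (intro mult_right_mono) auto
          finally show ?thesis unfolding power_mult_distrib[symmetric] by (intro power_mono) auto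
        qed
      qed
      then have "(norm (P B s - c *\<^sub>R P B f))\<^sup>2 \<le> ((\<epsilon> + 1 / m) * norm (P B f))\<^sup>2"
        using B by (simp add: P_diff P_scale power_mult_distrib)
      then show ?thesis by (rule power2_le_imp_le) (use eps0 m in simp)
    qed
  qed
qed

text \<open>The step approximations at resolution 1/(n + 1) form a Cauchy sequence: on a small cell
  two of them differ by at most the sum of their resolutions, up to an error controlled by the cell
  size, and \<open>cell_le\<close> turns this into a global estimate. The defining inequality
  survives the limit because each projection is bounded.\<close>

lemma LC_exists:
  assumes phi: "\<phi> \<in> borel_measurable borel" and K: "\<And>l. \<bar>\<phi> l\<bar> \<le> K"
  shows "\<exists>h. LC \<phi> f h"
proof -
  have "\<forall>n. \<exists>s. \<forall>B\<in>sets borel. \<forall>c \<epsilon>. (\<forall>l\<in>B. \<bar>\<phi> l - c\<bar> \<le> \<epsilon>) \<longrightarrow>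
    norm (P B s - c *\<^sub>R P B f) \<le> (\<epsilon> + 1 / real (Suc n)) * norm (P B f)"
    using LC_step[OF phi K] by simp
  then obtain s where "\<forall>n. \<forall>B\<in>sets borel. \<forall>c \<epsilon>. (\<forall>l\<in>B. \<bar>\<phi> l - c\<bar> \<le> \<epsilon>) \<longrightarrow>
    norm (P B (s n) - c *\<^sub>R P B f) \<le> (\<epsilon> + 1 / real (Suc n)) * norm (P B f)"
    by (rule choice[THEN exE])
  then have s: "norm (P B (s n) - c *\<^sub>R P B f) \<le> (\<epsilon> + 1 / real (Suc n)) * norm (P B f)"
    if "B \<in> sets borel" "\<And>l. l \<in> B \<Longrightarrow> \<bar>\<phi> l - c\<bar> \<le> \<epsilon>" for n B c \<epsilon>
    using that by blast
  have diff: "norm (s n - s n') \<le> (1 / real (Suc n) + 1 / real (Suc n')) * norm f" for n n'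
  proof -
    define \<kappa> where "\<kappa> = 1 / real (Suc n) + 1 / real (Suc n')"
    have k0: "\<kappa> \<ge> 0" by (simp add: \<kappa>_def)
    have "(\<lambda>B. (norm (P B (s n - s n')))\<^sup>2) UNIV \<le> (\<lambda>B. \<kappa>\<^sup>2 * (norm (P B f))\<^sup>2) UNIV"
    proof (rule cell_le[OF phi sadd_norm2 sadd_mult[OF sadd_norm2] sadd_mult[OF sadd_norm2, of "4 * \<kappa> + 4" f]])
      fix \<eta> l0 :: real and D assume eta: "0 < \<eta>" "\<eta> \<le> 1" and D: "D \<in> sets borel" "l0 \<in> D"
        and osc: "\<And>l. l \<in> D \<Longrightarrow> \<bar>\<phi> l - \<phi> l0\<bar> \<le> \<eta>"
      have "norm (P D (s n - s n')) \<le> norm (P D (s n) - \<phi> l0 *\<^sub>R P D f) + norm (P D (s n') - \<phi> l0 *\<^sub>R P D f)"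
        using norm_triangle_ineq4[of "P D (s n) - \<phi> l0 *\<^sub>R P D f" "P D (s n') - \<phi> l0 *\<^sub>R P D f"] D by (simp add: P_diff)
      also have "\<dots> \<le> (2 * \<eta> + \<kappa>) * norm (P D f)"
        using s[OF D(1) osc, of n] s[OF D(1) osc, of n'] by (simp add: algebra_simps \<kappa>_def)
      finally have "(norm (P D (s n - s n')))\<^sup>2 \<le> ((2 * \<eta> + \<kappa>) * norm (P D f))\<^sup>2" by (simp add: power_mono)
      also have "\<dots> = \<kappa>\<^sup>2 * (norm (P D f))\<^sup>2 + \<eta> * ((4 * \<kappa> + 4 * \<eta>) * (norm (P D f))\<^sup>2)" by (simp add: power2_eq_square algebra_simps)
      also have "\<dots> \<le> \<kappa>\<^sup>2 * (norm (P D f))\<^sup>2 + \<eta> * ((4 * \<kappa> + 4) * (norm (P D f))\<^sup>2)" using eta by (intro add_mono mult_left_mono mult_right_mono) auto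
      finally show "(norm (P D (s n - s n')))\<^sup>2 \<le> \<kappa>\<^sup>2 * (norm (P D f))\<^sup>2 + \<eta> * ((4 * \<kappa> + 4) * (norm (P D f))\<^sup>2)" .
    qed auto
    then have "(norm (s n - s n'))\<^sup>2 \<le> (\<kappa> * norm f)\<^sup>2" by (simp add: P_UNIV power_mult_distrib)
    then have "norm (s n - s n') \<le> \<kappa> * norm f" by (rule power2_le_imp_le) (use k0 in simp)
    then show ?thesis by (simp add: \<kappa>_def)
  qed
  have lim0: "(\<lambda>n. 1 / real (Suc n)) \<longlonglongrightarrow> 0" using LIMSEQ_inverse_real_of_nat by (simp add: inverse_eq_divide)
  have "Cauchy s"
  proof (rule metric_CauchyI)
    fix e :: real assume e: "0 < e"
    have "(\<lambda>n. 2 * (1 / real (Suc n)) * norm f) \<longlonglongrightarrow> 2 * 0 * norm f"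
      by (intro tendsto_intros lim0)
    then have "eventually (\<lambda>n. 2 * (1 / real (Suc n)) * norm f < e) sequentially"
      using e by (intro order_tendstoD) auto
    then obtain N where N: "2 * (1 / real (Suc N)) * norm f < e" by (auto simp: eventually_sequentially)
    have "dist (s m) (s n) < e" if "m \<ge> N" "n \<ge> N" for m n
    proof -
      have "1 / real (Suc m) \<le> 1 / real (Suc N)" "1 / real (Suc n) \<le> 1 / real (Suc N)"
        using that by (auto intro!: divide_left_mono)
      then have "(1 / real (Suc m) + 1 / real (Suc n)) * norm f \<le> 2 * (1 / real (Suc N)) * norm f"
        by (intro mult_right_mono) auto
      then show ?thesis using diff[of m n] N by (simp add: dist_norm)
    qed
    then show "\<exists>M. \<forall>m\<ge>M. \<forall>n\<ge>M. dist (s m) (s n) < e" by blast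
  qed
  then obtain h where h: "s \<longlonglongrightarrow> h" using Cauchy_convergent convergent_def by blast
  have "LC \<phi> f h"
    unfolding LC_def
  proof (intro ballI allI impI)
    fix B :: "real set" and c \<epsilon> :: real assume B: "B \<in> sets borel" and eps: "\<forall>l\<in>B. \<bar>\<phi> l - c\<bar> \<le> \<epsilon>"
    have "(\<lambda>n. norm (P B (s n) - c *\<^sub>R P B f)) \<longlonglongrightarrow> norm (P B h - c *\<^sub>R P B f)"
      by (intro tendsto_intros bounded_linear.tendsto[OF P_bounded_linear[OF B] h])
    moreover have "(\<lambda>n. (\<epsilon> + 1 / real (Suc n)) * norm (P B f)) \<longlonglongrightarrow> (\<epsilon> + 0) * norm (P B f)"
      by (intro tendsto_intros lim0)
    ultimately have "norm (P B h - c *\<^sub>R P B f) \<le> (\<epsilon> + 0) * norm (P B f)"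
      using s[OF B] eps by (intro LIMSEQ_le[of "\<lambda>n. norm (P B (s n) - c *\<^sub>R P B f)"]) auto
    then show "norm (P B h - c *\<^sub>R P B f) \<le> \<epsilon> * norm (P B f)" by simp
  qed
  then show ?thesis ..
qed

end

section \<open>Spectral measures of transformed vectors\<close>

lemma sadd_integral:
  fixes f :: "real \<Rightarrow> real"
  assumes N: "sets N = sets borel" and f: "integrable N f"
  shows "sadd (\<lambda>B. LINT l|N. indicator B l * f l)"
  unfolding sadd_def
proof (intro allI impI)
  fix B :: "nat \<Rightarrow> real set" assume B: "range B \<subseteq> sets borel" "disjoint_family B"
  have Bm: "B i \<in> sets N" for i using B N by auto
  have s: "(\<lambda>i. indicator (B i) l :: real) sums indicator (\<Union>i. B i) l" for l
    using B(2) by (intro indicator_sums) (auto simp: disjoint_family_on_def)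
  have le1: "(\<Sum>i<n. indicator (B i) l :: real) \<le> 1" for l :: real and n :: nat
  proof -
    have "(\<Sum>i<n. indicator (B i) l :: real) \<le> (\<Sum>i. indicator (B i) l)"
      by (rule sum_le_suminf[OF sums_summable[OF s]]) auto
    also have "\<dots> = indicator (\<Union>i. B i) l" using sums_unique[OF s, of l] by (rule sym)
    also have "\<dots> \<le> 1" by (simp add: indicator_def)
    finally show ?thesis .
  qed
  have int: "integrable N (\<lambda>l. indicator (B i) l * f l)" for i
    using integrable_mult_indicator[OF Bm f] by simp
  have "(\<lambda>n. LINT l|N. (\<Sum>i<n. indicator (B i) l) * f l) \<longlonglongrightarrow> (LINT l|N. indicator (\<Union>i. B i) l * f l)"
  proof (rule integral_dominated_convergence[where w = "\<lambda>l. \<bar>f l\<bar>"])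
    show "(\<lambda>l. indicator (\<Union>i. B i) l * f l) \<in> borel_measurable N"
      using Bm f by (intro borel_measurable_times borel_measurable_indicator) auto
    show "(\<lambda>l. (\<Sum>i<n. indicator (B i) l) * f l) \<in> borel_measurable N" for n
      using Bm f by (intro borel_measurable_times borel_measurable_sum borel_measurable_indicator) auto
    show "integrable N (\<lambda>l. \<bar>f l\<bar>)" using f by simp
    show "AE l in N. (\<lambda>n. (\<Sum>i<n. indicator (B i) l) * f l) \<longlonglongrightarrow> indicator (\<Union>i. B i) l * f l"
      using s by (auto simp: sums_def intro!: tendsto_intros)
    show "AE l in N. norm ((\<Sum>i<n. indicator (B i) l) * f l) \<le> \<bar>f l\<bar>" for n
    proof (rule AE_I2)
      fix l
      have "\<bar>\<Sum>i<n. indicator (B i) l :: real\<bar> \<le> 1" using le1[of l n] by (simp add: sum_nonneg)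
      then have "\<bar>\<Sum>i<n. indicator (B i) l :: real\<bar> * \<bar>f l\<bar> \<le> 1 * \<bar>f l\<bar>" by (intro mult_right_mono) auto
      then show "norm ((\<Sum>i<n. indicator (B i) l) * f l) \<le> \<bar>f l\<bar>" by (simp add: abs_mult)
    qed
  qed
  moreover have "(LINT l|N. (\<Sum>i<n. indicator (B i) l) * f l) = (\<Sum>i<n. LINT l|N. indicator (B i) l * f l)" for n
    unfolding sum_distrib_right by (rule Bochner_Integration.integral_sum[OF int])
  ultimately show "(\<lambda>n. LINT l|N. indicator (B n) l * f l) sums (LINT l|N. indicator (\<Union>n. B n) l * f l)"
    by (simp add: sums_def)
qed

context pvm
begin

lemma norm_M: "(norm x)\<^sup>2 = measure (M x) UNIV"
  by (simp add: measure_M P_UNIV)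

lemma integrable_M_bounded:
  fixes \<psi> :: "real \<Rightarrow> real"
  assumes "\<psi> \<in> borel_measurable borel" "\<And>l. \<bar>\<psi> l\<bar> \<le> K"
  shows "integrable (M x) \<psi>"
  using assms by (intro finite_measure.integrable_const_bound[OF finite_measure_M, of _ K]) auto

lemma integral_cell:
  fixes \<psi> :: "real \<Rightarrow> real"
  assumes int: "integrable (M x) \<psi>" and D: "D \<in> sets borel" and le: "\<And>l. l \<in> D \<Longrightarrow> \<bar>\<psi> l - k\<bar> \<le> e"
  shows "\<bar>(LINT l|M x. indicator D l * \<psi> l) - k * (norm (P D x))\<^sup>2\<bar> \<le> e * (norm (P D x))\<^sup>2"
proof -
  have i1: "integrable (M x) (\<lambda>l. indicator D l * c)" for c :: real
    using D by (intro integrable_mult_left) (auto simp: integrable_indicator_iff emeasure_M)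
  have i2: "(LINT l|M x. indicator D l * c) = c * (norm (P D x))\<^sup>2" for c :: real
    using D by (simp add: measure_M)
  have i3: "integrable (M x) (\<lambda>l. indicator D l * \<psi> l)"
    using integrable_mult_indicator[OF _ int, of D] D by simp
  have "(LINT l|M x. indicator D l * \<psi> l) \<le> (LINT l|M x. indicator D l * (k + e))"
    using le by (intro integral_mono i1 i3) (auto simp: indicator_def abs_le_iff algebra_simps)
  moreover have "(LINT l|M x. indicator D l * (k - e)) \<le> (LINT l|M x. indicator D l * \<psi> l)"
    using le by (intro integral_mono i1 i3) (auto simp: indicator_def abs_le_iff algebra_simps)
  ultimately show ?thesis unfolding i2 abs_le_iff by (simp only: distrib_right left_diff_distrib) linarith
qed

text \<open>On a small cell D both sides equal \<open>(\<phi> l0)\<^sup>2\<close> times the squared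
  norm of \<open>P D f\<close> up to a multiple of \<eta>: the left side by the local comparison,
  the right side because the integrand is nearly constant. \<open>cell_le\<close> is applied once in
  each direction.\<close>

lemma LC_measure_bounded:
  assumes phi: "\<phi> \<in> borel_measurable borel" and lc: "LC \<phi> f h" and B: "B \<in> sets borel"
    and K: "\<And>l. l \<in> B \<Longrightarrow> \<bar>\<phi> l\<bar> \<le> K"
  shows "(norm (P B h))\<^sup>2 = (LINT l|M f. indicator B l * (\<phi> l)\<^sup>2)"
proof (cases "B = {}")
  case True then show ?thesis by (simp add: P_empty)
next
  case False
  then have K0: "0 \<le> K" using K abs_ge_zero order_trans by blast
  define \<psi> where "\<psi> l = indicator B l * (\<phi> l)\<^sup>2" for l
  have int: "integrable (M f) \<psi>"
  proof (rule integrable_M_bounded[of _ "K\<^sup>2"])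
    show "\<psi> \<in> borel_measurable borel" unfolding \<psi>_def using phi B by measurable
    show "\<bar>\<psi> l\<bar> \<le> K\<^sup>2" for l
      using K[of l] K0 power_mono[of "\<bar>\<phi> l\<bar>" K 2] by (auto simp: \<psi>_def indicator_def)
  qed
  define I where "I D = (LINT l|M f. indicator D l * \<psi> l)" for D
  have sI: "sadd I" unfolding I_def by (rule sadd_integral[OF _ int]) simp
  have cell: "\<bar>(norm (P D h))\<^sup>2 - I D\<bar> \<le> \<eta> * ((4 * K + 1) * (norm (P D f))\<^sup>2)"
    if eta: "0 < \<eta>" "\<eta> \<le> 1" and D: "D \<in> sets borel" "D \<subseteq> B" "l0 \<in> D"
      and osc: "\<And>l. l \<in> D \<Longrightarrow> \<bar>\<phi> l - \<phi> l0\<bar> \<le> \<eta>" for \<eta> D l0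
  proof -
    define a where "a = \<bar>\<phi> l0\<bar>"
    define x where "x = norm (P D h)" define y where "y = norm (P D f)"
    have a: "0 \<le> a" "a \<le> K" using K[of l0] D by (auto simp: a_def)
    have xy: "0 \<le> x" "0 \<le> y" by (auto simp: x_def y_def)
    have "norm (P D h - \<phi> l0 *\<^sub>R P D f) \<le> \<eta> * y" unfolding y_def by (rule LC_D[OF lc D(1) osc])
    moreover have "\<bar>x - a * y\<bar> \<le> norm (P D h - \<phi> l0 *\<^sub>R P D f)"
      using norm_triangle_ineq3[of "P D h" "\<phi> l0 *\<^sub>R P D f"] by (simp add: x_def y_def a_def)
    ultimately have d: "\<bar>x - a * y\<bar> \<le> \<eta> * y" by linarith
    have "\<eta> * y \<le> 1 * y" using eta xy by (intro mult_right_mono) auto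
    moreover have "a * y \<le> K * y" using a xy by (intro mult_right_mono) auto
    ultimately have s: "x + a * y \<le> (2 * K + 1) * y" using d by (simp add: algebra_simps abs_le_iff)
    have "x\<^sup>2 - (a * y)\<^sup>2 = (x - a * y) * (x + a * y)" by (simp add: power2_eq_square algebra_simps)
    then have "\<bar>x\<^sup>2 - (a * y)\<^sup>2\<bar> = \<bar>x - a * y\<bar> * (x + a * y)"
      using xy a by (simp add: abs_mult)
    also have "\<dots> \<le> (\<eta> * y) * ((2 * K + 1) * y)"
      using d s xy a eta by (intro mult_mono) auto
    finally have 1: "\<bar>x\<^sup>2 - a\<^sup>2 * y\<^sup>2\<bar> \<le> \<eta> * (2 * K + 1) * y\<^sup>2" by (simp add: power2_eq_square algebra_simps)
    have 2: "\<bar>I D - a\<^sup>2 * y\<^sup>2\<bar> \<le> (\<eta> * (2 * K)) * y\<^sup>2"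
      unfolding I_def y_def
    proof (rule integral_cell[OF int D(1)])
      fix l assume l: "l \<in> D"
      have "\<bar>(\<phi> l)\<^sup>2 - (\<phi> l0)\<^sup>2\<bar> = \<bar>\<phi> l - \<phi> l0\<bar> * \<bar>\<phi> l + \<phi> l0\<bar>"
        by (simp add: square_diff_square_factored power2_eq_square flip: abs_mult) (simp add: algebra_simps)
      also have "\<dots> \<le> \<eta> * (2 * K)"
      proof (intro mult_mono)
        have "\<bar>\<phi> l\<bar> \<le> K" "\<bar>\<phi> l0\<bar> \<le> K" using K D l by auto
        then show "\<bar>\<phi> l + \<phi> l0\<bar> \<le> 2 * K" by linarith
      qed (use osc[OF l] eta in auto)
      finally show "\<bar>\<psi> l - a\<^sup>2\<bar> \<le> \<eta> * (2 * K)" using l D by (auto simp: \<psi>_def a_def)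
    qed
    have "\<bar>x\<^sup>2 - I D\<bar> \<le> \<bar>x\<^sup>2 - a\<^sup>2 * y\<^sup>2\<bar> + \<bar>I D - a\<^sup>2 * y\<^sup>2\<bar>" by linarith
    also have "\<dots> \<le> \<eta> * ((4 * K + 1) * y\<^sup>2)" using 1 2 by (simp add: algebra_simps)
    finally show ?thesis by (simp add: x_def y_def)
  qed
  have "(\<lambda>B. (norm (P B h))\<^sup>2) B \<le> I B"
  proof (rule cell_le[OF phi sadd_norm2 sI sadd_mult[OF sadd_norm2, of "4 * K + 1" f] B])
    fix \<eta> :: real and D and l0 :: real assume "0 < \<eta>" "\<eta> \<le> 1" "D \<in> sets borel" "D \<subseteq> B" "l0 \<in> D" "\<And>l. l \<in> D \<Longrightarrow> \<bar>\<phi> l - \<phi> l0\<bar> \<le> \<eta>"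
    from cell[OF this] show "(norm (P D h))\<^sup>2 \<le> I D + \<eta> * ((4 * K + 1) * (norm (P D f))\<^sup>2)" by linarith
  qed
  moreover have "I B \<le> (\<lambda>B. (norm (P B h))\<^sup>2) B"
  proof (rule cell_le[OF phi sI sadd_norm2 sadd_mult[OF sadd_norm2, of "4 * K + 1" f] B])
    fix \<eta> :: real and D and l0 :: real assume "0 < \<eta>" "\<eta> \<le> 1" "D \<in> sets borel" "D \<subseteq> B" "l0 \<in> D" "\<And>l. l \<in> D \<Longrightarrow> \<bar>\<phi> l - \<phi> l0\<bar> \<le> \<eta>"
    from cell[OF this] show "I D \<le> (norm (P D h))\<^sup>2 + \<eta> * ((4 * K + 1) * (norm (P D f))\<^sup>2)" by linarith
  qed
  moreover have "I B = (LINT l|M f. indicator B l * (\<phi> l)\<^sup>2)"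
    unfolding I_def \<psi>_def by (intro Bochner_Integration.integral_cong) (auto simp: indicator_def)
  ultimately show ?thesis by simp
qed

text \<open>The sets where \<phi> is at most n in absolute value exhaust B, and on each of them the
  bounded case applies. This isometry, valid also for unbounded \<phi>, is how norms of evolved
  vectors are computed from the spectral measure of the data.\<close>

lemma LC_M:
  assumes phi: "\<phi> \<in> borel_measurable borel" and lc: "LC \<phi> f h"
  shows "M h = density (M f) (\<lambda>l. ennreal ((\<phi> l)\<^sup>2))"
proof (rule measure_eqI)
  fix B assume "B \<in> sets (M h)"
  then have B: "B \<in> sets borel" by simp
  define C where "C n = B \<inter> {l. \<bar>\<phi> l\<bar> \<le> real n}" for n
  have C: "C n \<in> sets borel" for n
  proof -
    have "{l \<in> space borel. \<bar>\<phi> l\<bar> \<le> real n} \<in> sets borel" using phi by measurable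
    then show ?thesis unfolding C_def using B by (intro sets.Int) auto
  qed
  have inc: "incseq C" by (auto simp: C_def incseq_def)
  have U: "(\<Union>n. C n) = B" using real_arch_simple by (auto simp: C_def)
  let ?D = "density (M f) (\<lambda>l. ennreal ((\<phi> l)\<^sup>2))"
  have eq: "emeasure (M h) (C n) = emeasure ?D (C n)" for n
  proof -
    have bd: "\<bar>\<phi> l\<bar> \<le> real n" if "l \<in> C n" for l using that by (simp add: C_def)
    have int: "integrable (M f) (\<lambda>l. indicator (C n) l * (\<phi> l)\<^sup>2)"
    proof (rule integrable_M_bounded[of _ "(real n)\<^sup>2"])
      show "(\<lambda>l. indicator (C n) l * (\<phi> l)\<^sup>2) \<in> borel_measurable borel" using phi C by measurable
      show "\<bar>indicator (C n) l * (\<phi> l)\<^sup>2\<bar> \<le> (real n)\<^sup>2" for l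
        using bd[of l] power_mono[of "\<bar>\<phi> l\<bar>" "real n" 2] by (auto simp: indicator_def)
    qed
    have "emeasure ?D (C n) = (\<integral>\<^sup>+l. ennreal (indicator (C n) l * (\<phi> l)\<^sup>2) \<partial>M f)"
      using phi C by (subst emeasure_density) (auto intro!: nn_integral_cong simp: indicator_def)
    also have "\<dots> = ennreal (LINT l|M f. indicator (C n) l * (\<phi> l)\<^sup>2)"
      by (intro nn_integral_eq_integral int) auto
    also have "\<dots> = emeasure (M h) (C n)"
      using LC_measure_bounded[OF phi lc C bd] C by (simp add: emeasure_M)
    finally show ?thesis by simp
  qed
  have "emeasure (M h) B = (SUP n. emeasure (M h) (C n))"
    using SUP_emeasure_incseq[of C "M h"] C inc U by (simp add: image_subset_iff)
  also have "\<dots> = (SUP n. emeasure ?D (C n))" by (simp add: eq)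
  also have "\<dots> = emeasure ?D B"
    using SUP_emeasure_incseq[of C ?D] C inc U by (simp add: image_subset_iff)
  finally show "emeasure (M h) B = emeasure ?D B" .
qed simp

lemma LC_nn_integral:
  assumes phi: "\<phi> \<in> borel_measurable borel" and lc: "LC \<phi> f h" and g: "g \<in> borel_measurable borel"
  shows "(\<integral>\<^sup>+l. g l \<partial>M h) = (\<integral>\<^sup>+l. ennreal ((\<phi> l)\<^sup>2) * g l \<partial>M f)"
  using phi g by (simp add: LC_M[OF phi lc] nn_integral_density)

lemma nn_integral_M_1: "(\<integral>\<^sup>+l. 1 \<partial>M x) = ennreal ((norm x)\<^sup>2)"
  by (simp add: emeasure_M P_UNIV)

section \<open>Equivalence of the weak and the local functional calculus\<close>

definition dom :: "(real \<Rightarrow> real) \<Rightarrow> 'a set" where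
  "dom \<phi> = {f. integrable (M f) (\<lambda>l. (\<phi> l)\<^sup>2)}"

lemma LC_dom:
  assumes phi: "\<phi> \<in> borel_measurable borel" and lc: "LC \<phi> f h"
  shows "f \<in> dom \<phi>"
proof -
  have "(\<integral>\<^sup>+l. ennreal ((\<phi> l)\<^sup>2) \<partial>M f) = ennreal ((norm h)\<^sup>2)"
    using LC_nn_integral[OF phi lc, of "\<lambda>_. 1"] nn_integral_M_1[of h] by simp
  then show ?thesis unfolding dom_def using phi
    by (simp add: integrable_iff_bounded)
qed

lemma dom_add:
  assumes phi: "\<phi> \<in> borel_measurable borel" and "x \<in> dom \<phi>" "y \<in> dom \<phi>"
  shows "x + y \<in> dom \<phi>"
proof -
  have m: "(\<lambda>l. ennreal ((\<phi> l)\<^sup>2)) \<in> borel_measurable borel" using phi by measurable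
  have fin: "(\<integral>\<^sup>+l. ennreal ((\<phi> l)\<^sup>2) \<partial>M x) < \<infinity>" "(\<integral>\<^sup>+l. ennreal ((\<phi> l)\<^sup>2) \<partial>M y) < \<infinity>"
    using assms by (auto simp: dom_def integrable_iff_bounded)
  have "(\<integral>\<^sup>+l. ennreal ((\<phi> l)\<^sup>2) \<partial>M (x + y)) < \<infinity>"
    using nn_integral_M_add_le[OF m, of x y] fin
    by (auto intro: le_less_trans simp: ennreal_mult_less_top)
  then show ?thesis using phi by (simp add: dom_def integrable_iff_bounded)
qed

lemma dom_scale: "\<phi> \<in> borel_measurable borel \<Longrightarrow> x \<in> dom \<phi> \<Longrightarrow> k *\<^sub>R x \<in> dom \<phi>"
  by (simp add: dom_def M_scale integrable_density)

lemma dom_diff: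
  assumes "\<phi> \<in> borel_measurable borel" "x \<in> dom \<phi>" "y \<in> dom \<phi>" shows "x - y \<in> dom \<phi>"
  using dom_add[OF assms(1,2) dom_scale[OF assms(1,3), of "-1"]] by simp

lemma dom_P:
  assumes phi: "\<phi> \<in> borel_measurable borel" and B: "B \<in> sets borel" and K: "\<And>l. l \<in> B \<Longrightarrow> \<bar>\<phi> l\<bar> \<le> K"
  shows "P B z \<in> dom \<phi>"
  unfolding dom_def
proof (simp, rule finite_measure.integrable_const_bound[OF finite_measure_M, of _ "K\<^sup>2"])
  show "AE l in M (P B z). norm ((\<phi> l)\<^sup>2) \<le> K\<^sup>2"
    unfolding M_P[OF B] using B
    by (subst AE_density) (use K power_mono[of "\<bar>\<phi> _\<bar>" K 2] in \<open>auto simp: indicator_def split: if_splits\<close>)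
qed (use phi in measurable)

text \<open>This is the real part of the weak definition in \<open>spectral_integral\<close>: the
  four terms of the complex polarization reduce to two.\<close>

definition SI :: "(real \<Rightarrow> real) \<Rightarrow> 'a \<Rightarrow> 'a \<Rightarrow> bool" where
  "SI \<phi> f h \<longleftrightarrow> f \<in> dom \<phi> \<and>
     (\<forall>y\<in>dom \<phi>. inner h y = ((LINT l|M (f + y). \<phi> l) - (LINT l|M (f - y). \<phi> l)) / 4)"

lemma dom_integrable: "\<phi> \<in> borel_measurable borel \<Longrightarrow> x \<in> dom \<phi> \<Longrightarrow> integrable (M x) \<phi>"
  unfolding dom_def
  by (rule finite_measure.square_integrable_imp_integrable[OF finite_measure_M]) auto

lemma inner_polar: "inner f y = ((norm (f + y))\<^sup>2 - (norm (f - y))\<^sup>2) / (4::real)" for f y :: 'a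
  by (simp add: power2_norm_eq_inner inner_add_left inner_add_right inner_diff_left inner_diff_right inner_commute)

text \<open>On a small cell both sides are \<open>\<phi> l0\<close> times the inner product of
  \<open>P D f\<close> and \<open>P D y\<close>, the right side by the polarization identity, with
  an error of at most \<eta> times the sum of the squared norms of the two projections. The
  difference is countably additive, so \<open>cell_le\<close> in both directions shows that it
  vanishes on the whole line.\<close>

lemma LC_imp_SI:
  assumes phi: "\<phi> \<in> borel_measurable borel" and lc: "LC \<phi> f h"
  shows "SI \<phi> f h"
  unfolding SI_def
proof (intro conjI ballI)
  show f: "f \<in> dom \<phi>" by (rule LC_dom[OF phi lc])
  fix y assume y: "y \<in> dom \<phi>"
  have int: "integrable (M (f + y)) \<phi>" "integrable (M (f - y)) \<phi>"
    using dom_integrable dom_add dom_diff phi f y by blast+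
  define a where "a D = inner (P D h) y - ((LINT l|M (f + y). indicator D l * \<phi> l) - (LINT l|M (f - y). indicator D l * \<phi> l)) * (1/4)" for D
  have "sadd (\<lambda>D. inner (P D h) y - (1/4) * ((LINT l|M (f + y). indicator D l * \<phi> l) - (LINT l|M (f - y). indicator D l * \<phi> l)))"
    by (intro sadd_diff sadd_mult sadd_inner sadd_integral int) auto
  then have sa: "sadd a" unfolding a_def by (simp add: mult.commute)
  have sc: "sadd (\<lambda>D. (norm (P D f))\<^sup>2 + (norm (P D y))\<^sup>2)" by (intro sadd_add sadd_norm2)
  have cell: "\<bar>a D\<bar> \<le> \<eta> * ((norm (P D f))\<^sup>2 + (norm (P D y))\<^sup>2)"
    if eta: "0 < \<eta>" and D: "D \<in> sets borel" and osc: "\<And>l. l \<in> D \<Longrightarrow> \<bar>\<phi> l - \<phi> l0\<bar> \<le> \<eta>" for \<eta> D l0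
  proof -
    define m1 where "m1 = (norm (P D f + P D y))\<^sup>2" define m2 where "m2 = (norm (P D f - P D y))\<^sup>2"
    have m: "m1 + m2 = 2 * (norm (P D f))\<^sup>2 + 2 * (norm (P D y))\<^sup>2"
      by (simp add: m1_def m2_def power2_norm_eq_inner inner_add_left inner_add_right inner_diff_left inner_diff_right)
    have 1: "\<bar>(LINT l|M (f + y). indicator D l * \<phi> l) - \<phi> l0 * m1\<bar> \<le> \<eta> * m1"
      using integral_cell[OF int(1) D osc] D by (simp add: P_add m1_def)
    have 2: "\<bar>(LINT l|M (f - y). indicator D l * \<phi> l) - \<phi> l0 * m2\<bar> \<le> \<eta> * m2"
      using integral_cell[OF int(2) D osc] D by (simp add: P_diff m2_def)
    have "\<bar>inner (P D h - \<phi> l0 *\<^sub>R P D f) (P D y)\<bar> \<le> (\<eta> * norm (P D f)) * norm (P D y)"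
      by (rule order_trans[OF Cauchy_Schwarz_ineq2]) (intro mult_right_mono LC_D[OF lc D osc]; simp)
    moreover have "inner (P D h - \<phi> l0 *\<^sub>R P D f) (P D y) = inner (P D h) y - \<phi> l0 * inner (P D f) (P D y)"
      using P_sym[OF D, of "P D h" y] P_idem[OF D] by (simp add: inner_diff_left)
    moreover have "inner (P D f) (P D y) = (m1 - m2) / 4" using inner_polar by (simp add: m1_def m2_def)
    moreover have "2 * (norm (P D f) * norm (P D y)) \<le> (norm (P D f))\<^sup>2 + (norm (P D y))\<^sup>2"
      using sum_squares_bound[of "norm (P D f)" "norm (P D y)"] by simp
    then have "\<eta> * (2 * (norm (P D f) * norm (P D y))) \<le> \<eta> * ((norm (P D f))\<^sup>2 + (norm (P D y))\<^sup>2)"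
      using eta by (intro mult_left_mono) auto
    ultimately have 3: "\<bar>inner (P D h) y - \<phi> l0 * ((m1 - m2) / 4)\<bar> \<le> \<eta> * ((norm (P D f))\<^sup>2 + (norm (P D y))\<^sup>2) / 2"
      by (simp add: algebra_simps)
    have "\<eta> * (m1 + m2) = \<eta> * (2 * (norm (P D f))\<^sup>2 + 2 * (norm (P D y))\<^sup>2)" by (simp add: m)
    then have 4: "\<eta> * m1 + \<eta> * m2 = 2 * (\<eta> * ((norm (P D f))\<^sup>2 + (norm (P D y))\<^sup>2))" by (simp add: algebra_simps)
    have 5: "\<phi> l0 * ((m1 - m2) / 4) = (\<phi> l0 * m1 - \<phi> l0 * m2) / 4" by (simp add: algebra_simps)
    have aux: "\<bar>X - (I1 - I2) * (1 / 4)\<bar> \<le> S"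
      if "\<bar>I1 - p1\<bar> \<le> e1" "\<bar>I2 - p2\<bar> \<le> e2" "\<bar>X - (p1 - p2) / 4\<bar> \<le> S / 2" "e1 + e2 = 2 * S" for X I1 I2 p1 p2 e1 e2 S :: real
    proof -
      have "\<bar>4 * X - (p1 - p2)\<bar> \<le> 2 * S" using that(3) by (simp add: abs_le_iff field_simps)
      then have "\<bar>4 * X - (I1 - I2)\<bar> \<le> 4 * S" using that by linarith
      then show ?thesis by (simp add: abs_le_iff field_simps)
    qed
    show ?thesis using aux[OF 1 2 3[unfolded 5] 4] unfolding a_def .
  qed
  have "a UNIV \<le> (\<lambda>_. 0) UNIV"
  proof (rule cell_le[OF phi sa sadd_zero sc])
    fix \<eta> :: real and D and l0 :: real assume "0 < \<eta>" "D \<in> sets borel" "\<And>l. l \<in> D \<Longrightarrow> \<bar>\<phi> l - \<phi> l0\<bar> \<le> \<eta>"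
    from cell[OF this] show "a D \<le> 0 + \<eta> * ((norm (P D f))\<^sup>2 + (norm (P D y))\<^sup>2)" by linarith
  qed auto
  moreover have "(\<lambda>_. 0) UNIV \<le> a UNIV"
  proof (rule cell_le[OF phi sadd_zero sa sc])
    fix \<eta> :: real and D and l0 :: real assume "0 < \<eta>" "D \<in> sets borel" "\<And>l. l \<in> D \<Longrightarrow> \<bar>\<phi> l - \<phi> l0\<bar> \<le> \<eta>"
    from cell[OF this] show "0 \<le> a D + \<eta> * ((norm (P D f))\<^sup>2 + (norm (P D y))\<^sup>2)" by linarith
  qed auto
  ultimately have "a UNIV = 0" by simp
  then show "inner h y = ((LINT l|M (f + y). \<phi> l) - (LINT l|M (f - y). \<phi> l)) / 4"
    by (simp add: a_def P_UNIV)
qed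

text \<open>The weak identity is tested with multiples of \<open>x = P B (h - c f)\<close>. Such a
  test vector sees only B, where \<phi> differs from c by at most \<epsilon>, and the best multiple
  turns the resulting quadratic inequality into the required linear one.\<close>

lemma SI_imp_LC:
  assumes phi: "\<phi> \<in> borel_measurable borel" and si: "SI \<phi> f h"
  shows "LC \<phi> f h"
  unfolding LC_def
proof (intro ballI allI impI)
  fix B :: "real set" and c \<epsilon> :: real assume B: "B \<in> sets borel" and eps: "\<forall>l\<in>B. \<bar>\<phi> l - c\<bar> \<le> \<epsilon>"
  show "norm (P B h - c *\<^sub>R P B f) \<le> \<epsilon> * norm (P B f)"
  proof (cases "B = {}")
    case True then show ?thesis by (simp add: P_empty)
  next
    case False
    then have eps0: "0 \<le> \<epsilon>" using eps abs_ge_zero order_trans by blast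
    define x where "x = P B (h - c *\<^sub>R f)"
    have f: "f \<in> dom \<phi>" using si by (simp add: SI_def)
    \<comment> \<open>The scale s stays free; the choice s = \<open>norm (P B f) / norm x\<close>
      below is optimal, and the case \<open>P B f = 0\<close> needs another value.\<close>
    have key: "s * (norm x)\<^sup>2 \<le> \<epsilon> * ((norm (P B f))\<^sup>2 + s\<^sup>2 * (norm x)\<^sup>2) / 2" for s :: real
    proof -
      define y where "y = s *\<^sub>R x"
      have Py: "P B y = y" using B by (simp add: y_def x_def P_scale P_idem)
      have Py': "P (- B) y = 0" using P_disjoint[of "- B" B y] B Py by simp
      have y: "y \<in> dom \<phi>"
      proof -
        have "\<bar>\<phi> l\<bar> \<le> \<bar>c\<bar> + \<epsilon>" if "l \<in> B" for l using eps that by (smt (verit))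
        then show ?thesis using dom_P[OF phi B, of "\<bar>c\<bar> + \<epsilon>" y] by (simp add: Py)
      qed
      \<comment> \<open>The contribution of the complement of B depends on z only through
        \<open>P (- B) z\<close>, which is the same for \<open>f + y\<close> and
        \<open>f - y\<close>; it cancels in the polarized difference.\<close>
      have split: "(LINT l|M z. \<phi> l) - c * (norm z)\<^sup>2 = (LINT l|M z. indicator B l * (\<phi> l - c)) + (LINT l|M (P (- B) z). \<phi> l - c)"
        and part: "\<bar>LINT l|M z. indicator B l * (\<phi> l - c)\<bar> \<le> \<epsilon> * (norm (P B z))\<^sup>2"
        if z: "z \<in> dom \<phi>" for z
      proof -
        have i: "integrable (M z) \<phi>" by (rule dom_integrable[OF phi z])
        have ic: "integrable (M z) (\<lambda>l. \<phi> l - c)"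
          using i integrable_M_bounded[of "\<lambda>_. c" "\<bar>c\<bar>" z] by (intro Bochner_Integration.integrable_diff) auto
        have iB: "integrable (M z) (\<lambda>l. indicator D l * (\<phi> l - c))" if "D \<in> sets borel" for D
          using integrable_mult_indicator[OF _ ic, of D] that by simp
        have "(LINT l|M z. \<phi> l) - c * (norm z)\<^sup>2 = (LINT l|M z. \<phi> l - c)"
          using i by (simp add: norm_M finite_measure.integrable_const[OF finite_measure_M] mult.commute)
        also have "\<dots> = (LINT l|M z. indicator B l * (\<phi> l - c) + indicator (- B) l * (\<phi> l - c))"
          by (intro Bochner_Integration.integral_cong) (auto simp: indicator_def)
        also have "\<dots> = (LINT l|M z. indicator B l * (\<phi> l - c)) + (LINT l|M z. indicator (- B) l * (\<phi> l - c))"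
          using B by (intro Bochner_Integration.integral_add iB) auto
        also have "(LINT l|M z. indicator (- B) l * (\<phi> l - c)) = (LINT l|M (P (- B) z). \<phi> l - c)"
        proof -
          have "M (P (- B) z) = density (M z) (\<lambda>l. ennreal (indicator (- B) l))"
            using M_P[of "- B" z] B by (simp add: ennreal_indicator)
          then show ?thesis using phi B by (simp add: integral_density)
        qed
        finally show "(LINT l|M z. \<phi> l) - c * (norm z)\<^sup>2 = (LINT l|M z. indicator B l * (\<phi> l - c)) + (LINT l|M (P (- B) z). \<phi> l - c)" .
        show "\<bar>LINT l|M z. indicator B l * (\<phi> l - c)\<bar> \<le> \<epsilon> * (norm (P B z))\<^sup>2"
          using integral_cell[OF ic B, of 0 \<epsilon>] eps by simp
      qed
      have fy: "f + y \<in> dom \<phi>" "f - y \<in> dom \<phi>" using dom_add dom_diff phi f y by blast+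
      have e1: "inner h y = ((LINT l|M (f + y). \<phi> l) - (LINT l|M (f - y). \<phi> l)) / 4" using si y by (simp add: SI_def)
      have "4 * (c * inner f y) = c * (4 * (((norm (f + y))\<^sup>2 - (norm (f - y))\<^sup>2) / 4))"
        unfolding inner_polar[symmetric] by simp
      then have e2: "4 * (c * inner f y) = c * (norm (f + y))\<^sup>2 - c * (norm (f - y))\<^sup>2"
        by (simp add: right_diff_distrib)
      have aux: "4 * Y = (I1 - c1) - (I2 - c2)" if "X = (I1 - I2) / 4" "4 * d = c1 - c2" "Y = X - d" for X Y I1 I2 c1 c2 d :: real
        using that by (simp add: field_simps)
      have e3: "inner (h - c *\<^sub>R f) y = inner h y - c * inner f y" by (simp add: inner_diff_left)
      have "4 * inner (h - c *\<^sub>R f) y = ((LINT l|M (f + y). \<phi> l) - c * (norm (f + y))\<^sup>2) - ((LINT l|M (f - y). \<phi> l) - c * (norm (f - y))\<^sup>2)"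
        by (rule aux[OF e1 e2 e3])
      also have "\<dots> = (LINT l|M (f + y). indicator B l * (\<phi> l - c)) - (LINT l|M (f - y). indicator B l * (\<phi> l - c))"
        using split[OF fy(1)] split[OF fy(2)] B Py' by (simp add: P_add P_diff)
      also have "\<dots> \<le> \<epsilon> * (norm (P B (f + y)))\<^sup>2 + \<epsilon> * (norm (P B (f - y)))\<^sup>2"
        using part[OF fy(1)] part[OF fy(2)] by linarith
      also have "\<dots> = \<epsilon> * ((norm (P B f + y))\<^sup>2 + (norm (P B f - y))\<^sup>2)"
        using B by (simp add: P_add P_diff Py distrib_left)
      also have "(norm (P B f + y))\<^sup>2 + (norm (P B f - y))\<^sup>2 = 2 * ((norm (P B f))\<^sup>2 + (norm y)\<^sup>2)"
        by (simp add: power2_norm_eq_inner inner_add_left inner_add_right inner_diff_left inner_diff_right)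
      finally have "4 * inner (h - c *\<^sub>R f) y \<le> \<epsilon> * (2 * ((norm (P B f))\<^sup>2 + (norm y)\<^sup>2))" .
      moreover have "\<epsilon> * (2 * ((norm (P B f))\<^sup>2 + (norm y)\<^sup>2)) = 2 * (\<epsilon> * ((norm (P B f))\<^sup>2 + (norm y)\<^sup>2))" by simp
      ultimately have "2 * inner (h - c *\<^sub>R f) y \<le> \<epsilon> * ((norm (P B f))\<^sup>2 + (norm y)\<^sup>2)" by linarith
      moreover have "inner (h - c *\<^sub>R f) x = (norm x)\<^sup>2"
        using norm_P2[OF B, of "h - c *\<^sub>R f"] by (simp add: x_def inner_commute)
      then have "inner (h - c *\<^sub>R f) y = s * (norm x)\<^sup>2" by (simp add: y_def)
      moreover have "(norm y)\<^sup>2 = s\<^sup>2 * (norm x)\<^sup>2" by (simp add: y_def power_mult_distrib)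
      ultimately show ?thesis by (simp only:)
    qed
    define p where "p = norm (P B f)"
    have "norm x \<le> \<epsilon> * p"
    proof (cases "x = 0")
      case True then show ?thesis using eps0 by (simp add: p_def)
    next
      case False
      define X where "X = norm x"
      have X: "X > 0" using False by (simp add: X_def)
      have key': "s * X\<^sup>2 \<le> \<epsilon> * (p\<^sup>2 + s\<^sup>2 * X\<^sup>2) / 2" for s using key[of s] by (simp add: X_def p_def)
      show ?thesis
      proof (cases "p = 0")
        case True
        \<comment> \<open>The optimal scale degenerates to 0 here. The scale
          \<open>1 / (\<epsilon> + 1)\<close> is small enough that the quadratic side stays below
          the linear one, which contradicts a nonzero x.\<close>
        have "1 / (\<epsilon> + 1) * X\<^sup>2 \<le> \<epsilon> / (\<epsilon> + 1)\<^sup>2 * X\<^sup>2 / 2"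
          using key'[of "1 / (\<epsilon> + 1)"] True by (simp add: power_divide)
        then have "X\<^sup>2 * (1 / (\<epsilon> + 1)) \<le> X\<^sup>2 * (\<epsilon> / (\<epsilon> + 1)\<^sup>2 / 2)" by (simp add: mult.commute)
        then have "1 / (\<epsilon> + 1) \<le> \<epsilon> / (\<epsilon> + 1)\<^sup>2 / 2"
          by (rule iffD1[OF mult_le_cancel_left_pos, rotated]) (use X in simp)
        then have "2 * (\<epsilon> + 1) \<le> \<epsilon>" using eps0 by (simp add: power2_eq_square divide_simps split: if_splits)
        then show ?thesis using eps0 by simp
      next
        case False
        then have p: "p > 0" by (simp add: p_def)
        have "p * X \<le> \<epsilon> * p\<^sup>2" using key'[of "p / X"] X by (simp add: power2_eq_square field_simps)
        then have "X \<le> \<epsilon> * p" using p by (simp add: power2_eq_square mult.commute mult.left_commute)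
        then show ?thesis by (simp add: X_def)
      qed
    qed
    then show ?thesis using B by (simp add: x_def p_def P_diff P_scale)
  qed
qed

section \<open>Quadratic forms and lower bounds of the spectrum\<close>

lemma LC_norm:
  assumes phi: "\<phi> \<in> borel_measurable borel" and lc: "LC \<phi> f h"
  shows "ennreal ((norm h)\<^sup>2) = (\<integral>\<^sup>+l. ennreal ((\<phi> l)\<^sup>2) \<partial>M f)"
  using LC_nn_integral[OF phi lc, of "\<lambda>_. 1"] nn_integral_M_1[of h] by simp

lemma LC_inner_self:
  assumes phi: "\<phi> \<in> borel_measurable borel" and lc: "LC \<phi> f h"
  shows "inner h f = (LINT l|M f. \<phi> l)"
proof -
  have "inner h f = ((LINT l|M (f + f). \<phi> l) - (LINT l|M (f - f). \<phi> l)) / 4"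
    using LC_imp_SI[OF assms] LC_dom[OF assms] by (simp add: SI_def)
  moreover have "(LINT l|M (f + f). \<phi> l) = 4 * (LINT l|M f. \<phi> l)"
    using integral_M_scale[OF phi, of 2 f] by (simp add: scaleR_2)
  moreover have "(LINT l|M (f - f). \<phi> l) = 0"
    using integral_M_scale[OF phi, of 0 f] by simp
  ultimately show ?thesis by simp
qed

lemma LC_inner_self_le:
  assumes lc: "LC \<phi> y z" and phi: "\<phi> \<in> borel_measurable borel" and Az: "LC (\<lambda>l. l) z az"
  shows "ennreal \<bar>inner az z\<bar> \<le> (\<integral>\<^sup>+l. ennreal ((\<phi> l)\<^sup>2 * \<bar>l\<bar>) \<partial>M y)"
proof -
  have i: "integrable (M z) (\<lambda>l. l)"
    using dom_integrable[OF _ LC_dom[OF _ Az]] by simp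
  have "\<bar>inner az z\<bar> = \<bar>LINT l|M z. l\<bar>" using LC_inner_self[OF _ Az] by simp
  also have "\<dots> \<le> (LINT l|M z. \<bar>l\<bar>)" by (rule integral_abs_bound)
  finally have "ennreal \<bar>inner az z\<bar> \<le> ennreal (LINT l|M z. \<bar>l\<bar>)" by (rule ennreal_leI)
  also have "\<dots> = (\<integral>\<^sup>+l. ennreal \<bar>l\<bar> \<partial>M z)"
    using i by (intro nn_integral_eq_integral[symmetric]) auto
  also have "\<dots> = (\<integral>\<^sup>+l. ennreal ((\<phi> l)\<^sup>2 * \<bar>l\<bar>) \<partial>M y)"
    using LC_nn_integral[OF phi lc, of "\<lambda>l. ennreal \<bar>l\<bar>"] by (simp add: ennreal_mult)
  finally show ?thesis .
qed

lemma bounded_cutoff: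
  assumes B: "B \<in> sets borel" and K: "\<And>l. l \<in> B \<Longrightarrow> \<bar>l\<bar> \<le> K"
  shows "\<exists>h. LC (\<lambda>l. l) (P B y) h \<and> P B h = h"
proof -
  have "\<exists>h. LC (\<lambda>l. indicator B l * l) y h"
  proof (rule LC_exists[of _ "\<bar>K\<bar>"])
    show "(\<lambda>l. indicator B l * l) \<in> borel_measurable borel" using B by measurable
    show "\<bar>indicator B l * l\<bar> \<le> \<bar>K\<bar>" for l using K[of l] by (auto simp: indicator_def)
  qed
  then show ?thesis using LC_P[OF B] by blast
qed

text \<open>On a bounded set to the left of \<open>- (C + 1)\<close> the quadratic form is at most
  \<open>- (C + 1)\<close> and at least \<open>- C\<close> times the squared norm, so the projection
  is zero; countably many such sets cover the ray. The assumption speaks of h that are themselves in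
  the domain, since these have continuous representatives, for which the energy identity
  holds.\<close>

lemma M_lower_bound:
  assumes low: "\<And>f h h2. LC (\<lambda>l. l) f h \<Longrightarrow> LC (\<lambda>l. l) h h2 \<Longrightarrow> inner h f \<ge> - C * (norm f)\<^sup>2"
  shows "AE l in M y. - (C + 1) \<le> l"
proof -
  define B where "B n = {- real n ..< - (C + 1)}" for n
  have null: "emeasure (M y) (B n) = 0" for n
  proof -
    have Bm: "B n \<in> sets borel" by (simp add: B_def)
    have Bb: "\<bar>l\<bar> \<le> real n + \<bar>C + 1\<bar>" if "l \<in> B n" for l using that by (auto simp: B_def)
    obtain h where h: "LC (\<lambda>l. l) (P (B n) y) h" "P (B n) h = h" using bounded_cutoff[OF Bm Bb] by blast
    obtain h2 where h2: "LC (\<lambda>l. l) h h2" using bounded_cutoff[OF Bm Bb, of h] h(2) by auto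
    let ?f = "P (B n) y"
    have i: "integrable (M ?f) (\<lambda>l. l)"
      using dom_integrable[OF _ LC_dom[OF _ h(1)]] by simp
    have "inner h ?f = (LINT l|M ?f. l)" using LC_inner_self[OF _ h(1)] by simp
    also have "\<dots> \<le> (LINT l|M ?f. - (C + 1))"
    proof (rule integral_mono_AE[OF i])
      show "AE l in M ?f. l \<le> - (C + 1)"
        unfolding M_P[OF Bm] using Bm by (subst AE_density) (auto simp: B_def indicator_def)
    qed (simp add: finite_measure.integrable_const[OF finite_measure_M])
    also have "\<dots> = - (C + 1) * (norm ?f)\<^sup>2" by (simp add: norm_M algebra_simps)
    finally have "- C * (norm ?f)\<^sup>2 \<le> - (C + 1) * (norm ?f)\<^sup>2" using low[OF h(1) h2] by linarith
    then have "norm ?f = 0" by (simp add: algebra_simps)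
    then show ?thesis using Bm by (simp add: emeasure_M)
  qed
  have "AE l in M y. \<forall>n. l \<notin> B n"
    unfolding AE_all_countable using null by (intro allI AE_not_in) (auto simp: null_sets_def B_def)
  then show ?thesis
  proof (rule AE_mp, intro AE_I2 impI)
    fix l assume l: "\<forall>n. l \<notin> B n"
    obtain n where "- l \<le> real n" using real_arch_simple by blast
    then show "- (C + 1) \<le> l" using l[rule_format, of n] by (auto simp: B_def)
  qed
qed

text \<open>For l at least -C one has |l| \<le> l + 2 C, and the integral of l is the quadratic
  form.\<close>

lemma nn_integral_abs_le:
  assumes low: "AE l in M y. - C \<le> l" and C: "C \<ge> 0" and h: "LC (\<lambda>l. l) y h"
  shows "(\<integral>\<^sup>+l. ennreal \<bar>l\<bar> \<partial>M y) \<le> ennreal (inner h y + 2 * C * (norm y)\<^sup>2)"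
proof -
  have i: "integrable (M y) (\<lambda>l. l)"
    using dom_integrable[OF _ LC_dom[OF _ h]] by simp
  have ic: "integrable (M y) (\<lambda>l. c)" for c :: real
    by (simp add: finite_measure.integrable_const[OF finite_measure_M])
  have pos: "AE l in M y. 0 \<le> l + 2 * C" using low by eventually_elim (use C in simp)
  have le: "AE l in M y. ennreal \<bar>l\<bar> \<le> ennreal (l + 2 * C)"
    using low by eventually_elim (rule ennreal_leI, use C in linarith)
  have "(\<integral>\<^sup>+l. ennreal \<bar>l\<bar> \<partial>M y) \<le> (\<integral>\<^sup>+l. ennreal (l + 2 * C) \<partial>M y)"
    by (rule nn_integral_mono_AE[OF le])
  also have "\<dots> = ennreal (LINT l|M y. l + 2 * C)"
    using i ic pos by (intro nn_integral_eq_integral Bochner_Integration.integrable_add) auto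
  also have "(LINT l|M y. l + 2 * C) = inner h y + 2 * C * (norm y)\<^sup>2"
  proof -
    have "(LINT l|M y. l + 2 * C) = (LINT l|M y. l) + (LINT l|M y. 2 * C)"
      by (rule Bochner_Integration.integral_add[OF i ic])
    moreover have "(LINT l|M y. 2 * C) = 2 * C * (norm y)\<^sup>2"
      unfolding norm_M by simp
    ultimately show ?thesis using LC_inner_self[OF _ h] by simp
  qed
  finally show ?thesis .
qed

end

section \<open>Square-integrable functions on the half-line as a Hilbert space\<close>

lemma halfline_AE_iff: "(AE x in halfline. P x) \<longleftrightarrow> (AE x in lebesgue. x \<ge> 0 \<longrightarrow> P x)"
  by (subst AE_restrict_space_iff) auto

lemma L2_measurable: "f \<in> L2 \<Longrightarrow> f \<in> borel_measurable halfline"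
  and L2_integrable: "f \<in> L2 \<Longrightarrow> integrable halfline (\<lambda>x. (cmod (f x))\<^sup>2)"
  by (auto simp: L2_def)

lemma L2_add: assumes "f \<in> L2" "g \<in> L2" shows "(\<lambda>x. f x + g x) \<in> L2"
proof -
  have m: "(\<lambda>x. f x + g x) \<in> borel_measurable halfline" using assms by (auto simp: L2_def)
  have "integrable halfline (\<lambda>x. (cmod (f x + g x))\<^sup>2)"
  proof (rule Bochner_Integration.integrable_bound)
    show "integrable halfline (\<lambda>x. 2 * (cmod (f x))\<^sup>2 + 2 * (cmod (g x))\<^sup>2)"
      using assms by (auto simp: L2_def)
    show "AE x in halfline. norm ((cmod (f x + g x))\<^sup>2) \<le> norm (2 * (cmod (f x))\<^sup>2 + 2 * (cmod (g x))\<^sup>2)"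
    proof (rule AE_I2)
      fix x
      have "(cmod (f x + g x))\<^sup>2 \<le> (cmod (f x) + cmod (g x))\<^sup>2" by (intro power_mono norm_triangle_ineq) auto
      also have "\<dots> \<le> 2 * (cmod (f x))\<^sup>2 + 2 * (cmod (g x))\<^sup>2"
        using sum_squares_bound[of "cmod (f x)" "cmod (g x)"] by (simp add: power2_sum)
      finally show "norm ((cmod (f x + g x))\<^sup>2) \<le> norm (2 * (cmod (f x))\<^sup>2 + 2 * (cmod (g x))\<^sup>2)" by simp
    qed
  qed (use m in measurable)
  then show ?thesis using m by (simp add: L2_def)
qed

lemma L2_cmult: assumes "f \<in> L2" shows "(\<lambda>x. c * f x) \<in> L2"
  using assms by (auto simp: L2_def norm_mult power_mult_distrib)

lemma L2_zero: "(\<lambda>x. 0) \<in> L2" by (simp add: L2_def)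

lemma L2_uminus: "f \<in> L2 \<Longrightarrow> (\<lambda>x. - f x) \<in> L2"
  using L2_cmult[of f "-1"] by simp

lemma L2_diff: "f \<in> L2 \<Longrightarrow> g \<in> L2 \<Longrightarrow> (\<lambda>x. f x - g x) \<in> L2"
  using L2_add[of f "\<lambda>x. - g x"] L2_uminus by simp

lemma L2_sum: "(\<And>i. i \<in> I \<Longrightarrow> f i \<in> L2) \<Longrightarrow> (\<lambda>x. \<Sum>i\<in>I. f i x) \<in> L2"
  by (induction I rule: infinite_finite_induct) (auto intro: L2_zero L2_add)

lemma L2_bounded_mult:
  assumes f: "f \<in> L2" and m: "g \<in> borel_measurable halfline" and le: "\<And>x. x \<ge> 0 \<Longrightarrow> cmod (g x) \<le> K * cmod (f x)"
  shows "g \<in> L2"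
proof -
  have "integrable halfline (\<lambda>x. (cmod (g x))\<^sup>2)"
  proof (rule Bochner_Integration.integrable_bound)
    show "integrable halfline (\<lambda>x. K\<^sup>2 * (cmod (f x))\<^sup>2)" using f by (auto simp: L2_def)
    show "AE x in halfline. norm ((cmod (g x))\<^sup>2) \<le> norm (K\<^sup>2 * (cmod (f x))\<^sup>2)"
      using le by (intro AE_I2) (auto simp flip: power_mult_distrib intro!: power_mono)
  qed (use m in measurable)
  then show ?thesis using m by (simp add: L2_def)
qed

lemma L2_norm_nonneg: "0 \<le> L2_norm f"
  by (simp add: L2_norm_def)

lemma L2_norm_sq: "(L2_norm f)\<^sup>2 = (LINT x|halfline. (cmod (f x))\<^sup>2)"
  by (simp add: L2_norm_def)

lemma L2_norm_bounded_mult: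
  assumes f: "f \<in> L2" and K: "0 \<le> K" and m: "g \<in> borel_measurable halfline" and le: "\<And>x. x \<ge> 0 \<Longrightarrow> cmod (g x) \<le> K * cmod (f x)"
  shows "L2_norm g \<le> K * L2_norm f"
proof -
  have "(LINT x|halfline. (cmod (g x))\<^sup>2) \<le> (LINT x|halfline. K\<^sup>2 * (cmod (f x))\<^sup>2)"
  proof (rule integral_mono)
    show "integrable halfline (\<lambda>x. (cmod (g x))\<^sup>2)" using L2_bounded_mult[OF f m le] by (simp add: L2_def)
    show "integrable halfline (\<lambda>x. K\<^sup>2 * (cmod (f x))\<^sup>2)" using f by (simp add: L2_def)
    show "(cmod (g x))\<^sup>2 \<le> K\<^sup>2 * (cmod (f x))\<^sup>2" if "x \<in> space halfline" for x
      using le[of x] that by (auto simp flip: power_mult_distrib intro!: power_mono)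
  qed
  then have "(L2_norm g)\<^sup>2 \<le> (K * L2_norm f)\<^sup>2" by (simp add: L2_norm_sq power_mult_distrib)
  then show ?thesis by (rule power2_le_imp_le) (simp add: K L2_norm_nonneg)
qed

lemma borel_measurable_cnj:
  "f \<in> borel_measurable M \<Longrightarrow> (\<lambda>x. cnj (f x)) \<in> borel_measurable M"
  by (rule measurable_compose[OF _ borel_measurable_continuous_onI]) (auto intro!: continuous_intros)

lemma L2_mult_integrable:
  assumes "f \<in> L2" "g \<in> L2" shows "integrable halfline (\<lambda>x. f x * cnj (g x))"
proof (rule Bochner_Integration.integrable_bound)
  show "integrable halfline (\<lambda>x. (cmod (f x))\<^sup>2 + (cmod (g x))\<^sup>2)"
    using assms by (auto simp: L2_def)
  show "AE x in halfline. norm (f x * cnj (g x)) \<le> norm ((cmod (f x))\<^sup>2 + (cmod (g x))\<^sup>2)"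
  proof (rule AE_I2)
    fix x
    show "norm (f x * cnj (g x)) \<le> norm ((cmod (f x))\<^sup>2 + (cmod (g x))\<^sup>2)"
      using sum_squares_bound[of "cmod (f x)" "cmod (g x)"] mult_nonneg_nonneg[of "cmod (f x)" "cmod (g x)"]
      by (simp add: norm_mult del: mult_nonneg_nonneg zero_le_mult_iff)
  qed
qed (use assms in \<open>auto simp: L2_def intro!: borel_measurable_times borel_measurable_cnj\<close>)

lemma L2_inner_commute: "L2_inner g f = cnj (L2_inner f g)"
proof -
  have "(LINT x|halfline. cnj (f x * cnj (g x))) = cnj (LINT x|halfline. f x * cnj (g x))"
    by (rule Bochner_Integration.integral_cnj)
  then show ?thesis by (simp add: L2_inner_def mult.commute)
qed

lemma L2_inner_add: "f \<in> L2 \<Longrightarrow> f' \<in> L2 \<Longrightarrow> g \<in> L2 \<Longrightarrow> L2_inner (\<lambda>x. f x + f' x) g = L2_inner f g + L2_inner f' g"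
  unfolding L2_inner_def by (simp add: distrib_right L2_mult_integrable)

lemma L2_inner_cmult: "L2_inner (\<lambda>x. c * f x) g = c * L2_inner f g"
  unfolding L2_inner_def by (simp add: mult.assoc)

lemma L2_inner_self: "L2_inner f f = complex_of_real ((L2_norm f)\<^sup>2)"
  unfolding L2_inner_def L2_norm_sq complex_norm_square[symmetric]
  by (rule integral_complex_of_real)

lemma L2_eq_refl: "L2_eq f f" and L2_eq_sym: "L2_eq f g \<Longrightarrow> L2_eq g f"
  by (auto simp: L2_eq_def elim: eventually_mono)
lemma L2_eq_trans: assumes "L2_eq f g" "L2_eq g h" shows "L2_eq f h"
  using assms unfolding L2_eq_def by eventually_elim simp

definition l2rel :: "(real \<Rightarrow> complex) \<Rightarrow> (real \<Rightarrow> complex) \<Rightarrow> bool" where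
  "l2rel f g \<longleftrightarrow> f \<in> L2 \<and> g \<in> L2 \<and> L2_eq f g"

\<comment> \<open>The locale \<open>pvm\<close> is formulated over type classes, so the space of
  square-integrable functions has to become a type. The relation is partial because not every
  function is square integrable.\<close>
quotient_type l2 = "real \<Rightarrow> complex" / partial: l2rel
  morphisms rep_l2 cls
proof (rule part_equivpI)
  show "\<exists>x. l2rel x x" using L2_zero L2_eq_refl by (auto simp: l2rel_def)
  show "symp l2rel" by (auto simp: l2rel_def symp_def L2_eq_sym)
  show "transp l2rel" by (auto simp: l2rel_def transp_def intro: L2_eq_trans)
qed

lemma L2_inner_cong:
  assumes "l2rel f f'" "l2rel g g'" shows "L2_inner f g = L2_inner f' g'"
proof -
  have "AE x in halfline. f x * cnj (g x) = f' x * cnj (g' x)"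
  proof -
    have "AE x in halfline. f x = f' x" "AE x in halfline. g x = g' x"
      using assms by (auto simp: l2rel_def L2_eq_def)
    then show ?thesis by eventually_elim simp
  qed
  then show ?thesis unfolding L2_inner_def using assms
    by (intro integral_cong_AE) (auto simp: l2rel_def L2_def intro!: borel_measurable_times borel_measurable_cnj)
qed

instantiation l2 :: real_vector
begin

lift_definition zero_l2 :: l2 is "\<lambda>_. 0" by (simp add: l2rel_def L2_zero L2_eq_refl)
lift_definition plus_l2 :: "l2 \<Rightarrow> l2 \<Rightarrow> l2" is "\<lambda>f g x. f x + g x"
  by (auto simp: l2rel_def L2_add L2_eq_def elim: eventually_elim2)
lift_definition minus_l2 :: "l2 \<Rightarrow> l2 \<Rightarrow> l2" is "\<lambda>f g x. f x - g x"
  by (auto simp: l2rel_def L2_diff L2_eq_def elim: eventually_elim2)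
lift_definition uminus_l2 :: "l2 \<Rightarrow> l2" is "\<lambda>f x. - f x"
  by (auto simp: l2rel_def L2_uminus L2_eq_def elim: eventually_mono)
lift_definition scaleR_l2 :: "real \<Rightarrow> l2 \<Rightarrow> l2" is "\<lambda>r f x. complex_of_real r * f x"
  by (auto simp: l2rel_def L2_cmult L2_eq_def elim: eventually_mono)

instance
proof
  fix x y z :: l2 and a b :: real
  show "x + y + z = x + (y + z)" by transfer (auto simp: l2rel_def L2_add L2_eq_refl add.assoc)
  show "x + y = y + x" by transfer (auto simp: l2rel_def L2_add L2_eq_refl add.commute)
  show "0 + x = x" by transfer (auto simp: l2rel_def L2_eq_refl)
  show "- x + x = 0" by transfer (auto simp: l2rel_def L2_eq_refl L2_zero)
  show "x - y = x + - y" by transfer (auto simp: l2rel_def L2_eq_refl L2_diff)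
  show "a *\<^sub>R (x + y) = a *\<^sub>R x + a *\<^sub>R y" by transfer (auto simp: l2rel_def L2_add L2_cmult L2_eq_refl distrib_left)
  show "(a + b) *\<^sub>R x = a *\<^sub>R x + b *\<^sub>R x" by transfer (auto simp: l2rel_def L2_add L2_cmult L2_eq_refl distrib_right)
  show "a *\<^sub>R b *\<^sub>R x = (a * b) *\<^sub>R x" by transfer (auto simp: l2rel_def L2_cmult L2_eq_refl mult.assoc)
  show "1 *\<^sub>R x = x" by transfer (auto simp: l2rel_def L2_eq_refl)
qed

end

instantiation l2 :: real_inner
begin

lift_definition inner_l2 :: "l2 \<Rightarrow> l2 \<Rightarrow> real" is "\<lambda>f g. Re (L2_inner f g)"
  by (simp add: L2_inner_cong)
definition norm_l2 :: "l2 \<Rightarrow> real" where "norm_l2 x = sqrt (inner x x)"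
definition dist_l2 :: "l2 \<Rightarrow> l2 \<Rightarrow> real" where "dist_l2 x y = norm (x - y)"
definition sgn_l2 :: "l2 \<Rightarrow> l2" where "sgn_l2 x = x /\<^sub>R norm x"
definition uniformity_l2 :: "(l2 \<times> l2) filter" where
  "uniformity_l2 = (INF e\<in>{0<..}. principal {(x, y). dist x y < e})"
definition open_l2 :: "l2 set \<Rightarrow> bool" where
  "open_l2 U = (\<forall>x\<in>U. eventually (\<lambda>(x', y). x' = x \<longrightarrow> y \<in> U) uniformity)"

instance
proof
  fix x y z :: l2 and a b :: real and U :: "l2 set"
  show "inner x y = inner y x" by transfer (subst L2_inner_commute, simp)
  show "inner (x + y) z = inner x z + inner y z" by transfer (simp add: l2rel_def L2_inner_add)
  show "inner (a *\<^sub>R x) y = a * inner x y" by transfer (simp add: L2_inner_cmult)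
  show "0 \<le> inner x x" by transfer (simp add: L2_inner_self)
  show "(inner x x = 0) = (x = 0)"
  proof transfer
    fix f assume "l2rel f f"
    then have f: "f \<in> L2" by (simp add: l2rel_def)
    have "(Re (L2_inner f f) = 0) = ((LINT x|halfline. (cmod (f x))\<^sup>2) = 0)"
      by (simp add: L2_inner_self L2_norm_sq del: of_real_power)
    also have "\<dots> = (AE x in halfline. (cmod (f x))\<^sup>2 = 0)"
      using f by (intro integral_nonneg_eq_0_iff_AE) (auto simp: L2_def)
    also have "\<dots> = l2rel f (\<lambda>_. 0)" using f by (simp add: l2rel_def L2_eq_def L2_zero)
    finally show "(Re (L2_inner f f) = 0) = l2rel f (\<lambda>_. 0)" .
  qed
qed (simp_all add: norm_l2_def dist_l2_def sgn_l2_def uniformity_l2_def open_l2_def)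

end

lift_definition scaleC :: "complex \<Rightarrow> l2 \<Rightarrow> l2" is "\<lambda>c f x. c * f x"
  by (auto simp: l2rel_def L2_cmult L2_eq_def elim: eventually_mono)

lemma cls_eq_iff: "f \<in> L2 \<Longrightarrow> g \<in> L2 \<Longrightarrow> cls f = cls g \<longleftrightarrow> L2_eq f g"
  using Quotient3_rel[OF Quotient3_l2, of f g] by (auto simp: l2rel_def L2_eq_refl)

lemma rep_l2: "rep_l2 x \<in> L2" and cls_rep: "cls (rep_l2 x) = x"
  using Quotient3_rep_reflp[OF Quotient3_l2, of x] Quotient3_abs_rep[OF Quotient3_l2, of x]
  by (auto simp: l2rel_def)

lemma cls_cases: obtains f where "f \<in> L2" "cls f = x"
  using rep_l2 cls_rep by blast

lemma rep_cls: "f \<in> L2 \<Longrightarrow> L2_eq (rep_l2 (cls f)) f"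
  using cls_eq_iff[OF rep_l2] cls_rep by blast

lemma cls_add: "f \<in> L2 \<Longrightarrow> g \<in> L2 \<Longrightarrow> cls (\<lambda>x. f x + g x) = cls f + cls g"
  by (simp add: plus_l2.abs_eq l2rel_def L2_eq_refl)
lemma cls_diff: "f \<in> L2 \<Longrightarrow> g \<in> L2 \<Longrightarrow> cls (\<lambda>x. f x - g x) = cls f - cls g"
  by (simp add: minus_l2.abs_eq l2rel_def L2_eq_refl)
lemma cls_zero: "cls (\<lambda>x. 0) = 0"
  by (simp add: zero_l2.abs_eq)
lemma cls_scaleC: "f \<in> L2 \<Longrightarrow> cls (\<lambda>x. c * f x) = scaleC c (cls f)"
  by (simp add: scaleC.abs_eq l2rel_def L2_eq_refl)
lemma cls_scaleR: "f \<in> L2 \<Longrightarrow> cls (\<lambda>x. complex_of_real c * f x) = c *\<^sub>R cls f"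
  by (simp add: scaleR_l2.abs_eq l2rel_def L2_eq_refl)
lemma cls_inner: "f \<in> L2 \<Longrightarrow> g \<in> L2 \<Longrightarrow> inner (cls f) (cls g) = Re (L2_inner f g)"
  by (simp add: inner_l2.abs_eq l2rel_def L2_eq_refl)
lemma cls_norm: "f \<in> L2 \<Longrightarrow> norm (cls f) = L2_norm f"
  by (simp add: norm_l2_def cls_inner L2_inner_self L2_norm_nonneg)
lemma cls_sum: "(\<And>i. i \<in> I \<Longrightarrow> f i \<in> L2) \<Longrightarrow> cls (\<lambda>x. \<Sum>i\<in>I. f i x) = (\<Sum>i\<in>I. cls (f i))"
proof (induction I rule: infinite_finite_induct)
  case (insert i I)
  have "cls (\<lambda>x. f i x + (\<Sum>i\<in>I. f i x)) = cls (f i) + cls (\<lambda>x. \<Sum>i\<in>I. f i x)"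
    using insert.prems by (intro cls_add L2_sum) auto
  then show ?case using insert by simp
qed (auto simp: cls_zero)

section \<open>Completeness\<close>

text \<open>Convergence of the weighted series bounds the k-th increment eventually by (1/2)^(k/2),
  which is summable. The weight 2^k fits subsequences whose squared increments integrate to at most
  (1/4)^k.\<close>

lemma fast_Cauchy_convergent:
  fixes f :: "nat \<Rightarrow> complex"
  assumes "(\<Sum>k. ennreal (2 ^ k * (cmod (f (Suc k) - f k))\<^sup>2)) \<noteq> \<infinity>"
  shows "convergent f"
proof -
  have s: "summable (\<lambda>k. 2 ^ k * (cmod (f (Suc k) - f k))\<^sup>2)"
    using assms by (intro summable_suminf_not_top) auto
  have "eventually (\<lambda>k. 2 ^ k * (cmod (f (Suc k) - f k))\<^sup>2 < 1) sequentially"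
    using summable_LIMSEQ_zero[OF s] by (rule order_tendstoD) simp
  then have ev: "eventually (\<lambda>k. norm (f (Suc k) - f k) \<le> sqrt (1/2) ^ k) sequentially"
  proof eventually_elim
    case (elim k)
    have "(cmod (f (Suc k) - f k))\<^sup>2 \<le> (sqrt (1/2) ^ k)\<^sup>2"
    proof -
      have "(sqrt (1/2) ^ k)\<^sup>2 = (1/2 :: real) ^ k"
        by (simp add: power2_eq_square flip: power_mult_distrib)
      moreover have "(cmod (f (Suc k) - f k))\<^sup>2 \<le> (1/2) ^ k"
        using elim by (simp add: power_one_over field_simps)
      ultimately show ?thesis by simp
    qed
    then show ?case by (rule power2_le_imp_le) simp
  qed
  have "summable (\<lambda>k. f (Suc k) - f k)"
    by (rule summable_comparison_test_ev[OF ev]) (auto intro!: summable_geometric simp: real_sqrt_lt_1_iff)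
  then have "(\<lambda>n. \<Sum>k<n. f (Suc k) - f k) \<longlonglongrightarrow> (\<Sum>k. f (Suc k) - f k)"
    by (rule summable_LIMSEQ)
  then have "(\<lambda>n. f n - f 0) \<longlonglongrightarrow> (\<Sum>k. f (Suc k) - f k)"
    by (simp add: sum_lessThan_telescope)
  then have "(\<lambda>n. (f n - f 0) + f 0) \<longlonglongrightarrow> (\<Sum>k. f (Suc k) - f k) + f 0"
    by (intro tendsto_add tendsto_const)
  then show ?thesis by (auto simp: convergent_def)
qed

lemma nn_integral_L2:
  "f \<in> L2 \<Longrightarrow> (\<integral>\<^sup>+x. ennreal ((cmod (f x))\<^sup>2) \<partial>halfline) = ennreal ((L2_norm f)\<^sup>2)"
  by (subst nn_integral_eq_integral) (auto simp: L2_def L2_norm_sq)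

lemma L2_Fatou:
  assumes f: "\<And>k. f k \<in> L2" and m: "F \<in> borel_measurable halfline"
    and lim: "AE x in halfline. (\<lambda>k. f k x) \<longlonglongrightarrow> F x"
    and bd: "eventually (\<lambda>k. L2_norm (f k) \<le> e) sequentially"
  shows "F \<in> L2" "L2_norm F \<le> e"
proof -
  obtain k where "L2_norm (f k) \<le> e" using bd by (auto simp: eventually_sequentially)
  then have e0: "0 \<le> e" using L2_norm_nonneg order_trans by blast
  have "(\<integral>\<^sup>+x. ennreal ((cmod (F x))\<^sup>2) \<partial>halfline) = (\<integral>\<^sup>+x. liminf (\<lambda>k. ennreal ((cmod (f k x))\<^sup>2)) \<partial>halfline)"
  proof (rule nn_integral_cong_AE)
    show "AE x in halfline. ennreal ((cmod (F x))\<^sup>2) = liminf (\<lambda>k. ennreal ((cmod (f k x))\<^sup>2))"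
      using lim
    proof eventually_elim
      case (elim x)
      have "(\<lambda>k. ennreal ((cmod (f k x))\<^sup>2)) \<longlonglongrightarrow> ennreal ((cmod (F x))\<^sup>2)"
        using elim by (intro tendsto_ennrealI tendsto_intros)
      then show ?case by (intro lim_imp_Liminf[symmetric]) auto
    qed
  qed
  also have "\<dots> \<le> liminf (\<lambda>k. \<integral>\<^sup>+x. ennreal ((cmod (f k x))\<^sup>2) \<partial>halfline)"
    using f by (intro nn_integral_liminf) (auto simp: L2_def)
  also have "\<dots> \<le> liminf (\<lambda>k. ennreal (e\<^sup>2))"
    using bd by (intro Liminf_mono) (auto elim!: eventually_mono simp: nn_integral_L2[OF f] L2_norm_nonneg intro!: ennreal_leI power_mono)
  also have "\<dots> = ennreal (e\<^sup>2)" by (simp add: Liminf_const)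
  finally have le: "(\<integral>\<^sup>+x. ennreal ((cmod (F x))\<^sup>2) \<partial>halfline) \<le> ennreal (e\<^sup>2)" .
  then show F: "F \<in> L2"
    unfolding L2_def using m by (auto simp: integrable_iff_bounded intro: le_less_trans[OF le])
  have "(L2_norm F)\<^sup>2 \<le> e\<^sup>2" using le by (simp add: nn_integral_L2[OF F])
  then show "L2_norm F \<le> e" by (rule power2_le_imp_le) (rule e0)
qed

text \<open>The argument is that of Riesz and Fischer: a rapidly convergent subsequence converges
  almost everywhere by \<open>fast_Cauchy_convergent\<close>, and Fatou's lemma carries the Cauchy
  estimates over to the pointwise limit.\<close>

instance l2 :: complete_space
proof
  fix X :: "nat \<Rightarrow> l2" assume C: "Cauchy X"
  define g where "g n = rep_l2 (X n)" for n
  have g: "g n \<in> L2" "cls (g n) = X n" for n by (auto simp: g_def rep_l2 cls_rep)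
  have dist: "L2_norm (\<lambda>x. g m x - g n x) = dist (X m) (X n)" for m n
    using g by (simp add: cls_norm[symmetric] L2_diff cls_diff dist_norm)
  have "\<forall>k. \<exists>N. \<forall>m\<ge>N. \<forall>n\<ge>N. dist (X m) (X n) < (1/2) ^ k"
    using metric_CauchyD[OF C] by simp
  then obtain N where N: "\<And>k m n. m \<ge> N k \<Longrightarrow> n \<ge> N k \<Longrightarrow> dist (X m) (X n) < (1/2) ^ k"
    by metis
  \<comment> \<open>Summing the thresholds gives indices that are monotone and still at least
    \<open>N k\<close>.\<close>
  define s where "s k = (\<Sum>j\<le>k. N j)" for k
  have s: "s k \<ge> N k" "s (Suc k) \<ge> s k" for k by (auto simp: s_def intro!: member_le_sum)
  have s_inc: "s k \<ge> s j" if "k \<ge> j" for j k using that s(2) by (rule lift_Suc_mono_le[rotated])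
  define f where "f k = g (s k)" for k
  have d: "(L2_norm (\<lambda>x. f (Suc k) x - f k x))\<^sup>2 \<le> (1/4) ^ k" for k
  proof -
    have "L2_norm (\<lambda>x. f (Suc k) x - f k x) \<le> (1/2) ^ k"
      unfolding f_def dist using N[of k "s (Suc k)" "s k"] s[of k] by simp
    then have "(L2_norm (\<lambda>x. f (Suc k) x - f k x))\<^sup>2 \<le> ((1/2) ^ k)\<^sup>2"
      by (intro power_mono L2_norm_nonneg)
    also have "\<dots> = ((1/2)\<^sup>2) ^ k" by (simp only: power_mult[symmetric] mult.commute)
    finally show ?thesis by (simp add: power2_eq_square)
  qed
  have fL: "f k \<in> L2" for k by (simp add: f_def g)
  have fm[measurable]: "f k \<in> borel_measurable halfline" for k using fL by (rule L2_measurable)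
  have "(\<integral>\<^sup>+x. (\<Sum>k. ennreal (2 ^ k * (cmod (f (Suc k) x - f k x))\<^sup>2)) \<partial>halfline)
      = (\<Sum>k. \<integral>\<^sup>+x. ennreal (2 ^ k * (cmod (f (Suc k) x - f k x))\<^sup>2) \<partial>halfline)"
    by (intro nn_integral_suminf) measurable
  also have "\<dots> = (\<Sum>k. ennreal (2 ^ k * (L2_norm (\<lambda>x. f (Suc k) x - f k x))\<^sup>2))"
    using nn_integral_L2[OF L2_diff[OF fL fL]]
    by (simp add: ennreal_mult nn_integral_cmult)
  also have "\<dots> \<le> (\<Sum>k. ennreal ((1/2) ^ k))"
  proof (intro suminf_le ennreal_leI)
    fix k
    have "2 ^ k * (L2_norm (\<lambda>x. f (Suc k) x - f k x))\<^sup>2 \<le> 2 ^ k * (1/4) ^ k"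
      using d[of k] by (intro mult_left_mono) auto
    also have "\<dots> = (1/2) ^ k" by (simp add: power_mult_distrib[symmetric])
    finally show "2 ^ k * (L2_norm (\<lambda>x. f (Suc k) x - f k x))\<^sup>2 \<le> (1/2) ^ k" .
  qed auto
  also have "\<dots> = ennreal (\<Sum>k. (1/2) ^ k)" by (intro suminf_ennreal2) (auto intro: summable_geometric)
  finally have "(\<integral>\<^sup>+x. (\<Sum>k. ennreal (2 ^ k * (cmod (f (Suc k) x - f k x))\<^sup>2)) \<partial>halfline) \<noteq> \<infinity>"
    by (auto simp: top_unique)
  then have "AE x in halfline. (\<Sum>k. ennreal (2 ^ k * (cmod (f (Suc k) x - f k x))\<^sup>2)) \<noteq> \<infinity>"
    by (intro nn_integral_PInf_AE) measurable
  then have conv: "AE x in halfline. (\<lambda>k. f k x) \<longlonglongrightarrow> lim (\<lambda>k. f k x)"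
    by eventually_elim (rule convergent_LIMSEQ_iff[THEN iffD1, OF fast_Cauchy_convergent])
  define F where "F x = lim (\<lambda>k. f k x)" for x
  have Fm: "F \<in> borel_measurable halfline"
    unfolding F_def by (rule borel_measurable_lim_metric) (rule fm)
  have key: "(\<lambda>x. F x - g n x) \<in> L2 \<and> L2_norm (\<lambda>x. F x - g n x) \<le> (1/2) ^ j" if n: "n \<ge> N j" for n j
  proof -
    have gm: "g n \<in> borel_measurable halfline" using g by (intro L2_measurable)
    have a: "\<And>k. (\<lambda>x. f k x - g n x) \<in> L2" using fL g L2_diff by blast
    have b: "(\<lambda>x. F x - g n x) \<in> borel_measurable halfline" using Fm gm by measurable
    have c: "AE x in halfline. (\<lambda>k. f k x - g n x) \<longlonglongrightarrow> F x - g n x"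
      using conv by eventually_elim (auto simp: F_def intro!: tendsto_intros)
    have "L2_norm (\<lambda>x. f k x - g n x) \<le> (1/2) ^ j" if "k \<ge> j" for k
      unfolding f_def dist using N[of j "s k" n] n s_inc[OF that] s(1)[of j] by simp
    then have d: "eventually (\<lambda>k. L2_norm (\<lambda>x. f k x - g n x) \<le> (1/2) ^ j) sequentially"
      by (auto simp: eventually_sequentially)
    show ?thesis using L2_Fatou[OF a b c d] by blast
  qed
  have "(\<lambda>x. (F x - g (N 0) x) + g (N 0) x) \<in> L2" using key[of 0 "N 0"] g by (intro L2_add) auto
  then have F: "F \<in> L2" by simp
  have "X \<longlonglongrightarrow> cls F"
  proof (rule metric_LIMSEQ_I)
    fix e :: real assume "0 < e"
    then obtain j where j: "(1/2) ^ j < e" using real_arch_pow_inv[of e "1/2"] by auto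
    have "dist (X n) (cls F) < e" if "n \<ge> N j" for n
    proof -
      have "dist (cls F) (X n) = L2_norm (\<lambda>x. F x - g n x)"
      proof -
        have "dist (cls F) (X n) = norm (cls (\<lambda>x. F x - g n x))"
          using cls_diff[OF F g(1)[of n]] by (simp add: dist_norm g(2))
        then show ?thesis using cls_norm[OF L2_diff[OF F g(1)]] by simp
      qed
      then show ?thesis using key[OF that] j by (simp add: dist_commute)
    qed
    then show "\<exists>no. \<forall>n\<ge>no. dist (X n) (cls F) < e" by blast
  qed
  then show "convergent X" by (auto simp: convergent_def)
qed

lemma scaleC_zero_right: "scaleC c 0 = 0"
  using cls_scaleC[OF L2_zero, of c] by (simp add: cls_zero)

lemma scaleC_one: "scaleC 1 x = x"
  by (cases x rule: cls_cases) (auto simp flip: cls_scaleC)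
lemma scaleC_of_real: "scaleC (complex_of_real r) x = r *\<^sub>R x"
  by (cases x rule: cls_cases) (auto simp flip: cls_scaleC cls_scaleR)
lemma norm_scaleC: "norm (scaleC c x) = cmod c * norm x"
proof (cases x rule: cls_cases)
  case (1 f)
  have "L2_norm (\<lambda>x. c * f x) = cmod c * L2_norm f"
    by (simp add: L2_norm_def norm_mult power_mult_distrib real_sqrt_mult)
  then show ?thesis using 1 by (auto simp: cls_norm L2_cmult simp flip: cls_scaleC)
qed

section \<open>Transfer of a spectral family to the quotient space\<close>

locale spectral_family =
  fixes E :: "real set \<Rightarrow> (real \<Rightarrow> complex) \<Rightarrow> real \<Rightarrow> complex"
  assumes pvm: "projection_valued_measure E"
begin

lemma E_L2: "B \<in> sets borel \<Longrightarrow> f \<in> L2 \<Longrightarrow> E B f \<in> L2"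
  and E_lin: "B \<in> sets borel \<Longrightarrow> f \<in> L2 \<Longrightarrow> g \<in> L2 \<Longrightarrow> L2_eq (E B (\<lambda>x. a * f x + b * g x)) (\<lambda>x. a * E B f x + b * E B g x)"
  and E_idem: "B \<in> sets borel \<Longrightarrow> f \<in> L2 \<Longrightarrow> L2_eq (E B (E B f)) (E B f)"
  and E_sym: "B \<in> sets borel \<Longrightarrow> f \<in> L2 \<Longrightarrow> g \<in> L2 \<Longrightarrow> L2_inner (E B f) g = L2_inner f (E B g)"
  and E_UNIV: "f \<in> L2 \<Longrightarrow> L2_eq (E UNIV f) f"
  and E_sums: "range C \<subseteq> sets borel \<Longrightarrow> disjoint_family C \<Longrightarrow> f \<in> L2 \<Longrightarrow>
        (\<lambda>n. L2_norm (\<lambda>x. E (\<Union>i::nat. C i) f x - (\<Sum>i<n. E (C i) f x))) \<longlonglongrightarrow> 0"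
  using pvm by (auto simp: projection_valued_measure_def orthogonal_projection_def)

text \<open>The projections act on representatives, and compatibility with equality almost
  everywhere is not part of their definition. It follows from symmetry: for d = f - g the squared
  norm of \<open>E B d\<close> is the inner product of d with \<open>E B (E B d)\<close>, which is 0
  for a null function d.\<close>

lemma E_cong:
  assumes B: "B \<in> sets borel" and f: "f \<in> L2" and g: "g \<in> L2" and eq: "L2_eq f g"
  shows "L2_eq (E B f) (E B g)"
proof -
  define d where "d x = 1 * f x + (-1) * g x" for x
  have d: "d \<in> L2" unfolding d_def using L2_diff[OF f g] by simp
  have lin: "L2_eq (E B d) (\<lambda>x. 1 * E B f x + (-1) * E B g x)"
    unfolding d_def by (rule E_lin[OF B f g])
  have d0: "cls d = 0" unfolding d_def using cls_diff[OF f g] cls_eq_iff[OF f g] eq by simp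
  have "inner (cls (E B d)) (cls (E B d)) = inner (cls d) (cls (E B (E B d)))"
    using E_sym[OF B d E_L2[OF B d]] B d by (simp add: cls_inner E_L2)
  then have "cls (E B d) = 0" using d0 by simp
  then have "cls (E B f) - cls (E B g) = 0"
    using lin cls_eq_iff[OF E_L2[OF B d], of "\<lambda>x. E B f x - E B g x"] B f g
    by (simp add: E_L2 L2_diff cls_diff)
  then show ?thesis using cls_eq_iff B f g by (simp add: E_L2)
qed

definition P :: "real set \<Rightarrow> l2 \<Rightarrow> l2" where "P B x = cls (E B (rep_l2 x))"

lemma P_cls: "B \<in> sets borel \<Longrightarrow> f \<in> L2 \<Longrightarrow> P B (cls f) = cls (E B f)"
  unfolding P_def using E_cong[of B "rep_l2 (cls f)" f] rep_l2 rep_cls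
  by (simp add: cls_eq_iff E_L2)

lemma P_comb:
  assumes B: "B \<in> sets borel" and f: "f \<in> L2" and g: "g \<in> L2"
  shows "P B (cls (\<lambda>x. a * f x + b * g x)) = scaleC a (P B (cls f)) + scaleC b (P B (cls g))"
proof -
  have "P B (cls (\<lambda>x. a * f x + b * g x)) = cls (E B (\<lambda>x. a * f x + b * g x))"
    using B f g by (simp add: P_cls L2_add L2_cmult)
  also have "\<dots> = cls (\<lambda>x. a * E B f x + b * E B g x)"
    using E_lin[OF B f g] B f g by (subst cls_eq_iff) (auto simp: E_L2 L2_add L2_cmult)
  finally show ?thesis using B f g by (simp add: P_cls cls_add cls_scaleC E_L2 L2_cmult)
qed

lemma P_scaleC: assumes B: "B \<in> sets borel" shows "P B (scaleC c x) = scaleC c (P B x)"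
proof (cases x rule: cls_cases)
  case (1 f)
  then show ?thesis using P_comb[OF B 1(1) L2_zero, of c 0] P_comb[OF B 1(1) 1(1), of 0 0]
    scaleC_of_real[of 0] by (auto simp: cls_scaleC cls_zero scaleC_zero_right)
qed

sublocale pvm P
proof (rule pvm.intro)
  fix B :: "real set" and x y :: l2 assume B: "B \<in> sets borel"
  show "linear (P B)"
  proof (rule linearI)
    fix x y :: l2 and r :: real
    obtain f where f: "f \<in> L2" "cls f = x" by (rule cls_cases)
    obtain g where g: "g \<in> L2" "cls g = y" by (rule cls_cases)
    show "P B (x + y) = P B x + P B y"
      using P_comb[OF B f(1) g(1), of 1 1] f g by (simp add: cls_add scaleC_one)
    show "P B (r *\<^sub>R x) = r *\<^sub>R P B x"
      using P_scaleC[OF B, of "complex_of_real r" x] by (simp add: scaleC_of_real)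
  qed
  obtain f where f: "f \<in> L2" "cls f = x" by (rule cls_cases)
  obtain g where g: "g \<in> L2" "cls g = y" by (rule cls_cases)
  show "P B (P B x) = P B x"
    using E_idem[OF B f(1)] f B by (simp add: P_cls E_L2 cls_eq_iff flip: f(2))
  show "inner (P B x) y = inner x (P B y)"
    using E_sym[OF B f(1) g(1)] f g B by (simp add: P_cls E_L2 cls_inner flip: f(2) g(2))
next
  fix x :: l2
  obtain f where f: "f \<in> L2" "cls f = x" by (rule cls_cases)
  show "P UNIV x = x" using E_UNIV[OF f(1)] f by (simp add: P_cls E_L2 cls_eq_iff flip: f(2))
  fix C :: "nat \<Rightarrow> real set" assume C: "range C \<subseteq> sets borel" "disjoint_family C"
  have Cm: "C i \<in> sets borel" "(\<Union>i. C i) \<in> sets borel" for i using C by auto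
  have "norm (P (\<Union>i. C i) x - (\<Sum>i<n. P (C i) x)) = L2_norm (\<lambda>x. E (\<Union>i. C i) f x - (\<Sum>i<n. E (C i) f x))" for n
    using Cm f by (simp add: P_cls E_L2 cls_sum[symmetric] cls_diff[symmetric] cls_norm L2_diff L2_sum flip: f(2))
  then have "(\<lambda>n. norm (P (\<Union>i. C i) x - (\<Sum>i<n. P (C i) x))) \<longlonglongrightarrow> 0"
    using E_sums[OF C f(1)] by simp
  then have "(\<lambda>n. P (\<Union>i. C i) x - (\<Sum>i<n. P (C i) x)) \<longlonglongrightarrow> 0"
    by (simp add: tendsto_norm_zero_iff)
  then have "(\<lambda>n. P (\<Union>i. C i) x - (P (\<Union>i. C i) x - (\<Sum>i<n. P (C i) x))) \<longlonglongrightarrow> P (\<Union>i. C i) x - 0"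
    by (intro tendsto_intros)
  then show "(\<lambda>n. P (C n) x) sums P (\<Union>n. C n) x" by (simp add: sums_def)
qed

lemma spectral_measure_eq: "f \<in> L2 \<Longrightarrow> spectral_measure E f = M (cls f)"
  unfolding spectral_measure_def M_def
  by (rule measure_of_eq) (use sets.sigma_sets_eq[of "borel :: real measure"] in \<open>auto simp: P_cls cls_norm E_L2\<close>)

lemma M_scaleC_unit: assumes "cmod c = 1" shows "M (scaleC c x) = M x"
  by (rule measure_eqI) (auto simp: emeasure_M P_scaleC norm_scaleC assms)

text \<open>Real and imaginary parts of the complex identity are the real identity tested with g and
  with \<open>\<i>\<close> times g. Multiplication by \<open>\<i>\<close> preserves spectral
  measures, hence the domain, so both tests are available.\<close>

lemma spectral_integral_iff:
  assumes f: "f \<in> L2" and h: "h \<in> L2"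
  shows "(f, h) \<in> spectral_integral E \<phi> \<longleftrightarrow> SI \<phi> (cls f) (cls h)"
proof -
  have dom: "g \<in> spectral_domain E \<phi> \<longleftrightarrow> cls g \<in> dom \<phi>" if "g \<in> L2" for g
    using that by (simp add: spectral_domain_def dom_def spectral_measure_eq)
  have domL2: "g \<in> spectral_domain E \<phi> \<Longrightarrow> g \<in> L2" for g by (simp add: spectral_domain_def)
  define I where "I x = (LINT l|M x. \<phi> l)" for x
  have form: "spectral_form E \<phi> f g = Complex ((I (cls f + cls g) - I (cls f - cls g)) / 4) ((I (cls f + scaleC \<i> (cls g)) - I (cls f - scaleC \<i> (cls g))) / 4)"
    if g: "g \<in> L2" for g
  proof -
    have s: "(LINT l|spectral_measure E (\<lambda>x. f x + c * g x). \<phi> l) = I (cls f + scaleC c (cls g))" for c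
      using f g by (simp add: spectral_measure_eq L2_add L2_cmult cls_add cls_scaleC I_def)
    have m: "cls f + scaleC (- 1) (cls g) = cls f - cls g"
      using scaleC_of_real[of "-1" "cls g"] by simp
    have i: "cls f + scaleC (- \<i>) (cls g) = cls f - scaleC \<i> (cls g)"
    proof -
      have "scaleC (- \<i>) (cls g) = - scaleC \<i> (cls g)"
        using g cls_scaleC[OF g, of "- \<i>"] cls_scaleC[OF g, of \<i>] cls_scaleR[OF L2_cmult[OF g, of \<i>], of "-1"] by simp
      then show ?thesis by simp
    qed
    have "(\<Sum>k<4. \<i> ^ k * complex_of_real (LINT l|spectral_measure E (\<lambda>x. f x + \<i> ^ k * g x). \<phi> l))
      = complex_of_real (I (cls f + cls g)) + \<i> * complex_of_real (I (cls f + scaleC \<i> (cls g)))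
        - complex_of_real (I (cls f - cls g)) - \<i> * complex_of_real (I (cls f - scaleC \<i> (cls g)))"
      unfolding s by (simp add: eval_nat_numeral lessThan_Suc m i scaleC_one)
    then show ?thesis unfolding spectral_form_def by (simp add: complex_eq_iff)
  qed
  have inn: "L2_inner h g = Complex (inner (cls h) (cls g)) (inner (cls h) (scaleC \<i> (cls g)))" if g: "g \<in> L2" for g
  proof -
    have "L2_inner h (\<lambda>x. \<i> * g x) = cnj \<i> * L2_inner h g"
      by (subst (1 2) L2_inner_commute) (simp add: L2_inner_cmult)
    then show ?thesis using g h by (simp add: cls_inner L2_cmult complex_eq_iff flip: cls_scaleC)
  qed
  show ?thesis
  proof
    assume "(f, h) \<in> spectral_integral E \<phi>"
    then have fd: "cls f \<in> dom \<phi>" and eq: "\<And>g. g \<in> L2 \<Longrightarrow> cls g \<in> dom \<phi> \<Longrightarrow> L2_inner h g = spectral_form E \<phi> f g"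
      using dom f by (auto simp: spectral_integral_def)
    show "SI \<phi> (cls f) (cls h)"
      unfolding SI_def
    proof (intro conjI ballI fd)
      fix y assume y: "y \<in> dom \<phi>"
      obtain g where g: "g \<in> L2" "cls g = y" by (rule cls_cases)
      show "inner (cls h) y = ((LINT l|M (cls f + y). \<phi> l) - (LINT l|M (cls f - y). \<phi> l)) / 4"
        using eq[OF g(1)] y g form[OF g(1)] inn[OF g(1)] by (simp add: I_def)
    qed
  next
    assume si: "SI \<phi> (cls f) (cls h)"
    show "(f, h) \<in> spectral_integral E \<phi>"
      unfolding spectral_integral_def
    proof (simp, intro conjI ballI h)
      show "f \<in> spectral_domain E \<phi>" using si dom[OF f] by (simp add: SI_def)
      fix g assume "g \<in> spectral_domain E \<phi>"
      then have g: "g \<in> L2" "cls g \<in> dom \<phi>" using dom domL2 by auto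
      then have "scaleC \<i> (cls g) \<in> dom \<phi>" by (simp add: dom_def M_scaleC_unit)
      then show "L2_inner h g = spectral_form E \<phi> f g"
        using si g unfolding form[OF g(1)] inn[OF g(1)] by (simp add: SI_def I_def)
    qed
  qed
qed

lemma spectral_integral_LC:
  assumes "\<phi> \<in> borel_measurable borel" "f \<in> L2" "h \<in> L2"
  shows "(f, h) \<in> spectral_integral E \<phi> \<longleftrightarrow> LC \<phi> (cls f) (cls h)"
  using spectral_integral_iff[OF assms(2,3)] LC_imp_SI[OF assms(1)] SI_imp_LC[OF assms(1)] by blast

end

section \<open>Absolutely continuous functions\<close>

text \<open>Absolute continuity is defined with families indexed by initial segments of the natural
  numbers, whereas the elements of a tagged division are pairs of a point and an interval; a
  bijection reindexes.\<close>

lemma AC_loc_finite_family: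
  assumes AC: "AC_loc f" "0 < b" "0 < \<epsilon>"
  shows "\<exists>\<delta>>0. \<forall>(p :: 'b set) s t. finite p \<and> (\<forall>i\<in>p. 0 \<le> s i \<and> s i \<le> t i \<and> t i \<le> b) \<and>
     disjoint_family_on (\<lambda>i. {s i<..<t i}) p \<and> (\<Sum>i\<in>p. t i - s i) < \<delta> \<longrightarrow>
     (\<Sum>i\<in>p. cmod (f (t i) - f (s i))) < \<epsilon>"
proof -
  from AC(1)[unfolded AC_loc_def, THEN spec, THEN mp, OF AC(2), THEN spec, THEN mp, OF AC(3)]
  obtain \<delta> where d0: "0 < \<delta> \<and> (\<forall>(N::nat) s t. (\<forall>i<N. 0 \<le> s i \<and> s i \<le> t i \<and> t i \<le> b) \<and>
     disjoint_family_on (\<lambda>i. {s i<..<t i}) {..<N} \<and> (\<Sum>i<N. t i - s i) < \<delta> \<longrightarrow>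
     (\<Sum>i<N. cmod (f (t i) - f (s i))) < \<epsilon>)" ..
  note d = conjunct1[OF d0] conjunct2[OF d0]
  show ?thesis
  proof (intro exI[of _ \<delta>] conjI allI impI d(1))
    fix p :: "'b set" and s t assume *: "finite p \<and> (\<forall>i\<in>p. 0 \<le> s i \<and> s i \<le> t i \<and> t i \<le> b) \<and>
     disjoint_family_on (\<lambda>i. {s i<..<t i}) p \<and> (\<Sum>i\<in>p. t i - s i) < \<delta>"
    then have p: "finite p" and st: "\<And>i. i \<in> p \<Longrightarrow> 0 \<le> s i \<and> s i \<le> t i \<and> t i \<le> b"
      and disj: "disjoint_family_on (\<lambda>i. {s i<..<t i}) p" and sm: "(\<Sum>i\<in>p. t i - s i) < \<delta>" by auto
    obtain h where h: "bij_betw h {0..<card p} p" using ex_bij_betw_nat_finite[OF p] by blast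
    then have h': "bij_betw h {..<card p} p" by (simp add: atLeast0LessThan)
    have hp: "h i \<in> p" if "i < card p" for i using h' that by (auto simp: bij_betw_def)
    have "(\<Sum>i<card p. cmod (f (t (h i)) - f (s (h i)))) < \<epsilon>"
    proof (rule d(2)[rule_format, of "card p" "\<lambda>i. s (h i)" "\<lambda>i. t (h i)"], intro conjI allI impI)
      show "0 \<le> s (h i)" "s (h i) \<le> t (h i)" "t (h i) \<le> b" if "i < card p" for i using st[OF hp[OF that]] by auto
      show "disjoint_family_on (\<lambda>i. {s (h i)<..<t (h i)}) {..<card p}"
        unfolding disjoint_family_on_def
      proof (intro ballI impI)
        fix i j assume "i \<in> {..<card p}" "j \<in> {..<card p}" "i \<noteq> j"
        then have "h i \<noteq> h j" "h i \<in> p" "h j \<in> p" using h' hp by (auto simp: bij_betw_def inj_on_def)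
        then show "{s (h i)<..<t (h i)} \<inter> {s (h j)<..<t (h j)} = {}" using disj by (auto simp: disjoint_family_on_def)
      qed
      show "(\<Sum>i<card p. t (h i) - s (h i)) < \<delta>" using sm sum.reindex_bij_betw[OF h', of "\<lambda>i. t i - s i"] by simp
    qed
    then show "(\<Sum>i\<in>p. cmod (f (t i) - f (s i))) < \<epsilon>"
      using sum.reindex_bij_betw[OF h', of "\<lambda>i. cmod (f (t i) - f (s i))"] by simp
  qed
qed

lemma sum_lengths_le_measure:
  assumes p: "finite p" and st: "\<And>i. i \<in> p \<Longrightarrow> s i \<le> (t i :: real) \<and> {s i<..<t i} \<subseteq> U"
    and disj: "disjoint_family_on (\<lambda>i. {s i<..<t i}) p" and U: "U \<in> lmeasurable"
  shows "(\<Sum>i\<in>p. t i - s i) \<le> measure lebesgue U"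
proof -
  have "(\<Sum>i\<in>p. t i - s i) = (\<Sum>i\<in>p. measure lebesgue {s i<..<t i})"
    using st by (intro sum.cong) auto
  also have "\<dots> = measure lebesgue (\<Union>i\<in>p. {s i<..<t i})"
  proof (rule measure_finite_Union[symmetric, OF p _ disj])
    show "emeasure lebesgue {s i<..<t i} \<noteq> \<infinity>" if "i \<in> p" for i using st[OF that] by simp
  qed auto
  also have "\<dots> \<le> measure lebesgue U"
    using st U p by (intro measure_mono_fmeasurable) auto
  finally show ?thesis .
qed

text \<open>
  The gauge of the fundamental theorem of calculus is refined at the exceptional points so that
  the tagged intervals there lie in an open set of small measure, which absolute continuity controls.
\<close>

lemma AC_has_integral:
  fixes G k :: "real \<Rightarrow> complex"
  assumes AC: "AC_loc G" and b: "0 < b" and N: "negligible N"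
    and der: "\<And>x. 0 \<le> x \<Longrightarrow> x \<notin> N \<Longrightarrow> (G has_vector_derivative k x) (at x within {0..})"
  shows "((\<lambda>x. if x \<in> N then 0 else k x) has_integral (G b - G 0)) {0..b}"
  unfolding box_real[symmetric] has_integral
proof (intro allI impI)
  fix e :: real assume e: "e > 0"
  \<comment> \<open>With this \<eta> the regular tags contribute less than e/2; the other half is
    reserved for the tags in N.\<close>
  define \<eta> where "\<eta> = e / (2 * (b + 1))"
  have eta: "\<eta> > 0" "\<eta> * b < e / 2" using e b by (auto simp: \<eta>_def field_simps)
  from AC_loc_finite_family[OF AC b half_gt_zero[OF e], where ?'b = "real \<times> real set"]
  obtain \<delta> where \<delta>0: "0 < \<delta> \<and> (\<forall>(p :: (real \<times> real set) set) s t. finite p \<and> (\<forall>i\<in>p. 0 \<le> s i \<and> s i \<le> t i \<and> t i \<le> b) \<and>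
     disjoint_family_on (\<lambda>i. {s i<..<t i}) p \<and> (\<Sum>i\<in>p. t i - s i) < \<delta> \<longrightarrow>
     (\<Sum>i\<in>p. cmod (G (t i) - G (s i))) < e / 2)" ..
  note \<delta> = conjunct1[OF \<delta>0] conjunct2[OF \<delta>0]
  have Nn: "N \<in> null_sets lebesgue" using N negligible_iff_null_sets by blast
  then have Ns: "N \<in> sets lebesgue" by auto
  obtain U where U: "open U" "N \<subseteq> U" "U - N \<in> lmeasurable" "emeasure lebesgue (U - N) < ennreal \<delta>"
    by (rule sets_lebesgue_outer_open[OF Ns \<delta>(1)])
  have Um: "emeasure lebesgue U < ennreal \<delta>"
  proof -
    have "emeasure lebesgue U = emeasure lebesgue (U - N)"
      using emeasure_Diff_null_set[OF Nn, of U] sets_completionI_sets[of U lborel] borel_open[OF U(1)] by simp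
    then show ?thesis using U by simp
  qed
  have Ul: "U \<in> lmeasurable" "measure lebesgue U < \<delta>"
  proof -
    show "U \<in> lmeasurable" using Um U(1) by (intro fmeasurableI) (auto intro: less_trans[OF _ ennreal_less_top])
    have "emeasure lebesgue U \<noteq> top" using Um by (auto simp: top_unique)
    then have "emeasure lebesgue U = ennreal (measure lebesgue U)" by (rule emeasure_eq_ennreal_measure)
    then show "measure lebesgue U < \<delta>" using Um by (simp add: ennreal_less_iff)
  qed
  have "\<forall>x. \<exists>d>0. (x \<in> N \<longrightarrow> ball x d \<subseteq> U) \<and> (0 \<le> x \<and> x \<notin> N \<longrightarrow>
     (\<forall>y\<in>{0..}. norm (y-x) < d \<longrightarrow> norm (G y - G x - (y-x) *\<^sub>R k x) \<le> \<eta> * norm (y-x)))"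
  proof
    fix x
    show "\<exists>d>0. (x \<in> N \<longrightarrow> ball x d \<subseteq> U) \<and> (0 \<le> x \<and> x \<notin> N \<longrightarrow>
     (\<forall>y\<in>{0..}. norm (y-x) < d \<longrightarrow> norm (G y - G x - (y-x) *\<^sub>R k x) \<le> \<eta> * norm (y-x)))"
    proof (cases "x \<in> N")
      case True
      then show ?thesis using U(1,2) by (meson in_mono open_contains_ball)
    next
      case xN: False
      show ?thesis
      proof (cases "0 \<le> x")
        case True
        then have "\<exists>d>0. \<forall>y\<in>{0..}. norm (y-x) < d \<longrightarrow> norm (G y - G x - (y-x) *\<^sub>R k x) \<le> \<eta> * norm (y-x)"
          using der[OF True xN] eta(1) unfolding has_vector_derivative_def has_derivative_within_alt by blast
        then show ?thesis using xN by blast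
      next
        case False
        then show ?thesis using xN by (auto intro: exI[of _ 1])
      qed
    qed
  qed
  from choice[OF this] obtain d where "\<forall>x. d x > 0 \<and> (x \<in> N \<longrightarrow> ball x (d x) \<subseteq> U) \<and> (0 \<le> x \<and> x \<notin> N \<longrightarrow>
     (\<forall>y\<in>{0..}. norm (y-x) < d x \<longrightarrow> norm (G y - G x - (y-x) *\<^sub>R k x) \<le> \<eta> * norm (y-x)))" ..
  then have d: "\<And>x. d x > 0" "\<And>x. x \<in> N \<Longrightarrow> ball x (d x) \<subseteq> U"
    "\<And>x y. 0 \<le> x \<Longrightarrow> x \<notin> N \<Longrightarrow> 0 \<le> y \<Longrightarrow> norm (y-x) < d x \<Longrightarrow> norm (G y - G x - (y-x) *\<^sub>R k x) \<le> \<eta> * norm (y-x)"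
    by auto
  show "\<exists>\<gamma>. gauge \<gamma> \<and> (\<forall>\<D>. \<D> tagged_division_of cbox 0 b \<and> \<gamma> fine \<D> \<longrightarrow>
      norm ((\<Sum>(x, K)\<in>\<D>. measure lborel K *\<^sub>R (if x \<in> N then 0 else k x)) - (G b - G 0)) < e)"
  proof (intro exI[of _ "\<lambda>x. ball x (d x)"] conjI allI impI)
    show "gauge (\<lambda>x. ball x (d x))" using d(1) gauge_ball_dependent by blast
    fix p assume "p tagged_division_of cbox 0 b \<and> (\<lambda>x. ball x (d x)) fine p"
    then have p: "p tagged_division_of cbox 0 b" and fine: "(\<lambda>x. ball x (d x)) fine p" by auto
    note pD = tagged_division_ofD[OF p]
    have K: "\<exists>u v. K = {u..v} \<and> u \<le> v \<and> 0 \<le> u \<and> v \<le> b \<and> u \<le> x \<and> x \<le> v \<and> {u..v} \<subseteq> ball x (d x)" if xK: "(x, K) \<in> p" for x K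
    proof -
      obtain u v where uv: "K = cbox u v" using pD(4)[OF xK] by blast
      have "x \<in> K" "K \<subseteq> cbox 0 b" using pD(2,3)[OF xK] by auto
      moreover have "K \<subseteq> ball x (d x)" using fine xK by (auto simp: fine_def)
      ultimately show ?thesis using uv by (intro exI[of _ u] exI[of _ v]) auto
    qed
    define T where "T = (\<lambda>(x::real, K). measure lborel K *\<^sub>R (if x \<in> N then 0 else k x) - (G (Sup K) - G (Inf K)))"
    have "(\<Sum>(x, K)\<in>p. G (Sup K) - G (Inf K)) = G b - G 0"
      using additive_tagged_division_1[of 0 b p G] b p by simp
    then have "(\<Sum>(x, K)\<in>p. measure lborel K *\<^sub>R (if x \<in> N then 0 else k x)) - (G b - G 0) = sum T p"
      by (simp add: T_def sum_subtractf split_beta)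
    also have "\<dots> = sum T {q\<in>p. fst q \<notin> N} + sum T {q\<in>p. fst q \<in> N}"
    proof -
      have "p = {q\<in>p. fst q \<notin> N} \<union> {q\<in>p. fst q \<in> N}" by blast
      then show ?thesis using pD(1) by (subst (1) sum.union_disjoint[symmetric]) auto
    qed
    finally have eq: "(\<Sum>(x, K)\<in>p. measure lborel K *\<^sub>R (if x \<in> N then 0 else k x)) - (G b - G 0) = sum T {q\<in>p. fst q \<notin> N} + sum T {q\<in>p. fst q \<in> N}" .
    have "norm (sum T {q\<in>p. fst q \<notin> N}) \<le> (\<Sum>q\<in>{q\<in>p. fst q \<notin> N}. \<eta> * (Sup (snd q) - Inf (snd q)))"
    proof (rule sum_norm_le)
      fix q assume q: "q \<in> {q\<in>p. fst q \<notin> N}"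
      obtain x K where xK: "q = (x, K)" by (cases q)
      then obtain u v where uv: "K = {u..v}" "u \<le> v" "0 \<le> u" "v \<le> b" "u \<le> x" "x \<le> v" "{u..v} \<subseteq> ball x (d x)"
        using K q by blast
      have "u \<in> ball x (d x)" "v \<in> ball x (d x)" using uv(2,7) by auto
      then have du: "norm (u - x) < d x" "norm (v - x) < d x" by (auto simp: dist_real_def abs_minus_commute)
      have x: "0 \<le> x" "x \<notin> N" using uv q xK by auto
      have "T q = (G u - G x - (u-x) *\<^sub>R k x) - (G v - G x - (v-x) *\<^sub>R k x)"
        using uv x by (simp add: T_def xK algebra_simps)
      then have "norm (T q) \<le> norm (G u - G x - (u-x) *\<^sub>R k x) + norm (G v - G x - (v-x) *\<^sub>R k x)"
        using norm_triangle_ineq4 by metis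
      also have "\<dots> \<le> \<eta> * norm (u - x) + \<eta> * norm (v - x)"
        using d(3)[OF x _ du(1)] d(3)[OF x _ du(2)] uv by (intro add_mono) auto
      also have "\<dots> = \<eta> * (v - u)" using uv by (simp add: algebra_simps)
      finally show "norm (T q) \<le> \<eta> * (Sup (snd q) - Inf (snd q))" using uv by (simp add: xK)
    qed
    also have "\<dots> \<le> (\<Sum>q\<in>p. \<eta> * (Sup (snd q) - Inf (snd q)))"
    proof (rule sum_mono2[OF pD(1)])
      fix q assume "q \<in> p - {q\<in>p. fst q \<notin> N}"
      then obtain u v where "snd q = {u..v}" "u \<le> v" using K[of "fst q" "snd q"] by auto
      then show "0 \<le> \<eta> * (Sup (snd q) - Inf (snd q))" using eta by simp
    qed auto
    also have "\<dots> = \<eta> * (\<Sum>(x, K)\<in>p. Sup K - Inf K)" by (simp add: sum_distrib_left split_beta)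
    also have "\<dots> = \<eta> * b" using additive_tagged_division_1[of 0 b p "\<lambda>x. x"] b p by simp
    finally have 1: "norm (sum T {q\<in>p. fst q \<notin> N}) < e / 2" using eta by simp
    define q where "q = {q\<in>p. fst q \<in> N}"
    have fq: "finite q" using pD(1) by (simp add: q_def)
    have intv: "snd i = {Inf (snd i)..Sup (snd i)} \<and> 0 \<le> Inf (snd i) \<and> Inf (snd i) \<le> Sup (snd i) \<and> Sup (snd i) \<le> b \<and> snd i \<subseteq> U" if iq: "i \<in> q" for i
    proof -
      obtain u v where "snd i = {u..v}" "u \<le> v" "0 \<le> u" "v \<le> b" "{u..v} \<subseteq> ball (fst i) (d (fst i))"
        using K[of "fst i" "snd i"] iq by (auto simp: q_def)
      moreover have "ball (fst i) (d (fst i)) \<subseteq> U" using iq d(2) by (simp add: q_def)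
      ultimately show ?thesis by auto
    qed
    have disj: "disjoint_family_on (\<lambda>i. {Inf (snd i)<..<Sup (snd i)}) q"
      unfolding disjoint_family_on_def
    proof (intro ballI impI)
      fix i j assume ij: "i \<in> q" "j \<in> q" "i \<noteq> j"
      have "interior (snd i) \<inter> interior (snd j) = {}"
        using pD(5)[of "fst i" "snd i" "fst j" "snd j"] ij by (auto simp: q_def prod_eq_iff)
      moreover have "interior (snd i) = {Inf (snd i)<..<Sup (snd i)}" "interior (snd j) = {Inf (snd j)<..<Sup (snd j)}"
        using intv[OF ij(1)] intv[OF ij(2)] interior_atLeastAtMost_real by (metis)+
      ultimately show "{Inf (snd i)<..<Sup (snd i)} \<inter> {Inf (snd j)<..<Sup (snd j)} = {}" by simp
    qed
    have len: "(\<Sum>i\<in>q. Sup (snd i) - Inf (snd i)) < \<delta>"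
    proof (rule le_less_trans[OF sum_lengths_le_measure[OF fq _ disj Ul(1)] Ul(2)])
      fix i assume "i \<in> q"
      note I = intv[OF this]
      have "{Inf (snd i)<..<Sup (snd i)} \<subseteq> {Inf (snd i)..Sup (snd i)}" by auto
      then have "{Inf (snd i)<..<Sup (snd i)} \<subseteq> snd i" by (subst conjunct1[OF I])
      then show "Inf (snd i) \<le> Sup (snd i) \<and> {Inf (snd i)<..<Sup (snd i)} \<subseteq> U"
        using I by blast
    qed
    have "norm (sum T q) \<le> (\<Sum>i\<in>q. cmod (G (Sup (snd i)) - G (Inf (snd i))))"
      by (rule sum_norm_le) (auto simp: q_def T_def split_beta norm_minus_commute)
    also have "\<dots> < e / 2" using \<delta>(2)[rule_format, of q "\<lambda>i. Inf (snd i)" "\<lambda>i. Sup (snd i)"] fq disj len intv by simp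
    finally show "norm ((\<Sum>(x, K)\<in>p. measure lborel K *\<^sub>R (if x \<in> N then 0 else k x)) - (G b - G 0)) < e"
      using 1 norm_triangle_ineq[of "sum T {q\<in>p. fst q \<notin> N}" "sum T q"] unfolding eq q_def by linarith
  qed
qed

lemma at_within_halfline_local:
  assumes "0 \<le> x" "x < b" shows "at x within {0..} = at x within {0..b::real}"
  using assms by (intro at_within_nhd[of _ "{..<b}"]) auto

text \<open>G is the integral of its derivative, and changing the integrand on a null set gives the
  integral of the continuous function k, which is differentiable at every point. This turns the
  almost-everywhere equation in \<open>schroedinger_op\<close> into a classical one once the
  right-hand side is continuous.\<close>

lemma AC_loc_derivative:
  fixes G k :: "real \<Rightarrow> complex"
  assumes AC: "AC_loc G" and der: "AE x in halfline. (G has_vector_derivative k x) (at x within {0..})"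
    and cont: "continuous_on {0..} k" and x: "0 \<le> x"
  shows "(G has_vector_derivative k x) (at x within {0..})"
proof -
  have "AE x in lebesgue. 0 \<le> x \<longrightarrow> (G has_vector_derivative k x) (at x within {0..})"
    using der by (simp add: halfline_AE_iff)
  then obtain N where N: "N \<in> null_sets lebesgue" "\<And>x. 0 \<le> x \<Longrightarrow> x \<notin> N \<Longrightarrow> (G has_vector_derivative k x) (at x within {0..})"
    by (auto elim!: AE_E3)
  have neg: "negligible N" using N(1) negligible_iff_null_sets by blast
  have int: "G y = G 0 + integral {0..y} k" if "0 < y" for y
  proof -
    have "((\<lambda>x. if x \<in> N then 0 else k x) has_integral (G y - G 0)) {0..y}"
      using AC_has_integral[OF AC that neg N(2)] by simp
    then have "(k has_integral (G y - G 0)) {0..y}"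
      by (rule has_integral_spike[OF neg, rotated]) auto
    then show ?thesis by (simp add: integral_unique)
  qed
  then have int0: "G y = G 0 + integral {0..y} k" if "0 \<le> y" for y
    using that by (cases "y = 0") (simp, rule int, simp)
  have "((\<lambda>u. integral {0..u} k) has_vector_derivative k x) (at x within {0..x + 1})"
    using x by (intro integral_has_vector_derivative continuous_on_subset[OF cont]) auto
  then have "((\<lambda>u. G 0 + integral {0..u} k) has_vector_derivative k x) (at x within {0..x + 1})"
    using has_vector_derivative_add[OF has_vector_derivative_const] by fastforce
  then have "((\<lambda>u. G 0 + integral {0..u} k) has_vector_derivative k x) (at x within {0..})"
    using at_within_halfline_local[of x "x + 1"] x by simp
  note der0 = this
  show ?thesis
  proof (rule has_vector_derivative_transform[OF _ _ der0])
    show "x \<in> {0..}" using x by simp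
    show "G y = G 0 + integral {0..y} k" if "y \<in> {0..}" for y using that by (intro int0) simp
  qed
qed

lemma C1_imp_AC_loc:
  assumes der: "\<And>x. 0 \<le> x \<Longrightarrow> (f has_vector_derivative f' x) (at x within {0..})"
    and cont: "continuous_on {0..} f'"
  shows "AC_loc f"
  unfolding AC_loc_def
proof (intro allI impI)
  fix b \<epsilon> :: real assume b: "0 < b" "0 < \<epsilon>"
  have "bounded (f' ` {0..b})"
    by (intro compact_imp_bounded compact_continuous_image continuous_on_subset[OF cont]) auto
  then obtain K where K: "0 < K" "\<And>x. x \<in> {0..b} \<Longrightarrow> norm (f' x) \<le> K"
    unfolding bounded_pos by blast
  have lip: "cmod (f t - f s) \<le> K * (t - s)" if "0 \<le> s" "s \<le> t" "t \<le> b" for s t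
  proof -
    have "norm (f t - f s) \<le> K * norm (t - s)"
    proof (rule differentiable_bound[of "{0..b}" f "\<lambda>x h. h *\<^sub>R f' x"])
      show "(f has_derivative (\<lambda>h. h *\<^sub>R f' x)) (at x within {0..b})" if "x \<in> {0..b}" for x
        using der[of x] that unfolding has_vector_derivative_def
        by (rule_tac has_derivative_subset) auto
      show "onorm (\<lambda>h. h *\<^sub>R f' x) \<le> K" if "x \<in> {0..b}" for x
        using K(2)[OF that] K(1) by (intro onorm_le) (auto simp: mult.commute[of K] intro: mult_left_mono)
    qed (use that in auto)
    then show ?thesis using that by simp
  qed
  show "\<exists>\<delta>>0. \<forall>(N::nat) s t. (\<forall>i<N. 0 \<le> s i \<and> s i \<le> t i \<and> t i \<le> b) \<and>
     disjoint_family_on (\<lambda>i. {s i<..<t i}) {..<N} \<and> (\<Sum>i<N. t i - s i) < \<delta> \<longrightarrow>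
     (\<Sum>i<N. cmod (f (t i) - f (s i))) < \<epsilon>"
  proof (intro exI[of _ "\<epsilon> / K"] conjI allI impI)
    show "0 < \<epsilon> / K" using b K by simp
    fix N :: nat and s t :: "nat \<Rightarrow> real"
    assume a: "(\<forall>i<N. 0 \<le> s i \<and> s i \<le> t i \<and> t i \<le> b) \<and>
     disjoint_family_on (\<lambda>i. {s i<..<t i}) {..<N} \<and> (\<Sum>i<N. t i - s i) < \<epsilon> / K"
    have "(\<Sum>i<N. cmod (f (t i) - f (s i))) \<le> (\<Sum>i<N. K * (t i - s i))"
      using a lip by (intro sum_mono) auto
    also have "\<dots> = K * (\<Sum>i<N. t i - s i)" by (simp add: sum_distrib_left)
    also have "\<dots> < K * (\<epsilon> / K)" using a K by (intro mult_strict_left_mono) auto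
    finally show "(\<Sum>i<N. cmod (f (t i) - f (s i))) < \<epsilon>" using K by simp
  qed
qed

section \<open>Towers of derivatives and test functions\<close>

text \<open>All derivatives are carried along as one explicit family. Products, sums and affine
  substitutions then act on whole families, and \<open>nth_deriv\<close> is identified only where
  the definitions require it.\<close>

definition tower :: "real set \<Rightarrow> (nat \<Rightarrow> real \<Rightarrow> 'a::real_normed_vector) \<Rightarrow> bool" where
  "tower S F \<longleftrightarrow> (\<forall>n. \<forall>x\<in>S. (F n has_vector_derivative F (Suc n) x) (at x within S))"

lemma towerD: "tower S F \<Longrightarrow> x \<in> S \<Longrightarrow> (F n has_vector_derivative F (Suc n) x) (at x within S)"
  by (simp add: tower_def)

lemma tower_shift: "tower S F \<Longrightarrow> tower S (\<lambda>n. F (Suc n))"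
  by (simp add: tower_def)

lemma tower_subset: "tower S F \<Longrightarrow> T \<subseteq> S \<Longrightarrow> tower T F"
  unfolding tower_def using has_vector_derivative_within_subset by blast

lemma tower_continuous: "tower S F \<Longrightarrow> continuous_on S (F n)"
  unfolding tower_def by (blast intro: has_vector_derivative_continuous continuous_on_eq_continuous_within[THEN iffD2])

lemma tower_smooth_on: "smooth_on S f \<Longrightarrow> tower S (\<lambda>n. nth_deriv S n f)"
  unfolding tower_def smooth_on_def nth_deriv_def
  by (auto simp: vector_derivative_works[symmetric])

lemma nth_deriv_tower:
  assumes S: "\<And>x. x \<in> S \<Longrightarrow> at x within S \<noteq> bot" and F: "tower S F" and f: "\<And>x. x \<in> S \<Longrightarrow> f x = F 0 x"
  shows "x \<in> S \<Longrightarrow> nth_deriv S n f x = F n x"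
proof (induction n arbitrary: x)
  case 0 then show ?case using f by (simp add: nth_deriv_def)
next
  case (Suc n)
  have "(nth_deriv S n f has_vector_derivative F (Suc n) x) (at x within S)"
    by (rule has_vector_derivative_transform[OF Suc.prems Suc.IH towerD[OF F Suc.prems]])
  then show ?case using vector_derivative_within[OF S[OF Suc.prems]] by (simp add: nth_deriv_def)
qed

lemma smooth_on_tower:
  assumes S: "\<And>x. x \<in> S \<Longrightarrow> at x within S \<noteq> bot" and F: "tower S F" and f: "\<And>x. x \<in> S \<Longrightarrow> f x = F 0 x"
  shows "smooth_on S f"
  unfolding smooth_on_def
proof (intro allI ballI)
  fix n x assume x: "x \<in> S"
  have "(nth_deriv S n f has_vector_derivative F (Suc n) x) (at x within S)"
    by (rule has_vector_derivative_transform[OF x nth_deriv_tower[OF S F f] towerD[OF F x]])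
  then show "nth_deriv S n f differentiable (at x within S)"
    by (rule differentiableI_vector)
qed

lemma tower_of_real: "tower S F \<Longrightarrow> tower S (\<lambda>n x. of_real (F n x) :: 'a::real_normed_algebra_1)"
  unfolding tower_def using bounded_linear.has_vector_derivative[OF bounded_linear_of_real] by blast

lemma tower_affine:
  fixes F :: "nat \<Rightarrow> real \<Rightarrow> real"
  assumes "tower UNIV F" shows "tower UNIV (\<lambda>n x. s ^ n * F n (s * x + b))"
  unfolding tower_def
proof (intro allI ballI)
  fix n x
  have "(F n has_real_derivative F (Suc n) (s * x + b)) (at (s * x + b))"
    using towerD[OF assms, of "s * x + b" n] by (simp add: has_real_derivative_iff_has_vector_derivative)
  then have "((\<lambda>x. F n (s * x + b)) has_real_derivative F (Suc n) (s * x + b) * s) (at x)"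
    by (rule DERIV_chain2) (auto intro!: derivative_eq_intros)
  then have "((\<lambda>x. s ^ n * F n (s * x + b)) has_real_derivative s ^ n * (F (Suc n) (s * x + b) * s)) (at x)"
    by (rule DERIV_cmult)
  then show "((\<lambda>x. s ^ n * F n (s * x + b)) has_vector_derivative s ^ Suc n * F (Suc n) (s * x + b)) (at x within UNIV)"
    by (simp add: has_real_derivative_iff_has_vector_derivative mult_ac)
qed

text \<open>The \<open>n\<close>-th derivative of a product, written as a binary recursion instead of a binomial sum.\<close>

primrec leibniz :: "nat \<Rightarrow> (nat \<Rightarrow> real \<Rightarrow> 'a::real_normed_algebra) \<Rightarrow> (nat \<Rightarrow> real \<Rightarrow> 'a) \<Rightarrow> real \<Rightarrow> 'a" where
  "leibniz 0 A B x = A 0 x * B 0 x"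
| "leibniz (Suc n) A B x = leibniz n (\<lambda>k. A (Suc k)) B x + leibniz n A (\<lambda>k. B (Suc k)) x"

lemma tower_leibniz:
  assumes "tower S A" "tower S B" shows "tower S (\<lambda>n. leibniz n A B)"
proof -
  have *: "(leibniz n A B has_vector_derivative leibniz (Suc n) A B x) (at x within S)"
    if "tower S A" "tower S B" "x \<in> S" for n x A B
    using that
  proof (induction n arbitrary: A B)
    case 0
    have "((\<lambda>x. A 0 x * B 0 x) has_vector_derivative A 0 x * B (Suc 0) x + A (Suc 0) x * B 0 x) (at x within S)"
      by (intro has_vector_derivative_mult towerD 0)
    moreover have "leibniz 0 A B = (\<lambda>x. A 0 x * B 0 x)" by (simp add: fun_eq_iff)
    ultimately show ?case by (simp add: add.commute)
  next
    case (Suc n)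
    have "((\<lambda>x. leibniz n (\<lambda>k. A (Suc k)) B x + leibniz n A (\<lambda>k. B (Suc k)) x) has_vector_derivative
       leibniz (Suc n) (\<lambda>k. A (Suc k)) B x + leibniz (Suc n) A (\<lambda>k. B (Suc k)) x) (at x within S)"
      using Suc.prems by (intro has_vector_derivative_add Suc.IH tower_shift)
    moreover have "leibniz (Suc n) A B = (\<lambda>x. leibniz n (\<lambda>k. A (Suc k)) B x + leibniz n A (\<lambda>k. B (Suc k)) x)"
      by (simp add: fun_eq_iff)
    ultimately show ?case by simp
  qed
  show ?thesis unfolding tower_def by (intro allI ballI *[OF assms])
qed

lemma leibniz_bound:
  fixes A B :: "nat \<Rightarrow> real \<Rightarrow> 'a::real_normed_algebra"
  assumes "\<And>i. i \<le> n \<Longrightarrow> norm (A i x) \<le> a" and "\<And>i. i \<le> n \<Longrightarrow> norm (B i x) \<le> b"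
  shows "norm (leibniz n A B x) \<le> 2 ^ n * (a * b)"
  using assms
proof (induction n arbitrary: A B)
  case 0
  have "norm (A 0 x * B 0 x) \<le> norm (A 0 x) * norm (B 0 x)" by (rule norm_mult_ineq)
  also have "\<dots> \<le> a * b" using 0 by (intro mult_mono) (auto intro: order_trans[OF norm_ge_zero])
  finally show ?case by simp
next
  case (Suc n)
  have 1: "norm (leibniz n (\<lambda>k. A (Suc k)) B x) \<le> 2 ^ n * (a * b)" using Suc.prems by (intro Suc.IH) auto
  have 2: "norm (leibniz n A (\<lambda>k. B (Suc k)) x) \<le> 2 ^ n * (a * b)" using Suc.prems by (intro Suc.IH) auto
  have "norm (leibniz (Suc n) A B x) \<le> norm (leibniz n (\<lambda>k. A (Suc k)) B x) + norm (leibniz n A (\<lambda>k. B (Suc k)) x)"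
    by (simp add: norm_triangle_ineq)
  then show ?case using 1 2 by simp
qed

text \<open>The offsets p and q keep the induction going: each step of the recursion differentiates
  one factor and so shifts the parity of exactly one of the two families.\<close>

lemma leibniz_parity:
  assumes "\<And>i. odd (i + p) \<Longrightarrow> A i x = 0" "\<And>i. odd (i + q) \<Longrightarrow> B i x = 0" "odd (n + p + q)"
  shows "leibniz n A B x = 0"
  using assms
proof (induction n arbitrary: A B p q)
  case 0
  then have "odd p \<or> odd q" by auto
  then show ?case using 0(1)[of 0] 0(2)[of 0] by auto
next
  case (Suc n)
  have "leibniz n (\<lambda>k. A (Suc k)) B x = 0"
    using Suc.prems by (intro Suc.IH[of "Suc p" _ q]) auto
  moreover have "leibniz n A (\<lambda>k. B (Suc k)) x = 0"
    using Suc.prems by (intro Suc.IH[of p _ "Suc q"]) auto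
  ultimately show ?case by simp
qed

section \<open>Smooth approximations of indicator functions\<close>

definition bump_term :: "real poly \<Rightarrow> real \<Rightarrow> real" where
  "bump_term p x = (if x > 0 then poly p (1 / x) * exp (- (1 / x)) else 0)"

lemma poly_exp_tendsto_0: "((\<lambda>y. poly p y * exp (- y)) \<longlongrightarrow> (0::real)) at_top"
proof -
  have "((\<lambda>y. \<Sum>i\<le>degree p. coeff p i * (y ^ i / exp y)) \<longlongrightarrow> (\<Sum>i\<le>degree p. coeff p i * 0)) at_top"
    by (intro tendsto_intros tendsto_power_div_exp_0)
  then show ?thesis by (simp add: poly_altdef exp_minus sum_distrib_left divide_inverse mult_ac)
qed

text \<open>With y = 1/x the derivative of p(y) exp(-y) in x is y^2 (p(y) - p'(y)) exp(-y), so the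
  functions of this form are closed under differentiation. At 0 the difference quotient is again of
  this form, with y p(y) in place of p(y), and it tends to 0.\<close>

lemma bump_term_deriv:
  "(bump_term p has_real_derivative bump_term (monom 1 2 * (p - pderiv p)) x) (at x)"
proof -
  consider "x > 0" | "x < 0" | "x = 0" by linarith
  then show ?thesis
  proof cases
    case 1
    have "((\<lambda>x. poly p (1 / x) * exp (- (1 / x))) has_real_derivative
        poly (monom 1 2 * (p - pderiv p)) (1 / x) * exp (- (1 / x))) (at x)"
      using 1 by (auto intro!: derivative_eq_intros DERIV_chain'[OF _ poly_DERIV]
          simp: poly_monom power2_eq_square field_simps)
    moreover have "eventually (\<lambda>y. y > 0) (nhds x)" using eventually_nhds_in_open[of "{0<..}" x] 1 by simp
    then have "eventually (\<lambda>y. bump_term p y = poly p (1 / y) * exp (- (1 / y))) (nhds x)"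
      by eventually_elim (simp add: bump_term_def)
    ultimately show ?thesis using 1 by (subst DERIV_cong_ev[OF refl _ refl]) (auto simp: bump_term_def)
  next
    case 2
    have "eventually (\<lambda>y. y < 0) (nhds x)" using eventually_nhds_in_open[of "{..<0}" x] 2 by simp
    then have "eventually (\<lambda>y. bump_term p y = 0) (nhds x)"
      by eventually_elim (simp add: bump_term_def)
    then show ?thesis using 2 by (subst DERIV_cong_ev[OF refl _ refl]) (auto simp: bump_term_def)
  next
    case 3
    have "((\<lambda>h. bump_term p h / h) \<longlongrightarrow> 0) (at_right 0)"
    proof -
      have "((\<lambda>y. poly (pCons 0 p) y * exp (- y)) \<longlongrightarrow> 0) at_top" by (rule poly_exp_tendsto_0)
      then have "((\<lambda>h. poly (pCons 0 p) (inverse h) * exp (- inverse h)) \<longlongrightarrow> 0) (at_right 0)"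
        by (rule filterlim_compose[OF _ filterlim_inverse_at_top_right])
      moreover have "eventually (\<lambda>h::real. poly (pCons 0 p) (inverse h) * exp (- inverse h) = bump_term p h / h) (at_right 0)"
        by (auto simp: eventually_at_right_field bump_term_def field_simps intro!: exI[of _ 1])
      ultimately show ?thesis by (rule Lim_transform_eventually)
    qed
    moreover have "((\<lambda>h. bump_term p h / h) \<longlongrightarrow> 0) (at_left 0)"
    proof (rule Lim_transform_eventually[OF tendsto_const])
      show "eventually (\<lambda>h. 0 = bump_term p h / h) (at_left 0)"
        by (auto simp: eventually_at_left_field bump_term_def intro!: exI[of _ "-1"])
    qed
    ultimately have "((\<lambda>h. bump_term p h / h) \<longlongrightarrow> 0) (at 0)" by (simp add: filterlim_at_split)
    then show ?thesis using 3 by (simp add: DERIV_def bump_term_def)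
  qed
qed

definition bump_tower :: "nat \<Rightarrow> real \<Rightarrow> real" where
  "bump_tower n = bump_term (((\<lambda>p. monom 1 2 * (p - pderiv p)) ^^ n) 1)"

lemma tower_bump: "tower UNIV bump_tower"
  unfolding tower_def bump_tower_def
  using bump_term_deriv by (simp add: has_real_derivative_iff_has_vector_derivative)

lemma bump_tower_0: "bump_tower 0 x = (if x > 0 then exp (- (1 / x)) else 0)"
  by (simp add: bump_tower_def bump_term_def)

text \<open>For x between a and c this is exp(-1/(m (x - a))) * exp(-1/(m (c - x))). It is bounded
  by 1, vanishes outside the interval and converges pointwise to its indicator as m grows, which is
  what dominated convergence needs.\<close>

definition plateau :: "real \<Rightarrow> real \<Rightarrow> nat \<Rightarrow> real \<Rightarrow> complex" where
  "plateau a c m x = of_real (bump_tower 0 (real m * x + - real m * a) * bump_tower 0 (- real m * x + real m * c))"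

lemma test_function_plateau: assumes "0 < a" shows "test_function (plateau a c m)"
  unfolding test_function_def
proof
  let ?A = "\<lambda>n x. complex_of_real (real m ^ n * bump_tower n (real m * x + - real m * a))"
  let ?B = "\<lambda>n x. complex_of_real ((- real m) ^ n * bump_tower n (- real m * x + real m * c))"
  have "tower UNIV (\<lambda>n. leibniz n ?A ?B)"
    by (intro tower_leibniz tower_of_real tower_affine tower_bump)
  then show "smooth_on UNIV (plateau a c m)"
    by (rule smooth_on_tower[rotated]) (auto simp: plateau_def)
  have "plateau a c m x = 0" if "x \<notin> {a..c}" for x
  proof -
    have "real m * x + - real m * a \<le> 0 \<or> - real m * x + real m * c \<le> 0"
    proof (cases "x < a")
      case True
      then have "real m * x \<le> real m * a" by (intro mult_left_mono) auto
      then show ?thesis by simp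
    next
      case False
      then have "real m * c \<le> real m * x" using that by (intro mult_left_mono) auto
      then show ?thesis by simp
    qed
    then show ?thesis by (auto simp: plateau_def bump_tower_0)
  qed
  then show "\<exists>a' b. 0 < a' \<and> (\<forall>x. x \<notin> {a'..b} \<longrightarrow> plateau a c m x = 0)" using assms by blast
qed

lemma bump_tower_0_tendsto:
  "(\<lambda>m. bump_tower 0 (real m * y)) \<longlonglongrightarrow> (if y > 0 then 1 else 0)"
proof (cases "y > 0")
  case True
  have "(\<lambda>m. exp (- ((1 / y) * (1 / real m)))) \<longlonglongrightarrow> exp (- ((1 / y) * 0))"
    by (intro tendsto_intros lim_1_over_n)
  moreover have "eventually (\<lambda>m. exp (- ((1 / y) * (1 / real m))) = bump_tower 0 (real m * y)) sequentially"
    using eventually_gt_at_top[of 0] by eventually_elim (use True in \<open>auto simp: bump_tower_0 mult.commute\<close>)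
  ultimately show ?thesis using True by (auto intro: Lim_transform_eventually)
next
  case False
  then have "bump_tower 0 (real m * y) = 0" for m by (auto simp: bump_tower_0 zero_less_mult_iff)
  then show ?thesis using False by simp
qed

lemma plateau_tendsto: "(\<lambda>m. plateau a c m x) \<longlonglongrightarrow> indicator {a<..<c} x"
proof -
  have "(\<lambda>m. complex_of_real (bump_tower 0 (real m * (x - a)) * bump_tower 0 (real m * (c - x)))) \<longlonglongrightarrow>
     complex_of_real ((if x - a > 0 then 1 else 0) * (if c - x > 0 then 1 else 0))"
    by (intro tendsto_intros bump_tower_0_tendsto)
  moreover have "complex_of_real ((if x - a > 0 then 1 else 0) * (if c - x > 0 then 1 else 0)) = indicator {a<..<c} x"
    by (auto simp: indicator_def)
  moreover have "plateau a c m x = complex_of_real (bump_tower 0 (real m * (x - a)) * bump_tower 0 (real m * (c - x)))" for m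
    by (simp add: plateau_def algebra_simps)
  ultimately show ?thesis by simp
qed

lemma norm_plateau_le: "cmod (plateau a c m x) \<le> 1"
proof -
  have "\<bar>bump_tower 0 y\<bar> \<le> 1" for y by (simp add: bump_tower_0)
  then show ?thesis unfolding plateau_def norm_of_real abs_mult by (intro mult_le_one) auto
qed

section \<open>Weak derivatives\<close>

text \<open>The positive and the negative part are densities of finite measures that agree on all
  rays, hence everywhere, so the two densities agree almost everywhere. A Borel representative is
  chosen first because the uniqueness of densities is applied over \<open>lborel\<close>.\<close>

lemma AE_zero_of_rays:
  fixes f :: "real \<Rightarrow> real"
  assumes f: "integrable lebesgue f" and zero: "\<And>x. (LINT y|lebesgue. indicator {x<..} y * f y) = 0"
  shows "AE x in lebesgue. f x = 0"
proof -
  obtain g where g: "g \<in> borel_measurable lborel" and fg: "AE x in lborel. f x = g x"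
    using completion_ex_borel_measurable_real[of f lborel] borel_measurable_integrable[OF f] by blast
  have fg': "AE x in lebesgue. f x = g x" using fg by (rule AE_completion)
  have gl: "g \<in> borel_measurable lebesgue" using g by (rule measurable_completion)
  have "integrable lebesgue g"
    using integrable_cong_AE[OF borel_measurable_integrable[OF f] gl fg'] f by simp
  then have gi: "integrable lborel g" using integrable_completion[OF g] by simp
  have zg: "(LINT y|lborel. indicator {x<..} y * g y) = 0" for x
  proof -
    have m: "(\<lambda>y. indicator {x<..} y * g y) \<in> borel_measurable lborel" using g by measurable
    have "(LINT y|lborel. indicator {x<..} y * g y) = (LINT y|lebesgue. indicator {x<..} y * g y)"
      using integral_completion[OF m] by simp
    also have "\<dots> = (LINT y|lebesgue. indicator {x<..} y * f y)"
    proof (rule integral_cong_AE)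
      show "(\<lambda>y. indicator {x<..} y * g y) \<in> borel_measurable lebesgue" using m by (rule measurable_completion)
      show "(\<lambda>y. indicator {x<..} y * f y) \<in> borel_measurable lebesgue"
        using borel_measurable_integrable[OF f] by (intro borel_measurable_times borel_measurable_indicator) auto
      show "AE y in lebesgue. indicator {x<..} y * g y = indicator {x<..} y * f y"
        using fg' by eventually_elim simp
    qed
    finally show ?thesis using zero by simp
  qed
  define p where "p y = ennreal (max 0 (g y))" for y
  define q where "q y = ennreal (max 0 (- g y))" for y
  have pm: "p \<in> borel_measurable lborel" "q \<in> borel_measurable lborel"
    unfolding p_def q_def using g by measurable
  have e: "emeasure (density lborel (\<lambda>y. ennreal (h y))) {x<..} = ennreal (LINT y|lborel. indicator {x<..} y * h y)"
    if h: "integrable lborel h" "\<And>y. 0 \<le> h y" for h :: "real \<Rightarrow> real" and x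
  proof -
    have "emeasure (density lborel (\<lambda>y. ennreal (h y))) {x<..} = (\<integral>\<^sup>+y. ennreal (indicator {x<..} y * h y) \<partial>lborel)"
      using h by (subst emeasure_density) (auto intro!: nn_integral_cong simp: indicator_def)
    also have "\<dots> = ennreal (LINT y|lborel. indicator {x<..} y * h y)"
      using integrable_mult_indicator[OF _ h(1), of "{x<..}"] h(2) by (intro nn_integral_eq_integral) auto
    finally show ?thesis .
  qed
  have i1: "integrable lborel (\<lambda>y. max 0 (g y))" "integrable lborel (\<lambda>y. max 0 (- g y))" using gi by auto
  have eq: "(LINT y|lborel. indicator {x<..} y * max 0 (g y)) = (LINT y|lborel. indicator {x<..} y * max 0 (- g y))" for x
  proof -
    have "(LINT y|lborel. indicator {x<..} y * max 0 (g y)) - (LINT y|lborel. indicator {x<..} y * max 0 (- g y))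
       = (LINT y|lborel. indicator {x<..} y * max 0 (g y) - indicator {x<..} y * max 0 (- g y))"
      using integrable_mult_indicator[OF _ i1(1), of "{x<..}"] integrable_mult_indicator[OF _ i1(2), of "{x<..}"]
      by (intro Bochner_Integration.integral_diff[symmetric]) auto
    also have "\<dots> = (LINT y|lborel. indicator {x<..} y * g y)"
      by (intro Bochner_Integration.integral_cong) (auto simp: indicator_def)
    finally show ?thesis using zg by simp
  qed
  have "density lborel p = density lborel q"
  proof (rule measure_eqI_lessThan)
    show "emeasure (density lborel p) {x<..} < \<infinity>" for x
      unfolding p_def using e[OF i1(1)] by simp
    show "emeasure (density lborel p) {x<..} = emeasure (density lborel q) {x<..}" for x
      unfolding p_def q_def using e[OF i1(1)] e[OF i1(2)] eq by simp
  qed auto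
  then have "AE x in lborel. p x = q x"
    using sigma_finite_measure.density_unique_iff[OF sigma_finite_lborel pm] by simp
  then have "AE x in lborel. g x = 0"
    by eventually_elim (auto simp: p_def q_def max_def split: if_splits)
  then have "AE x in lborel. f x = 0" using fg by eventually_elim simp
  then show ?thesis by (rule AE_completion)
qed

lemma halfline_restrict:
  fixes f :: "real \<Rightarrow> 'a::{banach, second_countable_topology}"
  shows "(LINT x|halfline. f x) = (LINT x|lebesgue. indicator {0..} x *\<^sub>R f x)"
  by (rule integral_restrict_space) auto

text \<open>Testing with \<open>plateau\<close> functions shows that the integral of d over every
  compact subinterval of the open half-line vanishes. Truncation to such an interval makes d
  integrable with vanishing integrals over rays. Countably many intervals
  \<open>{1 / real (Suc n)..real (Suc n)}\<close> together with the null set {0} cover the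
  half-line; intervals touching 0 are out of reach of the test functions.\<close>

lemma weak_zero:
  assumes loc: "locally_integrable d" and zero: "\<And>\<phi>. test_function \<phi> \<Longrightarrow> (LINT x|halfline. d x * \<phi> x) = 0"
  shows "AE x in halfline. d x = 0"
proof -
  have ind: "integrable lebesgue (\<lambda>x. indicator {a..c} x *\<^sub>R d x)" if "0 < a" for a c
    using loc that integrable_restrict_space[of "{a..c}" lebesgue d] by (auto simp: locally_integrable_def)
  have intv: "(LINT x|lebesgue. indicator {a<..<c} x *\<^sub>R d x) = 0" if a: "0 < a" for a c
  proof -
    let ?g = "\<lambda>x. indicator {a..c} x *\<^sub>R d x"
    have gm: "?g \<in> borel_measurable lebesgue" using ind[OF a] by (rule borel_measurable_integrable)
    have pm: "plateau a c m \<in> borel_measurable lebesgue" for m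
    proof -
      have "continuous_on UNIV (plateau a c m)"
        using tower_continuous[OF tower_smooth_on, of UNIV "plateau a c m" 0] test_function_plateau[OF a]
        by (simp add: test_function_def nth_deriv_def)
      then show ?thesis by (intro measurable_completion) (simp add: borel_measurable_continuous_onI)
    qed
    have "(\<lambda>m. LINT x|lebesgue. ?g x * plateau a c m x) \<longlonglongrightarrow> (LINT x|lebesgue. indicator {a<..<c} x *\<^sub>R d x)"
    proof (rule integral_dominated_convergence[where w = "\<lambda>x. norm (?g x)"])
      show "integrable lebesgue (\<lambda>x. norm (?g x))" using ind[OF a] by (rule integrable_norm)
      show "(\<lambda>x. ?g x * plateau a c m x) \<in> borel_measurable lebesgue" for m
        by (intro borel_measurable_times gm pm)
      show "(\<lambda>x. indicator {a<..<c} x *\<^sub>R d x) \<in> borel_measurable lebesgue"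
      proof -
        have "(\<lambda>x. indicator {a<..<c} x *\<^sub>R ?g x) \<in> borel_measurable lebesgue"
          by (intro borel_measurable_scaleR gm borel_measurable_indicator) auto
        moreover have "(\<lambda>x. indicator {a<..<c} x *\<^sub>R ?g x) = (\<lambda>x. indicator {a<..<c} x *\<^sub>R d x)"
          by (auto simp: indicator_def fun_eq_iff)
        ultimately show ?thesis by simp
      qed
      show "AE x in lebesgue. (\<lambda>m. ?g x * plateau a c m x) \<longlonglongrightarrow> indicator {a<..<c} x *\<^sub>R d x"
      proof (rule AE_I2)
        fix x
        have "(\<lambda>m. ?g x * plateau a c m x) \<longlonglongrightarrow> ?g x * indicator {a<..<c} x"
          by (intro tendsto_intros plateau_tendsto)
        moreover have "?g x * indicator {a<..<c} x = indicator {a<..<c} x *\<^sub>R d x"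
          by (auto simp: indicator_def)
        ultimately show "(\<lambda>m. ?g x * plateau a c m x) \<longlonglongrightarrow> indicator {a<..<c} x *\<^sub>R d x" by simp
      qed
      show "AE x in lebesgue. norm (?g x * plateau a c m x) \<le> norm (?g x)" for m
        using norm_plateau_le by (intro AE_I2) (auto simp: norm_mult indicator_def intro: mult_left_le)
    qed
    moreover have "(LINT x|lebesgue. ?g x * plateau a c m x) = 0" for m
    proof -
      have z: "plateau a c m x = 0" if "x \<notin> {a..c}" for x
      proof -
        have "real m * x + - real m * a \<le> 0 \<or> - real m * x + real m * c \<le> 0"
        proof (cases "x < a")
          case True
          then have "real m * x \<le> real m * a" by (intro mult_left_mono) auto
          then show ?thesis by simp
        next
          case False
          then have "real m * c \<le> real m * x" using that by (intro mult_left_mono) auto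
          then show ?thesis by simp
        qed
        then show ?thesis by (auto simp: plateau_def bump_tower_0)
      qed
      have "(LINT x|lebesgue. ?g x * plateau a c m x) = (LINT x|halfline. d x * plateau a c m x)"
        unfolding halfline_restrict using z a by (intro Bochner_Integration.integral_cong) (auto simp: indicator_def)
      then show ?thesis using zero[OF test_function_plateau[OF a]] by simp
    qed
    ultimately show ?thesis by (simp add: LIMSEQ_const_iff)
  qed
  have loc0: "AE x in lebesgue. x \<in> {a..c} \<longrightarrow> d x = 0" if a: "0 < a" for a c
  proof -
    let ?g = "\<lambda>x. indicator {a..c} x *\<^sub>R d x"
    have ray: "(LINT y|lebesgue. indicator {x<..} y *\<^sub>R ?g y) = 0" for x
    proof -
      have "(LINT y|lebesgue. indicator {x<..} y *\<^sub>R ?g y) = (LINT y|lebesgue. indicator {max x a<..<c} y *\<^sub>R d y)"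
      proof (rule integral_cong_AE)
        have gm: "?g \<in> borel_measurable lebesgue" using ind[OF a] by (rule borel_measurable_integrable)
        show "(\<lambda>y. indicator {x<..} y *\<^sub>R ?g y) \<in> borel_measurable lebesgue"
          by (intro borel_measurable_scaleR gm borel_measurable_indicator) auto
        have "(\<lambda>y. indicator {max x a<..<c} y *\<^sub>R ?g y) \<in> borel_measurable lebesgue"
          by (intro borel_measurable_scaleR gm borel_measurable_indicator) auto
        moreover have "(\<lambda>y. indicator {max x a<..<c} y *\<^sub>R ?g y) = (\<lambda>y. indicator {max x a<..<c} y *\<^sub>R d y)"
          by (auto simp: indicator_def fun_eq_iff)
        ultimately show "(\<lambda>y. indicator {max x a<..<c} y *\<^sub>R d y) \<in> borel_measurable lebesgue" by simp
        have "AE y in lebesgue. y \<notin> {a, c}"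
          by (intro AE_completion AE_not_in) (auto intro: finite_imp_null_set_lborel)
        then show "AE y in lebesgue. indicator {x<..} y *\<^sub>R ?g y = indicator {max x a<..<c} y *\<^sub>R d y"
          by eventually_elim (auto simp: indicator_def)
      qed
      then show ?thesis using intv[of "max x a" c] a by simp
    qed
    have i: "integrable lebesgue (\<lambda>y. indicator {x<..} y *\<^sub>R ?g y)" for x
      by (rule integrable_mult_indicator[OF _ ind[OF a]]) auto
    have "AE x in lebesgue. Re (?g x) = 0"
    proof (rule AE_zero_of_rays)
      show "integrable lebesgue (\<lambda>x. Re (?g x))" using ind[OF a] by (rule integrable_Re)
      show "(LINT y|lebesgue. indicator {x<..} y * Re (?g y)) = 0" for x
        using integral_Re[OF i[of x]] ray[of x] by (simp add: mult.assoc)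
    qed
    moreover have "AE x in lebesgue. Im (?g x) = 0"
    proof (rule AE_zero_of_rays)
      show "integrable lebesgue (\<lambda>x. Im (?g x))" using ind[OF a] by (rule integrable_Im)
      show "(LINT y|lebesgue. indicator {x<..} y * Im (?g y)) = 0" for x
        using integral_Im[OF i[of x]] ray[of x] by (simp add: mult.assoc)
    qed
    ultimately show ?thesis by eventually_elim (auto simp: complex_eq_iff)
  qed
  have "AE x in lebesgue. \<forall>n. x \<in> {1 / real (Suc n)..real (Suc n)} \<longrightarrow> d x = 0"
    unfolding AE_all_countable using loc0 by simp
  moreover have "AE x in lebesgue. x \<notin> {0::real}"
    by (intro AE_completion AE_not_in) auto
  ultimately have "AE x in lebesgue. 0 \<le> x \<longrightarrow> d x = 0"
  proof eventually_elim
    case (elim x)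
    show ?case
    proof
      assume "0 \<le> x"
      then have x: "0 < x" using elim(2) by simp
      obtain n :: nat where n: "max x (1 / x) \<le> real n" using real_arch_simple by blast
      then have "1 / x \<le> real (Suc n)" "x \<le> real (Suc n)" by auto
      then have "1 / real (Suc n) \<le> x" using x by (simp add: field_simps)
      then show "d x = 0" using elim(1) \<open>x \<le> real (Suc n)\<close> by auto
    qed
  qed
  then show ?thesis by (simp add: halfline_AE_iff)
qed

section \<open>Weak derivatives of smooth functions\<close>

lemma test_function_continuous: "test_function \<phi> \<Longrightarrow> continuous_on UNIV (nth_deriv UNIV j \<phi>)"
  using tower_continuous[OF tower_smooth_on] by (auto simp: test_function_def)

lemma test_function_support:
  assumes "test_function \<phi>"
  obtains a b where "0 < a" "a \<le> b" "\<And>j x. x \<notin> {a..b} \<Longrightarrow> nth_deriv UNIV j \<phi> x = 0"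
proof -
  obtain a b0 where ab: "0 < a" "\<And>x. x \<notin> {a..b0} \<Longrightarrow> \<phi> x = 0"
    using assms unfolding test_function_def by blast
  define b where "b = max a b0"
  have z: "nth_deriv UNIV j \<phi> x = 0" if "x \<notin> {a..b}" for j x
    using that
  proof (induction j arbitrary: x)
    case 0
    then show ?case using ab(2)[of x] by (auto simp: nth_deriv_def b_def max_def split: if_splits)
  next
    case (Suc j)
    have "((\<lambda>x. 0) has_vector_derivative (0::complex)) (at x)" by simp
    then have "(nth_deriv UNIV j \<phi> has_vector_derivative 0) (at x)"
      by (rule has_vector_derivative_transform_within_open[of _ _ _ "- {a..b}"]) (use Suc in auto)
    then show ?case using vector_derivative_at by (simp add: nth_deriv_def)
  qed
  show ?thesis by (rule that[OF ab(1) _ z]) (auto simp: b_def)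
qed

lemma halfline_integral_compact:
  fixes h :: "real \<Rightarrow> complex"
  assumes c: "continuous_on {0..B} h" and z: "\<And>x. x > B \<Longrightarrow> h x = 0"
  shows "integrable halfline h" "(LINT x|halfline. h x) = integral {0..B} h"
proof -
  have i: "integrable (lebesgue_on {0..B}) h" by (rule continuous_imp_integrable_real[OF c])
  have eq: "(\<lambda>x. indicator {0..B} x *\<^sub>R h x) = (\<lambda>x. indicator {0..} x *\<^sub>R h x)"
  proof
    fix x show "indicator {0..B} x *\<^sub>R h x = indicator {0..} x *\<^sub>R h x"
      by (cases "x \<le> B") (auto simp: indicator_def z)
  qed
  show "integrable halfline h"
    using i by (simp add: integrable_restrict_space eq)
  have "(LINT x|halfline. h x) = (LINT x|lebesgue_on {0..B}. h x)"
    unfolding halfline_restrict by (subst integral_restrict_space) (auto simp: eq)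
  then show "(LINT x|halfline. h x) = integral {0..B} h"
    using lebesgue_integral_eq_integral[OF i] by simp
qed

lemma weak_by_parts:
  assumes Z: "tower {0..} Z" and phi: "test_function \<phi>"
  shows "(LINT x|halfline. Z i x * nth_deriv UNIV j \<phi> x) = (- 1) ^ j * (LINT x|halfline. Z (i + j) x * \<phi> x)"
proof -
  obtain a b where ab: "0 < a" "a \<le> b" "\<And>j x. x \<notin> {a..b} \<Longrightarrow> nth_deriv UNIV j \<phi> x = 0"
    using test_function_support[OF phi] by blast
  have T: "tower UNIV (\<lambda>n. nth_deriv UNIV n \<phi>)" using phi by (intro tower_smooth_on) (simp add: test_function_def)
  have step: "(LINT x|halfline. Z i x * nth_deriv UNIV (Suc j) \<phi> x) = - (LINT x|halfline. Z (Suc i) x * nth_deriv UNIV j \<phi> x)" for i j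
  proof -
    \<comment> \<open>The endpoint lies strictly beyond the support, so the test function and all
      its derivatives vanish at \<open>B\<close> itself, and no boundary term remains.\<close>
    define B where "B = b + 1"
    have B: "0 \<le> B" using ab by (simp add: B_def)
    have c: "continuous_on {0..B} (\<lambda>x. Z i x * nth_deriv UNIV j \<phi> x)" for i j
      by (intro continuous_intros continuous_on_subset[OF tower_continuous[OF Z]] continuous_on_subset[OF tower_continuous[OF T]]) auto
    have z: "Z i x * nth_deriv UNIV j \<phi> x = 0" if "x > B" for i j x using ab(3)[of x] that by (simp add: B_def)
    have "((\<lambda>x. Z i x * nth_deriv UNIV (Suc j) \<phi> x + Z (Suc i) x * nth_deriv UNIV j \<phi> x) has_integral
      (Z i B * nth_deriv UNIV j \<phi> B - Z i 0 * nth_deriv UNIV j \<phi> 0)) {0..B}"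
    proof (rule fundamental_theorem_of_calculus[OF B])
      fix x assume "x \<in> {0..B}"
      then show "((\<lambda>x. Z i x * nth_deriv UNIV j \<phi> x) has_vector_derivative
         Z i x * nth_deriv UNIV (Suc j) \<phi> x + Z (Suc i) x * nth_deriv UNIV j \<phi> x) (at x within {0..B})"
        by (intro has_vector_derivative_mult has_vector_derivative_within_subset[OF towerD[OF Z]]
             has_vector_derivative_within_subset[OF towerD[OF T]]) auto
    qed
    moreover have "nth_deriv UNIV j \<phi> B = 0" "nth_deriv UNIV j \<phi> 0 = 0" using ab by (auto simp: B_def)
    ultimately have "integral {0..B} (\<lambda>x. Z i x * nth_deriv UNIV (Suc j) \<phi> x + Z (Suc i) x * nth_deriv UNIV j \<phi> x) = 0"
      by (simp add: integral_unique)
    then have "integral {0..B} (\<lambda>x. Z i x * nth_deriv UNIV (Suc j) \<phi> x) + integral {0..B} (\<lambda>x. Z (Suc i) x * nth_deriv UNIV j \<phi> x) = 0"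
      by (subst (asm) Henstock_Kurzweil_Integration.integral_add) (auto intro!: integrable_continuous_real c)
    then show ?thesis
      using halfline_integral_compact(2)[OF c z] by (simp add: eq_neg_iff_add_eq_0)
  qed
  show ?thesis
  proof (induction j arbitrary: i)
    case 0
    then show ?case by (simp add: nth_deriv_def)
  next
    case (Suc j)
    then show ?case using step[of i j] by simp
  qed
qed

lemma continuous_halfline_measurable:
  "continuous_on {0..} (f :: real \<Rightarrow> complex) \<Longrightarrow> f \<in> borel_measurable halfline"
  by (rule continuous_imp_measurable_on_sets_lebesgue) auto

lemma continuous_locally_integrable:
  assumes "continuous_on {0..} f" shows "locally_integrable f"
  unfolding locally_integrable_def
  by (intro allI impI, rule continuous_imp_integrable_real[OF continuous_on_subset[OF assms]]) auto

lemma halfline_measurable_AE: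
  fixes f g :: "real \<Rightarrow> complex"
  assumes f: "f \<in> borel_measurable halfline" and eq: "AE x in halfline. f x = g x"
  shows "g \<in> borel_measurable halfline"
proof -
  have "(\<lambda>x. if x \<in> {0..} then g x else 0) \<in> borel_measurable lebesgue"
  proof (rule borel_measurable_AE)
    show "(\<lambda>x. if x \<in> {0..} then f x else 0) \<in> borel_measurable lebesgue"
      using f by (subst borel_measurable_if) auto
    show "AE x in lebesgue. (if x \<in> {0..} then f x else 0) = (if x \<in> {0..} then g x else 0)"
      using eq unfolding halfline_AE_iff by eventually_elim auto
  qed
  then show ?thesis by (subst (asm) borel_measurable_if) auto
qed

lemma locally_integrable_AE:
  assumes f: "locally_integrable f" "f \<in> borel_measurable halfline" and eq: "AE x in halfline. f x = g x"
  shows "locally_integrable g"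
  unfolding locally_integrable_def
proof (intro allI impI)
  fix a b :: real assume a: "0 < a"
  have g: "g \<in> borel_measurable halfline" by (rule halfline_measurable_AE[OF f(2) eq])
  have sub: "h \<in> borel_measurable (lebesgue_on {a..b})" if "h \<in> borel_measurable halfline" for h :: "real \<Rightarrow> complex"
    using measurable_restrict_mono[OF that, of "{a..b}"] a by auto
  have "AE x in lebesgue_on {a..b}. f x = g x"
    using eq a by (subst AE_restrict_space_iff) (auto simp: halfline_AE_iff elim!: eventually_mono)
  then show "integrable (lebesgue_on {a..b}) g"
    using integrable_cong_AE[OF sub[OF f(2)] sub[OF g]] f(1) a by (auto simp: locally_integrable_def)
qed

lemma has_weak_deriv_tower:
  assumes Z: "tower {0..} Z" and f: "AE x in halfline. Z i x = f x"
  shows "has_weak_deriv j f (Z (i + j))"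
proof -
  have m: "Z k \<in> borel_measurable halfline" "locally_integrable (Z k)" for k
    using tower_continuous[OF Z] by (auto intro: continuous_halfline_measurable continuous_locally_integrable)
  have fm: "f \<in> borel_measurable halfline" by (rule halfline_measurable_AE[OF m(1) f])
  show ?thesis
    unfolding has_weak_deriv_def
  proof (intro conjI allI impI m)
    show "locally_integrable f" by (rule locally_integrable_AE[OF m(2,1) f])
    fix \<phi> assume phi: "test_function \<phi>"
    have pm: "nth_deriv UNIV j \<phi> \<in> borel_measurable halfline"
      by (rule continuous_halfline_measurable[OF continuous_on_subset[OF test_function_continuous[OF phi]]]) auto
    have "(LINT x|halfline. f x * nth_deriv UNIV j \<phi> x) = (LINT x|halfline. Z i x * nth_deriv UNIV j \<phi> x)"
    proof (rule integral_cong_AE)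
      show "AE x in halfline. f x * nth_deriv UNIV j \<phi> x = Z i x * nth_deriv UNIV j \<phi> x"
        using f by eventually_elim simp
    qed (auto intro!: borel_measurable_times fm m(1) pm)
    then show "(LINT x|halfline. f x * nth_deriv UNIV j \<phi> x) = (- 1) ^ j * (LINT x|halfline. Z (i + j) x * \<phi> x)"
      using weak_by_parts[OF Z phi] by simp
  qed
qed

lemma locally_integrable_test_integrable:
  assumes g: "locally_integrable g" and phi: "test_function \<phi>"
  shows "integrable halfline (\<lambda>x. g x * \<phi> x)"
proof -
  obtain a b where ab: "0 < a" "a \<le> b" "\<And>j x. x \<notin> {a..b} \<Longrightarrow> nth_deriv UNIV j \<phi> x = 0"
    using test_function_support[OF phi] by blast
  have z: "\<phi> x = 0" if "x \<notin> {a..b}" for x using ab(3)[OF that, of 0] by (simp add: nth_deriv_def)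
  have c: "continuous_on UNIV \<phi>" using test_function_continuous[OF phi, of 0] by (simp add: nth_deriv_def)
  have "bounded (\<phi> ` {a..b})"
    by (intro compact_imp_bounded compact_continuous_image continuous_on_subset[OF c]) auto
  then obtain K where "\<forall>y\<in>\<phi> ` {a..b}. norm y \<le> K" unfolding bounded_iff by blast
  then have K: "\<And>x. x \<in> {a..b} \<Longrightarrow> norm (\<phi> x) \<le> K" by blast
  have gi: "integrable lebesgue (\<lambda>x. indicator {a..b} x *\<^sub>R g x)"
    using g ab(1) integrable_restrict_space[of "{a..b}" lebesgue g] by (auto simp: locally_integrable_def)
  have "integrable lebesgue (\<lambda>x. (indicator {a..b} x *\<^sub>R g x) * \<phi> x)"
  proof (rule Bochner_Integration.integrable_bound)
    show "integrable lebesgue (\<lambda>x. K * norm (indicator {a..b} x *\<^sub>R g x))" using gi by (intro integrable_mult_right integrable_norm)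
    show "(\<lambda>x. (indicator {a..b} x *\<^sub>R g x) * \<phi> x) \<in> borel_measurable lebesgue"
      using borel_measurable_integrable[OF gi] c
      by (intro borel_measurable_times measurable_completion[of \<phi>]) (auto simp: borel_measurable_continuous_onI)
    show "AE x in lebesgue. norm ((indicator {a..b} x *\<^sub>R g x) * \<phi> x) \<le> norm (K * norm (indicator {a..b} x *\<^sub>R g x))"
    proof (rule AE_I2)
      fix x
      show "norm ((indicator {a..b} x *\<^sub>R g x) * \<phi> x) \<le> norm (K * norm (indicator {a..b} x *\<^sub>R g x))"
      proof (cases "x \<in> {a..b}")
        case True
        then have "norm (\<phi> x) * norm (g x) \<le> K * norm (g x)" using K by (intro mult_right_mono) auto
        then show ?thesis using True abs_ge_self[of "K * norm (g x)"] by (simp add: norm_mult mult.commute)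
      qed auto
    qed
  qed
  moreover have "(\<lambda>x. (indicator {a..b} x *\<^sub>R g x) * \<phi> x) = (\<lambda>x. indicator {0..} x *\<^sub>R (g x * \<phi> x))"
    using z ab(1) by (auto simp: indicator_def fun_eq_iff)
  ultimately show ?thesis by (simp add: integrable_restrict_space)
qed

lemma has_weak_deriv_unique:
  assumes 1: "has_weak_deriv j f g" and 2: "has_weak_deriv j f h"
  shows "AE x in halfline. g x = h x"
proof -
  have loc: "locally_integrable g" "locally_integrable h" using assms by (auto simp: has_weak_deriv_def)
  have "AE x in halfline. g x - h x = 0"
  proof (rule weak_zero)
    show "locally_integrable (\<lambda>x. g x - h x)"
      using loc by (auto simp: locally_integrable_def)
    fix \<phi> assume phi: "test_function \<phi>"
    have "(- 1) ^ j * (LINT x|halfline. g x * \<phi> x) = (- 1) ^ j * (LINT x|halfline. h x * \<phi> x)"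
      using 1[unfolded has_weak_deriv_def, THEN conjunct2, THEN conjunct2, THEN spec, THEN mp, OF phi]
        2[unfolded has_weak_deriv_def, THEN conjunct2, THEN conjunct2, THEN spec, THEN mp, OF phi] by (rule trans[OF sym])
    then have "(LINT x|halfline. g x * \<phi> x) = (LINT x|halfline. h x * \<phi> x)" by simp
    then show "(LINT x|halfline. (g x - h x) * \<phi> x) = 0"
      using locally_integrable_test_integrable[OF loc(1) phi] locally_integrable_test_integrable[OF loc(2) phi]
      by (simp add: left_diff_distrib)
  qed
  then show ?thesis by simp
qed

lemma L2_norm_cong_AE:
  assumes "f \<in> borel_measurable halfline" "AE x in halfline. f x = g x"
  shows "L2_norm f = L2_norm g"
proof -
  have g: "g \<in> borel_measurable halfline" by (rule halfline_measurable_AE[OF assms])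
  have "(LINT x|halfline. (cmod (f x))\<^sup>2) = (LINT x|halfline. (cmod (g x))\<^sup>2)"
  proof (rule integral_cong_AE)
    show "AE x in halfline. (cmod (f x))\<^sup>2 = (cmod (g x))\<^sup>2" using assms(2) by eventually_elim simp
  qed (use assms(1) g in measurable)
  then show ?thesis by (simp add: L2_norm_def)
qed

text \<open>The choice inside \<open>sobolev_norm\<close> selects some weak derivative; uniqueness
  up to null sets identifies its norm with that of the classical derivative.\<close>

lemma sobolev_tower:
  assumes Z: "tower {0..} Z" and f: "AE x in halfline. Z i x = f x" and L: "\<And>j. j \<le> k \<Longrightarrow> Z (i + j) \<in> L2"
  shows "f \<in> sobolev k" "sobolev_norm k f = sqrt (\<Sum>j\<le>k. (L2_norm (Z (i + j)))\<^sup>2)"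
proof -
  have m: "Z k \<in> borel_measurable halfline" for k
    using tower_continuous[OF Z] by (auto intro: continuous_halfline_measurable)
  note w = has_weak_deriv_tower[OF Z f]
  have fm: "f \<in> borel_measurable halfline" by (rule halfline_measurable_AE[OF m f])
  have "integrable halfline (\<lambda>x. (cmod (f x))\<^sup>2)"
  proof (rule iffD1[OF integrable_cong_AE])
    show "integrable halfline (\<lambda>x. (cmod (Z i x))\<^sup>2)" using L[of 0] by (simp add: L2_def)
    show "AE x in halfline. (cmod (Z i x))\<^sup>2 = (cmod (f x))\<^sup>2" using f by eventually_elim simp
  qed (use m fm in measurable)
  then show "f \<in> sobolev k" using fm L w by (auto simp: sobolev_def L2_def)
  have "L2_norm (SOME g. has_weak_deriv j f g) = L2_norm (Z (i + j))" for j
  proof -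
    have "has_weak_deriv j f (SOME g. has_weak_deriv j f g)" by (rule someI[of "has_weak_deriv j f", OF w])
    from has_weak_deriv_unique[OF w this] show ?thesis using L2_norm_cong_AE[OF m] by simp
  qed
  then show "sobolev_norm k f = sqrt (\<Sum>j\<le>k. (L2_norm (Z (i + j)))\<^sup>2)" by (simp add: sobolev_norm_def)
qed

section \<open>Energy identities\<close>

lemma L2_norm_mult_integrable:
  assumes "f \<in> L2" "g \<in> L2"
  shows "integrable halfline (\<lambda>x. cmod (f x) * cmod (g x))" "(LINT x|halfline. cmod (f x) * cmod (g x)) \<le> L2_norm f * L2_norm g"
proof -
  let ?f = "\<lambda>x. complex_of_real (cmod (f x))" let ?g = "\<lambda>x. complex_of_real (cmod (g x))"
  have L: "?f \<in> L2" "?g \<in> L2" using assms by (auto simp: L2_def)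
  have n: "L2_norm ?f = L2_norm f" "L2_norm ?g = L2_norm g" by (auto simp: L2_norm_def)
  have eq: "?f x * cnj (?g x) = complex_of_real (cmod (f x) * cmod (g x))" for x by simp
  have "integrable halfline (\<lambda>x. ?f x * cnj (?g x))" by (rule L2_mult_integrable[OF L])
  then have "integrable halfline (\<lambda>x. Re (?f x * cnj (?g x)))" by (rule integrable_Re)
  then show "integrable halfline (\<lambda>x. cmod (f x) * cmod (g x))" by simp
  have "L2_inner ?f ?g = complex_of_real (LINT x|halfline. cmod (f x) * cmod (g x))"
    unfolding L2_inner_def eq by (rule integral_complex_of_real)
  then have "(LINT x|halfline. cmod (f x) * cmod (g x)) = inner (cls ?f) (cls ?g)"
    using cls_inner[OF L] by simp
  also have "\<dots> \<le> norm (cls ?f) * norm (cls ?g)" by (rule norm_cauchy_schwarz)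
  finally show "(LINT x|halfline. cmod (f x) * cmod (g x)) \<le> L2_norm f * L2_norm g"
    using L n by (simp add: cls_norm)
qed

lemma halfline_interval:
  fixes g :: "real \<Rightarrow> real"
  assumes c: "continuous_on {0..} g" and a: "0 \<le> a"
  shows "integrable halfline (\<lambda>x. indicator {a..b} x * g x)" "(LINT x|halfline. indicator {a..b} x * g x) = integral {a..b} g"
proof -
  have i: "integrable (lebesgue_on {a..b}) g"
    using a by (intro continuous_imp_integrable_real continuous_on_subset[OF c]) auto
  have eq: "(\<lambda>x. indicator {0..} x *\<^sub>R (indicator {a..b} x * g x)) = (\<lambda>x. indicator {a..b} x *\<^sub>R g x)"
    using a by (auto simp: indicator_def fun_eq_iff)
  show "integrable halfline (\<lambda>x. indicator {a..b} x * g x)"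
    using i by (simp add: integrable_restrict_space eq del: real_scaleR_def)
  have "(LINT x|halfline. indicator {a..b} x * g x) = (LINT x|lebesgue_on {a..b}. g x)"
    unfolding halfline_restrict eq by (subst integral_restrict_space) auto
  then show "(LINT x|halfline. indicator {a..b} x * g x) = integral {a..b} g"
    using lebesgue_integral_eq_integral[OF i] by simp
qed

lemma interval_integral_le:
  fixes g :: "real \<Rightarrow> real"
  assumes c: "continuous_on {0..} g" and a: "0 \<le> a" and pos: "\<And>x. 0 \<le> x \<Longrightarrow> 0 \<le> g x" and i: "integrable halfline g"
  shows "integral {a..b} g \<le> (LINT x|halfline. g x)"
  unfolding halfline_interval(2)[OF c a, symmetric]
  using pos by (intro integral_mono halfline_interval(1)[OF c a] i) (auto simp: indicator_def)

lemma halfline_integral_tendsto: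
  fixes g :: "real \<Rightarrow> real"
  assumes c: "continuous_on {0..} g" and i: "integrable halfline g"
  shows "((\<lambda>b. integral {0..b} g) \<longlongrightarrow> (LINT x|halfline. g x)) at_top"
proof -
  have "((\<lambda>b. LINT x|halfline. indicator {0..b} x * g x) \<longlongrightarrow> (LINT x|halfline. g x)) at_top"
  proof (rule integral_dominated_convergence_at_top[where w = "\<lambda>x. \<bar>g x\<bar>"])
    show "g \<in> borel_measurable halfline" using i by (rule borel_measurable_integrable)
    show "(\<lambda>x. indicator {0..b} x * g x) \<in> borel_measurable halfline" for b
      using halfline_interval(1)[OF c order_refl] by (rule borel_measurable_integrable)
    show "integrable halfline (\<lambda>x. \<bar>g x\<bar>)" using i by simp
    show "\<forall>\<^sub>F b in at_top. AE x in halfline. norm (indicator {0..b} x * g x) \<le> \<bar>g x\<bar>"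
      by (auto intro!: always_eventually simp: indicator_def)
    show "AE x in halfline. ((\<lambda>b. indicator {0..b} x * g x) \<longlongrightarrow> g x) at_top"
    proof (rule AE_I2)
      fix x assume "x \<in> space halfline"
      then have x: "0 \<le> x" by simp
      have "eventually (\<lambda>b. g x = indicator {0..b} x * g x) at_top"
        using eventually_ge_at_top[of x] by eventually_elim (use x in simp)
      then show "((\<lambda>b. indicator {0..b} x * g x) \<longlongrightarrow> g x) at_top"
        by (rule Lim_transform_eventually[OF tendsto_const])
    qed
  qed
  then show ?thesis by (simp add: halfline_interval(2)[OF c])
qed

lemma halfline_integrable_bounded:
  fixes g :: "real \<Rightarrow> real"
  assumes c: "continuous_on {0..} g" and pos: "\<And>x. 0 \<le> x \<Longrightarrow> 0 \<le> g x" and bd: "\<And>b. 0 \<le> b \<Longrightarrow> integral {0..b} g \<le> K"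
  shows "integrable halfline g" "(LINT x|halfline. g x) \<le> K"
proof -
  have m: "g \<in> borel_measurable halfline"
    by (rule continuous_imp_measurable_on_sets_lebesgue[OF c]) auto
  have "(\<integral>\<^sup>+x. ennreal (g x) \<partial>halfline) = (\<integral>\<^sup>+x. (SUP n. ennreal (indicator {0..real n} x * g x)) \<partial>halfline)"
  proof (rule nn_integral_cong)
    fix x assume "x \<in> space halfline"
    then have x: "0 \<le> x" by simp
    obtain n where n: "x \<le> real n" using real_arch_simple by blast
    show "ennreal (g x) = (SUP n. ennreal (indicator {0..real n} x * g x))"
    proof (rule antisym)
      have "ennreal (g x) = ennreal (indicator {0..real n} x * g x)" using n x by simp
      then show "ennreal (g x) \<le> (SUP n. ennreal (indicator {0..real n} x * g x))"
        by (simp only:) (rule SUP_upper, simp)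
      show "(SUP n. ennreal (indicator {0..real n} x * g x)) \<le> ennreal (g x)"
        using pos[OF x] by (intro SUP_least) (auto simp: indicator_def)
    qed
  qed
  also have "\<dots> = (SUP n. \<integral>\<^sup>+x. ennreal (indicator {0..real n} x * g x) \<partial>halfline)"
  proof (rule nn_integral_monotone_convergence_SUP_AE)
    show "AE x in halfline. ennreal (indicator {0..real n} x * g x) \<le> ennreal (indicator {0..real (Suc n)} x * g x)" for n
      using pos by (intro AE_I2 ennreal_leI) (auto simp: indicator_def)
    show "(\<lambda>x. ennreal (indicator {0..real n} x * g x)) \<in> borel_measurable halfline" for n
      using borel_measurable_integrable[OF halfline_interval(1)[OF c order_refl]] by measurable
  qed
  also have "\<dots> \<le> ennreal K"
  proof (rule SUP_least)
    fix n :: nat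
    have "(\<integral>\<^sup>+x. ennreal (indicator {0..real n} x * g x) \<partial>halfline) = ennreal (integral {0..real n} g)"
      using pos unfolding halfline_interval(2)[OF c order_refl, symmetric]
      by (intro nn_integral_eq_integral halfline_interval(1)[OF c order_refl]) (auto intro!: AE_I2 simp: indicator_def)
    then show "(\<integral>\<^sup>+x. ennreal (indicator {0..real n} x * g x) \<partial>halfline) \<le> ennreal K"
      using bd[of "real n"] by (simp add: ennreal_leI)
  qed
  finally have le: "(\<integral>\<^sup>+x. ennreal (g x) \<partial>halfline) \<le> ennreal K" .
  have p: "AE x in halfline. 0 \<le> g x" using pos by (intro AE_I2) simp
  show i: "integrable halfline g"
    by (intro integrableI_nonneg m p le_less_trans[OF le]) simp
  show "(LINT x|halfline. g x) \<le> K"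
    by (rule tendsto_upperbound[OF halfline_integral_tendsto[OF c i]])
      (use bd in \<open>auto simp: eventually_at_top_linorder intro!: exI[of _ 0]\<close>)
qed

text \<open>The minimum of |f|^2 over an interval is at most its mean.\<close>

lemma L2_small_point:
  assumes f: "f \<in> L2" and c: "continuous_on {0..} f" and ab: "0 \<le> a" "a < b"
  shows "\<exists>x\<in>{a..b}. (cmod (f x))\<^sup>2 * (b - a) \<le> (L2_norm f)\<^sup>2"
proof -
  have cg: "continuous_on {0..} (\<lambda>x. (cmod (f x))\<^sup>2)" by (intro continuous_intros c)
  have "\<exists>x\<in>{a..b}. \<forall>y\<in>{a..b}. (cmod (f x))\<^sup>2 \<le> (cmod (f y))\<^sup>2"
    using ab by (intro continuous_attains_inf continuous_on_subset[OF cg]) auto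
  then obtain x where x: "x \<in> {a..b}" "\<And>y. y \<in> {a..b} \<Longrightarrow> (cmod (f x))\<^sup>2 \<le> (cmod (f y))\<^sup>2" by blast
  have "integral {a..b} (\<lambda>y. (cmod (f x))\<^sup>2) \<le> integral {a..b} (\<lambda>y. (cmod (f y))\<^sup>2)"
    using x ab by (intro integral_le integrable_continuous_real continuous_on_subset[OF cg]) auto
  also have "\<dots> \<le> (L2_norm f)\<^sup>2"
    unfolding L2_norm_sq using ab by (intro interval_integral_le cg L2_integrable[OF f]) auto
  finally show ?thesis using x(1) ab by (auto simp: mult.commute)
qed

lemma L2_interval_L1:
  assumes f: "f \<in> L2" and c: "continuous_on {0..} f" and ab: "0 \<le> a" "a \<le> b"
  shows "integral {a..b} (\<lambda>x. cmod (f x)) \<le> sqrt (b - a) * L2_norm f"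
proof -
  let ?g = "\<lambda>x. indicator {a..b} x :: complex"
  have i: "integrable halfline (\<lambda>x. indicator {a..b} x * (1::real))" and v: "(LINT x|halfline. indicator {a..b} x * (1::real)) = b - a"
    using halfline_interval[of "\<lambda>_. 1" a b] ab by auto
  have e: "(\<lambda>x. (cmod (?g x))\<^sup>2) = (\<lambda>x. indicator {a..b} x * (1::real))" by (auto simp: indicator_def fun_eq_iff)
  have m: "?g \<in> borel_measurable halfline"
    using ab by (intro borel_measurable_indicator) (auto simp: sets_restrict_space intro!: image_eqI[of _ _ "{a..b}"])
  have g: "?g \<in> L2" unfolding L2_def using i m by (simp add: e)
  have ng: "L2_norm ?g = sqrt (b - a)" unfolding L2_norm_def e v ..
  have cg: "continuous_on {0..} (\<lambda>x. cmod (f x))" by (intro continuous_intros c)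
  have "integral {a..b} (\<lambda>x. cmod (f x)) = (LINT x|halfline. indicator {a..b} x * cmod (f x))"
    by (rule halfline_interval(2)[OF cg ab(1), symmetric])
  also have "\<dots> = (LINT x|halfline. cmod (?g x) * cmod (f x))"
    by (intro Bochner_Integration.integral_cong) (auto simp: indicator_def)
  also have "\<dots> \<le> L2_norm ?g * L2_norm f" by (rule L2_norm_mult_integrable(2)[OF g f])
  finally show ?thesis by (simp add: ng)
qed

text \<open>Solutions are small far out and have to be controlled towards the origin, hence the
  direction: a lower bound for the derivative bounds E at the left end by its value at the right
  end.\<close>

lemma backward_bound:
  fixes E :: "real \<Rightarrow> real"
  assumes ab: "0 \<le> a" "a \<le> b" and E: "\<And>x. x \<in> {a..b} \<Longrightarrow> (E has_real_derivative E' x) (at x within {a..b})"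
    and le: "\<And>x. x \<in> {a..b} \<Longrightarrow> - (k * (cmod (h x))\<^sup>2) \<le> E' x" and k: "0 \<le> k"
    and h: "h \<in> L2" "continuous_on {0..} h"
  shows "E a \<le> E b + k * (L2_norm h)\<^sup>2"
proof -
  have cg: "continuous_on {0..} (\<lambda>x. (cmod (h x))\<^sup>2)" by (intro continuous_intros h)
  have i: "(E' has_integral (E b - E a)) {a..b}"
    using ab E by (intro fundamental_theorem_of_calculus) (auto simp: has_real_derivative_iff_has_vector_derivative)
  have g: "(\<lambda>x. (cmod (h x))\<^sup>2) integrable_on {a..b}"
    using ab by (intro integrable_continuous_real continuous_on_subset[OF cg]) auto
  have "- (k * integral {a..b} (\<lambda>x. (cmod (h x))\<^sup>2)) \<le> E b - E a"
    by (rule has_integral_le[OF has_integral_neg[OF has_integral_mult_right[OF integrable_integral[OF g]]] i])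
      (use le in auto)
  moreover have "k * integral {a..b} (\<lambda>x. (cmod (h x))\<^sup>2) \<le> k * (L2_norm h)\<^sup>2"
    unfolding L2_norm_sq using ab k by (intro mult_left_mono interval_integral_le cg L2_integrable[OF h(1)]) auto
  ultimately show ?thesis by linarith
qed

lemma cmod_sq_deriv:
  assumes "(f has_vector_derivative f') (at x within S)"
  shows "((\<lambda>x. (cmod (f x))\<^sup>2) has_real_derivative 2 * Re (f' * cnj (f x))) (at x within S)"
proof -
  have r: "((\<lambda>x. Re (f x)) has_real_derivative Re f') (at x within S)"
    using bounded_linear.has_vector_derivative[OF bounded_linear_Re assms] by (simp add: has_real_derivative_iff_has_vector_derivative)
  have i: "((\<lambda>x. Im (f x)) has_real_derivative Im f') (at x within S)"
    using bounded_linear.has_vector_derivative[OF bounded_linear_Im assms] by (simp add: has_real_derivative_iff_has_vector_derivative)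
  have "((\<lambda>x. (Re (f x))\<^sup>2 + (Im (f x))\<^sup>2) has_real_derivative 2 * Re (f' * cnj (f x))) (at x within S)"
    by (rule derivative_eq_intros r i refl)+ (simp add: algebra_simps)
  then show ?thesis by (simp add: cmod_power2)
qed

lemma Re_mult_cnj_deriv:
  assumes f: "(f has_vector_derivative f') (at x within S)" and g: "(g has_vector_derivative g') (at x within S)"
  shows "((\<lambda>x. Re (f x * cnj (g x))) has_real_derivative Re (f' * cnj (g x)) + Re (f x * cnj g')) (at x within S)"
proof -
  have r: "((\<lambda>x. Re (f x)) has_real_derivative Re f') (at x within S)" "((\<lambda>x. Re (g x)) has_real_derivative Re g') (at x within S)"
    using bounded_linear.has_vector_derivative[OF bounded_linear_Re f] bounded_linear.has_vector_derivative[OF bounded_linear_Re g] by (simp_all add: has_real_derivative_iff_has_vector_derivative)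
  have i: "((\<lambda>x. Im (f x)) has_real_derivative Im f') (at x within S)" "((\<lambda>x. Im (g x)) has_real_derivative Im g') (at x within S)"
    using bounded_linear.has_vector_derivative[OF bounded_linear_Im f] bounded_linear.has_vector_derivative[OF bounded_linear_Im g] by (simp_all add: has_real_derivative_iff_has_vector_derivative)
  have "((\<lambda>x. Re (f x) * Re (g x) + Im (f x) * Im (g x)) has_real_derivative Re (f' * cnj (g x)) + Re (f x * cnj g')) (at x within S)"
    by (rule derivative_eq_intros r i refl)+ (simp add: algebra_simps)
  then show ?thesis by simp
qed

lemma abs_Re_mult_cnj_le: "\<bar>Re (a * cnj b)\<bar> \<le> cmod a * cmod b"
  using abs_Re_le_cmod[of "a * cnj b"] by (simp add: norm_mult)

section \<open>Flux at infinity and the supremum bound\<close>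

context
  fixes f f1 :: "real \<Rightarrow> complex"
  assumes der: "\<And>x. 0 \<le> x \<Longrightarrow> (f has_vector_derivative f1 x) (at x within {0..})"
    and c1: "continuous_on {0..} f1" and fL: "f \<in> L2"
begin

lemma cont_f: "continuous_on {0..} f"
  using der has_vector_derivative_continuous continuous_on_eq_continuous_within by (metis atLeast_iff)

lemma cmod_sq_integral:
  assumes "0 \<le> a" "a \<le> b"
  shows "((\<lambda>x. 2 * Re (f1 x * cnj (f x))) has_integral ((cmod (f b))\<^sup>2 - (cmod (f a))\<^sup>2)) {a..b}"
proof (rule fundamental_theorem_of_calculus[OF assms(2)])
  fix x assume "x \<in> {a..b}"
  then have "(f has_vector_derivative f1 x) (at x within {a..b})"
    using assms by (intro has_vector_derivative_within_subset[OF der]) auto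
  then show "((\<lambda>x. (cmod (f x))\<^sup>2) has_vector_derivative 2 * Re (f1 x * cnj (f x))) (at x within {a..b})"
    using cmod_sq_deriv by (simp add: has_real_derivative_iff_has_vector_derivative)
qed

text \<open>The flux is half the derivative of |f|^2. If it stayed above e, |f|^2 would grow
  linearly, which square integrability forbids. Since nothing is known about f' at infinity
  beforehand, only the existence of good points arbitrarily far out is claimed.\<close>

lemma flux_le:
  assumes e: "0 < e" and b0: "0 \<le> b0"
  shows "\<exists>b\<ge>b0. Re (f1 b * cnj (f b)) \<le> e"
proof (rule ccontr)
  assume "\<not> ?thesis"
  then have q: "\<And>x. b0 \<le> x \<Longrightarrow> e \<le> Re (f1 x * cnj (f x))" by (meson less_imp_le not_le)
  \<comment> \<open>By this point |f|^2 would have gained twice the squared norm plus 2, while the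
    interval from a to a + 1 contains a point where |f|^2 is at most the squared norm.\<close>
  define a where "a = b0 + ((L2_norm f)\<^sup>2 + 1) / e"
  have a: "b0 \<le> a" using e by (simp add: a_def)
  obtain x where x: "x \<in> {a..a+1}" "(cmod (f x))\<^sup>2 \<le> (L2_norm f)\<^sup>2"
    using L2_small_point[OF fL cont_f, of a "a + 1"] a b0 by auto
  have "(x - b0) * (2 * e) \<le> (cmod (f x))\<^sup>2 - (cmod (f b0))\<^sup>2"
  proof -
    have bx: "b0 \<le> x" using x a by simp
    have "measure lborel {b0..x} *\<^sub>R (2 * e) \<le> (cmod (f x))\<^sup>2 - (cmod (f b0))\<^sup>2"
    proof (rule has_integral_le[OF has_integral_const_real cmod_sq_integral[OF b0 bx]])
      fix z assume "z \<in> {b0..x}"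
      then have "e \<le> Re (f1 z * cnj (f z))" using q by simp
      then show "2 * e \<le> 2 * Re (f1 z * cnj (f z))" by linarith
    qed
    then show ?thesis using bx by simp
  qed
  moreover have "((L2_norm f)\<^sup>2 + 1) / e * (2 * e) \<le> (x - b0) * (2 * e)"
    using x e by (intro mult_right_mono) (auto simp: a_def)
  moreover have "((L2_norm f)\<^sup>2 + 1) / e * (2 * e) = 2 * ((L2_norm f)\<^sup>2 + 1)" using e by simp
  moreover have "0 \<le> (cmod (f b0))\<^sup>2" "0 \<le> (L2_norm f)\<^sup>2" by auto
  ultimately show False using x(2) by argo
qed

text \<open>If the flux stayed below -e, |f|^2 would decrease linearly and become negative.\<close>

lemma flux_ge:
  assumes e: "0 < e" and b0: "0 \<le> b0"
  shows "\<exists>b\<ge>b0. - e \<le> Re (f1 b * cnj (f b))"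
proof (rule ccontr)
  assume "\<not> ?thesis"
  then have q: "\<And>x. b0 \<le> x \<Longrightarrow> Re (f1 x * cnj (f x)) \<le> - e" by (meson less_imp_le not_le)
  define x where "x = b0 + ((cmod (f b0))\<^sup>2 + 1) / e"
  have x: "b0 \<le> x" using e by (simp add: x_def)
  have "(cmod (f x))\<^sup>2 - (cmod (f b0))\<^sup>2 \<le> (x - b0) * (2 * (- e))"
  proof -
    have "(cmod (f x))\<^sup>2 - (cmod (f b0))\<^sup>2 \<le> measure lborel {b0..x} *\<^sub>R (2 * (- e))"
    proof (rule has_integral_le[OF cmod_sq_integral[OF b0 x] has_integral_const_real])
      fix z assume "z \<in> {b0..x}"
      then have "Re (f1 z * cnj (f z)) \<le> - e" using q by simp
      then show "2 * Re (f1 z * cnj (f z)) \<le> 2 * (- e)" by linarith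
    qed
    then show ?thesis using x by simp
  qed
  moreover have "(x - b0) * (2 * (- e)) = - 2 * ((cmod (f b0))\<^sup>2 + 1)" using e by (simp add: x_def)
  moreover have "0 \<le> (cmod (f b0))\<^sup>2" "0 \<le> (cmod (f x))\<^sup>2" by auto
  ultimately show False by argo
qed

text \<open>|f|^2 at x differs from its value at a far point y by the integral of twice the flux,
  which Cauchy-Schwarz bounds by twice the product of the norms. An interval long enough contains a
  point y with |f|^2 at most e.\<close>

lemma sup_bound:
  assumes L1: "f1 \<in> L2" and x: "0 \<le> x"
  shows "(cmod (f x))\<^sup>2 \<le> 2 * L2_norm f * L2_norm f1"
proof (rule field_le_epsilon)
  fix e :: real assume e: "0 < e"
  define b where "b = x + ((L2_norm f)\<^sup>2 + 1) / e"
  have b: "x < b" using e by (simp add: b_def add_nonneg_pos)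
  obtain y where y: "y \<in> {x..b}" "(cmod (f y))\<^sup>2 * (b - x) \<le> (L2_norm f)\<^sup>2"
    using L2_small_point[OF fL cont_f x b] by blast
  have ye: "(cmod (f y))\<^sup>2 \<le> e"
  proof (rule ccontr)
    assume "\<not> ?thesis"
    then have "e * (b - x) \<le> (cmod (f y))\<^sup>2 * (b - x)" using b by (intro mult_right_mono) auto
    then show False using y(2) e by (simp add: b_def)
  qed
  have cg: "continuous_on {0..} (\<lambda>x. cmod (f x) * cmod (f1 x))" by (intro continuous_intros cont_f c1)
  have "integral {x..y} (\<lambda>x. cmod (f x) * cmod (f1 x)) \<le> (LINT x|halfline. cmod (f x) * cmod (f1 x))"
    by (intro interval_integral_le cg x L2_norm_mult_integrable(1) fL L1) auto
  also have "\<dots> \<le> L2_norm f * L2_norm f1" by (rule L2_norm_mult_integrable(2)[OF fL L1])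
  finally have I: "integral {x..y} (\<lambda>x. cmod (f x) * cmod (f1 x)) \<le> L2_norm f * L2_norm f1" .
  have "(\<lambda>x. cmod (f x) * cmod (f1 x)) integrable_on {x..y}"
    using x by (intro integrable_continuous_real continuous_on_subset[OF cg]) auto
  then have "((\<lambda>x. (- 2) * (cmod (f x) * cmod (f1 x))) has_integral (- 2) * integral {x..y} (\<lambda>x. cmod (f x) * cmod (f1 x))) {x..y}"
    by (intro has_integral_mult_right integrable_integral)
  then have "(- 2) * integral {x..y} (\<lambda>x. cmod (f x) * cmod (f1 x)) \<le> (cmod (f y))\<^sup>2 - (cmod (f x))\<^sup>2"
  proof (rule has_integral_le[OF _ cmod_sq_integral])
    fix z
    show "- 2 * (cmod (f z) * cmod (f1 z)) \<le> 2 * Re (f1 z * cnj (f z))"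
      using abs_Re_mult_cnj_le[of "f1 z" "f z"] by (simp add: mult.commute abs_le_iff)
  qed (use x y in auto)
  then show "(cmod (f x))\<^sup>2 \<le> 2 * L2_norm f * L2_norm f1 + e" using I ye by linarith
qed

end

text \<open>\<open>V n\<close> is the n-th derivative of the potential. The threshold
  \<open>x1\<close> trades the decay rate of the perturbation for smallness: beyond it the deviation
  from -1/(4 x^2) is at most the 1/64 that \<open>growth_algebra\<close> absorbs. Vanishing odd
  derivatives at 0 make the operator preserve the boundary conditions of even data.\<close>

locale potential =
  fixes V :: "nat \<Rightarrow> real \<Rightarrow> real" and K :: "nat \<Rightarrow> real" and x1 :: real
  assumes tower_V: "tower {0..} V"
    and decay: "0 \<le> x \<Longrightarrow> \<bar>V n x\<bar> \<le> K n / (1 + x)\<^sup>2"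
    and odd_V: "odd n \<Longrightarrow> V n 0 = 0"
    and x1: "1 \<le> x1"
    and critical: "x1 \<le> x \<Longrightarrow> \<bar>x\<^sup>2 * V 0 x + 1 / 4\<bar> \<le> 1 / 64"
begin

lemma K_nonneg: "0 \<le> K n"
  using decay[of 0 n] abs_ge_zero[of "V n 0"] by simp

lemma V_bound: assumes "0 \<le> x" shows "\<bar>V n x\<bar> \<le> K n / (1 + x)" "\<bar>V n x\<bar> \<le> K n"
proof -
  have "1 * (1 + x) \<le> (1 + x) * (1 + x)" using assms by (intro mult_right_mono) auto
  then have "K n / (1 + x)\<^sup>2 \<le> K n / (1 + x)"
    using K_nonneg[of n] assms by (intro divide_left_mono) (auto simp: power2_eq_square)
  then show 1: "\<bar>V n x\<bar> \<le> K n / (1 + x)" using decay[OF assms, of n] by linarith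
  have "K n / (1 + x) \<le> K n / 1" using K_nonneg[of n] assms by (intro divide_left_mono) auto
  then show "\<bar>V n x\<bar> \<le> K n" using 1 by simp
qed

lemma cont_V: "continuous_on {0..} (V n)" by (rule tower_continuous[OF tower_V])

text \<open>f is the classical representative of a vector in the domain, f1 its derivative and h = A
  f. Continuity of h makes the differential equation hold at every point.\<close>

definition regular :: "(real \<Rightarrow> complex) \<Rightarrow> (real \<Rightarrow> complex) \<Rightarrow> (real \<Rightarrow> complex) \<Rightarrow> bool" where
  "regular f f1 h \<longleftrightarrow> f \<in> L2 \<and> h \<in> L2 \<and> continuous_on {0..} h \<and> f1 0 = 0 \<and>
     (\<forall>x\<ge>0. (f has_vector_derivative f1 x) (at x within {0..})) \<and>
     (\<forall>x\<ge>0. (f1 has_vector_derivative (complex_of_real (V 0 x) * f x - h x)) (at x within {0..}))"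

lemma regularD:
  assumes "regular f f1 h"
  shows "f \<in> L2" "h \<in> L2" "continuous_on {0..} h" "f1 0 = 0"
    "\<And>x. 0 \<le> x \<Longrightarrow> (f has_vector_derivative f1 x) (at x within {0..})"
    "\<And>x. 0 \<le> x \<Longrightarrow> (f1 has_vector_derivative (complex_of_real (V 0 x) * f x - h x)) (at x within {0..})"
    "continuous_on {0..} f" "continuous_on {0..} f1"
  using assms unfolding regular_def
  by (auto intro!: continuous_on_eq_continuous_within[THEN iffD2] has_vector_derivative_continuous)

lemma potential_term_integrable:
  assumes "f \<in> L2" shows "integrable halfline (\<lambda>x. V 0 x * (cmod (f x))\<^sup>2)"
proof (rule Bochner_Integration.integrable_bound)
  show "integrable halfline (\<lambda>x. K 0 * (cmod (f x))\<^sup>2)" using L2_integrable[OF assms] by simp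
  have "V 0 \<in> borel_measurable halfline" by (rule continuous_imp_measurable_on_sets_lebesgue[OF cont_V]) auto
  then show "(\<lambda>x. V 0 x * (cmod (f x))\<^sup>2) \<in> borel_measurable halfline" using L2_measurable[OF assms] by measurable
  show "AE x in halfline. norm (V 0 x * (cmod (f x))\<^sup>2) \<le> norm (K 0 * (cmod (f x))\<^sup>2)"
    using V_bound(2)[of _ 0] K_nonneg[of 0] by (intro AE_I2) (auto simp: abs_mult intro: mult_right_mono)
qed

text \<open>The equation is multiplied by the conjugate of f and integrated over [0,b]; the boundary
  term at 0 vanishes by \<open>f1 0 = 0\<close>. Far points with flux at most 1 show that f1 is
  square integrable. Then the flux has a limit, and \<open>flux_le\<close> and
  \<open>flux_ge\<close> leave 0 as the only possible value.\<close>

lemma energy: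
  assumes r: "regular f f1 h"
  shows "f1 \<in> L2" "(L2_norm f1)\<^sup>2 = Re (L2_inner h f) - (LINT x|halfline. V 0 x * (cmod (f x))\<^sup>2)"
proof -
  note D = regularD[OF r]
  define q where "q x = Re (f1 x * cnj (f x))" for x
  define \<tau> where "\<tau> x = V 0 x * (cmod (f x))\<^sup>2 - Re (h x * cnj (f x))" for x
  have ihf: "integrable halfline (\<lambda>x. Re (h x * cnj (f x)))"
    by (intro integrable_Re L2_mult_integrable D)
  have ti: "integrable halfline \<tau>" unfolding \<tau>_def
    using potential_term_integrable[OF D(1)] ihf by (rule Bochner_Integration.integrable_diff)
  have tint: "(LINT x|halfline. \<tau> x) = (LINT x|halfline. V 0 x * (cmod (f x))\<^sup>2) - Re (L2_inner h f)"
    unfolding \<tau>_def L2_inner_def integral_Re[OF L2_mult_integrable[OF D(2,1)], symmetric]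
    by (rule Bochner_Integration.integral_diff[OF potential_term_integrable[OF D(1)] ihf])
  have tc: "continuous_on {0..} \<tau>" unfolding \<tau>_def by (intro continuous_intros cont_V D)
  have sc: "continuous_on {0..} (\<lambda>x. (cmod (f1 x))\<^sup>2)" by (intro continuous_intros D)
  have S: "integral {0..b} (\<lambda>x. (cmod (f1 x))\<^sup>2) = q b - integral {0..b} \<tau>" if b: "0 \<le> b" for b
  proof -
    have "((\<lambda>x. (cmod (f1 x))\<^sup>2 + \<tau> x) has_integral (q b - q 0)) {0..b}"
    proof (rule fundamental_theorem_of_calculus[OF b])
      fix x assume x: "x \<in> {0..b}"
      have "(q has_real_derivative Re ((complex_of_real (V 0 x) * f x - h x) * cnj (f x)) + Re (f1 x * cnj (f1 x))) (at x within {0..b})"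
        unfolding q_def using x
        by (intro Re_mult_cnj_deriv has_vector_derivative_within_subset[OF D(5)] has_vector_derivative_within_subset[OF D(6)]) auto
      moreover have "Re ((complex_of_real (V 0 x) * f x - h x) * cnj (f x)) + Re (f1 x * cnj (f1 x)) = (cmod (f1 x))\<^sup>2 + \<tau> x"
        unfolding \<tau>_def cmod_power2 by (simp add: algebra_simps power2_eq_square)
      ultimately show "(q has_vector_derivative (cmod (f1 x))\<^sup>2 + \<tau> x) (at x within {0..b})"
        by (simp add: has_real_derivative_iff_has_vector_derivative)
    qed
    moreover have "q 0 = 0" using D(4) by (simp add: q_def)
    ultimately have "q b = integral {0..b} (\<lambda>x. (cmod (f1 x))\<^sup>2 + \<tau> x)" by (simp add: integral_unique)
    also have "\<dots> = integral {0..b} (\<lambda>x. (cmod (f1 x))\<^sup>2) + integral {0..b} \<tau>"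
      by (intro Henstock_Kurzweil_Integration.integral_add integrable_continuous_real continuous_on_subset[OF sc] continuous_on_subset[OF tc]) auto
    finally show ?thesis by simp
  qed
  define W where "W = (LINT x|halfline. \<bar>\<tau> x\<bar>)"
  have tb: "- integral {0..b} \<tau> \<le> W" for b
  proof -
    have ca: "continuous_on {0..} (\<lambda>x. \<bar>\<tau> x\<bar>)" by (intro continuous_intros tc)
    have "- integral {0..b} \<tau> = integral {0..b} (\<lambda>x. - \<tau> x)" by simp
    also have "\<dots> \<le> integral {0..b} (\<lambda>x. \<bar>\<tau> x\<bar>)"
      by (intro integral_le integrable_continuous_real continuous_on_subset[OF ca] continuous_on_minus continuous_on_subset[OF tc]) auto
    also have "\<dots> \<le> W" unfolding W_def by (intro interval_integral_le ca) (use ti in auto)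
    finally show ?thesis .
  qed
  have bd: "integral {0..b} (\<lambda>x. (cmod (f1 x))\<^sup>2) \<le> 1 + W" if b: "0 \<le> b" for b
  proof -
    \<comment> \<open>The integrand is nonnegative, so the bound on [0,b] may be read off at any
      later point, in particular at one with small flux.\<close>
    obtain b' where b': "b' \<ge> b" "q b' \<le> 1"
      using flux_le[OF D(5) D(8) D(1), of 1 b] b by (auto simp: q_def)
    have "integral {0..b} (\<lambda>x. (cmod (f1 x))\<^sup>2) \<le> integral {0..b'} (\<lambda>x. (cmod (f1 x))\<^sup>2)"
      using b' by (intro integral_subset_le integrable_continuous_real continuous_on_subset[OF sc]) auto
    also have "\<dots> \<le> 1 + W" using S[of b'] b' b tb[of b'] by simp
    finally show ?thesis .
  qed
  have i1: "integrable halfline (\<lambda>x. (cmod (f1 x))\<^sup>2)"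
    by (rule halfline_integrable_bounded(1)[OF sc _ bd]) auto
  then show L1: "f1 \<in> L2" using continuous_halfline_measurable[OF D(8)] by (simp add: L2_def)
  define L where "L = (L2_norm f1)\<^sup>2 + (LINT x|halfline. \<tau> x)"
  have "((\<lambda>b. integral {0..b} (\<lambda>x. (cmod (f1 x))\<^sup>2) + integral {0..b} \<tau>) \<longlongrightarrow> L) at_top"
    unfolding L_def L2_norm_sq by (intro tendsto_add halfline_integral_tendsto sc tc i1 ti)
  then have qL: "(q \<longlongrightarrow> L) at_top"
    by (rule Lim_transform_eventually)
      (auto simp: eventually_at_top_linorder S intro!: exI[of _ 0])
  have "L \<le> 0"
  proof (rule ccontr)
    assume "\<not> L \<le> 0"
    then have L: "0 < L / 2" "L / 2 < L" by auto
    obtain b0 where b0: "\<And>b. b \<ge> b0 \<Longrightarrow> L / 2 < q b"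
      using order_tendstoD(1)[OF qL L(2)] by (auto simp: eventually_at_top_linorder)
    obtain b where "b \<ge> max 0 b0" "q b \<le> L / 2"
      using flux_le[OF D(5) D(8) D(1) L(1), of "max 0 b0"] by (auto simp: q_def)
    then show False using b0[of b] by simp
  qed
  moreover have "0 \<le> L"
  proof (rule ccontr)
    assume "\<not> 0 \<le> L"
    then have L: "0 < - L / 2" "L < L / 2" by auto
    obtain b0 where b0: "\<And>b. b \<ge> b0 \<Longrightarrow> q b < L / 2"
      using order_tendstoD(2)[OF qL L(2)] by (auto simp: eventually_at_top_linorder)
    obtain b where "b \<ge> max 0 b0" "- (- L / 2) \<le> q b"
      using flux_ge[OF D(5) D(8) D(1) L(1), of "max 0 b0"] by (auto simp: q_def)
    then show False using b0[of b] by simp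
  qed
  ultimately show "(L2_norm f1)\<^sup>2 = Re (L2_inner h f) - (LINT x|halfline. V 0 x * (cmod (f x))\<^sup>2)"
    using tint by (simp add: L_def)
qed

end

section \<open>Low-energy estimates\<close>

text \<open>Let G = |F|^2/64 + |Y|^2, s = Re(F cnj Y), t = Re(H cnj Y), and let L be the right-hand
  side, which is the derivative of G along a solution. Then z L = G + (1/32 + 2 \<rho>) s - 2 z^2 t
  exactly. The weight 1/64 gives |s| \<le> 4 G, and 1/32 + 2 \<rho> is at most 1/16 in absolute
  value, so the middle term costs G/4; Cauchy-Schwarz lets the source term cost another G/4 plus 4
  z^4 |H|^2. Half of G remains.\<close>

lemma growth_algebra:
  fixes F P H Y :: complex and z \<rho> v :: real
  assumes z: "0 < z" and Y: "Y = of_real z * P - F / 2" and v: "z\<^sup>2 * v = \<rho> - 1 / 4" and rho: "\<bar>\<rho>\<bar> \<le> 1 / 64"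
  shows "((cmod F)\<^sup>2 / 64 + (cmod Y)\<^sup>2) / (2 * z) - 4 * z ^ 3 * (cmod H)\<^sup>2
    \<le> (1 / 32) * Re (P * cnj F) + 2 * Re ((P / 2 + of_real z * (of_real v * F - H)) * cnj Y)"
proof -
  define G where "G = (cmod F)\<^sup>2 / 64 + (cmod Y)\<^sup>2"
  define s where "s = Re (F * cnj Y)" define t where "t = Re (H * cnj Y)"
  define L where "L = (1 / 32) * Re (P * cnj F) + 2 * Re ((P / 2 + of_real z * (of_real v * F - H)) * cnj Y)"
  have zP: "of_real z * P = Y + F / 2" using Y by simp
  have a: "z * Re (P * cnj F) = s + (cmod F)\<^sup>2 / 2"
  proof -
    have "z * Re (P * cnj F) = Re ((of_real z * P) * cnj F)" by simp (simp add: algebra_simps)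
    also have "\<dots> = s + (cmod F)\<^sup>2 / 2" unfolding zP s_def cmod_power2 by (simp add: algebra_simps power2_eq_square)
    finally show ?thesis .
  qed
  have b: "z * Re ((P / 2 + of_real z * (of_real v * F - H)) * cnj Y) = ((cmod Y)\<^sup>2 + s / 2) / 2 + (\<rho> - 1 / 4) * s - z\<^sup>2 * t"
  proof -
    have "z * Re ((P / 2 + of_real z * (of_real v * F - H)) * cnj Y) = Re ((of_real z * P) * cnj Y) / 2 + (z\<^sup>2 * v) * s - z\<^sup>2 * t"
      unfolding s_def t_def by (simp add: algebra_simps power2_eq_square)
    also have "Re ((of_real z * P) * cnj Y) = (cmod Y)\<^sup>2 + s / 2" unfolding zP s_def cmod_power2 by (simp add: algebra_simps power2_eq_square)
    finally show ?thesis by (simp add: v)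
  qed
  have "z * L = (1 / 32) * (z * Re (P * cnj F)) + 2 * (z * Re ((P / 2 + of_real z * (of_real v * F - H)) * cnj Y))"
    unfolding L_def by (simp only: distrib_left mult.left_commute)
  also have "\<dots> = G + (1 / 32 + 2 * \<rho>) * s - 2 * z\<^sup>2 * t"
    unfolding a b G_def by (simp add: algebra_simps)
  finally have eq: "z * L = G + (1 / 32 + 2 * \<rho>) * s - 2 * z\<^sup>2 * t" .
  have s4: "\<bar>s\<bar> \<le> 4 * G"
  proof -
    have "\<bar>s\<bar> \<le> cmod F * cmod Y" unfolding s_def by (rule abs_Re_mult_cnj_le)
    also have "\<dots> \<le> 4 * G" using sum_squares_bound[of "cmod F / 8" "cmod Y"] by (simp add: G_def power_divide)
    finally show ?thesis .
  qed
  have "\<bar>(1 / 32 + 2 * \<rho>) * s\<bar> \<le> (1 / 16) * (4 * G)"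
    unfolding abs_mult using rho s4 by (intro mult_mono) auto
  then have 1: "- (G / 4) \<le> (1 / 32 + 2 * \<rho>) * s" by (simp add: abs_le_iff)
  have 2: "2 * z\<^sup>2 * t \<le> G / 4 + 4 * z ^ 4 * (cmod H)\<^sup>2"
  proof -
    have "t \<le> cmod H * cmod Y" using abs_Re_mult_cnj_le[of H Y] by (simp add: t_def abs_le_iff)
    then have "2 * z\<^sup>2 * t \<le> 2 * z\<^sup>2 * (cmod H * cmod Y)" by (intro mult_left_mono) auto
    also have "\<dots> = 2 * (2 * z\<^sup>2 * cmod H) * (cmod Y / 2)" by simp
    also have "\<dots> \<le> (2 * z\<^sup>2 * cmod H)\<^sup>2 + (cmod Y / 2)\<^sup>2" by (rule sum_squares_bound)
    also have "\<dots> = 4 * z ^ 4 * (cmod H)\<^sup>2 + (cmod Y)\<^sup>2 / 4"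
      by (simp add: power_mult_distrib power_divide flip: power_mult)
    also have "(cmod Y)\<^sup>2 / 4 \<le> G / 4" by (simp add: G_def)
    finally show ?thesis by simp
  qed
  have "G / 2 - 4 * z ^ 4 * (cmod H)\<^sup>2 \<le> z * L" using 1 2 eq by linarith
  then have "(G / 2 - 4 * z ^ 4 * (cmod H)\<^sup>2) / z \<le> L" using z by (simp add: pos_divide_le_eq mult.commute)
  moreover have "(G / 2 - 4 * z ^ 4 * (cmod H)\<^sup>2) / z = G / (2 * z) - 4 * z ^ 3 * (cmod H)\<^sup>2"
    using z by (simp add: diff_divide_distrib power_eq_if)
  ultimately show ?thesis by (simp add: G_def L_def)
qed

context potential
begin

text \<open>For f = sqrt x * v this is x (|v|^2/64 + |x v'|^2). Taking out the factor sqrt x, a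
  zero-energy solution of the critical equation, leaves a function v that varies at most
  logarithmically.\<close>

definition gauge_energy :: "(real \<Rightarrow> complex) \<Rightarrow> (real \<Rightarrow> complex) \<Rightarrow> real \<Rightarrow> real" where
  "gauge_energy f f1 x = (cmod (f x))\<^sup>2 / 64 + (cmod (of_real x * f1 x - f x / 2))\<^sup>2"

lemma gauge_energy_nonneg: "0 \<le> gauge_energy f f1 x" by (simp add: gauge_energy_def)

text \<open>By \<open>growth_algebra\<close> the derivative of the gauge energy is at least 1/(2 x)
  times the energy, up to the source, and this is exactly the rate that division by sqrt x
  compensates. The weight x^2 sqrt x of the source is replaced by its value at the right
  end.\<close>

lemma gauge_energy_backward:
  assumes r: "regular f f1 h" and x: "x1 \<le> x" "x \<le> X"
  shows "gauge_energy f f1 x / sqrt x \<le> gauge_energy f f1 X / sqrt X + 4 * X\<^sup>2 * sqrt X * (L2_norm h)\<^sup>2"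
proof -
  note D = regularD[OF r]
  define Y where "Y z = of_real z * f1 z - f z / 2" for z
  define Y' where "Y' z = f1 z / 2 + of_real z * (of_real (V 0 z) * f z - h z)" for z
  define G' where "G' z = (1 / 32) * Re (f1 z * cnj (f z)) + 2 * Re (Y' z * cnj (Y z))" for z
  have dG: "((\<lambda>z. gauge_energy f f1 z) has_real_derivative G' z) (at z within {x..X})" if z: "z \<in> {x..X}" for z
  proof -
    have z0: "0 \<le> z" "{x..X} \<subseteq> {0..}" using z x x1 by auto
    note df = has_vector_derivative_within_subset[OF D(5)[OF z0(1)] z0(2)]
    note df1 = has_vector_derivative_within_subset[OF D(6)[OF z0(1)] z0(2)]
    have dz: "(complex_of_real has_vector_derivative 1) (at z within {x..X})"
      by (auto intro!: derivative_eq_intros)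
    have "((\<lambda>z. of_real z * f1 z - (1/2) * f z) has_vector_derivative
       (of_real z * (of_real (V 0 z) * f z - h z) + 1 * f1 z) - (1/2) * f1 z) (at z within {x..X})"
      by (intro has_vector_derivative_diff has_vector_derivative_mult has_vector_derivative_mult_right dz df df1)
    moreover have "(of_real z * (of_real (V 0 z) * f z - h z) + 1 * f1 z) - (1/2) * f1 z = Y' z"
      by (simp add: Y'_def field_simps)
    moreover have "(\<lambda>z. of_real z * f1 z - (1/2) * f z) = Y" by (simp add: Y_def fun_eq_iff)
    ultimately have dY: "(Y has_vector_derivative Y' z) (at z within {x..X})" by simp
    have "((\<lambda>z. (1/64) * (cmod (f z))\<^sup>2 + (cmod (Y z))\<^sup>2) has_real_derivative
        (1/64) * (2 * Re (f1 z * cnj (f z))) + 2 * Re (Y' z * cnj (Y z))) (at z within {x..X})"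
      by (intro DERIV_add DERIV_cmult cmod_sq_deriv df dY)
    moreover have "(\<lambda>z. (1/64) * (cmod (f z))\<^sup>2 + (cmod (Y z))\<^sup>2) = gauge_energy f f1"
      by (simp add: fun_eq_iff gauge_energy_def Y_def)
    moreover have "(1/64) * (2 * Re (f1 z * cnj (f z))) + 2 * Re (Y' z * cnj (Y z)) = G' z" unfolding G'_def by simp
    ultimately show ?thesis by (simp only:)
  qed
  show ?thesis
  proof (rule backward_bound[where E = "\<lambda>z. gauge_energy f f1 z / sqrt z" and k = "4 * X\<^sup>2 * sqrt X" and a = x and b = X and E' = "\<lambda>z. G' z / sqrt z - gauge_energy f f1 z / (2 * z * sqrt z)" and h = h])
    fix z assume z: "z \<in> {x..X}"
    then have z0: "0 < z" using x x1 by auto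
    have ds: "(sqrt has_real_derivative (inverse (sqrt z) / 2)) (at z within {x..X})"
      using DERIV_real_sqrt[OF z0] by (rule has_field_derivative_at_within)
    have "((\<lambda>z. gauge_energy f f1 z / sqrt z) has_real_derivative
       (G' z * sqrt z - gauge_energy f f1 z * (inverse (sqrt z) / 2)) / (sqrt z * sqrt z)) (at z within {x..X})"
      by (rule DERIV_divide[OF dG[OF z] ds]) (use z0 in simp)
    moreover have "(G' z * sqrt z - gauge_energy f f1 z * (inverse (sqrt z) / 2)) / (sqrt z * sqrt z) = G' z / sqrt z - gauge_energy f f1 z / (2 * z * sqrt z)"
    proof -
      have "(p * s - g * (inverse s / 2)) / (s * s) = p / s - g / (2 * (s * s) * s)" if "0 < s" for p g s :: real
        using that by (simp add: field_simps)
      from this[of "sqrt z" "G' z" "gauge_energy f f1 z"] show ?thesis using z0 by simp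
    qed
    ultimately show "((\<lambda>z. gauge_energy f f1 z / sqrt z) has_real_derivative G' z / sqrt z - gauge_energy f f1 z / (2 * z * sqrt z)) (at z within {x..X})"
      by simp
    have "gauge_energy f f1 z / (2 * z) - 4 * z ^ 3 * (cmod (h z))\<^sup>2 \<le> G' z"
      unfolding gauge_energy_def G'_def Y_def Y'_def
      by (rule growth_algebra[where \<rho> = "z\<^sup>2 * V 0 z + 1 / 4"]) (use z0 critical[of z] z x in auto)
    then have "(gauge_energy f f1 z / (2 * z) - 4 * z ^ 3 * (cmod (h z))\<^sup>2) / sqrt z \<le> G' z / sqrt z"
      using z0 by (intro divide_right_mono) auto
    moreover have "z ^ 3 / sqrt z = z\<^sup>2 * sqrt z"
    proof -
      have "z ^ 3 / sqrt z = z\<^sup>2 * (z / sqrt z)" by (simp add: power3_eq_cube power2_eq_square)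
      then show ?thesis using z0 by (simp add: real_div_sqrt)
    qed
    moreover have "(gauge_energy f f1 z / (2 * z) - 4 * z ^ 3 * (cmod (h z))\<^sup>2) / sqrt z = gauge_energy f f1 z / (2 * z * sqrt z) - 4 * (cmod (h z))\<^sup>2 * (z ^ 3 / sqrt z)"
      by (simp add: diff_divide_distrib)
    ultimately have "- (4 * (cmod (h z))\<^sup>2 * (z\<^sup>2 * sqrt z)) \<le> G' z / sqrt z - gauge_energy f f1 z / (2 * z * sqrt z)"
      by simp
    moreover have "4 * (cmod (h z))\<^sup>2 * (z\<^sup>2 * sqrt z) \<le> 4 * (cmod (h z))\<^sup>2 * (X\<^sup>2 * sqrt X)"
      using z z0 by (intro mult_left_mono mult_mono power_mono) auto
    ultimately show "- (4 * X\<^sup>2 * sqrt X * (cmod (h z))\<^sup>2) \<le> G' z / sqrt z - gauge_energy f f1 z / (2 * z * sqrt z)"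
      by (simp add: mult_ac)
  qed (use x x1 D in auto)
qed

text \<open>Two points at distance comparable to R where |f| is small give a small difference
  quotient. On the interval between them f'' has small integral, since the potential is at most
  K/R^2 there and h is at most the norm of f over R^2, so f' is nearly constant and must itself be
  small at X.\<close>

lemma gauge_energy_start:
  assumes r: "regular f f1 h" and R: "1 \<le> R" and h: "L2_norm h \<le> L2_norm f / R\<^sup>2"
  shows "\<exists>X\<in>{R..2*R}. gauge_energy f f1 X \<le> (1 + (4 * K 0 + 9)\<^sup>2) * (L2_norm f)\<^sup>2 / R"
proof -
  note D = regularD[OF r]
  define n where "n = L2_norm f"
  have n0: "0 \<le> n" by (simp add: n_def L2_norm_nonneg)
  have R0: "0 < R" using R by simp
  \<comment> \<open>This is the size of |f| at scale R that square integrability alone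
    provides.\<close>
  define u where "u = n / sqrt R"
  have u0: "0 \<le> u" using n0 R by (simp add: u_def)
  have small: "cmod y \<le> u" if "(cmod y)\<^sup>2 * R \<le> n\<^sup>2" for y
  proof -
    have "(cmod y)\<^sup>2 \<le> n\<^sup>2 / R" using that R0 by (simp add: field_simps)
    also have "\<dots> = u\<^sup>2" using R0 by (simp add: u_def power_divide)
    finally show ?thesis by (rule power2_le_imp_le) (rule u0)
  qed
  obtain X where X: "X \<in> {R..2*R}" "(cmod (f X))\<^sup>2 * R \<le> n\<^sup>2"
    using L2_small_point[OF D(1,7), of R "2*R"] R by (auto simp: n_def)
  \<comment> \<open>Taking Z from a separate interval keeps the distance to X between R and 3
    R.\<close>
  obtain Z where Z: "Z \<in> {3*R..4*R}" "(cmod (f Z))\<^sup>2 * R \<le> n\<^sup>2"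
    using L2_small_point[OF D(1,7), of "3*R" "4*R"] R by (auto simp: n_def)
  have XZ: "0 \<le> X" "X \<le> Z" "R \<le> Z - X" "Z - X \<le> 3 * R" using X Z R by auto
  \<comment> \<open>Cauchy-Schwarz over a length of at most 4 R gives a factor 2 sqrt R; together
    with K/R^2 for the potential and 1/R^2 for h, both multiplied by the norm n, this is the bound
    for the oscillation of f'.\<close>
  define d where "d = 2 * (K 0 + 1) * u / R"
  have d0: "0 \<le> d" using u0 R0 K_nonneg[of 0] by (simp add: d_def)
  have osc: "cmod (f1 s - f1 X) \<le> d" if s: "s \<in> {X..Z}" for s
  proof -
    have cf: "continuous_on {0..} (\<lambda>x. cmod (f x))" and ch: "continuous_on {0..} (\<lambda>x. cmod (h x))"
      by (intro continuous_intros D)+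
    have sub: "{X..s} \<subseteq> {0..}" using XZ by auto
    have i: "((\<lambda>x. of_real (V 0 x) * f x - h x) has_integral (f1 s - f1 X)) {X..s}"
      using s XZ by (intro fundamental_theorem_of_calculus has_vector_derivative_within_subset[OF D(6)]) auto
    have g: "((\<lambda>x. K 0 / R\<^sup>2 * cmod (f x) + cmod (h x)) has_integral
        (K 0 / R\<^sup>2 * integral {X..s} (\<lambda>x. cmod (f x)) + integral {X..s} (\<lambda>x. cmod (h x)))) {X..s}"
      by (intro has_integral_add has_integral_mult_right integrable_integral integrable_continuous_real
          continuous_on_subset[OF cf sub] continuous_on_subset[OF ch sub])
    have "cmod (integral {X..s} (\<lambda>x. of_real (V 0 x) * f x - h x)) \<le> integral {X..s} (\<lambda>x. K 0 / R\<^sup>2 * cmod (f x) + cmod (h x))"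
    proof (rule integral_norm_bound_integral)
      show "(\<lambda>x. of_real (V 0 x) * f x - h x) integrable_on {X..s}" using i by (rule has_integral_integrable)
      show "(\<lambda>x. K 0 / R\<^sup>2 * cmod (f x) + cmod (h x)) integrable_on {X..s}" using g by (rule has_integral_integrable)
      fix x assume x: "x \<in> {X..s}"
      then have xR: "R \<le> x" using X by auto
      have "\<bar>V 0 x\<bar> \<le> K 0 / (1 + x)\<^sup>2" using xR R by (intro decay) auto
      also have "\<dots> \<le> K 0 / R\<^sup>2" using xR R K_nonneg[of 0] by (intro divide_left_mono power_mono) auto
      finally have "\<bar>V 0 x\<bar> * cmod (f x) \<le> K 0 / R\<^sup>2 * cmod (f x)" by (intro mult_right_mono) auto
      moreover have "cmod (of_real (V 0 x) * f x - h x) \<le> \<bar>V 0 x\<bar> * cmod (f x) + cmod (h x)"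
        using norm_triangle_ineq4[of "of_real (V 0 x) * f x" "h x"] by (simp add: norm_mult)
      ultimately show "cmod (of_real (V 0 x) * f x - h x) \<le> K 0 / R\<^sup>2 * cmod (f x) + cmod (h x)" by linarith
    qed
    then have "cmod (f1 s - f1 X) \<le> K 0 / R\<^sup>2 * integral {X..s} (\<lambda>x. cmod (f x)) + integral {X..s} (\<lambda>x. cmod (h x))"
      unfolding integral_unique[OF i] integral_unique[OF g] .
    also have "\<dots> \<le> K 0 / R\<^sup>2 * (2 * sqrt R * n) + 2 * sqrt R * (n / R\<^sup>2)"
    proof (intro add_mono mult_left_mono)
      have sq: "sqrt (s - X) \<le> 2 * sqrt R"
      proof -
        have "sqrt (s - X) \<le> sqrt (4 * R)" using s XZ R0 by (intro real_sqrt_le_mono) auto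
        then show ?thesis by (simp add: real_sqrt_mult)
      qed
      have "integral {X..s} (\<lambda>x. cmod (f x)) \<le> sqrt (s - X) * n"
        unfolding n_def using s XZ by (intro L2_interval_L1 D) auto
      also have "\<dots> \<le> 2 * sqrt R * n" using sq n0 by (intro mult_right_mono)
      finally show "integral {X..s} (\<lambda>x. cmod (f x)) \<le> 2 * sqrt R * n" .
      have "integral {X..s} (\<lambda>x. cmod (h x)) \<le> sqrt (s - X) * L2_norm h"
        using s XZ by (intro L2_interval_L1 D) auto
      also have "\<dots> \<le> 2 * sqrt R * (n / R\<^sup>2)" using sq h R0 L2_norm_nonneg[of h] by (intro mult_mono) (auto simp: n_def)
      finally show "integral {X..s} (\<lambda>x. cmod (h x)) \<le> 2 * sqrt R * (n / R\<^sup>2)" .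
      show "0 \<le> K 0 / R\<^sup>2" using K_nonneg[of 0] by simp
    qed
    also have "\<dots> = 2 * (K 0 + 1) * n * (sqrt R / R) / R"
      using R0 by (simp add: field_simps power2_eq_square)
    also have "sqrt R / R = 1 / sqrt R" using R0 by (simp add: sqrt_divide_self_eq inverse_eq_divide)
    also have "2 * (K 0 + 1) * n * (1 / sqrt R) / R = d" by (simp add: d_def u_def)
    finally show ?thesis .
  qed
  have "norm ((f Z - of_real Z * f1 X) - (f X - of_real X * f1 X)) \<le> d * norm (Z - X)"
  proof (rule differentiable_bound[of "{X..Z}" "\<lambda>s. f s - of_real s * f1 X" "\<lambda>s t. t *\<^sub>R (f1 s - f1 X)"])
    fix s assume s: "s \<in> {X..Z}"
    have "(f has_vector_derivative f1 s) (at s within {X..Z})"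
      using s XZ by (intro has_vector_derivative_within_subset[OF D(5)]) auto
    moreover have "((\<lambda>s. of_real s * f1 X) has_vector_derivative 1 * f1 X) (at s within {X..Z})"
      by (intro has_vector_derivative_mult_left) (auto intro!: derivative_eq_intros)
    ultimately have "((\<lambda>s. f s - of_real s * f1 X) has_vector_derivative f1 s - 1 * f1 X) (at s within {X..Z})"
      by (rule has_vector_derivative_diff)
    then show "((\<lambda>s. f s - of_real s * f1 X) has_derivative (\<lambda>t. t *\<^sub>R (f1 s - f1 X))) (at s within {X..Z})"
      by (simp add: has_vector_derivative_def)
    show "onorm (\<lambda>t. t *\<^sub>R (f1 s - f1 X)) \<le> d"
      using osc[OF s] by (intro onorm_le) (auto simp: mult.commute[of d] intro: mult_left_mono)
  qed (use XZ in auto)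
  then have taylor: "cmod ((f Z - f X) - of_real (Z - X) * f1 X) \<le> d * (Z - X)"
    using XZ by (simp add: algebra_simps)
  have "(Z - X) * cmod (f1 X) = cmod (of_real (Z - X) * f1 X)" using XZ by (simp add: norm_mult del: of_real_diff)
  also have "\<dots> \<le> cmod ((f Z - f X) - of_real (Z - X) * f1 X) + cmod (f Z - f X)"
    using norm_triangle_ineq4[of "f Z - f X" "(f Z - f X) - of_real (Z - X) * f1 X"] by (simp add: add.commute)
  also have "\<dots> \<le> d * (Z - X) + (cmod (f Z) + cmod (f X))"
    by (intro add_mono taylor norm_triangle_ineq4)
  also have "\<dots> \<le> d * (Z - X) + (u + u)" using small[OF X(2)] small[OF Z(2)] by simp
  also have "\<dots> \<le> (d + 2 * u / R) * (Z - X)"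
  proof -
    have "u * R \<le> u * (Z - X)" using XZ u0 by (intro mult_left_mono) auto
    then have a: "u \<le> u * (Z - X) / R" using R0 by (simp add: pos_le_divide_eq)
    have b: "(d + 2 * u / R) * (Z - X) = d * (Z - X) + 2 * (u * (Z - X) / R)" by (simp add: distrib_right)
    show ?thesis unfolding b using a by linarith
  qed
  finally have "cmod (f1 X) * (Z - X) \<le> (d + 2 * u / R) * (Z - X)" by (simp only: mult.commute)
  then have "cmod (f1 X) \<le> d + 2 * u / R" by (rule mult_right_le_imp_le) (use XZ R0 in simp)
  then have "X * cmod (f1 X) \<le> (2 * R) * (d + 2 * u / R)" using X R0 d0 by (intro mult_mono) auto
  also have "\<dots> = (4 * K 0 + 8) * u" using R0 by (simp add: d_def field_simps)
  finally have f1X: "X * cmod (f1 X) \<le> (4 * K 0 + 8) * u" .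
  have "cmod (of_real X * f1 X - f X / 2) \<le> X * cmod (f1 X) + cmod (f X) / 2"
    using norm_triangle_ineq4[of "of_real X * f1 X" "f X / 2"] XZ by (simp add: norm_mult norm_divide)
  also have "\<dots> \<le> (4 * K 0 + 9) * u" using f1X small[OF X(2)] u0 by (simp add: algebra_simps)
  finally have "(cmod (of_real X * f1 X - f X / 2))\<^sup>2 \<le> ((4 * K 0 + 9) * u)\<^sup>2" by (intro power_mono) auto
  moreover have "(cmod (f X))\<^sup>2 \<le> u\<^sup>2" using small[OF X(2)] by (intro power_mono) auto
  ultimately have "gauge_energy f f1 X \<le> u\<^sup>2 + ((4 * K 0 + 9) * u)\<^sup>2"
    unfolding gauge_energy_def using zero_le_power2[of "cmod (f X)"] by linarith
  also have "\<dots> = (1 + (4 * K 0 + 9)\<^sup>2) * u\<^sup>2" unfolding power_mult_distrib by (simp only: distrib_right mult_1)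
  also have "u\<^sup>2 = n\<^sup>2 / R" using R0 by (simp add: u_def power_divide)
  finally have "gauge_energy f f1 X \<le> (1 + (4 * K 0 + 9)\<^sup>2) * (n\<^sup>2 / R)" .
  then show ?thesis using X(1) by (intro bexI[of _ X]) (simp_all add: n_def)
qed

end

section \<open>Weighted and supremum bounds at low energy\<close>

lemma inv_sqrt_cube_integral:
  "integrable halfline (\<lambda>x. 1 / ((1 + x) * sqrt (1 + x)))" "(LINT x|halfline. 1 / ((1 + x) * sqrt (1 + x))) \<le> 2"
proof -
  have c: "continuous_on {0..} (\<lambda>x::real. 1 / ((1 + x) * sqrt (1 + x)))" by (intro continuous_intros) auto
  have I: "((\<lambda>x. 1 / ((1 + x) * sqrt (1 + x))) has_integral (- 2 / sqrt (1 + b) - (- 2 / sqrt (1 + 0)))) {0..b}"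
    if b: "0 \<le> b" for b :: real
  proof (rule fundamental_theorem_of_calculus[OF b])
    fix x :: real assume "x \<in> {0..b}"
    then have x: "0 < 1 + x" by auto
    have "((\<lambda>x. - 2 / sqrt (1 + x)) has_real_derivative 1 / ((1 + x) * sqrt (1 + x))) (at x)"
      using x by (auto intro!: derivative_eq_intros simp: field_simps power2_eq_square)
    then show "((\<lambda>x. - 2 / sqrt (1 + x)) has_vector_derivative 1 / ((1 + x) * sqrt (1 + x))) (at x within {0..b})"
      by (simp add: has_real_derivative_iff_has_vector_derivative has_vector_derivative_at_within)
  qed
  have bd: "integral {0..b} (\<lambda>x::real. 1 / ((1 + x) * sqrt (1 + x))) \<le> 2" if b: "0 \<le> b" for b
    using integral_unique[OF I[OF b]] b by simp
  show "integrable halfline (\<lambda>x. 1 / ((1 + x) * sqrt (1 + x)))" "(LINT x|halfline. 1 / ((1 + x) * sqrt (1 + x))) \<le> 2"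
    by (rule halfline_integrable_bounded[OF c _ bd]; simp)+
qed

lemma continuous_weighted_L2:
  assumes f: "f \<in> L2" shows "(\<lambda>x. f x / of_real (1 + x)) \<in> L2" "L2_norm (\<lambda>x. f x / of_real (1 + x)) \<le> L2_norm f"
proof -
  have "(\<lambda>x. inverse (complex_of_real (1 + x))) \<in> borel_measurable halfline"
    by (intro measurable_restrict_space1 measurable_completion) simp
  then have m: "(\<lambda>x. f x / of_real (1 + x)) \<in> borel_measurable halfline"
    unfolding divide_inverse using L2_measurable[OF f] by measurable
  have le: "cmod (f x / of_real (1 + x)) \<le> 1 * cmod (f x)" if "0 \<le> x" for x
  proof -
    have "cmod (f x) / (1 + x) \<le> cmod (f x) / 1" using that by (intro divide_left_mono) auto
    then show ?thesis using that by (simp add: norm_divide del: of_real_add)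
  qed
  show "(\<lambda>x. f x / of_real (1 + x)) \<in> L2" by (rule L2_bounded_mult[OF f m le])
  show "L2_norm (\<lambda>x. f x / of_real (1 + x)) \<le> L2_norm f"
    using L2_norm_bounded_mult[OF f _ m le] by simp
qed

context potential
begin

text \<open>The inverse-square decay of the potential bounds the potential energy by the weighted
  norm of f. Keeping the weight in the first bound matters for the sine evolution, which has no
  uniform bound in the unweighted norm.\<close>

lemma energy_bounds:
  assumes r: "regular f f1 h"
  shows "(L2_norm f1)\<^sup>2 \<le> Re (L2_inner h f) + K 0 * (L2_norm (\<lambda>x. f x / of_real (1 + x)))\<^sup>2"
    "Re (L2_inner h f) \<le> (L2_norm f1)\<^sup>2 + K 0 * (L2_norm f)\<^sup>2"
    "- K 0 * (L2_norm f)\<^sup>2 \<le> Re (L2_inner h f)"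
proof -
  note D = regularD[OF r]
  let ?w = "\<lambda>x. f x / of_real (1 + x)"
  have wL: "?w \<in> L2" "L2_norm ?w \<le> L2_norm f" using continuous_weighted_L2[OF D(1)] by auto
  have "(LINT x|halfline. \<bar>V 0 x * (cmod (f x))\<^sup>2\<bar>) \<le> (LINT x|halfline. K 0 * (cmod (?w x))\<^sup>2)"
  proof (rule integral_mono)
    show "integrable halfline (\<lambda>x. \<bar>V 0 x * (cmod (f x))\<^sup>2\<bar>)"
      by (intro integrable_abs potential_term_integrable D)
    show "integrable halfline (\<lambda>x. K 0 * (cmod (?w x))\<^sup>2)" using L2_integrable[OF wL(1)] by simp
    fix x assume "x \<in> space halfline"
    then have x: "0 \<le> x" by simp
    have "\<bar>V 0 x\<bar> * (cmod (f x))\<^sup>2 \<le> K 0 / (1 + x)\<^sup>2 * (cmod (f x))\<^sup>2" using decay[OF x, of 0] by (intro mult_right_mono) auto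
    then show "\<bar>V 0 x * (cmod (f x))\<^sup>2\<bar> \<le> K 0 * (cmod (?w x))\<^sup>2"
      using x by (simp add: abs_mult norm_divide power_divide del: of_real_add)
  qed
  also have "\<dots> = K 0 * (L2_norm ?w)\<^sup>2" by (simp add: L2_norm_sq)
  finally have "(LINT x|halfline. \<bar>V 0 x * (cmod (f x))\<^sup>2\<bar>) \<le> K 0 * (L2_norm ?w)\<^sup>2" .
  then have V: "\<bar>LINT x|halfline. V 0 x * (cmod (f x))\<^sup>2\<bar> \<le> K 0 * (L2_norm ?w)\<^sup>2"
    using integral_abs_bound[of halfline "\<lambda>x. V 0 x * (cmod (f x))\<^sup>2"] by linarith
  have W: "K 0 * (L2_norm ?w)\<^sup>2 \<le> K 0 * (L2_norm f)\<^sup>2"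
    using wL(2) K_nonneg[of 0] by (intro mult_left_mono power_mono L2_norm_nonneg)
  note E = energy(2)[OF r]
  show "(L2_norm f1)\<^sup>2 \<le> Re (L2_inner h f) + K 0 * (L2_norm ?w)\<^sup>2" using E V by linarith
  show "Re (L2_inner h f) \<le> (L2_norm f1)\<^sup>2 + K 0 * (L2_norm f)\<^sup>2" using E V W by linarith
  have "0 \<le> (L2_norm f1)\<^sup>2" by simp
  then show "- K 0 * (L2_norm f)\<^sup>2 \<le> Re (L2_inner h f)" using E V W by (simp add: algebra_simps)
qed

text \<open>This is Gronwall's inequality, run backwards, for |f|^2 + |f'|^2. It serves the bounded
  interval below \<open>x1\<close>, where the potential need not be close to critical. The rate k =
  2 + K 0 absorbs all products of f, f' and h, leaving only |h|^2.\<close>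

lemma compact_backward:
  assumes r: "regular f f1 h" and x: "0 \<le> x" "x \<le> X"
  shows "(cmod (f x))\<^sup>2 \<le> exp ((2 + K 0) * X) * ((cmod (f X))\<^sup>2 + (cmod (f1 X))\<^sup>2 + (L2_norm h)\<^sup>2)"
proof -
  note D = regularD[OF r]
  define k where "k = 2 + K 0"
  have k: "0 \<le> k" using K_nonneg[of 0] by (simp add: k_def)
  define N where "N z = (cmod (f z))\<^sup>2 + (cmod (f1 z))\<^sup>2" for z
  define N' where "N' z = 2 * Re (f1 z * cnj (f z)) + 2 * Re ((of_real (V 0 z) * f z - h z) * cnj (f1 z))" for z
  have "exp (k * x) * N x \<le> exp (k * X) * N X + exp (k * X) * (L2_norm h)\<^sup>2"
  proof (rule backward_bound[where E = "\<lambda>z. exp (k * z) * N z" and E' = "\<lambda>z. exp (k * z) * N' z + (exp (k * z) * k) * N z" and a = x and b = X and h = h])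
    fix z assume z: "z \<in> {x..X}"
    then have z0: "0 \<le> z" "{x..X} \<subseteq> {0..}" using x by auto
    have "(N has_real_derivative N' z) (at z within {x..X})"
      unfolding N_def N'_def using z0
      by (intro DERIV_add cmod_sq_deriv has_vector_derivative_within_subset[OF D(5)] has_vector_derivative_within_subset[OF D(6)]) auto
    then show "((\<lambda>z. exp (k * z) * N z) has_real_derivative exp (k * z) * N' z + (exp (k * z) * k) * N z) (at z within {x..X})"
      by (auto intro!: derivative_eq_intros simp: algebra_simps)
    define a b c where "a = cmod (f z)" and "b = cmod (f1 z)" and "c = cmod (h z)"
    have nn: "0 \<le> a" "0 \<le> b" "0 \<le> c" by (auto simp: a_def b_def c_def)
    have ab: "2 * a * b \<le> a\<^sup>2 + b\<^sup>2" "2 * b * c \<le> b\<^sup>2 + c\<^sup>2" by (rule sum_squares_bound)+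
    have "\<bar>Re (f1 z * cnj (f z))\<bar> \<le> a * b" using abs_Re_mult_cnj_le[of "f1 z" "f z"] by (simp add: a_def b_def mult.commute)
    moreover have "\<bar>Re ((of_real (V 0 z) * f z - h z) * cnj (f1 z))\<bar> \<le> (K 0 * a + c) * b"
    proof -
      have "\<bar>V 0 z\<bar> * a \<le> K 0 * a" using V_bound(2)[OF z0(1), of 0] nn by (intro mult_right_mono)
      then have "cmod (of_real (V 0 z) * f z - h z) \<le> K 0 * a + c"
        using norm_triangle_ineq4[of "of_real (V 0 z) * f z" "h z"] by (simp add: norm_mult a_def c_def)
      then have "cmod (of_real (V 0 z) * f z - h z) * b \<le> (K 0 * a + c) * b" using nn by (intro mult_right_mono)
      then show ?thesis using abs_Re_mult_cnj_le[of "of_real (V 0 z) * f z - h z" "f1 z"] unfolding b_def by linarith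
    qed
    ultimately have "- N' z \<le> 2 * (a * b) + 2 * ((K 0 * a + c) * b)" unfolding N'_def by linarith
    also have "\<dots> = (1 + K 0) * (2 * a * b) + 2 * b * c" by (simp add: algebra_simps)
    also have "\<dots> \<le> (1 + K 0) * (a\<^sup>2 + b\<^sup>2) + (b\<^sup>2 + c\<^sup>2)"
      using ab K_nonneg[of 0] by (intro add_mono mult_left_mono) auto
    also have "\<dots> \<le> k * (a\<^sup>2 + b\<^sup>2) + c\<^sup>2" by (simp add: k_def algebra_simps)
    finally have "- (c\<^sup>2) \<le> N' z + k * N z" by (simp add: N_def a_def b_def)
    then have "exp (k * z) * - (c\<^sup>2) \<le> exp (k * z) * (N' z + k * N z)" by (intro mult_left_mono) auto
    moreover have "exp (k * z) * c\<^sup>2 \<le> exp (k * X) * c\<^sup>2" using z k by (intro mult_right_mono) (auto intro: mult_left_mono)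
    ultimately show "- (exp (k * X) * (cmod (h z))\<^sup>2) \<le> exp (k * z) * N' z + (exp (k * z) * k) * N z"
      by (simp add: c_def algebra_simps)
  qed (use x D in auto)
  moreover have "1 * N x \<le> exp (k * x) * N x" using k x by (intro mult_right_mono) (auto simp: N_def)
  moreover have "(cmod (f x))\<^sup>2 \<le> N x" by (simp add: N_def)
  ultimately have "(cmod (f x))\<^sup>2 \<le> exp (k * X) * N X + exp (k * X) * (L2_norm h)\<^sup>2" by linarith
  also have "\<dots> = exp (k * X) * (N X + (L2_norm h)\<^sup>2)" by (simp only: distrib_left)
  finally show ?thesis by (simp add: k_def N_def)
qed

text \<open>Between \<open>x1\<close> and R the gauge energy is carried back from a point X of
  [R, 2 R], where it is of order n^2/R with n the norm of f; so it is at most of order n^2 R^(-3/2)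
  sqrt x. Below \<open>x1\<close> the Cauchy data at \<open>x1\<close> are continued by
  \<open>compact_backward\<close>.\<close>

lemma low_pointwise:
  "\<exists>C\<ge>0. \<forall>f f1 h R x. regular f f1 h \<longrightarrow> x1 \<le> R \<longrightarrow> L2_norm h \<le> L2_norm f / R\<^sup>2 \<longrightarrow> 0 \<le> x \<longrightarrow> x \<le> R \<longrightarrow>
     (cmod (f x))\<^sup>2 \<le> C * ((L2_norm f)\<^sup>2 / (R * sqrt R)) * sqrt (1 + x)"
proof -
  \<comment> \<open>The 32 comes from the source: 4 X^2 sqrt X with X \<le> 2 R is at most 32 R^2
    sqrt R, and the squared norm of h contributes R^(-4).\<close>
  define C2 where "C2 = (1 + (4 * K 0 + 9)\<^sup>2) + 32"
  have C2: "0 \<le> C2" by (simp add: C2_def)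
  define e where "e = exp ((2 + K 0) * x1)"
  \<comment> \<open>At \<open>x1\<close> the gauge energy g controls |f|^2 by 64 g and |f'|^2 by 34
    g; 98 is the sum.\<close>
  define C where "C = 64 * C2 + e * (98 * (C2 * sqrt x1) + 1)"
  have e: "0 < e" by (simp add: e_def)
  have eC: "0 \<le> e * (98 * (C2 * sqrt x1) + 1)" using C2 e x1 by simp
  have C: "0 \<le> C" using C2 eC by (simp add: C_def)
  have "(cmod (f x))\<^sup>2 \<le> C * ((L2_norm f)\<^sup>2 / (R * sqrt R)) * sqrt (1 + x)"
    if r: "regular f f1 h" and R: "x1 \<le> R" and h: "L2_norm h \<le> L2_norm f / R\<^sup>2" and x: "0 \<le> x" "x \<le> R" for f f1 h R x
  proof -
    define A where "A = (L2_norm f)\<^sup>2 / (R * sqrt R)"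
    have R1: "1 \<le> R" and R0: "0 < R" using R x1 by auto
    have A: "0 \<le> A" using R0 by (simp add: A_def)
    have hsq: "(L2_norm h)\<^sup>2 \<le> (L2_norm f)\<^sup>2 / R ^ 4"
    proof -
      have "(L2_norm h)\<^sup>2 \<le> (L2_norm f / R\<^sup>2)\<^sup>2" by (intro power_mono h L2_norm_nonneg)
      then show ?thesis by (simp add: power_divide flip: power_mult)
    qed
    have sR: "sqrt R * sqrt R = R" "0 < sqrt R" "sqrt R \<le> R"
    proof -
      show "sqrt R * sqrt R = R" using R0 by simp
      show "0 < sqrt R" using R0 by simp
      have "sqrt R * 1 \<le> sqrt R * sqrt R" using R1 by (intro mult_left_mono) auto
      then show "sqrt R \<le> R" using R0 by simp
    qed
    have hA: "(L2_norm h)\<^sup>2 \<le> A"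
    proof -
      have "R * sqrt R \<le> R * R" using sR R0 by (intro mult_left_mono) auto
      also have "\<dots> = R ^ 2" by (simp add: power2_eq_square)
      also have "\<dots> \<le> R ^ 4" using R1 by (intro power_increasing) auto
      finally have "(L2_norm f)\<^sup>2 / R ^ 4 \<le> A" unfolding A_def using R0 by (intro divide_left_mono) auto
      then show ?thesis using hsq by linarith
    qed
    obtain X where X: "X \<in> {R..2*R}" "gauge_energy f f1 X \<le> (1 + (4 * K 0 + 9)\<^sup>2) * (L2_norm f)\<^sup>2 / R"
      using gauge_energy_start[OF r R1 h] by blast
    have G: "gauge_energy f f1 y \<le> C2 * A * sqrt y" if y: "x1 \<le> y" "y \<le> R" for y
    proof -
      have y0: "0 < sqrt y" using y x1 by simp
      have "gauge_energy f f1 y / sqrt y \<le> gauge_energy f f1 X / sqrt X + 4 * X\<^sup>2 * sqrt X * (L2_norm h)\<^sup>2"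
        using gauge_energy_backward[OF r y(1), of X] y X by auto
      also have "\<dots> \<le> (1 + (4 * K 0 + 9)\<^sup>2) * A + 32 * A"
      proof (rule add_mono)
        have "gauge_energy f f1 X / sqrt X \<le> gauge_energy f f1 X / sqrt R"
          using X R0 gauge_energy_nonneg by (intro divide_left_mono) auto
        also have "\<dots> \<le> ((1 + (4 * K 0 + 9)\<^sup>2) * (L2_norm f)\<^sup>2 / R) / sqrt R" using X R0 by (intro divide_right_mono) auto
        also have "\<dots> = (1 + (4 * K 0 + 9)\<^sup>2) * A" by (simp add: A_def)
        finally show "gauge_energy f f1 X / sqrt X \<le> (1 + (4 * K 0 + 9)\<^sup>2) * A" .
        have "sqrt X \<le> 2 * sqrt R"
        proof -
          have "sqrt X \<le> sqrt (4 * R)" using X R0 by (intro real_sqrt_le_mono) auto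
          then show ?thesis by (simp add: real_sqrt_mult)
        qed
        moreover have "X\<^sup>2 \<le> (2 * R)\<^sup>2" using X R0 by (intro power_mono) auto
        ultimately have "4 * X\<^sup>2 * sqrt X * (L2_norm h)\<^sup>2 \<le> 4 * (2 * R)\<^sup>2 * (2 * sqrt R) * ((L2_norm f)\<^sup>2 / R ^ 4)"
          using hsq X R0 by (intro mult_mono) auto
        also have "\<dots> = 32 * (L2_norm f)\<^sup>2 * (sqrt R / R ^ 2)"
          using R0 by (simp add: field_simps power_eq_if)
        also have "sqrt R / R ^ 2 = 1 / (R * sqrt R)"
          using sR R0 by (simp add: field_simps power2_eq_square)
        finally show "4 * X\<^sup>2 * sqrt X * (L2_norm h)\<^sup>2 \<le> 32 * A" by (simp add: A_def)
      qed
      also have "\<dots> = C2 * A" by (simp add: C2_def algebra_simps)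
      finally show ?thesis using y0 by (simp add: pos_divide_le_eq)
    qed
    have fG: "(cmod (f y))\<^sup>2 \<le> 64 * gauge_energy f f1 y" for y by (simp add: gauge_energy_def)
    show ?thesis
    proof (cases "x1 \<le> x")
      case True
      have "(cmod (f x))\<^sup>2 \<le> 64 * (C2 * A * sqrt x)" using G[OF True x(2)] fG[of x] by linarith
      also have "\<dots> = (64 * C2) * A * sqrt x" by simp
      also have "\<dots> \<le> C * A * sqrt (1 + x)" using A C2 eC C x by (intro mult_mono) (auto simp: C_def)
      finally show ?thesis by (simp add: A_def)
    next
      case False
      define g where "g = gauge_energy f f1 x1"
      have g: "g \<le> C2 * A * sqrt x1" unfolding g_def using G R by simp
      have "cmod (f1 x1) \<le> cmod (of_real x1 * f1 x1)" using x1 by (simp add: norm_mult mult_le_cancel_right1)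
      also have "\<dots> \<le> cmod (of_real x1 * f1 x1 - f x1 / 2) + cmod (f x1) / 2"
        using norm_triangle_sub[of "of_real x1 * f1 x1" "f x1 / 2"] by (simp add: norm_divide add.commute)
      finally have "(cmod (f1 x1))\<^sup>2 \<le> (cmod (of_real x1 * f1 x1 - f x1 / 2) + cmod (f x1) / 2)\<^sup>2" by (intro power_mono) auto
      also have "\<dots> \<le> 2 * (cmod (of_real x1 * f1 x1 - f x1 / 2))\<^sup>2 + 2 * (cmod (f x1) / 2)\<^sup>2"
        using sum_squares_bound[of "cmod (of_real x1 * f1 x1 - f x1 / 2)" "cmod (f x1) / 2"] by (simp add: power2_sum)
      also have "\<dots> \<le> 34 * g"
      proof -
        have "2 * y\<^sup>2 + 2 * (a / 2)\<^sup>2 \<le> 34 * (a\<^sup>2 / 64 + y\<^sup>2)" for a y :: real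
        proof -
          have "34 * (a\<^sup>2 / 64 + y\<^sup>2) - (2 * y\<^sup>2 + 2 * (a / 2)\<^sup>2) = a\<^sup>2 / 32 + 32 * y\<^sup>2" by (simp add: power_divide field_simps)
          moreover have "0 \<le> a\<^sup>2 / 32 + 32 * y\<^sup>2" by simp
          ultimately show ?thesis by linarith
        qed
        then show ?thesis unfolding g_def gauge_energy_def .
      qed
      finally have f1g: "(cmod (f1 x1))\<^sup>2 \<le> 34 * g" .
      have "(cmod (f x))\<^sup>2 \<le> e * ((cmod (f x1))\<^sup>2 + (cmod (f1 x1))\<^sup>2 + (L2_norm h)\<^sup>2)"
        unfolding e_def using False x by (intro compact_backward[OF r]) auto
      also have "\<dots> \<le> e * (98 * (C2 * A * sqrt x1) + A)"
        using e fG[of x1] f1g g hA by (intro mult_left_mono) (auto simp: g_def)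
      also have "\<dots> = (e * (98 * (C2 * sqrt x1) + 1)) * A * 1" by (simp add: algebra_simps)
      also have "\<dots> \<le> C * A * sqrt (1 + x)" using A C2 eC C x by (intro mult_mono) (auto simp: C_def)
      finally show ?thesis by (simp add: A_def)
    qed
  qed
  then show ?thesis using C by blast
qed

text \<open>Up to R the pointwise bound leaves (1 + x)^(-3/2), which is integrable; beyond R the
  weight itself is at most R^(-3/2). For R below \<open>x1\<close> the factor R sqrt R is bounded
  and the trivial estimate suffices.\<close>

lemma low_weighted:
  "\<exists>C\<ge>0. \<forall>f f1 h R. regular f f1 h \<longrightarrow> 1 \<le> R \<longrightarrow> L2_norm h \<le> L2_norm f / R\<^sup>2 \<longrightarrow>
     (L2_norm (\<lambda>x. f x / of_real (1 + x)))\<^sup>2 \<le> C * ((L2_norm f)\<^sup>2 / (R * sqrt R))"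
proof -
  obtain C where C: "0 \<le> C" and low: "\<And>f f1 h R x. regular f f1 h \<Longrightarrow> x1 \<le> R \<Longrightarrow> L2_norm h \<le> L2_norm f / R\<^sup>2 \<Longrightarrow> 0 \<le> x \<Longrightarrow> x \<le> R \<Longrightarrow>
     (cmod (f x))\<^sup>2 \<le> C * ((L2_norm f)\<^sup>2 / (R * sqrt R)) * sqrt (1 + x)"
    using low_pointwise by blast
  have xs: "0 \<le> x1 * sqrt x1" using x1 by simp
  have "(L2_norm (\<lambda>x. f x / of_real (1 + x)))\<^sup>2 \<le> (2 * C + 1 + x1 * sqrt x1) * ((L2_norm f)\<^sup>2 / (R * sqrt R))"
    if r: "regular f f1 h" and R: "1 \<le> R" and h: "L2_norm h \<le> L2_norm f / R\<^sup>2" for f f1 h R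
  proof -
    note D = regularD[OF r]
    let ?w = "\<lambda>x. f x / of_real (1 + x)"
    have wL: "?w \<in> L2" "L2_norm ?w \<le> L2_norm f" using continuous_weighted_L2[OF D(1)] by auto
    define A where "A = (L2_norm f)\<^sup>2 / (R * sqrt R)"
    have R0: "0 < R" using R by simp
    have A: "0 \<le> A" using R0 by (simp add: A_def)
    have nA: "(L2_norm f)\<^sup>2 = R * sqrt R * A" using R0 by (simp add: A_def)
    show ?thesis
    proof (cases "x1 \<le> R")
      case True
      let ?p = "\<lambda>x::real. 1 / ((1 + x) * sqrt (1 + x))"
      have "(L2_norm ?w)\<^sup>2 \<le> (LINT x|halfline. C * A * ?p x + 1 / (R * sqrt R) * (cmod (f x))\<^sup>2)"
        unfolding L2_norm_sq
      proof (rule integral_mono)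
        show "integrable halfline (\<lambda>x. (cmod (?w x))\<^sup>2)" by (rule L2_integrable[OF wL(1)])
        show "integrable halfline (\<lambda>x. C * A * ?p x + 1 / (R * sqrt R) * (cmod (f x))\<^sup>2)"
          by (intro Bochner_Integration.integrable_add integrable_mult_right inv_sqrt_cube_integral L2_integrable D)
        fix x assume "x \<in> space halfline"
        then have x: "0 \<le> x" by simp
        have w: "(cmod (?w x))\<^sup>2 = (cmod (f x))\<^sup>2 / (1 + x)\<^sup>2" using x by (simp add: norm_divide power_divide del: of_real_add)
        have pos: "0 \<le> C * A * ?p x" using C A x by simp
        have pos2: "0 \<le> 1 / (R * sqrt R) * (cmod (f x))\<^sup>2" using R0 by simp
        show "(cmod (?w x))\<^sup>2 \<le> C * A * ?p x + 1 / (R * sqrt R) * (cmod (f x))\<^sup>2"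
        proof (cases "x \<le> R")
          case xR: True
          have "(cmod (f x))\<^sup>2 / (1 + x)\<^sup>2 \<le> (C * A * sqrt (1 + x)) / (1 + x)\<^sup>2"
            using low[OF r True h x xR] by (intro divide_right_mono) (auto simp: A_def)
          also have "\<dots> = C * A * (sqrt (1 + x) / (1 + x)\<^sup>2)" by simp
          also have "sqrt (1 + x) / (1 + x)\<^sup>2 = ?p x"
          proof -
            have "sqrt (1 + x) * sqrt (1 + x) = 1 + x" using x by simp
            then show ?thesis using x by (simp add: frac_eq_eq power2_eq_square)
          qed
          finally show ?thesis using w pos2 by linarith
        next
          case xR: False
          have "sqrt R * 1 \<le> sqrt R * sqrt R" using R by (intro mult_left_mono) auto
          then have "sqrt R \<le> R" using R0 by simp
          then have "R * sqrt R \<le> (1 + x) * (1 + x)" using xR R0 by (intro mult_mono) auto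
          then have "(cmod (f x))\<^sup>2 / (1 + x)\<^sup>2 \<le> (cmod (f x))\<^sup>2 / (R * sqrt R)"
            using R0 x unfolding power2_eq_square by (intro divide_left_mono mult_pos_pos) auto
          then show ?thesis using w pos by simp
        qed
      qed
      also have "\<dots> = C * A * (LINT x|halfline. ?p x) + 1 / (R * sqrt R) * (L2_norm f)\<^sup>2"
        unfolding L2_norm_sq using inv_sqrt_cube_integral(1) L2_integrable[OF D(1)]
        by (subst Bochner_Integration.integral_add) (auto simp del: times_divide_eq_left times_divide_eq_right)
      also have "\<dots> \<le> C * A * 2 + A"
      proof (rule add_mono)
        show "C * A * (LINT x|halfline. ?p x) \<le> C * A * 2" using inv_sqrt_cube_integral(2) C A by (intro mult_left_mono) auto
      qed (simp add: A_def)
      also have "\<dots> \<le> (2 * C + 1 + x1 * sqrt x1) * A" using mult_nonneg_nonneg[OF xs A] by (simp add: algebra_simps)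
      finally show ?thesis by (simp add: A_def)
    next
      case False
      have "(L2_norm ?w)\<^sup>2 \<le> (L2_norm f)\<^sup>2" by (intro power_mono wL L2_norm_nonneg)
      also have "\<dots> = R * sqrt R * A" by (rule nA)
      also have "\<dots> \<le> x1 * sqrt x1 * A" using False R0 A by (intro mult_right_mono mult_mono) auto
      also have "\<dots> \<le> (2 * C + 1 + x1 * sqrt x1) * A" using C A by (intro mult_right_mono) auto
      finally show ?thesis by (simp add: A_def)
    qed
  qed
  then show ?thesis using C xs by (intro exI[of _ "2 * C + 1 + x1 * sqrt x1"]) auto
qed

text \<open>\<open>low_weighted\<close> and the energy identity bound the squared norm of f' by a
  multiple of R^(-3/2) times that of f; \<open>sup_bound\<close> interpolates. Fourth powers avoid
  roots.\<close>

lemma low_deriv_sup: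
  "\<exists>C\<ge>0. \<forall>f f1 h R x. regular f f1 h \<longrightarrow> 1 \<le> R \<longrightarrow> L2_norm h \<le> L2_norm f / R\<^sup>2 \<longrightarrow> 0 \<le> x \<longrightarrow>
     (cmod (f x)) ^ 4 \<le> C * ((L2_norm f) ^ 4 / (R * sqrt R))"
proof -
  obtain C where C: "0 \<le> C" and low: "\<And>f f1 h R. regular f f1 h \<Longrightarrow> 1 \<le> R \<Longrightarrow> L2_norm h \<le> L2_norm f / R\<^sup>2 \<Longrightarrow>
     (L2_norm (\<lambda>x. f x / of_real (1 + x)))\<^sup>2 \<le> C * ((L2_norm f)\<^sup>2 / (R * sqrt R))"
    using low_weighted by blast
  have "(cmod (f x)) ^ 4 \<le> (4 * (1 + K 0 * C)) * ((L2_norm f) ^ 4 / (R * sqrt R))"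
    if r: "regular f f1 h" and R: "1 \<le> R" and h: "L2_norm h \<le> L2_norm f / R\<^sup>2" and x: "0 \<le> x" for f f1 h R x
  proof -
    note D = regularD[OF r]
    define n where "n = L2_norm f"
    define A where "A = n\<^sup>2 / (R * sqrt R)"
    have R0: "0 < R" using R by simp
    have n0: "0 \<le> n" by (simp add: n_def L2_norm_nonneg)
    have "sqrt R * 1 \<le> sqrt R * sqrt R" using R by (intro mult_left_mono) auto
    then have "sqrt R \<le> R" using R0 by simp
    then have "R * sqrt R \<le> R\<^sup>2" unfolding power2_eq_square using R0 by (intro mult_left_mono) auto
    then have nR: "n\<^sup>2 / R\<^sup>2 \<le> A" unfolding A_def using R0 by (intro divide_left_mono) auto
    have "Re (L2_inner h f) = inner (cls h) (cls f)" using D by (simp add: cls_inner)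
    also have "\<dots> \<le> L2_norm h * n" using norm_cauchy_schwarz[of "cls h" "cls f"] D by (simp add: cls_norm n_def)
    also have "\<dots> \<le> (n / R\<^sup>2) * n" using h n0 by (intro mult_right_mono) (auto simp: n_def)
    also have "\<dots> \<le> A" using nR by (simp add: power2_eq_square)
    finally have "Re (L2_inner h f) \<le> A" .
    moreover have "K 0 * (L2_norm (\<lambda>x. f x / of_real (1 + x)))\<^sup>2 \<le> K 0 * (C * A)"
      using low[OF r R h] K_nonneg[of 0] by (intro mult_left_mono) (auto simp: A_def n_def)
    ultimately have f1: "(L2_norm f1)\<^sup>2 \<le> (1 + K 0 * C) * A" using energy_bounds(1)[OF r] by (simp add: algebra_simps)
    have "(cmod (f x))\<^sup>2 \<le> 2 * n * L2_norm f1"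
      unfolding n_def by (rule sup_bound[OF D(5) D(8) D(1) energy(1)[OF r] x])
    then have "((cmod (f x))\<^sup>2)\<^sup>2 \<le> (2 * n * L2_norm f1)\<^sup>2" by (intro power_mono) auto
    also have "\<dots> = 4 * n\<^sup>2 * (L2_norm f1)\<^sup>2" by (simp add: power_mult_distrib)
    also have "\<dots> \<le> 4 * n\<^sup>2 * ((1 + K 0 * C) * A)" using f1 by (intro mult_left_mono) auto
    also have "\<dots> = (4 * (1 + K 0 * C)) * (n ^ 4 / (R * sqrt R))" by (simp add: A_def power2_eq_square power4_eq_xxxx)
    finally show ?thesis by (simp add: n_def flip: power_mult)
  qed
  then show ?thesis using C K_nonneg[of 0] by (intro exI[of _ "4 * (1 + K 0 * C)"]) auto
qed

end

section \<open>The operator on towers of derivatives\<close>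

definition cx :: "(nat \<Rightarrow> real \<Rightarrow> real) \<Rightarrow> nat \<Rightarrow> real \<Rightarrow> complex" where
  "cx A n x = complex_of_real (A n x)"

lemma tower_cx: "tower S A \<Longrightarrow> tower S (cx A)"
  unfolding cx_def by (rule tower_of_real)

lemma tower_add: "tower S A \<Longrightarrow> tower S B \<Longrightarrow> tower S (\<lambda>n x. A n x + B n x)"
  unfolding tower_def by (auto intro: has_vector_derivative_add)

lemma tower_zero: "tower S (\<lambda>n x. 0)"
  by (simp add: tower_def)

context potential
begin

text \<open>The pair F, F1 is fixed before the continuous representative H of the image. In a chain,
  H can therefore be the representative that the next step produces.\<close>

lemma op_rep:
  assumes "(f, h) \<in> schroedinger_op (V 0)"
  shows "\<exists>F F1. L2_eq f F \<and> continuous_on {0..} F \<and> (\<forall>H. continuous_on {0..} H \<longrightarrow> L2_eq h H \<longrightarrow> regular F F1 H)"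
proof -
  obtain F F1 F2 where L: "f \<in> L2" "h \<in> L2" and eq: "L2_eq f F" and AC: "AC_loc F1"
    and d: "\<forall>x\<ge>0. (F has_vector_derivative F1 x) (at x within {0..})" and z: "F1 0 = 0"
    and d1: "AE x in halfline. (F1 has_vector_derivative F2 x) (at x within {0..})"
    and h: "L2_eq h (\<lambda>x. - F2 x + complex_of_real (V 0 x) * F x)"
    using assms unfolding schroedinger_op_def by auto
  have cF: "continuous_on {0..} F"
    unfolding continuous_on_eq_continuous_within using d has_vector_derivative_continuous by blast
  have cV: "continuous_on {0..} (\<lambda>x. complex_of_real (V 0 x))" by (intro continuous_intros cont_V)
  have FL: "F \<in> L2" using L(1) eq continuous_halfline_measurable[OF cF] unfolding L2_def L2_eq_def
  proof -
    assume a: "f \<in> {f \<in> borel_measurable halfline. integrable halfline (\<lambda>x. (cmod (f x))\<^sup>2)}"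
      and e: "AE x in halfline. f x = F x" and m: "F \<in> borel_measurable halfline"
    have "AE x in halfline. (cmod (f x))\<^sup>2 = (cmod (F x))\<^sup>2" using e by eventually_elim simp
    then have "integrable halfline (\<lambda>x. (cmod (f x))\<^sup>2) = integrable halfline (\<lambda>x. (cmod (F x))\<^sup>2)"
      using a m by (intro integrable_cong_AE) auto
    then show "F \<in> {f \<in> borel_measurable halfline. integrable halfline (\<lambda>x. (cmod (f x))\<^sup>2)}" using a m by simp
  qed
  have "regular F F1 H" if cH: "continuous_on {0..} H" and hH: "L2_eq h H" for H
  proof -
    have HL: "H \<in> L2"
    proof -
      have m: "H \<in> borel_measurable halfline" by (rule continuous_halfline_measurable[OF cH])
      have "AE x in halfline. (cmod (h x))\<^sup>2 = (cmod (H x))\<^sup>2" using hH unfolding L2_eq_def by eventually_elim simp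
      then have "integrable halfline (\<lambda>x. (cmod (h x))\<^sup>2) = integrable halfline (\<lambda>x. (cmod (H x))\<^sup>2)"
        using L(2) m by (intro integrable_cong_AE) (auto simp: L2_def)
      then show ?thesis using L(2) m by (simp add: L2_def)
    qed
    have "AE x in halfline. (F1 has_vector_derivative (complex_of_real (V 0 x) * F x - H x)) (at x within {0..})"
      using d1 h[unfolded L2_eq_def] hH[unfolded L2_eq_def]
    proof eventually_elim
      case (elim x)
      then have "F2 x = complex_of_real (V 0 x) * F x - H x" by (simp add: algebra_simps)
      then show ?case using elim(1) by simp
    qed
    then have "(F1 has_vector_derivative (complex_of_real (V 0 x) * F x - H x)) (at x within {0..})" if "0 \<le> x" for x
      by (rule AC_loc_derivative[OF AC _ _ that]) (intro continuous_intros cV cF cH)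
    then show ?thesis unfolding regular_def using FL HL cH z d by blast
  qed
  then show ?thesis using eq cF by blast
qed

text \<open>Each image lies in the domain again, so it has a continuous representative, and the
  equation one step earlier becomes classical.\<close>

lemma op_chain:
  assumes "\<And>m. (s m, s (Suc m)) \<in> schroedinger_op (V 0)"
  shows "\<exists>F F1. \<forall>m. L2_eq (s m) (F m) \<and> regular (F m) (F1 m) (F (Suc m))"
proof -
  have "\<forall>m. \<exists>p. L2_eq (s m) (fst p) \<and> continuous_on {0..} (fst p) \<and> (\<forall>H. continuous_on {0..} H \<longrightarrow> L2_eq (s (Suc m)) H \<longrightarrow> regular (fst p) (snd p) H)"
    using op_rep[OF assms] by simp
  from choice[OF this] obtain p where p: "\<And>m. L2_eq (s m) (fst (p m))" "\<And>m. continuous_on {0..} (fst (p m))"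
    "\<And>m H. continuous_on {0..} H \<Longrightarrow> L2_eq (s (Suc m)) H \<Longrightarrow> regular (fst (p m)) (snd (p m)) H" by blast
  show ?thesis
  proof (rule exI[of _ "\<lambda>m. fst (p m)"], rule exI[of _ "\<lambda>m. snd (p m)"], intro allI conjI)
    fix m
    show "L2_eq (s m) (fst (p m))" by (rule p(1))
    show "regular (fst (p m)) (snd (p m)) (fst (p (Suc m)))" by (rule p(3)[OF p(2) p(1)])
  qed
qed

lemma regular_imp_op:
  assumes r: "regular f f1 h" shows "(f, h) \<in> schroedinger_op (V 0)"
proof -
  note D = regularD[OF r]
  define f2 where "f2 x = complex_of_real (V 0 x) * f x - h x" for x
  have cV: "continuous_on {0..} (\<lambda>x. complex_of_real (V 0 x))" by (intro continuous_intros cont_V)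
  have c2: "continuous_on {0..} f2" unfolding f2_def by (intro continuous_intros cV D)
  have VL: "(\<lambda>x. complex_of_real (V 0 x) * f x) \<in> L2"
  proof (rule L2_bounded_mult[OF D(1)])
    show "(\<lambda>x. complex_of_real (V 0 x) * f x) \<in> borel_measurable halfline"
      by (rule continuous_halfline_measurable) (intro continuous_intros cV D)
    show "cmod (complex_of_real (V 0 x) * f x) \<le> K 0 * cmod (f x)" if "0 \<le> x" for x
      using V_bound(2)[OF that, of 0] by (simp add: norm_mult mult_right_mono)
  qed
  have "f2 \<in> L2" unfolding f2_def using VL D(2) by (rule L2_diff)
  moreover have "AC_loc f" by (rule C1_imp_AC_loc[OF D(5) D(8)])
  moreover have "AC_loc f1" using C1_imp_AC_loc[OF D(6)] c2 unfolding f2_def by blast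
  moreover have "L2_eq h (\<lambda>x. - f2 x + complex_of_real (V 0 x) * f x)" by (simp add: f2_def L2_eq_def)
  moreover have "AE x in halfline. (f1 has_vector_derivative f2 x) (at x within {0..})"
    using D(6) by (intro AE_I2) (simp add: f2_def)
  moreover have "L2_eq f f" by (rule L2_eq_refl)
  ultimately show ?thesis unfolding schroedinger_op_def using D by blast
qed

text \<open>The condition at 0 is what evenness leaves on the half-line. It contains the Neumann
  condition and is inherited by A \<Phi>, so all powers of A apply to the data.\<close>

definition dtower :: "(nat \<Rightarrow> real \<Rightarrow> complex) \<Rightarrow> bool" where
  "dtower \<Phi> \<longleftrightarrow> tower {0..} \<Phi> \<and> (\<forall>n. \<Phi> n \<in> L2) \<and> (\<forall>n. odd n \<longrightarrow> \<Phi> n 0 = 0)"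

text \<open>The n-th derivative of -f'' + V f. Acting on the whole tower, the m-th iterate carries
  A^m f together with all its derivatives.\<close>

definition op_tower :: "(nat \<Rightarrow> real \<Rightarrow> complex) \<Rightarrow> nat \<Rightarrow> real \<Rightarrow> complex" where
  "op_tower \<Phi> n x = - \<Phi> (Suc (Suc n)) x + leibniz n (cx V) \<Phi> x"

lemma L2_norm_triangle:
  assumes "f \<in> L2" "g \<in> L2" shows "L2_norm (\<lambda>x. f x + g x) \<le> L2_norm f + L2_norm g"
  using norm_triangle_ineq[of "cls f" "cls g"] assms by (simp add: cls_norm L2_add flip: cls_add)

lemma L2_norm_uminus: "L2_norm (\<lambda>x. - f x) = L2_norm f"
  by (simp add: L2_norm_def)

lemma L2_norm_sum_abs:
  assumes "\<And>i. i \<in> I \<Longrightarrow> f i \<in> L2"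
  shows "(\<lambda>x. complex_of_real (\<Sum>i\<in>I. cmod (f i x))) \<in> L2 \<and> L2_norm (\<lambda>x. complex_of_real (\<Sum>i\<in>I. cmod (f i x))) \<le> (\<Sum>i\<in>I. L2_norm (f i))"
  using assms
proof (induction I rule: infinite_finite_induct)
  case (insert i I)
  have a: "(\<lambda>x. complex_of_real (cmod (f i x))) \<in> L2" using insert.prems[of i] by (auto simp: L2_def)
  have n: "L2_norm (\<lambda>x. complex_of_real (cmod (f i x))) = L2_norm (f i)" by (simp add: L2_norm_def)
  have b: "(\<lambda>x. complex_of_real (\<Sum>i\<in>I. cmod (f i x))) \<in> L2"
    "L2_norm (\<lambda>x. complex_of_real (\<Sum>i\<in>I. cmod (f i x))) \<le> (\<Sum>i\<in>I. L2_norm (f i))"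
    using insert by auto
  show ?case using L2_add[OF a b(1)] L2_norm_triangle[OF a b(1)] b(2) insert.hyps n by simp
qed (auto simp: L2_zero L2_norm_def)

lemma leibniz_L2:
  assumes T: "tower {0..} \<Phi>" and L: "\<And>n. \<Phi> n \<in> L2"
  shows "leibniz n (cx V) \<Phi> \<in> L2" "L2_norm (leibniz n (cx V) \<Phi>) \<le> (2 ^ n * (\<Sum>i\<le>n. K i)) * (\<Sum>i\<le>n. L2_norm (\<Phi> i))"
proof -
  let ?S = "\<lambda>x. complex_of_real (\<Sum>i\<le>n. cmod (\<Phi> i x))"
  have S: "?S \<in> L2" "L2_norm ?S \<le> (\<Sum>i\<le>n. L2_norm (\<Phi> i))" using L2_norm_sum_abs[of "{..n}" \<Phi>] L by auto
  have m: "leibniz n (cx V) \<Phi> \<in> borel_measurable halfline"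
    by (rule continuous_halfline_measurable[OF tower_continuous[OF tower_leibniz[OF tower_cx[OF tower_V] T]]])
  have k0: "0 \<le> 2 ^ n * (\<Sum>i\<le>n. K i)" using K_nonneg by (simp add: sum_nonneg)
  have le: "cmod (leibniz n (cx V) \<Phi> x) \<le> (2 ^ n * (\<Sum>i\<le>n. K i)) * cmod (?S x)" if x: "0 \<le> x" for x
  proof -
    have "cmod (leibniz n (cx V) \<Phi> x) \<le> 2 ^ n * ((\<Sum>i\<le>n. K i) * (\<Sum>i\<le>n. cmod (\<Phi> i x)))"
    proof (rule leibniz_bound)
      fix i assume i: "i \<le> n"
      have "cmod (cx V i x) \<le> K i" using V_bound(2)[OF x, of i] by (simp add: cx_def)
      also have "\<dots> \<le> (\<Sum>i\<le>n. K i)" using i K_nonneg by (intro member_le_sum) auto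
      finally show "cmod (cx V i x) \<le> (\<Sum>i\<le>n. K i)" .
      show "cmod (\<Phi> i x) \<le> (\<Sum>i\<le>n. cmod (\<Phi> i x))" using i by (intro member_le_sum) auto
    qed
    then show ?thesis by (simp add: sum_nonneg mult.assoc del: of_real_sum)
  qed
  show "leibniz n (cx V) \<Phi> \<in> L2" by (rule L2_bounded_mult[OF S(1) m le])
  have "L2_norm (leibniz n (cx V) \<Phi>) \<le> (2 ^ n * (\<Sum>i\<le>n. K i)) * L2_norm ?S" by (rule L2_norm_bounded_mult[OF S(1) k0 m le])
  also have "\<dots> \<le> (2 ^ n * (\<Sum>i\<le>n. K i)) * (\<Sum>i\<le>n. L2_norm (\<Phi> i))" using S(2) k0 by (intro mult_left_mono)
  finally show "L2_norm (leibniz n (cx V) \<Phi>) \<le> (2 ^ n * (\<Sum>i\<le>n. K i)) * (\<Sum>i\<le>n. L2_norm (\<Phi> i))" .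
qed

lemma dtower_op_tower:
  assumes "dtower \<Phi>"
  shows "dtower (op_tower \<Phi>)" "regular (\<Phi> 0) (\<Phi> 1) (op_tower \<Phi> 0)"
    "L2_norm (op_tower \<Phi> n) \<le> (1 + 2 ^ n * (\<Sum>i\<le>n. K i)) * (\<Sum>i\<le>n+2. L2_norm (\<Phi> i))"
proof -
  have T: "tower {0..} \<Phi>" and L: "\<And>n. \<Phi> n \<in> L2" and O: "\<And>n. odd n \<Longrightarrow> \<Phi> n 0 = 0" using assms by (auto simp: dtower_def)
  have T2: "tower {0..} (\<lambda>n x. - \<Phi> (Suc (Suc n)) x)"
    using T unfolding tower_def by (auto intro!: has_vector_derivative_minus)
  have T': "tower {0..} (op_tower \<Phi>)"
    unfolding op_tower_def using tower_add[OF T2 tower_leibniz[OF tower_cx[OF tower_V] T]] by simp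
  have L': "op_tower \<Phi> n \<in> L2" for n
    unfolding op_tower_def using L2_add[OF L2_uminus[OF L] leibniz_L2(1)[OF T L]] by simp
  have O': "op_tower \<Phi> n 0 = 0" if "odd n" for n
  proof -
    have "leibniz n (cx V) \<Phi> 0 = 0"
      by (rule leibniz_parity[of 0 _ _ 0]) (use O odd_V that in \<open>auto simp: cx_def\<close>)
    then show ?thesis using O[of "Suc (Suc n)"] that by (simp add: op_tower_def)
  qed
  show "dtower (op_tower \<Phi>)" using T' L' O' by (simp add: dtower_def)
  have e: "complex_of_real (V 0 x) * \<Phi> 0 x - op_tower \<Phi> 0 x = \<Phi> (Suc (Suc 0)) x" for x
    by (simp add: op_tower_def cx_def)
  show "regular (\<Phi> 0) (\<Phi> 1) (op_tower \<Phi> 0)"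
    unfolding regular_def e using T L L' O[of 1] tower_continuous[OF T'] towerD[OF T] by auto
  define c where "c = 2 ^ n * (\<Sum>i\<le>n. K i)"
  have c0: "0 \<le> c" using K_nonneg by (simp add: c_def sum_nonneg)
  have "L2_norm (op_tower \<Phi> n) \<le> L2_norm (\<Phi> (Suc (Suc n))) + L2_norm (leibniz n (cx V) \<Phi>)"
    using L2_norm_triangle[OF L2_uminus[OF L] leibniz_L2(1)[OF T L]] unfolding op_tower_def L2_norm_uminus .
  also have "\<dots> \<le> (\<Sum>i\<le>n+2. L2_norm (\<Phi> i)) + c * (\<Sum>i\<le>n+2. L2_norm (\<Phi> i))"
  proof (rule add_mono)
    show "L2_norm (\<Phi> (Suc (Suc n))) \<le> (\<Sum>i\<le>n+2. L2_norm (\<Phi> i))" by (rule member_le_sum) (auto simp: L2_norm_nonneg)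
    have "L2_norm (leibniz n (cx V) \<Phi>) \<le> c * (\<Sum>i\<le>n. L2_norm (\<Phi> i))" unfolding c_def by (rule leibniz_L2(2)[OF T L])
    also have "\<dots> \<le> c * (\<Sum>i\<le>n+2. L2_norm (\<Phi> i))"
      using c0 by (intro mult_left_mono sum_mono2) (auto simp: L2_norm_nonneg)
    finally show "L2_norm (leibniz n (cx V) \<Phi>) \<le> c * (\<Sum>i\<le>n+2. L2_norm (\<Phi> i))" .
  qed
  also have "\<dots> = (1 + c) * (\<Sum>i\<le>n+2. L2_norm (\<Phi> i))" by (simp only: distrib_right mult_1)
  finally show "L2_norm (op_tower \<Phi> n) \<le> (1 + 2 ^ n * (\<Sum>i\<le>n. K i)) * (\<Sum>i\<le>n+2. L2_norm (\<Phi> i))" by (simp only: c_def)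
qed

lemma dtower_iterate: "dtower \<Phi> \<Longrightarrow> dtower ((op_tower ^^ m) \<Phi>)"
  by (induction m) (auto intro: dtower_op_tower)

lemma op_tower_iterate_bound:
  "\<exists>C\<ge>0. \<forall>\<Phi>. dtower \<Phi> \<longrightarrow> L2_norm ((op_tower ^^ m) \<Phi> n) \<le> C * (\<Sum>i\<le>n+2*m. L2_norm (\<Phi> i))"
proof (induction m arbitrary: n)
  case 0
  have "L2_norm (\<Phi> n) \<le> 1 * (\<Sum>i\<le>n. L2_norm (\<Phi> i))" for \<Phi> :: "nat \<Rightarrow> real \<Rightarrow> complex"
    using member_le_sum[of n "{..n}" "\<lambda>i. L2_norm (\<Phi> i)"] by (simp add: L2_norm_nonneg)
  then show ?case by (intro exI[of _ 1]) auto
next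
  case (Suc m)
  have "\<forall>i. \<exists>C\<ge>0. \<forall>\<Phi>. dtower \<Phi> \<longrightarrow> L2_norm ((op_tower ^^ m) \<Phi> i) \<le> C * (\<Sum>j\<le>i+2*m. L2_norm (\<Phi> j))" using Suc by blast
  from choice[OF this] obtain C where C: "\<And>i. 0 \<le> C i" "\<And>i \<Phi>. dtower \<Phi> \<Longrightarrow> L2_norm ((op_tower ^^ m) \<Phi> i) \<le> C i * (\<Sum>j\<le>i+2*m. L2_norm (\<Phi> j))" by blast
  define c where "c = 1 + 2 ^ n * (\<Sum>i\<le>n. K i)"
  have c0: "0 \<le> c" using K_nonneg by (simp add: c_def sum_nonneg)
  have "L2_norm ((op_tower ^^ Suc m) \<Phi> n) \<le> (c * (\<Sum>i\<le>n+2. C i)) * (\<Sum>i\<le>n+2*Suc m. L2_norm (\<Phi> i))" if d: "dtower \<Phi>" for \<Phi>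
  proof -
    have "L2_norm ((op_tower ^^ Suc m) \<Phi> n) \<le> c * (\<Sum>i\<le>n+2. L2_norm ((op_tower ^^ m) \<Phi> i))"
      using dtower_op_tower(3)[OF dtower_iterate[OF d]] by (simp add: c_def)
    also have "\<dots> \<le> c * (\<Sum>i\<le>n+2. C i * (\<Sum>i\<le>n+2*Suc m. L2_norm (\<Phi> i)))"
    proof (intro mult_left_mono sum_mono c0)
      fix i assume i: "i \<in> {..n+2}"
      have "L2_norm ((op_tower ^^ m) \<Phi> i) \<le> C i * (\<Sum>j\<le>i+2*m. L2_norm (\<Phi> j))" by (rule C(2)[OF d])
      also have "\<dots> \<le> C i * (\<Sum>i\<le>n+2*Suc m. L2_norm (\<Phi> i))"
        using C(1) i by (intro mult_left_mono sum_mono2) (auto simp: L2_norm_nonneg)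
      finally show "L2_norm ((op_tower ^^ m) \<Phi> i) \<le> C i * (\<Sum>i\<le>n+2*Suc m. L2_norm (\<Phi> i))" .
    qed
    also have "\<dots> = (c * (\<Sum>i\<le>n+2. C i)) * (\<Sum>i\<le>n+2*Suc m. L2_norm (\<Phi> i))"
      by (simp only: sum_distrib_right mult.assoc)
    finally show ?thesis .
  qed
  moreover have "0 \<le> c * (\<Sum>i\<le>n+2. C i)" using c0 C by (simp add: sum_nonneg)
  ultimately show ?case by blast
qed

section \<open>Derivatives in terms of powers of the operator\<close>

text \<open>
  With \<open>D (2 m) = (- A)\<^sup>m z\<close> and \<open>D (2 m + 1) = (D (2 m))'\<close> one has \<open>(D n)' = D (n + 1)\<close> for even \<open>n\<close>,
  \<open>(D n)' = D (n + 1) + V D (n - 1)\<close> for odd \<open>n\<close>. Hence the \<open>n\<close>-th derivative of \<open>z\<close> is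
  \<open>D n\<close> plus a combination of the \<open>D i\<close>, \<open>i + 1 < n\<close>; \<open>coef n i k\<close> is the \<open>k\<close>-th derivative of the
  coefficient of \<open>D i\<close>. Below, \<open>D\<close> is called \<open>jet\<close> and the combination \<open>elliptic\<close>.
\<close>

primrec coef :: "nat \<Rightarrow> nat \<Rightarrow> nat \<Rightarrow> real \<Rightarrow> real" where
  "coef 0 i k x = 0"
| "coef (Suc n) i k x = coef n i (Suc k) x + (if i = 0 then 0 else coef n (i - 1) k x)
     + (if even i then leibniz k V (coef n (Suc i)) x else 0) + (if odd n \<and> Suc i = n then V k x else 0)"

lemma leibniz_zero: "(\<And>k x. B k x = 0) \<Longrightarrow> leibniz n A B x = 0"
  by (induction n arbitrary: A B) auto

lemma coef_support: "n \<le> Suc i \<Longrightarrow> coef n i k x = 0"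
proof (induction n arbitrary: i k x)
  case (Suc n)
  have "coef n i (Suc k) x = 0" "leibniz k V (coef n (Suc i)) x = 0" using Suc by (auto intro!: leibniz_zero)
  moreover have "(if i = 0 then 0 else coef n (i - 1) k x) = 0" using Suc by auto
  ultimately show ?case using Suc.prems by auto
qed simp

lemma tower_coef: "tower {0..} (coef n i)"
proof (induction n arbitrary: i)
  case 0
  have "coef 0 i = (\<lambda>k x. 0)" by (simp add: fun_eq_iff)
  then show ?case by (simp add: tower_zero)
next
  case (Suc n)
  have 1: "tower {0..} (\<lambda>k x. if i = 0 then 0 else coef n (i - 1) k x)" using Suc by (cases "i = 0") (auto simp: tower_zero)
  have 2: "tower {0..} (\<lambda>k x. if even i then leibniz k V (coef n (Suc i)) x else 0)"
    using tower_leibniz[OF tower_V Suc] by (cases "even i") (auto simp: tower_zero)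
  have 3: "tower {0..} (\<lambda>k x. if odd n \<and> Suc i = n then V k x else 0)"
    using tower_V by (cases "odd n \<and> Suc i = n") (auto simp: tower_zero)
  have "coef (Suc n) i = (\<lambda>k x. coef n i (Suc k) x + (if i = 0 then 0 else coef n (i - 1) k x)
     + (if even i then leibniz k V (coef n (Suc i)) x else 0) + (if odd n \<and> Suc i = n then V k x else 0))"
    by (simp add: fun_eq_iff)
  then show ?case using tower_add[OF tower_add[OF tower_add[OF tower_shift[OF Suc] 1] 2] 3] by simp
qed

text \<open>Every coefficient is built from the potential and its derivatives without a constant
  term, so one factor 1/(1 + x) is always present. In products it is kept for one factor, and the
  other is merely bounded.\<close>

lemma coef_bound: "\<exists>c\<ge>0. \<forall>x\<ge>0. \<bar>coef n i k x\<bar> \<le> c / (1 + x)"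
proof (induction n arbitrary: i k)
  case 0 then show ?case by (intro exI[of _ 0]) simp
next
  case (Suc n)
  obtain c1 where c1: "0 \<le> c1" "\<And>x. 0 \<le> x \<Longrightarrow> \<bar>coef n i (Suc k) x\<bar> \<le> c1 / (1 + x)" using Suc by blast
  obtain c2 where c2: "0 \<le> c2" "\<And>x. 0 \<le> x \<Longrightarrow> \<bar>coef n (i - 1) k x\<bar> \<le> c2 / (1 + x)" using Suc by blast
  have "\<forall>j. \<exists>c\<ge>0. \<forall>x\<ge>0. \<bar>coef n (Suc i) j x\<bar> \<le> c / (1 + x)" using Suc by blast
  from choice[OF this] obtain d where d: "\<And>j. 0 \<le> d j" "\<And>j x. 0 \<le> x \<Longrightarrow> \<bar>coef n (Suc i) j x\<bar> \<le> d j / (1 + x)" by blast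
  define c3 where "c3 = 2 ^ k * ((\<Sum>j\<le>k. K j) * (\<Sum>j\<le>k. d j))"
  have c3: "0 \<le> c3" using K_nonneg d by (simp add: c3_def sum_nonneg)
  have l: "\<bar>leibniz k V (coef n (Suc i)) x\<bar> \<le> c3 / (1 + x)" if x: "0 \<le> x" for x
  proof -
    have "norm (leibniz k V (coef n (Suc i)) x) \<le> 2 ^ k * ((\<Sum>j\<le>k. K j) * ((\<Sum>j\<le>k. d j) / (1 + x)))"
    proof (rule leibniz_bound)
      fix j assume j: "j \<le> k"
      have "norm (V j x) \<le> K j" using V_bound(2)[OF x] by simp
      also have "\<dots> \<le> (\<Sum>j\<le>k. K j)" using j K_nonneg by (intro member_le_sum) auto
      finally show "norm (V j x) \<le> (\<Sum>j\<le>k. K j)" .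
      have "norm (coef n (Suc i) j x) \<le> d j / (1 + x)" using d(2)[OF x] by simp
      also have "\<dots> \<le> (\<Sum>j\<le>k. d j) / (1 + x)" using j d x by (intro divide_right_mono member_le_sum) auto
      finally show "norm (coef n (Suc i) j x) \<le> (\<Sum>j\<le>k. d j) / (1 + x)" .
    qed
    then show ?thesis by (simp add: c3_def)
  qed
  have "\<bar>coef (Suc n) i k x\<bar> \<le> (c1 + c2 + c3 + K k) / (1 + x)" if x: "0 \<le> x" for x
  proof -
    have p: "0 \<le> c2 / (1 + x)" "0 \<le> c3 / (1 + x)" "0 \<le> K k / (1 + x)" using c2 c3 K_nonneg x by auto
    have "\<bar>coef (Suc n) i k x\<bar> \<le> \<bar>coef n i (Suc k) x\<bar> + \<bar>if i = 0 then 0 else coef n (i - 1) k x\<bar>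
       + \<bar>if even i then leibniz k V (coef n (Suc i)) x else 0\<bar> + \<bar>if odd n \<and> Suc i = n then V k x else 0\<bar>"
      unfolding coef.simps by linarith
    also have "\<dots> \<le> c1 / (1 + x) + c2 / (1 + x) + c3 / (1 + x) + K k / (1 + x)"
      using c1(2)[OF x] c2(2)[OF x] l[OF x] V_bound(1)[OF x, of k] p by (intro add_mono) auto
    finally show ?thesis by (simp add: add_divide_distrib)
  qed
  moreover have "0 \<le> c1 + c2 + c3 + K k" using c1 c2 c3 K_nonneg[of k] by simp
  ultimately show ?case by blast
qed

end

lift_definition weight :: "l2 \<Rightarrow> l2" is "\<lambda>f x. f x / complex_of_real (1 + x)"
  by (auto simp: l2rel_def continuous_weighted_L2(1) L2_eq_def simp del: of_real_add elim: eventually_mono)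

lemma cls_weight: "f \<in> L2 \<Longrightarrow> cls (\<lambda>x. f x / complex_of_real (1 + x)) = weight (cls f)"
  by (simp add: weight.abs_eq l2rel_def L2_eq_refl)

lemma norm_weight: "f \<in> L2 \<Longrightarrow> norm (weight (cls f)) = L2_norm (\<lambda>x. f x / complex_of_real (1 + x))"
  using cls_norm[OF continuous_weighted_L2(1)] cls_weight by metis

lemma norm_weight_le: "norm (weight x) \<le> norm x"
proof (cases x rule: cls_cases)
  case (1 f)
  then show ?thesis using continuous_weighted_L2(2)[OF 1(1)] norm_weight[OF 1(1)] cls_norm[OF 1(1)] by simp
qed

lemma bounded_linear_weight: "bounded_linear weight"
proof (rule bounded_linear_intro[of _ 1])
  fix x y :: l2 and r :: real
  obtain f where f: "f \<in> L2" "cls f = x" by (rule cls_cases)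
  obtain g where g: "g \<in> L2" "cls g = y" by (rule cls_cases)
  note w = continuous_weighted_L2(1)
  have "weight (cls (\<lambda>x. f x + g x)) = cls (\<lambda>x. f x / complex_of_real (1 + x) + g x / complex_of_real (1 + x))"
    using cls_weight[OF L2_add[OF f(1) g(1)]] by (simp add: add_divide_distrib)
  then show "weight (x + y) = weight x + weight y"
    using cls_add[OF f(1) g(1)] cls_add[OF w[OF f(1)] w[OF g(1)]] cls_weight[OF f(1)] cls_weight[OF g(1)] f g by simp
  have "weight (cls (\<lambda>x. complex_of_real r * f x)) = cls (\<lambda>x. complex_of_real r * (f x / complex_of_real (1 + x)))"
    using cls_weight[OF L2_cmult[OF f(1)]] by simp
  then show "weight (r *\<^sub>R x) = r *\<^sub>R weight x"
    using cls_scaleR[OF f(1)] cls_scaleR[OF w[OF f(1)]] cls_weight[OF f(1)] f by simp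
  show "norm (weight x) \<le> norm x * 1" using norm_weight_le[of x] by simp
qed

context potential
begin

definition jet :: "(nat \<Rightarrow> real \<Rightarrow> complex) \<Rightarrow> (nat \<Rightarrow> real \<Rightarrow> complex) \<Rightarrow> nat \<Rightarrow> real \<Rightarrow> complex" where
  "jet F F1 n x = (- 1) ^ (n div 2) * (if even n then F (n div 2) x else F1 (n div 2) x)"

definition elliptic :: "(nat \<Rightarrow> real \<Rightarrow> complex) \<Rightarrow> (nat \<Rightarrow> real \<Rightarrow> complex) \<Rightarrow> nat \<Rightarrow> real \<Rightarrow> complex" where
  "elliptic F F1 n x = jet F F1 n x + (\<Sum>i<n. cx (coef n i) 0 x * jet F F1 i x)"

lemma jet_deriv:
  assumes r: "\<And>m. regular (F m) (F1 m) (F (Suc m))" and x: "0 \<le> x"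
  shows "(jet F F1 n has_vector_derivative
    (jet F F1 (Suc n) x + (if odd n then cx V 0 x * jet F F1 (n - 1) x else 0))) (at x within {0..})"
proof (cases "even n")
  case True
  then obtain m where n: "n = 2 * m" by (rule evenE)
  have e: "jet F F1 n = (\<lambda>x. (- 1) ^ m * F m x)" by (simp add: fun_eq_iff jet_def n)
  have "((\<lambda>x. (- 1) ^ m * F m x) has_vector_derivative (- 1) ^ m * F1 m x) (at x within {0..})"
    by (intro has_vector_derivative_mult_right regularD(5)[OF r x])
  moreover have "(- 1) ^ m * F1 m x = jet F F1 (Suc n) x + (if odd n then cx V 0 x * jet F F1 (n - 1) x else 0)"
    using n by (simp add: jet_def)
  ultimately show ?thesis unfolding e by (simp only:)
next
  case False
  then obtain m where n: "n = 2 * m + 1" by (rule oddE)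
  have e: "jet F F1 n = (\<lambda>x. (- 1) ^ m * F1 m x)" by (simp add: fun_eq_iff jet_def n)
  have "((\<lambda>x. (- 1) ^ m * F1 m x) has_vector_derivative (- 1) ^ m * (complex_of_real (V 0 x) * F m x - F (Suc m) x)) (at x within {0..})"
    by (intro has_vector_derivative_mult_right regularD(6)[OF r x])
  moreover have "(- 1) ^ m * (complex_of_real (V 0 x) * F m x - F (Suc m) x) = jet F F1 (Suc n) x + (if odd n then cx V 0 x * jet F F1 (n - 1) x else 0)"
    using n by (simp add: jet_def cx_def algebra_simps)
  ultimately show ?thesis by (simp add: e)
qed

lemma tower_elliptic:
  assumes r: "\<And>m. regular (F m) (F1 m) (F (Suc m))"
  shows "tower {0..} (elliptic F F1)"
  unfolding tower_def
proof (intro allI ballI)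
  fix n and x :: real assume "x \<in> {0..}"
  then have x: "0 \<le> x" by simp
  let ?D = "jet F F1" and ?c = "\<lambda>i. cx (coef n i)"
  \<comment> \<open>The extra term in the derivative of the i-th jet; it is present for odd i
    only.\<close>
  define W where "W i = (if odd i then cx V 0 x * ?D (i - 1) x else 0)" for i
  have "((\<lambda>x. ?D n x + (\<Sum>i<n. ?c i 0 x * ?D i x)) has_vector_derivative
      (?D (Suc n) x + W n) + (\<Sum>i<n. ?c i 0 x * (?D (Suc i) x + W i) + ?c i 1 x * ?D i x)) (at x within {0..})"
    unfolding W_def
    using towerD[OF tower_cx[OF tower_coef], of x] x
    by (intro has_vector_derivative_add has_vector_derivative_sum has_vector_derivative_mult jet_deriv r) auto
  moreover have "(\<lambda>x. ?D n x + (\<Sum>i<n. ?c i 0 x * ?D i x)) = elliptic F F1 n" by (simp add: fun_eq_iff elliptic_def)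
  moreover have "(?D (Suc n) x + W n) + (\<Sum>i<n. ?c i 0 x * (?D (Suc i) x + W i) + ?c i 1 x * ?D i x) = elliptic F F1 (Suc n) x"
  proof -
    have sup: "?c i k x = 0" if "n \<le> Suc i" for i k using coef_support[OF that] by (simp add: cx_def)
    \<comment> \<open>The four sums mirror the recursion of \<open>coef\<close>: derivatives falling
      on coefficients, the shift of the jet index, the terms \<open>W\<close> of odd jets, and the
      new term created by the leading jet. The sums \<open>a1\<close> to \<open>a4\<close> are their
      index-shifted forms; the boundary terms vanish by \<open>coef_support\<close>.\<close>
    have main: "(\<Sum>i<Suc n. cx (coef (Suc n) i) 0 x * ?D i x) = (\<Sum>i<Suc n. ?c i 1 x * ?D i x)
       + (\<Sum>i<Suc n. (if i = 0 then 0 else ?c (i - 1) 0 x) * ?D i x)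
       + (\<Sum>i<Suc n. ?c (Suc i) 0 x * W (Suc i))
       + (\<Sum>i<Suc n. (if odd n \<and> Suc i = n then cx V 0 x * ?D i x else 0))"
      unfolding sum.distrib[symmetric]
      by (intro sum.cong) (auto simp: cx_def W_def algebra_simps)
    have a1: "(\<Sum>i<Suc n. ?c i 1 x * ?D i x) = (\<Sum>i<n. ?c i 1 x * ?D i x)" using sup[of n] by simp
    have a2: "(\<Sum>i<Suc n. (if i = 0 then 0 else ?c (i - 1) 0 x) * ?D i x) = (\<Sum>i<n. ?c i 0 x * ?D (Suc i) x)"
      by (subst sum.lessThan_Suc_shift) simp
    have a3: "(\<Sum>i<Suc n. ?c (Suc i) 0 x * W (Suc i)) = (\<Sum>i<n. ?c i 0 x * W i)"
    proof -
      have "(\<Sum>i<Suc (Suc n). ?c i 0 x * W i) = ?c 0 0 x * W 0 + (\<Sum>i<Suc n. ?c (Suc i) 0 x * W (Suc i))"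
        by (rule sum.lessThan_Suc_shift)
      moreover have "W 0 = 0" by (simp add: W_def)
      ultimately show ?thesis using sup[of n] sup[of "Suc n"] by simp
    qed
    have a4: "(\<Sum>i<Suc n. (if odd n \<and> Suc i = n then cx V 0 x * ?D i x else 0)) = W n"
    proof (cases "odd n")
      case True
      then obtain m where n: "n = Suc m" using odd_Suc_minus_one by metis
      have "(\<Sum>i<Suc n. (if odd n \<and> Suc i = n then cx V 0 x * ?D i x else 0)) = (\<Sum>i<Suc n. if i = m then cx V 0 x * ?D m x else 0)"
        using True n by (intro sum.cong) auto
      also have "\<dots> = W n" using True n by (simp add: W_def)
      finally show ?thesis .
    next
      case False then show ?thesis by (simp add: W_def)
    qed
    show ?thesis
      unfolding elliptic_def main a1 a2 a3 a4 by (simp add: sum.distrib distrib_left add_ac)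
  qed
  ultimately show "(elliptic F F1 n has_vector_derivative elliptic F F1 (Suc n) x) (at x within {0..})" by simp
qed

lemma jet_L2:
  assumes r: "\<And>m. regular (F m) (F1 m) (F (Suc m))"
  shows "jet F F1 n \<in> L2"
proof -
  have "(if even n then F (n div 2) else F1 (n div 2)) \<in> L2" using regularD(1)[OF r] energy(1)[OF r] by auto
  from L2_cmult[OF this, of "(- 1) ^ (n div 2)"] show ?thesis unfolding jet_def by (cases "even n") simp_all
qed

lemma jet_norm: "L2_norm (jet F F1 n) = (if even n then L2_norm (F (n div 2)) else L2_norm (F1 (n div 2)))"
  by (simp add: L2_norm_def jet_def norm_mult norm_power)

text \<open>Only the leading jet enters unweighted. All lower jets carry the weight 1/(1 + x) of the
  coefficients, which is the form in which the sine evolution itself can be bounded uniformly in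
  time.\<close>

lemma elliptic_bound:
  "\<exists>c\<ge>0. \<forall>F F1. (\<forall>m. regular (F m) (F1 m) (F (Suc m))) \<longrightarrow>
     elliptic F F1 n \<in> L2 \<and> L2_norm (elliptic F F1 n) \<le> L2_norm (jet F F1 n) + c * (\<Sum>i<n. L2_norm (\<lambda>x. jet F F1 i x / complex_of_real (1 + x)))"
proof -
  have "\<forall>i. \<exists>c\<ge>0. \<forall>x\<ge>0. \<bar>coef n i 0 x\<bar> \<le> c / (1 + x)" using coef_bound by blast
  from choice[OF this] obtain d where d: "\<And>i. 0 \<le> d i" "\<And>i x. 0 \<le> x \<Longrightarrow> \<bar>coef n i 0 x\<bar> \<le> d i / (1 + x)" by blast
  define c where "c = (\<Sum>i<n. d i)"
  have c0: "0 \<le> c" using d by (simp add: c_def sum_nonneg)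
  have "elliptic F F1 n \<in> L2 \<and> L2_norm (elliptic F F1 n) \<le> L2_norm (jet F F1 n) + c * (\<Sum>i<n. L2_norm (\<lambda>x. jet F F1 i x / complex_of_real (1 + x)))"
    if r: "\<forall>m. regular (F m) (F1 m) (F (Suc m))" for F F1
  proof -
    have jL: "jet F F1 i \<in> L2" for i using r by (intro jet_L2) auto
    define w where "w i x = jet F F1 i x / complex_of_real (1 + x)" for i x
    have wL: "w i \<in> L2" for i unfolding w_def by (rule continuous_weighted_L2(1)[OF jL])
    let ?S = "\<lambda>x. complex_of_real (\<Sum>i<n. cmod (w i x))"
    have S: "?S \<in> L2" "L2_norm ?S \<le> (\<Sum>i<n. L2_norm (w i))" using L2_norm_sum_abs[of "{..<n}" w] wL by auto
    define e where "e x = elliptic F F1 n x - jet F F1 n x" for x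
    have em: "e \<in> borel_measurable halfline"
    proof -
      have "elliptic F F1 n \<in> borel_measurable halfline"
        by (rule continuous_halfline_measurable[OF tower_continuous[OF tower_elliptic]]) (use r in auto)
      then show ?thesis unfolding e_def using L2_measurable[OF jL] by measurable
    qed
    have le: "cmod (e x) \<le> c * cmod (?S x)" if x: "0 \<le> x" for x
    proof -
      have "cmod (e x) \<le> (\<Sum>i<n. cmod (cx (coef n i) 0 x * jet F F1 i x))"
        unfolding e_def elliptic_def by (simp add: norm_sum)
      also have "\<dots> \<le> (\<Sum>i<n. c * cmod (w i x))"
      proof (rule sum_mono)
        fix i assume i: "i \<in> {..<n}"
        have "d i \<le> c" unfolding c_def using i d by (intro member_le_sum) auto
        then have "d i / (1 + x) \<le> c / (1 + x)" using x by (intro divide_right_mono) auto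
        then have "\<bar>coef n i 0 x\<bar> \<le> c / (1 + x)" using d(2)[OF x, of i] by linarith
        then have "\<bar>coef n i 0 x\<bar> * cmod (jet F F1 i x) \<le> c / (1 + x) * cmod (jet F F1 i x)" by (intro mult_right_mono) auto
        then show "cmod (cx (coef n i) 0 x * jet F F1 i x) \<le> c * cmod (w i x)"
          using x by (simp add: norm_mult cx_def w_def norm_divide del: of_real_add)
      qed
      also have "\<dots> = c * cmod (?S x)" by (simp add: sum_distrib_left[symmetric] sum_nonneg del: of_real_sum)
      finally show ?thesis .
    qed
    have eL: "e \<in> L2" by (rule L2_bounded_mult[OF S(1) em le])
    have "L2_norm e \<le> c * L2_norm ?S" by (rule L2_norm_bounded_mult[OF S(1) c0 em le])
    also have "\<dots> \<le> c * (\<Sum>i<n. L2_norm (w i))" using S(2) c0 by (intro mult_left_mono)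
    finally have en: "L2_norm e \<le> c * (\<Sum>i<n. L2_norm (w i))" .
    have eq: "elliptic F F1 n = (\<lambda>x. jet F F1 n x + e x)" by (simp add: fun_eq_iff e_def)
    have "elliptic F F1 n \<in> L2" unfolding eq by (rule L2_add[OF jL eL])
    moreover have "L2_norm (elliptic F F1 n) \<le> L2_norm (jet F F1 n) + L2_norm e"
      unfolding eq by (rule L2_norm_triangle[OF jL eL])
    ultimately show ?thesis using en unfolding w_def by linarith
  qed
  then show ?thesis using c0 by blast
qed

end

section \<open>Spectral projections at low energy\<close>

locale schroedinger = potential V K x1 + spectral_family E
  for V :: "nat \<Rightarrow> real \<Rightarrow> real" and K x1 and E +
  assumes op: "schroedinger_op (V 0) = spectral_integral E (\<lambda>l. l)"
begin

lemma op_LC: "f \<in> L2 \<Longrightarrow> h \<in> L2 \<Longrightarrow> (f, h) \<in> schroedinger_op (V 0) \<longleftrightarrow> LC (\<lambda>l. l) (cls f) (cls h)"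
  unfolding op by (rule spectral_integral_LC) auto

lemma LC_chain_regular:
  assumes "\<And>m. LC (\<lambda>l. l) (y m) (y (Suc m))"
  shows "\<exists>F F1. \<forall>m. cls (F m) = y m \<and> regular (F m) (F1 m) (F (Suc m))"
proof -
  have s: "(rep_l2 (y m), rep_l2 (y (Suc m))) \<in> schroedinger_op (V 0)" for m
    using assms[of m] by (simp add: op_LC rep_l2 cls_rep)
  from op_chain[of "\<lambda>m. rep_l2 (y m)", OF s]
  obtain F F1 where F: "\<And>m. L2_eq (rep_l2 (y m)) (F m)" "\<And>m. regular (F m) (F1 m) (F (Suc m))" by blast
  have "cls (F m) = y m" for m
    using F(1)[of m] cls_eq_iff[OF rep_l2 regularD(1)[OF F(2)], of "y m" m] cls_rep[of "y m"] by simp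
  then show ?thesis using F(2) by blast
qed

text \<open>On a bounded spectral set every power of A is defined, so the projected vector starts an
  infinite chain and has a classical representative. The norm inequality is the hypothesis of the
  low-energy estimates when k = 1/R^2.\<close>

lemma bounded_cutoff_chain:
  assumes B: "B \<in> sets borel" and bd: "\<And>l. l \<in> B \<Longrightarrow> \<bar>l\<bar> \<le> k"
  shows "\<exists>F F1 H. cls F = P B y \<and> regular F F1 H \<and> L2_norm H \<le> k * L2_norm F"
proof -
  have ex: "\<exists>h. LC (\<lambda>l. l) z h \<and> P B h = h" if "P B z = z" for z
    using bounded_cutoff[OF B bd, of z] that by auto
  have "\<exists>s. \<forall>m. (P B (s m) = s m \<and> (m = 0 \<longrightarrow> s m = P B y)) \<and> LC (\<lambda>l. l) (s m) (s (Suc m))"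
  proof (rule dependent_nat_choice)
    show "\<exists>x. P B x = x \<and> (0 = (0::nat) \<longrightarrow> x = P B y)" using P_idem[OF B] by blast
    fix x and n :: nat assume "P B x = x \<and> (n = 0 \<longrightarrow> x = P B y)"
    then show "\<exists>y'. (P B y' = y' \<and> (Suc n = 0 \<longrightarrow> y' = P B y)) \<and> LC (\<lambda>l. l) x y'" using ex[of x] by auto
  qed
  then obtain s where s: "\<And>m. P B (s m) = s m" "s 0 = P B y" "\<And>m. LC (\<lambda>l. l) (s m) (s (Suc m))" by blast
  obtain F F1 where F: "\<And>m. cls (F m) = s m" "\<And>m. regular (F m) (F1 m) (F (Suc m))"
    using LC_chain_regular[of s, OF s(3)] by blast
  have "norm (P B (s 1)) \<le> k * norm (P B (s 0))" using LC_bound[OF s(3)[of 0] B bd] by simp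
  then have "L2_norm (F 1) \<le> k * L2_norm (F 0)"
    using F(1) s(1) cls_norm[OF regularD(1)[OF F(2)], of 0] cls_norm[OF regularD(1)[OF F(2)], of 1] by simp
  then show ?thesis using F(2)[of 0] F(1)[of 0] s(2) by (intro exI[of _ "F 0"] exI[of _ "F1 0"] exI[of _ "F 1"]) auto
qed

text \<open>A vector of zero energy satisfies the low-energy hypothesis for every R, so its supremum
  norm is bounded by a quantity that tends to 0.\<close>

lemma P_zero:
  assumes C: "\<And>f f1 h R x. regular f f1 h \<Longrightarrow> 1 \<le> R \<Longrightarrow> L2_norm h \<le> L2_norm f / R\<^sup>2 \<Longrightarrow> 0 \<le> x \<Longrightarrow>
     (cmod (f x)) ^ 4 \<le> C * ((L2_norm f) ^ 4 / (R * sqrt R))"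
  shows "P {0} y = 0"
proof -
  obtain F F1 H where F: "cls F = P {0} y" "regular F F1 H" "L2_norm H \<le> 0 * L2_norm F"
    using bounded_cutoff_chain[of "{0}" 0 y] by auto
  have "cmod (F x) ^ 4 \<le> 0" if x: "0 \<le> x" for x
  proof (rule tendsto_lowerbound[of "\<lambda>n. (C * (L2_norm F) ^ 4) * (1 / real n)" _ sequentially])
    have "(\<lambda>n. (C * (L2_norm F) ^ 4) * (1 / real n)) \<longlonglongrightarrow> (C * (L2_norm F) ^ 4) * 0"
      by (intro tendsto_intros lim_1_over_n)
    then show "(\<lambda>n. (C * (L2_norm F) ^ 4) * (1 / real n)) \<longlonglongrightarrow> 0" by simp
    have "cmod (F x) ^ 4 \<le> (C * (L2_norm F) ^ 4) * (1 / real n)" if n: "1 \<le> n" for n :: nat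
    proof -
      have Hn: "L2_norm H = 0" using F(3) L2_norm_nonneg[of H] by simp
      have a: "cmod (F x) ^ 4 \<le> C * ((L2_norm F) ^ 4 / (real n * sqrt (real n)))"
        using n Hn by (intro C[OF F(2) _ _ x]) (auto simp: L2_norm_nonneg)
      have p: "0 \<le> C * (L2_norm F) ^ 4"
      proof -
        have "0 \<le> cmod (F x) ^ 4" by simp
        also have "\<dots> \<le> C * ((L2_norm F) ^ 4 / (1 * sqrt 1))"
          using Hn by (intro C[OF F(2) _ _ x]) (auto simp: L2_norm_nonneg)
        finally show ?thesis by simp
      qed
      have "real n * 1 \<le> real n * sqrt (real n)" using n by (intro mult_left_mono) auto
      then have "(C * (L2_norm F) ^ 4) / (real n * sqrt (real n)) \<le> (C * (L2_norm F) ^ 4) / real n"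
        using p n by (intro divide_left_mono) auto
      then show ?thesis using a by simp
    qed
    then show "\<forall>\<^sub>F n in sequentially. cmod (F x) ^ 4 \<le> (C * (L2_norm F) ^ 4) * (1 / real n)"
      by (auto simp: eventually_sequentially)
  qed simp
  then have z: "F x = 0" if "0 \<le> x" for x using that zero_le_power[of "cmod (F x)" 4] by (metis antisym norm_ge_zero norm_eq_zero power_eq_0_iff)
  have "(LINT x|halfline. (cmod (F x))\<^sup>2) = (LINT x|halfline. 0)"
    by (intro Bochner_Integration.integral_cong) (auto simp: z)
  then have "L2_norm F = 0" by (simp add: L2_norm_def)
  then show ?thesis using F(1) cls_norm[OF regularD(1)[OF F(2)]] by simp
qed

text \<open>Duality: with G representing the projection of g and n its norm, n^2 is the inner
  product of G with g, at most the supremum of |G| times the L1 norm l of g. Since that supremum is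
  at most a multiple of n R^(-3/8), n is at most a multiple of l R^(-3/8). The multiplier costs 256
  R, and the weighted estimate for the projection of q gains R^(-3/4). In fourth powers R^(-1/2)
  remains.\<close>

lemma block_bound:
  assumes C1: "\<And>f f1 h R. regular f f1 h \<Longrightarrow> 1 \<le> R \<Longrightarrow> L2_norm h \<le> L2_norm f / R\<^sup>2 \<Longrightarrow>
     (L2_norm (\<lambda>x. f x / of_real (1 + x)))\<^sup>2 \<le> C1 * ((L2_norm f)\<^sup>2 / (R * sqrt R))" and C10: "0 \<le> C1"
    and C2: "\<And>f f1 h R x. regular f f1 h \<Longrightarrow> 1 \<le> R \<Longrightarrow> L2_norm h \<le> L2_norm f / R\<^sup>2 \<Longrightarrow> 0 \<le> x \<Longrightarrow>
     (cmod (f x)) ^ 4 \<le> C2 * ((L2_norm f) ^ 4 / (R * sqrt R))" and C20: "0 \<le> C2"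
    and R: "1 \<le> R" and B: "B \<in> sets borel" and BR: "\<And>l. l \<in> B \<Longrightarrow> \<bar>l\<bar> \<le> 1 / R\<^sup>2"
    and phi: "\<And>l. l \<in> B \<Longrightarrow> \<bar>\<phi> l\<bar> \<le> 256 * R" and lc: "LC \<phi> (cls g) q"
    and g: "g \<in> L2" "integrable halfline (\<lambda>x. cmod (g x))"
  shows "norm (weight (P B q)) ^ 4 \<le> C1\<^sup>2 * 256 ^ 4 * C2 * L1_norm g ^ 4 / sqrt R"
proof -
  have R0: "0 < R" "0 < sqrt R" using R by auto
  obtain G G1 H where G: "cls G = P B (cls g)" "regular G G1 H" "L2_norm H \<le> 1 / R\<^sup>2 * L2_norm G"
    using bounded_cutoff_chain[OF B BR] by blast
  obtain Y Y1 I where Y: "cls Y = P B q" "regular Y Y1 I" "L2_norm I \<le> 1 / R\<^sup>2 * L2_norm Y"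
    using bounded_cutoff_chain[OF B BR] by blast
  define n where "n = L2_norm G"
  have n0: "0 \<le> n" by (simp add: n_def L2_norm_nonneg)
  define l where "l = L1_norm g"
  have l0: "0 \<le> l" by (simp add: l_def L1_norm_def)
  define sup4 where "sup4 = C2 * (n ^ 4 / (R * sqrt R))"
  have s0: "0 \<le> sup4" using C20 n0 R0 by (simp add: sup4_def)
  define s where "s = root 4 sup4"
  have ss: "0 \<le> s" "s ^ 4 = sup4" using s0 by (auto simp: s_def)
  have Gs: "cmod (G x) \<le> s" if x: "0 \<le> x" for x
  proof -
    have "cmod (G x) ^ 4 \<le> s ^ 4" using C2[OF G(2) R _ x] G(3) by (simp add: ss n_def sup4_def)
    then show ?thesis using ss(1) by (rule power_le_imp_le_base[of _ 3, simplified] | simp add: power_mono_iff)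
  qed
  have "n\<^sup>2 = inner (P B (cls g)) (cls g)"
    using norm_P2[OF B, of "cls g"] cls_norm[OF regularD(1)[OF G(2)]] G(1) by (simp add: n_def)
  also have "\<dots> = Re (L2_inner G g)" using cls_inner[OF regularD(1)[OF G(2)] g(1)] G(1) by simp
  also have "\<dots> = (LINT x|halfline. Re (G x * cnj (g x)))"
    unfolding L2_inner_def by (rule integral_Re[symmetric, OF L2_mult_integrable[OF regularD(1)[OF G(2)] g(1)]])
  also have "\<dots> \<le> (LINT x|halfline. s * cmod (g x))"
  proof (rule integral_mono)
    show "integrable halfline (\<lambda>x. Re (G x * cnj (g x)))"
      by (intro integrable_Re L2_mult_integrable regularD(1)[OF G(2)] g)
    show "integrable halfline (\<lambda>x. s * cmod (g x))" using g by simp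
    fix x assume "x \<in> space halfline"
    then have "cmod (G x) * cmod (g x) \<le> s * cmod (g x)" using Gs by (intro mult_right_mono) auto
    then show "Re (G x * cnj (g x)) \<le> s * cmod (g x)" using abs_Re_mult_cnj_le[of "G x" "g x"] by linarith
  qed
  also have "\<dots> = s * l" by (simp add: l_def L1_norm_def)
  finally have "(n\<^sup>2) ^ 4 \<le> (s * l) ^ 4" using n0 by (intro power_mono) auto
  \<comment> \<open>The supremum bound contains n again; a factor n^4 is divided out next.\<close>
  then have n8: "n ^ 4 * n ^ 4 \<le> n ^ 4 * (C2 * l ^ 4 / (R * sqrt R))"
    by (simp add: power_mult_distrib ss sup4_def mult_ac flip: power_mult power_add)
  have n4: "n ^ 4 \<le> C2 * l ^ 4 / (R * sqrt R)"
  proof (cases "n = 0")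
    case True
    then show ?thesis using C20 l0 R0 by simp
  next
    case False
    then have "0 < n ^ 4" using n0 by simp
    then show ?thesis by (rule mult_left_le_imp_le[OF n8])
  qed
  have "norm (P B q) \<le> (256 * R) * norm (P B (cls g))" by (rule LC_bound[OF lc B phi])
  then have y: "L2_norm Y \<le> 256 * R * n"
    using cls_norm[OF regularD(1)[OF G(2)]] cls_norm[OF regularD(1)[OF Y(2)]] G(1) Y(1) by (simp add: n_def)
  have "(norm (weight (P B q)))\<^sup>2 \<le> C1 * ((L2_norm Y)\<^sup>2 / (R * sqrt R))"
    using C1[OF Y(2) R] Y(3) norm_weight[OF regularD(1)[OF Y(2)]] Y(1) by simp
  also have "\<dots> \<le> C1 * ((256 * R * n)\<^sup>2 / (R * sqrt R))"
    using y C10 R0 by (intro mult_left_mono divide_right_mono power_mono) (auto simp: L2_norm_nonneg)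
  also have "\<dots> = C1 * 256\<^sup>2 * sqrt R * n\<^sup>2"
  proof -
    have "R = sqrt R * sqrt R" using R0 by simp
    then have "(256 * R * n)\<^sup>2 / (R * sqrt R) = 256\<^sup>2 * sqrt R * n\<^sup>2"
      using R0 by (simp add: divide_simps power_mult_distrib power2_eq_square)
    then show ?thesis by simp
  qed
  finally have "((norm (weight (P B q)))\<^sup>2)\<^sup>2 \<le> (C1 * 256\<^sup>2 * sqrt R * n\<^sup>2)\<^sup>2" by (intro power_mono) auto
  also have "\<dots> = C1\<^sup>2 * 256 ^ 4 * R * n ^ 4" using R0 by (simp add: power_mult_distrib flip: power_mult)
  also have "\<dots> \<le> C1\<^sup>2 * 256 ^ 4 * R * (C2 * l ^ 4 / (R * sqrt R))" using n4 R0 by (intro mult_left_mono) auto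
  also have "\<dots> = C1\<^sup>2 * 256 ^ 4 * C2 * l ^ 4 / sqrt R" using R0 by simp
  finally show ?thesis by (simp add: l_def flip: power_mult)
qed

end

section \<open>The evolution\<close>

lemma half_powers_sum_le: "(\<Sum>j<n. (1/2) ^ j) \<le> (2::real)"
proof -
  have "(\<Sum>j<n. (1/2) ^ j) = 2 - 2 * (1/2 :: real) ^ n" by (induction n) auto
  then show ?thesis by simp
qed

context schroedinger
begin

text \<open>Energies above 1, where the multiplier is at most 1, are paid for by the L2 norm; each
  spectral block below 1 is paid for by the L1 norm with a factor 2^(-j).\<close>

lemma low_total:
  assumes C1: "\<And>f f1 h R. regular f f1 h \<Longrightarrow> 1 \<le> R \<Longrightarrow> L2_norm h \<le> L2_norm f / R\<^sup>2 \<Longrightarrow>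
     (L2_norm (\<lambda>x. f x / of_real (1 + x)))\<^sup>2 \<le> C1 * ((L2_norm f)\<^sup>2 / (R * sqrt R))" and C10: "0 \<le> C1"
    and C2: "\<And>f f1 h R x. regular f f1 h \<Longrightarrow> 1 \<le> R \<Longrightarrow> L2_norm h \<le> L2_norm f / R\<^sup>2 \<Longrightarrow> 0 \<le> x \<Longrightarrow>
     (cmod (f x)) ^ 4 \<le> C2 * ((L2_norm f) ^ 4 / (R * sqrt R))" and C20: "0 \<le> C2"
    and phi: "\<And>l. l \<noteq> 0 \<Longrightarrow> \<bar>\<phi> l\<bar> \<le> 1 / sqrt \<bar>l\<bar>" and lc: "LC \<phi> (cls g) q"
    and g: "g \<in> L2" "integrable halfline (\<lambda>x. cmod (g x))"
    and c: "0 \<le> c" "c ^ 4 = C1\<^sup>2 * 256 ^ 4 * C2"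
  shows "norm (weight q) \<le> L2_norm g + 2 * c * L1_norm g"
proof -
  define l1 where "l1 = L1_norm g"
  have l10: "0 \<le> l1" by (simp add: l1_def L1_norm_def)
  \<comment> \<open>The ratio \<open>256\<^sup>2\<close> makes the bound of \<open>block_bound\<close> decay like \<open>2 powr (- j)\<close>.\<close>
  define a where "a = (1 / 65536 :: real)"
  \<comment> \<open>Block 0 joins the high energies with l = 0, where nothing is assumed on the
    multiplier; that point contributes nothing by \<open>P_zero\<close>.\<close>
  define C where "C n = (case n of 0 \<Rightarrow> {0} \<union> {l. 1 < \<bar>l\<bar>} | Suc j \<Rightarrow> {l. a ^ Suc j < \<bar>l\<bar> \<and> \<bar>l\<bar> \<le> a ^ j})" for n :: nat
  have Cm: "C n \<in> sets borel" for n unfolding C_def by (cases n) auto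
  have apos: "0 < a ^ j" for j by (simp add: a_def)
  have amono: "a ^ j \<le> a ^ i" if "i \<le> j" for i j using that by (intro power_decreasing) (auto simp: a_def)
  have disj: "disjoint_family C"
    unfolding disjoint_family_on_def
  proof (intro ballI impI)
    have key: "C i \<inter> C j = {}" if ij: "i < j" for i j
    proof -
      obtain k where j: "j = Suc k" using ij by (cases j) auto
      show ?thesis
      proof (cases i)
        case 0
        have "False" if "l \<in> C i" "l \<in> C j" for l
        proof -
          have "a ^ Suc k < \<bar>l\<bar>" "\<bar>l\<bar> \<le> a ^ k" using that(2) by (simp_all add: C_def j del: power_Suc)
          moreover have "l = 0 \<or> 1 < \<bar>l\<bar>" using that(1) by (simp add: C_def 0)
          moreover have "a ^ k \<le> 1" using amono[of 0 k] by simp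
          ultimately show False using apos[of "Suc k"] by (elim disjE) linarith+
        qed
        then show ?thesis by blast
      next
        case (Suc i')
        have "False" if "l \<in> C i" "l \<in> C j" for l
        proof -
          have "\<bar>l\<bar> \<le> a ^ k" using that(2) by (simp add: C_def j del: power_Suc)
          moreover have "a ^ Suc i' < \<bar>l\<bar>" using that(1) by (simp add: C_def Suc del: power_Suc)
          moreover have "a ^ k \<le> a ^ Suc i'" using ij by (intro amono) (simp add: Suc j)
          ultimately show False by linarith
        qed
        then show ?thesis by blast
      qed
    qed
    fix i j :: nat assume "i \<noteq> j"
    then show "C i \<inter> C j = {}" using key[of i j] key[of j i] by (cases "i < j") auto
  qed
  have cover: "(\<Union>n. C n) = UNIV"
  proof -
    have "\<exists>n. l \<in> C n" for l
    proof (cases "l = 0 \<or> 1 < \<bar>l\<bar>")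
      case True
      then have "l \<in> C 0" by (auto simp: C_def)
      then show ?thesis ..
    next
      case False
      obtain n0 where "a ^ n0 < \<bar>l\<bar>" using real_arch_pow_inv[of "\<bar>l\<bar>" a] False by (auto simp: a_def)
      define n where "n = (LEAST n. a ^ n < \<bar>l\<bar>)"
      have n: "a ^ n < \<bar>l\<bar>" unfolding n_def by (rule LeastI) fact
      obtain k where k: "n = Suc k" using n False by (cases n) auto
      have "\<not> a ^ k < \<bar>l\<bar>" using not_less_Least[of k "\<lambda>n. a ^ n < \<bar>l\<bar>"] k by (simp add: n_def)
      then have "l \<in> C (Suc k)" using n k by (simp add: C_def)
      then show ?thesis ..
    qed
    then show ?thesis by blast
  qed
  have "(\<lambda>n. P (C n) q) sums P (\<Union>n. C n) q" using Cm disj by (intro P_sums) auto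
  then have "(\<lambda>n. P (C n) q) sums q" by (simp add: cover P_UNIV)
  then have s: "(\<lambda>n. weight (P (C n) q)) sums weight q" by (rule bounded_linear.sums[OF bounded_linear_weight])
  have b0: "norm (weight (P (C 0) q)) \<le> L2_norm g"
  proof -
    have m: "{l :: real. 1 < \<bar>l\<bar>} \<in> sets borel" by simp
    have "P (C 0) q = P {0} q + P {l. 1 < \<bar>l\<bar>} q"
    proof -
      have "C 0 = {0} \<union> {l. 1 < \<bar>l\<bar>}" by (simp add: C_def)
      then show ?thesis using P_Un[of "{0}" "{l. 1 < \<bar>l\<bar>}" q] m by simp
    qed
    also have "P {0} q = 0" by (rule P_zero[OF C2])
    finally have "norm (P (C 0) q) = norm (P {l. 1 < \<bar>l\<bar>} q)" by simp
    also have "\<dots> \<le> 1 * norm (P {l. 1 < \<bar>l\<bar>} (cls g))"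
    proof (rule LC_bound[OF lc m])
      fix l :: real assume "l \<in> {l. 1 < \<bar>l\<bar>}"
      then have "1 / sqrt \<bar>l\<bar> \<le> 1" "l \<noteq> 0" by auto
      then show "\<bar>\<phi> l\<bar> \<le> 1" using phi[of l] by linarith
    qed
    also have "\<dots> \<le> L2_norm g" using norm_P_le[OF m, of "cls g"] cls_norm[OF g(1)] by simp
    finally show ?thesis using norm_weight_le[of "P (C 0) q"] by linarith
  qed
  have bS: "norm (weight (P (C (Suc j)) q)) \<le> c * l1 * (1/2) ^ j" for j
  proof -
    \<comment> \<open>The upper end a^j of the block is R^(-2) and its lower end is (256 R)^(-2), so
      the multiplier is at most 256 R there. Since sqrt R = 16^j, the fourth root in
      \<open>block_bound\<close> gives 2^(-j).\<close>
    define R where "R = (256 :: real) ^ j"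
    have R: "1 \<le> R" by (simp add: R_def)
    have R2: "1 / R\<^sup>2 = a ^ j" by (simp add: R_def a_def power_one_over flip: power_mult) (simp add: power_mult mult.commute[of _ 2])
    have sR: "sqrt R = 16 ^ j"
    proof (rule real_sqrt_unique)
      show "(16 ^ j)\<^sup>2 = R" by (simp add: R_def flip: power_mult) (simp add: power_mult mult.commute[of _ 2])
    qed simp
    have "norm (weight (P (C (Suc j)) q)) ^ 4 \<le> C1\<^sup>2 * 256 ^ 4 * C2 * L1_norm g ^ 4 / sqrt R"
    proof (rule block_bound[OF C1 C10 C2 C20 R Cm _ _ lc g])
      fix l assume l: "l \<in> C (Suc j)"
      then show "\<bar>l\<bar> \<le> 1 / R\<^sup>2" unfolding R2 by (simp add: C_def)
      have l1: "a ^ Suc j < \<bar>l\<bar>" using l by (simp add: C_def)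
      then have l0: "l \<noteq> 0" using apos[of "Suc j"] by auto
      have "1 / (256 * R) \<le> sqrt \<bar>l\<bar>"
      proof (rule real_le_rsqrt)
        have "(1 / (256 * R))\<^sup>2 = a * (1 / R\<^sup>2)" by (simp add: power_divide power_mult_distrib a_def)
        also have "\<dots> = a ^ Suc j" by (simp add: R2)
        finally show "(1 / (256 * R))\<^sup>2 \<le> \<bar>l\<bar>" using l1 by simp
      qed
      then have "1 / sqrt \<bar>l\<bar> \<le> 256 * R" using R l0 by (simp add: field_simps)
      then show "\<bar>\<phi> l\<bar> \<le> 256 * R" using phi[OF l0] by linarith
    qed
    also have "\<dots> = (c * l1 * (1/2) ^ j) ^ 4"
    proof -
      have "((1/2 :: real) ^ j) ^ 4 = ((1/2) ^ 4) ^ j" by (simp only: power_mult[symmetric] mult.commute)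
      also have "\<dots> = 1 / 16 ^ j" by (simp add: power_one_over)
      finally show ?thesis by (simp add: power_mult_distrib c(2) sR l1_def)
    qed
    finally show ?thesis using c l10 by (subst (asm) power_mono_iff) auto
  qed
  have part: "norm (\<Sum>i<n. weight (P (C i) q)) \<le> L2_norm g + 2 * c * l1" for n
  proof (cases n)
    case 0
    then show ?thesis using c l10 L2_norm_nonneg[of g] by simp
  next
    case (Suc k)
    have "norm (\<Sum>i<n. weight (P (C i) q)) \<le> (\<Sum>i<Suc k. norm (weight (P (C i) q)))" unfolding Suc by (rule norm_sum)
    also have "\<dots> = norm (weight (P (C 0) q)) + (\<Sum>j<k. norm (weight (P (C (Suc j)) q)))" by (rule sum.lessThan_Suc_shift)
    also have "\<dots> \<le> L2_norm g + (\<Sum>j<k. c * l1 * (1/2) ^ j)" by (intro add_mono b0 sum_mono bS)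
    also have "(\<Sum>j<k. c * l1 * (1/2) ^ j) = c * l1 * (\<Sum>j<k. (1/2) ^ j)" by (simp only: sum_distrib_left)
    also have "L2_norm g + c * l1 * (\<Sum>j<k. (1/2) ^ j) \<le> L2_norm g + c * l1 * 2"
      using half_powers_sum_le[of k] c l10 by (intro add_left_mono mult_left_mono) auto
    finally show ?thesis by simp
  qed
  have "(\<lambda>n. norm (\<Sum>i<n. weight (P (C i) q))) \<longlonglongrightarrow> norm (weight q)"
    using s unfolding sums_def by (rule tendsto_norm)
  then show ?thesis using part unfolding l1_def by (intro LIMSEQ_le_const2[of "\<lambda>n. norm (\<Sum>i<n. weight (P (C i) q))"]) auto
qed

lemma regular_LC: "regular f f1 h \<Longrightarrow> LC (\<lambda>l. l) (cls f) (cls h)"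
  using op_LC[OF regularD(1,2)] regular_imp_op by blast

lemma LC_lower:
  assumes "LC (\<lambda>l. l) x h" "LC (\<lambda>l. l) h h2"
  shows "- K 0 * (norm x)\<^sup>2 \<le> inner h x"
proof -
  have "(rep_l2 x, rep_l2 h) \<in> schroedinger_op (V 0)" "(rep_l2 h, rep_l2 h2) \<in> schroedinger_op (V 0)"
    using assms by (simp_all add: op_LC rep_l2 cls_rep)
  from op_rep[OF this(1)] op_rep[OF this(2)]
  obtain F F1 H where F: "L2_eq (rep_l2 x) F" "L2_eq (rep_l2 h) H" "regular F F1 H" by blast
  note D = regularD[OF F(3)]
  have "cls F = x" "cls H = h" using F cls_eq_iff[OF rep_l2 D(1)] cls_eq_iff[OF rep_l2 D(2)] cls_rep by metis+
  then show ?thesis using energy_bounds(3)[OF F(3)] cls_inner[OF D(2,1)] cls_norm[OF D(1)] by simp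
qed

text \<open>Controls the half power of |A| by one derivative. The constant is K 0 from the quadratic
  form plus 2 (K 0 + 1) from the lower bound -(K 0 + 1) of the spectrum.\<close>

lemma nn_abs_bound:
  assumes r: "regular f f1 h"
  shows "(\<integral>\<^sup>+l. ennreal \<bar>l\<bar> \<partial>M (cls f)) \<le> ennreal ((L2_norm f1)\<^sup>2 + (3 * K 0 + 2) * (L2_norm f)\<^sup>2)"
proof -
  note D = regularD[OF r]
  have low: "AE l in M (cls f). - (K 0 + 1) \<le> l"
    by (rule M_lower_bound) (rule LC_lower)
  have "(\<integral>\<^sup>+l. ennreal \<bar>l\<bar> \<partial>M (cls f)) \<le> ennreal (inner (cls h) (cls f) + 2 * (K 0 + 1) * (norm (cls f))\<^sup>2)"
    by (rule nn_integral_abs_le[OF low _ regular_LC[OF r]]) (use K_nonneg[of 0] in simp)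
  also have "\<dots> \<le> ennreal ((L2_norm f1)\<^sup>2 + (3 * K 0 + 2) * (L2_norm f)\<^sup>2)"
    using energy_bounds(2)[OF r] cls_inner[OF D(2,1)] cls_norm[OF D(1)]
    by (intro ennreal_leI) (simp add: algebra_simps)
  finally show ?thesis .
qed

text \<open>The multiplier is applied to every power of A on the data, and \<open>LC_commute\<close>
  shows that consecutive results are again linked by A. The first entry has to be the given vector
  q; the others may be chosen freely.\<close>

lemma evolved_chain:
  assumes phi: "\<phi> \<in> borel_measurable borel" and k: "\<And>l. \<bar>\<phi> l\<bar> \<le> k" and lc: "LC \<phi> (y 0) q"
    and y: "\<And>m. LC (\<lambda>l. l) (y m) (y (Suc m))"
  shows "\<exists>F F1. cls (F 0) = q \<and> (\<forall>m. LC \<phi> (y m) (cls (F m)) \<and> regular (F m) (F1 m) (F (Suc m)))"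
proof -
  define s where "s m = (if m = 0 then q else SOME h. LC \<phi> (y m) h)" for m
  have s: "LC \<phi> (y m) (s m)" for m
  proof (cases "m = 0")
    case True then show ?thesis using lc by (simp add: s_def)
  next
    case False
    have "\<exists>h. LC \<phi> (y m) h" by (rule LC_exists[OF phi k])
    then show ?thesis using False someI_ex[of "\<lambda>h. LC \<phi> (y m) h"] by (simp add: s_def)
  qed
  have "LC (\<lambda>l. l) (s m) (s (Suc m))" for m by (rule LC_commute[OF phi k y s s])
  from LC_chain_regular[of s, OF this]
  obtain F F1 where F: "\<And>m. cls (F m) = s m" "\<And>m. regular (F m) (F1 m) (F (Suc m))" by blast
  then show ?thesis using s by (intro exI[of _ F] exI[of _ F1]) (simp add: s_def)
qed

text \<open>A multiplier bounded by 1 contracts both the norm and the form of |A|, and the energy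
  identity converts the form into the norm of the derivative. The constants are enlarged to squares
  so that the square root of the sum can be taken.\<close>

lemma cos_step:
  assumes phi: "\<phi> \<in> borel_measurable borel" and le: "\<And>l. \<bar>\<phi> l\<bar> \<le> 1"
    and r: "regular g g1 h" and lc: "LC \<phi> (cls g) (cls f)" and rf: "regular f f1 f2"
  shows "L2_norm f \<le> L2_norm g" "L2_norm f1 \<le> L2_norm g1 + (4 * K 0 + 3) * L2_norm g"
proof -
  note D = regularD[OF r] and Df = regularD[OF rf]
  have "norm (P UNIV (cls f)) \<le> 1 * norm (P UNIV (cls g))" by (rule LC_bound[OF lc]) (auto simp: le)
  then show n: "L2_norm f \<le> L2_norm g" using cls_norm[OF D(1)] cls_norm[OF Df(1)] by (simp add: P_UNIV)
  have "ennreal \<bar>inner (cls f2) (cls f)\<bar> \<le> (\<integral>\<^sup>+l. ennreal ((\<phi> l)\<^sup>2 * \<bar>l\<bar>) \<partial>M (cls g))"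
    by (rule LC_inner_self_le[OF lc phi regular_LC[OF rf]])
  also have "\<dots> \<le> (\<integral>\<^sup>+l. ennreal \<bar>l\<bar> \<partial>M (cls g))"
  proof (intro nn_integral_mono ennreal_leI)
    fix l
    have "(\<phi> l)\<^sup>2 \<le> 1" using le[of l] by (simp add: abs_square_le_1)
    then show "(\<phi> l)\<^sup>2 * \<bar>l\<bar> \<le> \<bar>l\<bar>" by (simp add: mult_left_le_one_le)
  qed
  also have "\<dots> \<le> ennreal ((L2_norm g1)\<^sup>2 + (3 * K 0 + 2) * (L2_norm g)\<^sup>2)" by (rule nn_abs_bound[OF r])
  finally have "\<bar>inner (cls f2) (cls f)\<bar> \<le> (L2_norm g1)\<^sup>2 + (3 * K 0 + 2) * (L2_norm g)\<^sup>2"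
    using K_nonneg[of 0] by (subst (asm) ennreal_le_iff) auto
  moreover have "(L2_norm f1)\<^sup>2 \<le> inner (cls f2) (cls f) + K 0 * (L2_norm (\<lambda>x. f x / of_real (1 + x)))\<^sup>2"
    using energy_bounds(1)[OF rf] cls_inner[OF Df(2,1)] by simp
  moreover have "K 0 * (L2_norm (\<lambda>x. f x / of_real (1 + x)))\<^sup>2 \<le> K 0 * (L2_norm g)\<^sup>2"
    using continuous_weighted_L2(2)[OF Df(1)] n K_nonneg[of 0]
    by (intro mult_left_mono power_mono L2_norm_nonneg) auto
  ultimately have "(L2_norm f1)\<^sup>2 \<le> (L2_norm g1)\<^sup>2 + (4 * K 0 + 2) * (L2_norm g)\<^sup>2" by (simp add: algebra_simps)
  also have "\<dots> \<le> (L2_norm g1)\<^sup>2 + (4 * K 0 + 3)\<^sup>2 * (L2_norm g)\<^sup>2"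
  proof -
    have "(4 * K 0 + 2) * 1 \<le> (4 * K 0 + 3) * (4 * K 0 + 3)" using K_nonneg[of 0] by (intro mult_mono) auto
    then show ?thesis by (intro add_left_mono mult_right_mono) (auto simp: power2_eq_square)
  qed
  also have "\<dots> \<le> (L2_norm g1 + (4 * K 0 + 3) * L2_norm g)\<^sup>2"
    using K_nonneg[of 0] L2_norm_nonneg[of g1] L2_norm_nonneg[of g] by (simp add: power2_sum power_mult_distrib)
  finally show "L2_norm f1 \<le> L2_norm g1 + (4 * K 0 + 3) * L2_norm g"
    by (rule power2_le_imp_le) (use K_nonneg[of 0] L2_norm_nonneg[of g1] L2_norm_nonneg[of g] in simp)
qed

text \<open>The multiplier gains half a power of |A|: A f is controlled by the form of g, and the
  form of f by the norm of g alone. Passing from the form of f to f' costs the potential energy,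
  which is where the weighted norm of f enters; its unweighted norm never does.\<close>

lemma sin_step:
  assumes phi: "\<phi> \<in> borel_measurable borel" and le: "\<And>l. (\<phi> l)\<^sup>2 * \<bar>l\<bar> \<le> 1"
    and r: "regular g g1 h" and lc: "LC \<phi> (cls g) (cls f)" and rf: "regular f f1 f2"
  shows "L2_norm f2 \<le> L2_norm g1 + (3 * K 0 + 3) * L2_norm g"
    "L2_norm f1 \<le> L2_norm g + (K 0 + 1) * L2_norm (\<lambda>x. f x / of_real (1 + x))"
proof -
  note D = regularD[OF r] and Df = regularD[OF rf]
  have "ennreal ((norm (cls f2))\<^sup>2) = (\<integral>\<^sup>+l. ennreal (l\<^sup>2) \<partial>M (cls f))" by (rule LC_norm[OF _ regular_LC[OF rf]]) simp
  also have "\<dots> = (\<integral>\<^sup>+l. ennreal ((\<phi> l)\<^sup>2) * ennreal (l\<^sup>2) \<partial>M (cls g))"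
    by (rule LC_nn_integral[OF phi lc]) simp
  also have "\<dots> \<le> (\<integral>\<^sup>+l. ennreal \<bar>l\<bar> \<partial>M (cls g))"
  proof (rule nn_integral_mono)
    fix l
    have "(\<phi> l)\<^sup>2 * l\<^sup>2 = ((\<phi> l)\<^sup>2 * \<bar>l\<bar>) * \<bar>l\<bar>" by (simp add: power2_eq_square)
    also have "\<dots> \<le> 1 * \<bar>l\<bar>" by (intro mult_right_mono le) auto
    finally show "ennreal ((\<phi> l)\<^sup>2) * ennreal (l\<^sup>2) \<le> ennreal \<bar>l\<bar>" by (simp flip: ennreal_mult add: ennreal_leI)
  qed
  also have "\<dots> \<le> ennreal ((L2_norm g1)\<^sup>2 + (3 * K 0 + 2) * (L2_norm g)\<^sup>2)" by (rule nn_abs_bound[OF r])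
  finally have "(norm (cls f2))\<^sup>2 \<le> (L2_norm g1)\<^sup>2 + (3 * K 0 + 2) * (L2_norm g)\<^sup>2"
    using K_nonneg[of 0] by (subst (asm) ennreal_le_iff) auto
  also have "\<dots> \<le> (L2_norm g1)\<^sup>2 + (3 * K 0 + 3)\<^sup>2 * (L2_norm g)\<^sup>2"
  proof -
    have "(3 * K 0 + 2) * 1 \<le> (3 * K 0 + 3) * (3 * K 0 + 3)" using K_nonneg[of 0] by (intro mult_mono) auto
    then show ?thesis by (intro add_left_mono mult_right_mono) (auto simp: power2_eq_square)
  qed
  also have "\<dots> \<le> (L2_norm g1 + (3 * K 0 + 3) * L2_norm g)\<^sup>2"
    using K_nonneg[of 0] L2_norm_nonneg[of g1] L2_norm_nonneg[of g] by (simp add: power2_sum power_mult_distrib)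
  finally have "norm (cls f2) \<le> L2_norm g1 + (3 * K 0 + 3) * L2_norm g"
    by (rule power2_le_imp_le) (use K_nonneg[of 0] L2_norm_nonneg[of g1] L2_norm_nonneg[of g] in simp)
  then show "L2_norm f2 \<le> L2_norm g1 + (3 * K 0 + 3) * L2_norm g" using cls_norm[OF Df(2)] by simp
  define w where "w = L2_norm (\<lambda>x. f x / of_real (1 + x))"
  have w0: "0 \<le> w" by (simp add: w_def L2_norm_nonneg)
  have "ennreal \<bar>inner (cls f2) (cls f)\<bar> \<le> (\<integral>\<^sup>+l. ennreal ((\<phi> l)\<^sup>2 * \<bar>l\<bar>) \<partial>M (cls g))"
    by (rule LC_inner_self_le[OF lc phi regular_LC[OF rf]])
  also have "\<dots> \<le> (\<integral>\<^sup>+l. 1 \<partial>M (cls g))" using le by (intro nn_integral_mono) (simp add: ennreal_le_1)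
  also have "\<dots> = ennreal ((L2_norm g)\<^sup>2)" using nn_integral_M_1[of "cls g"] cls_norm[OF D(1)] by simp
  finally have "\<bar>inner (cls f2) (cls f)\<bar> \<le> (L2_norm g)\<^sup>2" by (subst (asm) ennreal_le_iff) auto
  moreover have "(L2_norm f1)\<^sup>2 \<le> inner (cls f2) (cls f) + K 0 * w\<^sup>2"
    using energy_bounds(1)[OF rf] cls_inner[OF Df(2,1)] by (simp add: w_def)
  moreover have "K 0 * w\<^sup>2 \<le> (K 0 + 1)\<^sup>2 * w\<^sup>2"
  proof -
    have "K 0 * 1 \<le> (K 0 + 1) * (K 0 + 1)" using K_nonneg[of 0] by (intro mult_mono) auto
    then show ?thesis by (intro mult_right_mono) (auto simp: power2_eq_square)
  qed
  ultimately have "(L2_norm f1)\<^sup>2 \<le> (L2_norm g)\<^sup>2 + (K 0 + 1)\<^sup>2 * w\<^sup>2" by linarith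
  also have "\<dots> \<le> (L2_norm g + (K 0 + 1) * w)\<^sup>2"
    using K_nonneg[of 0] w0 L2_norm_nonneg[of g] by (simp add: power2_sum power_mult_distrib)
  finally show "L2_norm f1 \<le> L2_norm g + (K 0 + 1) * w"
    by (rule power2_le_imp_le) (use K_nonneg[of 0] w0 L2_norm_nonneg[of g] in simp)
qed

end

section \<open>Uniform bounds for the cosine and sine evolutions\<close>

context potential
begin

lemma iterate_regular:
  assumes "dtower \<Phi>"
  shows "regular ((op_tower ^^ m) \<Phi> 0) ((op_tower ^^ m) \<Phi> 1) ((op_tower ^^ Suc m) \<Phi> 0)"
  using dtower_op_tower(2)[OF dtower_iterate[OF assms, of m]] by simp

text \<open>Fixes one constant for each order before the chain is given. T stands for the norm of
  the data, and below the leading order only weighted bounds are asked for.\<close>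

lemma elliptic_estimate:
  assumes J: "\<And>n. 0 \<le> J n"
  shows "\<exists>c. (\<forall>n. 0 \<le> c n) \<and> (\<forall>F F1 T n. (\<forall>m. regular (F m) (F1 m) (F (Suc m))) \<longrightarrow>
    (\<forall>i<n. L2_norm (\<lambda>x. jet F F1 i x / complex_of_real (1 + x)) \<le> J i * T) \<longrightarrow> L2_norm (jet F F1 n) \<le> J n * T \<longrightarrow>
    L2_norm (elliptic F F1 n) \<le> c n * T)"
proof -
  define e where "e n = (SOME c. c \<ge> 0 \<and> (\<forall>F F1. (\<forall>m. regular (F m) (F1 m) (F (Suc m))) \<longrightarrow>
     elliptic F F1 n \<in> L2 \<and> L2_norm (elliptic F F1 n) \<le> L2_norm (jet F F1 n) + c * (\<Sum>i<n. L2_norm (\<lambda>x. jet F F1 i x / complex_of_real (1 + x)))))" for n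
  have e: "e n \<ge> 0 \<and> (\<forall>F F1. (\<forall>m. regular (F m) (F1 m) (F (Suc m))) \<longrightarrow>
     elliptic F F1 n \<in> L2 \<and> L2_norm (elliptic F F1 n) \<le> L2_norm (jet F F1 n) + e n * (\<Sum>i<n. L2_norm (\<lambda>x. jet F F1 i x / complex_of_real (1 + x))))" for n
    unfolding e_def by (rule someI_ex) (rule elliptic_bound)
  have "L2_norm (elliptic F F1 n) \<le> (J n + e n * (\<Sum>i<n. J i)) * T"
    if r: "\<forall>m. regular (F m) (F1 m) (F (Suc m))"
      and w: "\<forall>i<n. L2_norm (\<lambda>x. jet F F1 i x / complex_of_real (1 + x)) \<le> J i * T"
      and j: "L2_norm (jet F F1 n) \<le> J n * T" for F F1 T n
  proof -
    have "L2_norm (elliptic F F1 n) \<le> L2_norm (jet F F1 n) + e n * (\<Sum>i<n. L2_norm (\<lambda>x. jet F F1 i x / complex_of_real (1 + x)))"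
      using e[of n] r by blast
    also have "\<dots> \<le> J n * T + e n * (\<Sum>i<n. J i * T)"
      using e[of n] w by (intro add_mono j mult_left_mono sum_mono) auto
    also have "(\<Sum>i<n. J i * T) = (\<Sum>i<n. J i) * T" by (rule sum_distrib_right[symmetric])
    finally show ?thesis by (simp add: algebra_simps)
  qed
  moreover have "0 \<le> J n + e n * (\<Sum>i<n. J i)" for n using e[of n] J by (simp add: sum_nonneg)
  ultimately show ?thesis by (intro exI[of _ "\<lambda>n. J n + e n * (\<Sum>i<n. J i)"]) simp
qed

lemma elliptic_L2:
  assumes "\<And>m. regular (F m) (F1 m) (F (Suc m))" shows "elliptic F F1 n \<in> L2"
  using elliptic_bound[of n] assms by blast

lemma elliptic_0: "elliptic F F1 0 = F 0"
  by (simp add: elliptic_def jet_def fun_eq_iff)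

lemma iterate_bounds:
  "\<exists>A. (\<forall>m n. 0 \<le> A m n) \<and> (\<forall>m n \<Phi>. dtower \<Phi> \<longrightarrow> L2_norm ((op_tower ^^ m) \<Phi> n) \<le> A m n * (\<Sum>i\<le>n+2*m. L2_norm (\<Phi> i)))"
proof -
  define A where "A m n = (SOME C. C \<ge> 0 \<and> (\<forall>\<Phi>. dtower \<Phi> \<longrightarrow> L2_norm ((op_tower ^^ m) \<Phi> n) \<le> C * (\<Sum>i\<le>n+2*m. L2_norm (\<Phi> i))))" for m n
  have "A m n \<ge> 0 \<and> (\<forall>\<Phi>. dtower \<Phi> \<longrightarrow> L2_norm ((op_tower ^^ m) \<Phi> n) \<le> A m n * (\<Sum>i\<le>n+2*m. L2_norm (\<Phi> i)))" for m n
    unfolding A_def by (rule someI_ex) (rule op_tower_iterate_bound)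
  then show ?thesis by (intro exI[of _ A]) blast
qed

lemma dtowerD: "dtower \<Phi> \<Longrightarrow> tower {0..} \<Phi>" "dtower \<Phi> \<Longrightarrow> \<Phi> n \<in> L2"
  by (simp_all add: dtower_def)

end

context schroedinger
begin

lemma evolved_regular:
  assumes phi: "\<phi> \<in> borel_measurable borel" and k: "\<And>l. \<bar>\<phi> l\<bar> \<le> k"
    and D: "dtower \<Phi>" and p: "p \<in> L2" and pq: "(\<Phi> 0, p) \<in> spectral_integral E \<phi>"
  shows "\<exists>F F1. L2_eq (F 0) p \<and> (\<forall>m. regular (F m) (F1 m) (F (Suc m))) \<and>
    (\<forall>m. LC \<phi> (cls ((op_tower ^^ m) \<Phi> 0)) (cls (F m)))"
proof -
  have lc: "LC \<phi> (cls ((op_tower ^^ 0) \<Phi> 0)) (cls p)"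
    using spectral_integral_LC[OF phi dtowerD(2)[OF D, of 0] p] pq by simp
  obtain F F1 where F: "cls (F 0) = cls p" "\<And>m. LC \<phi> (cls ((op_tower ^^ m) \<Phi> 0)) (cls (F m))"
      "\<And>m. regular (F m) (F1 m) (F (Suc m))"
    using evolved_chain[of \<phi> k "\<lambda>m. cls ((op_tower ^^ m) \<Phi> 0)", OF phi k lc regular_LC[OF iterate_regular[OF D]]] by blast
  have "L2_eq (F 0) p" using F(1) cls_eq_iff[OF regularD(1)[OF F(3)] p] by simp
  then show ?thesis using F(2,3) by blast
qed

end

context potential
begin

text \<open>The constants precede the spectral family E because \<open>function_of_op\<close>
  supplies a family separately for each time and each multiplier. Jets of order 2 m and 2 m + 1 are
  bounded by applying \<open>cos_step\<close> to A^m of the data.\<close>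

lemma cos_bound:
  "\<exists>c. (\<forall>n. 0 \<le> c n) \<and> (\<forall>E \<Phi> \<phi> p. schroedinger V K x1 E \<longrightarrow> dtower \<Phi> \<longrightarrow> \<phi> \<in> borel_measurable borel \<longrightarrow>
     (\<forall>l. \<bar>\<phi> l\<bar> \<le> 1) \<longrightarrow> p \<in> L2 \<longrightarrow> (\<Phi> 0, p) \<in> spectral_integral E \<phi> \<longrightarrow>
     (\<exists>Z. tower {0..} Z \<and> L2_eq (Z 0) p \<and>
       (\<forall>n. Z n \<in> L2 \<and> L2_norm (Z n) \<le> c n * (\<Sum>i\<le>n. L2_norm (\<Phi> i)))))"
proof -
  obtain A where A0: "\<And>m n. 0 \<le> A m n"
    and A: "\<And>m n \<Phi>. dtower \<Phi> \<Longrightarrow> L2_norm ((op_tower ^^ m) \<Phi> n) \<le> A m n * (\<Sum>i\<le>n+2*m. L2_norm (\<Phi> i))"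
    using iterate_bounds by blast
  define J where "J n = A (n div 2) 1 + (4 * K 0 + 4) * A (n div 2) 0" for n
  have J0: "0 \<le> J n" for n using A0 K_nonneg[of 0] by (simp add: J_def)
  obtain c where c0: "\<And>n. 0 \<le> c n" and c: "\<And>F F1 T n. (\<forall>m. regular (F m) (F1 m) (F (Suc m))) \<Longrightarrow>
    (\<forall>i<n. L2_norm (\<lambda>x. jet F F1 i x / complex_of_real (1 + x)) \<le> J i * T) \<Longrightarrow> L2_norm (jet F F1 n) \<le> J n * T \<Longrightarrow>
    L2_norm (elliptic F F1 n) \<le> c n * T"
    using elliptic_estimate[of J, OF J0] by blast
  have "\<exists>Z. tower {0..} Z \<and> L2_eq (Z 0) p \<and> (\<forall>n. Z n \<in> L2 \<and> L2_norm (Z n) \<le> c n * (\<Sum>i\<le>n. L2_norm (\<Phi> i)))"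
    if S: "schroedinger V K x1 E" and D: "dtower \<Phi>" and phi: "\<phi> \<in> borel_measurable borel"
      and le: "\<And>l. \<bar>\<phi> l\<bar> \<le> 1" and p: "p \<in> L2" and pq: "(\<Phi> 0, p) \<in> spectral_integral E \<phi>" for E \<Phi> \<phi> p
  proof -
    interpret schroedinger V K x1 E by fact
    obtain F F1 where F: "L2_eq (F 0) p" "\<And>m. regular (F m) (F1 m) (F (Suc m))"
      "\<And>m. LC \<phi> (cls ((op_tower ^^ m) \<Phi> 0)) (cls (F m))"
      using evolved_regular[OF phi le D p pq] by blast
    define S where "S n = (\<Sum>i\<le>n. L2_norm (\<Phi> i))" for n
    have S0: "0 \<le> S n" for n by (simp add: S_def sum_nonneg L2_norm_nonneg)
    have Smono: "S i \<le> S n" if "i \<le> n" for i n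
      unfolding S_def using that by (intro sum_mono2) (auto simp: L2_norm_nonneg)
    have jS: "L2_norm (jet F F1 n) \<le> J n * S n" for n
    proof -
      define m where "m = n div 2"
      note step = cos_step[OF phi le iterate_regular[OF D, of m] F(3)[of m] F(2)[of m]]
      have N0: "L2_norm ((op_tower ^^ m) \<Phi> 0) \<le> A m 0 * S n"
      proof -
        have "L2_norm ((op_tower ^^ m) \<Phi> 0) \<le> A m 0 * S (2 * m)" using A[OF D, of m 0] by (simp add: S_def)
        also have "\<dots> \<le> A m 0 * S n" by (intro mult_left_mono Smono A0) (simp add: m_def)
        finally show ?thesis .
      qed
      show ?thesis
      proof (cases "even n")
        case True
        have "L2_norm (jet F F1 n) \<le> A m 0 * S n" using True step(1) N0 by (simp add: jet_norm m_def)
        also have "\<dots> \<le> J n * S n"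
        proof (rule mult_right_mono[OF _ S0])
          have "1 * A m 0 \<le> (4 * K 0 + 4) * A m 0" using K_nonneg[of 0] by (intro mult_right_mono A0) auto
          then show "A m 0 \<le> J n" using A0[of m 1] by (simp add: J_def m_def)
        qed
        finally show ?thesis .
      next
        case False
        have "L2_norm ((op_tower ^^ m) \<Phi> 1) \<le> A m 1 * S n"
          using A[OF D, of m 1] False by (simp add: S_def m_def odd_two_times_div_two_succ)
        moreover have "(4 * K 0 + 3) * L2_norm ((op_tower ^^ m) \<Phi> 0) \<le> (4 * K 0 + 4) * (A m 0 * S n)"
          using K_nonneg[of 0] N0 by (intro mult_mono) (auto simp: L2_norm_nonneg)
        ultimately have "L2_norm (F1 m) \<le> A m 1 * S n + (4 * K 0 + 4) * (A m 0 * S n)" using step(2) by linarith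
        then show ?thesis using False by (simp add: jet_norm m_def J_def algebra_simps)
      qed
    qed
    have bd: "L2_norm (elliptic F F1 n) \<le> c n * S n" for n
    proof (rule c)
      show "\<forall>i<n. L2_norm (\<lambda>x. jet F F1 i x / complex_of_real (1 + x)) \<le> J i * S n"
      proof (intro allI impI)
        fix i assume "i < n"
        have "L2_norm (\<lambda>x. jet F F1 i x / complex_of_real (1 + x)) \<le> L2_norm (jet F F1 i)"
          by (intro continuous_weighted_L2(2) jet_L2 F(2))
        also have "\<dots> \<le> J i * S i" by (rule jS)
        also have "\<dots> \<le> J i * S n" using \<open>i < n\<close> by (intro mult_left_mono J0 Smono) simp
        finally show "L2_norm (\<lambda>x. jet F F1 i x / complex_of_real (1 + x)) \<le> J i * S n" .
      qed
    qed (use F(2) jS in auto)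
    show ?thesis
      using tower_elliptic[of F F1, OF F(2)] elliptic_L2[of F F1, OF F(2)] bd F(1)
      by (intro exI[of _ "elliptic F F1"]) (simp add: elliptic_0 S_def)
  qed
  then show ?thesis using c0 by (intro exI[of _ c]) blast
qed

text \<open>The sine evolution gains one derivative, so only orders below n of the data enter. Order
  0 is excluded: there only the weighted norm is bounded, by \<open>low_total\<close>. The bound k
  of the multiplier, later |t|, does not enter the constants.\<close>

lemma sin_bound:
  "\<exists>c. (\<forall>n. 0 \<le> c n) \<and> (\<forall>E \<Phi> \<phi> k p. schroedinger V K x1 E \<longrightarrow> dtower \<Phi> \<longrightarrow> integrable halfline (\<lambda>x. cmod (\<Phi> 0 x)) \<longrightarrow>
     \<phi> \<in> borel_measurable borel \<longrightarrow> (\<forall>l. \<bar>\<phi> l\<bar> \<le> k) \<longrightarrow> (\<forall>l. l \<noteq> 0 \<longrightarrow> \<bar>\<phi> l\<bar> \<le> 1 / sqrt \<bar>l\<bar>) \<longrightarrow>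
     p \<in> L2 \<longrightarrow> (\<Phi> 0, p) \<in> spectral_integral E \<phi> \<longrightarrow>
     (\<exists>Z. tower {0..} Z \<and> L2_eq (Z 0) p \<and>
       (\<forall>n. Z n \<in> L2 \<and> (0 < n \<longrightarrow> L2_norm (Z n) \<le> c n * ((\<Sum>i<n. L2_norm (\<Phi> i)) + L1_norm (\<Phi> 0))))))"
proof -
  obtain A where A0: "\<And>m n. 0 \<le> A m n"
    and A: "\<And>m n \<Phi>. dtower \<Phi> \<Longrightarrow> L2_norm ((op_tower ^^ m) \<Phi> n) \<le> A m n * (\<Sum>i\<le>n+2*m. L2_norm (\<Phi> i))"
    using iterate_bounds by blast
  obtain C1 where C10: "0 \<le> C1" and C1: "\<And>f f1 h R. regular f f1 h \<Longrightarrow> 1 \<le> R \<Longrightarrow> L2_norm h \<le> L2_norm f / R\<^sup>2 \<Longrightarrow>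
     (L2_norm (\<lambda>x. f x / of_real (1 + x)))\<^sup>2 \<le> C1 * ((L2_norm f)\<^sup>2 / (R * sqrt R))"
    using low_weighted by blast
  obtain C2 where C20: "0 \<le> C2" and C2: "\<And>f f1 h R x. regular f f1 h \<Longrightarrow> 1 \<le> R \<Longrightarrow> L2_norm h \<le> L2_norm f / R\<^sup>2 \<Longrightarrow> 0 \<le> x \<Longrightarrow>
     (cmod (f x)) ^ 4 \<le> C2 * ((L2_norm f) ^ 4 / (R * sqrt R))"
    using low_deriv_sup by blast
  define d where "d = root 4 (C1\<^sup>2 * 256 ^ 4 * C2)"
  have d: "0 \<le> d" "d ^ 4 = C1\<^sup>2 * 256 ^ 4 * C2" using C20 by (simp_all add: d_def)
  \<comment> \<open>\<open>J 0\<close> bounds the weighted norm only. For positive n one constant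
    covers both parities; the index m - 1 is truncated at m = 0, where the additional terms are
    harmless since they are nonnegative.\<close>
  define J where "J n = (if n = 0 then 1 + 2 * d else
    A (n div 2) 0 + (K 0 + 1) * (1 + 2 * d + A (n div 2 - 1) 1 + (3 * K 0 + 3) * A (n div 2 - 1) 0))" for n
  have J0: "0 \<le> J n" for n using A0 K_nonneg[of 0] d by (simp add: J_def)
  obtain c where c0: "\<And>n. 0 \<le> c n" and c: "\<And>F F1 T n. (\<forall>m. regular (F m) (F1 m) (F (Suc m))) \<Longrightarrow>
    (\<forall>i<n. L2_norm (\<lambda>x. jet F F1 i x / complex_of_real (1 + x)) \<le> J i * T) \<Longrightarrow> L2_norm (jet F F1 n) \<le> J n * T \<Longrightarrow>
    L2_norm (elliptic F F1 n) \<le> c n * T"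
    using elliptic_estimate[of J, OF J0] by blast
  have "\<exists>Z. tower {0..} Z \<and> L2_eq (Z 0) p \<and>
       (\<forall>n. Z n \<in> L2 \<and> (0 < n \<longrightarrow> L2_norm (Z n) \<le> c n * ((\<Sum>i<n. L2_norm (\<Phi> i)) + L1_norm (\<Phi> 0))))"
    if S: "schroedinger V K x1 E" and D: "dtower \<Phi>" and i1: "integrable halfline (\<lambda>x. cmod (\<Phi> 0 x))"
      and phi: "\<phi> \<in> borel_measurable borel" and bd: "\<And>l. \<bar>\<phi> l\<bar> \<le> k" and le: "\<And>l. l \<noteq> 0 \<Longrightarrow> \<bar>\<phi> l\<bar> \<le> 1 / sqrt \<bar>l\<bar>"
      and p: "p \<in> L2" and pq: "(\<Phi> 0, p) \<in> spectral_integral E \<phi>" for E \<Phi> \<phi> k p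
  proof -
    interpret schroedinger V K x1 E by fact
    obtain F F1 where F: "L2_eq (F 0) p" "\<And>m. regular (F m) (F1 m) (F (Suc m))"
      "\<And>m. LC \<phi> (cls ((op_tower ^^ m) \<Phi> 0)) (cls (F m))"
      using evolved_regular[OF phi bd D p pq] by blast
    have le1: "(\<phi> l)\<^sup>2 * \<bar>l\<bar> \<le> 1" for l
    proof (cases "l = 0")
      case False
      have "(\<phi> l)\<^sup>2 \<le> (1 / sqrt \<bar>l\<bar>)\<^sup>2" using le[OF False] by (intro abs_le_square_iff[THEN iffD1]) simp
      then show ?thesis using False by (simp add: power_divide field_simps)
    qed simp
    define T where "T n = (\<Sum>i<n. L2_norm (\<Phi> i)) + L1_norm (\<Phi> 0)" for n
    have L10: "0 \<le> L1_norm (\<Phi> 0)" by (simp add: L1_norm_def)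
    have T0: "0 \<le> T n" for n using L10 by (simp add: T_def sum_nonneg L2_norm_nonneg)
    have Tmono: "T i \<le> T n" if "i \<le> n" for i n
      unfolding T_def using that by (intro add_right_mono sum_mono2) (auto simp: L2_norm_nonneg)
    have AT: "L2_norm ((op_tower ^^ m) \<Phi> j) \<le> A m j * T n" if "j + 2 * m < n" for m j n
    proof -
      have "(\<Sum>i\<le>j+2*m. L2_norm (\<Phi> i)) \<le> T (Suc (j + 2 * m))" using L10 by (simp add: T_def lessThan_Suc_atMost)
      also have "\<dots> \<le> T n" by (rule Tmono) (use that in simp)
      finally show ?thesis using A[OF D, of m j] A0[of m j] by (meson mult_left_mono order_trans)
    qed
    have w0: "L2_norm (\<lambda>x. F 0 x / complex_of_real (1 + x)) \<le> (1 + 2 * d) * T 1"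
    proof -
      have "L2_norm (\<lambda>x. F 0 x / complex_of_real (1 + x)) = norm (weight (cls (F 0)))"
        using norm_weight[OF regularD(1)[OF F(2)]] by simp
      also have "\<dots> \<le> L2_norm (\<Phi> 0) + 2 * d * L1_norm (\<Phi> 0)"
        by (rule low_total[OF C1 C10 C2 C20 le _ dtowerD(2)[OF D] i1 d]) (use F(3)[of 0] in simp_all)
      also have "\<dots> \<le> (1 + 2 * d) * T 1" using d L10 L2_norm_nonneg[of "\<Phi> 0"] by (simp add: T_def algebra_simps)
      finally show ?thesis .
    qed
    have F_bound: "L2_norm (F (Suc m)) \<le> (A m 1 + (3 * K 0 + 3) * A m 0) * T (2 * Suc m)" for m
    proof -
      have "L2_norm (F (Suc m)) \<le> L2_norm ((op_tower ^^ m) \<Phi> 1) + (3 * K 0 + 3) * L2_norm ((op_tower ^^ m) \<Phi> 0)"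
        by (rule sin_step(1)[OF phi le1 iterate_regular[OF D] F(3) F(2)])
      also have "\<dots> \<le> A m 1 * T (2 * Suc m) + (3 * K 0 + 3) * (A m 0 * T (2 * Suc m))"
        using K_nonneg[of 0] by (intro add_mono mult_left_mono AT) auto
      finally show ?thesis by (simp add: algebra_simps)
    qed
    \<comment> \<open>The maximum with 1 concerns m = 0: the weighted bound of F 0 uses the L2 norm
      of the data, which \<open>T 1\<close> contains and \<open>T 0\<close> does not.\<close>
    have wF: "L2_norm (\<lambda>x. F m x / complex_of_real (1 + x)) \<le>
        (1 + 2 * d + A (m - 1) 1 + (3 * K 0 + 3) * A (m - 1) 0) * T (max 1 (2 * m))" for m
    proof (cases m)
      case 0
      have "(1 + 2 * d) * T 1 \<le> (1 + 2 * d + A (m - 1) 1 + (3 * K 0 + 3) * A (m - 1) 0) * T 1"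
        using A0 K_nonneg[of 0] by (intro mult_right_mono T0) simp
      then show ?thesis using w0 0 by simp
    next
      case (Suc j)
      have "L2_norm (\<lambda>x. F m x / complex_of_real (1 + x)) \<le> L2_norm (F m)"
        by (rule continuous_weighted_L2(2)) (rule regularD(1)[OF F(2)])
      also have "\<dots> \<le> (A j 1 + (3 * K 0 + 3) * A j 0) * T (2 * m)" using F_bound[of j] Suc by simp
      also have "\<dots> \<le> (1 + 2 * d + A j 1 + (3 * K 0 + 3) * A j 0) * T (2 * m)"
        using d by (intro mult_right_mono T0) simp
      finally show ?thesis by (simp add: Suc)
    qed
    have jT: "L2_norm (jet F F1 n) \<le> J n * T n" if n: "0 < n" for n
    proof -
      define m where "m = n div 2"
      define B where "B = 1 + 2 * d + A (m - 1) 1 + (3 * K 0 + 3) * A (m - 1) 0"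
      have B0: "0 \<le> B" using A0 K_nonneg[of 0] d by (simp add: B_def)
      have Jn: "J n = A m 0 + (K 0 + 1) * B" using n by (simp add: J_def B_def m_def)
      have KB: "B \<le> (K 0 + 1) * B" using B0 K_nonneg[of 0] by (simp add: algebra_simps)
      show ?thesis
      proof (cases "even n")
        case True
        then obtain j where j: "m = Suc j" using n by (cases m) (auto simp: m_def)
        have nm: "n = 2 * m" using True by (simp add: m_def)
        have "L2_norm (jet F F1 n) \<le> (A j 1 + (3 * K 0 + 3) * A j 0) * T n"
          using True F_bound[of j] nm j by (simp add: jet_norm)
        also have "\<dots> \<le> J n * T n"
        proof (rule mult_right_mono[OF _ T0])
          have "A j 1 + (3 * K 0 + 3) * A j 0 \<le> B" using d by (simp add: B_def j)
          then show "A j 1 + (3 * K 0 + 3) * A j 0 \<le> J n" using KB A0[of m 0] unfolding Jn by linarith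
        qed
        finally show ?thesis .
      next
        case False
        have nm: "2 * m < n" "max 1 (2 * m) \<le> n" using False n by (auto simp: m_def)
        have "L2_norm (F1 m) \<le> L2_norm ((op_tower ^^ m) \<Phi> 0) + (K 0 + 1) * L2_norm (\<lambda>x. F m x / of_real (1 + x))"
          by (rule sin_step(2)[OF phi le1 iterate_regular[OF D] F(3) F(2)])
        also have "\<dots> \<le> A m 0 * T n + (K 0 + 1) * (B * T n)"
        proof (intro add_mono mult_left_mono)
          show "L2_norm ((op_tower ^^ m) \<Phi> 0) \<le> A m 0 * T n" by (rule AT) (use nm in simp)
          have "L2_norm (\<lambda>x. F m x / of_real (1 + x)) \<le> B * T (max 1 (2 * m))" using wF[of m] by (simp add: B_def)
          also have "\<dots> \<le> B * T n" by (intro mult_left_mono Tmono nm B0)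
          finally show "L2_norm (\<lambda>x. F m x / of_real (1 + x)) \<le> B * T n" .
        qed (use K_nonneg[of 0] in simp)
        finally show ?thesis using False by (simp add: jet_norm m_def Jn algebra_simps)
      qed
    qed
    have ebd: "L2_norm (elliptic F F1 n) \<le> c n * T n" if n: "0 < n" for n
    proof (rule c)
      show "\<forall>i<n. L2_norm (\<lambda>x. jet F F1 i x / complex_of_real (1 + x)) \<le> J i * T n"
      proof (intro allI impI)
        fix i assume i: "i < n"
        show "L2_norm (\<lambda>x. jet F F1 i x / complex_of_real (1 + x)) \<le> J i * T n"
        proof (cases "i = 0")
          case True
          have "L2_norm (\<lambda>x. jet F F1 i x / complex_of_real (1 + x)) \<le> J i * T 1" using w0 True by (simp add: jet_def J_def)
          also have "\<dots> \<le> J i * T n" using n by (intro mult_left_mono J0 Tmono) simp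
          finally show ?thesis .
        next
          case False
          have "L2_norm (\<lambda>x. jet F F1 i x / complex_of_real (1 + x)) \<le> L2_norm (jet F F1 i)"
            by (intro continuous_weighted_L2(2) jet_L2 F(2))
          also have "\<dots> \<le> J i * T i" using False by (intro jT) simp
          also have "\<dots> \<le> J i * T n" using i by (intro mult_left_mono J0 Tmono) simp
          finally show ?thesis .
        qed
      qed
    qed (use F(2) jT n in auto)
    show ?thesis
      using tower_elliptic[of F F1, OF F(2)] elliptic_L2[of F F1, OF F(2)] ebd F(1)
      by (intro exI[of _ "elliptic F F1"]) (simp add: elliptic_0 T_def)
  qed
  then show ?thesis using c0 by (intro exI[of _ c]) blast
qed

end

section \<open>Schwartz data and inverse square potentials\<close>

lemma inverse_square_integrable:
  fixes F :: "real \<Rightarrow> complex"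
  assumes c: "continuous_on {0..} F" and le: "\<And>x. 0 \<le> x \<Longrightarrow> cmod (F x) \<le> K / (1 + x)\<^sup>2"
  shows "integrable halfline (\<lambda>x. cmod (F x))" "F \<in> L2"
proof -
  define w where "w x = 1 / ((1 + x) * sqrt (1 + x))" for x :: real
  have w: "1 / (1 + x)\<^sup>2 \<le> w x" "w x \<le> 1" "0 \<le> w x" if "0 \<le> x" for x
  proof -
    have s: "sqrt (1 + x) \<le> 1 + x" using that by (intro real_le_lsqrt) (auto simp: power2_eq_square algebra_simps)
    have "1 \<le> (1 + x) * sqrt (1 + x)" using that mult_mono[of 1 "1 + x" 1 "sqrt (1 + x)"] by simp
    then show "w x \<le> 1" by (simp add: w_def)
    show "1 / (1 + x)\<^sup>2 \<le> w x"
      unfolding w_def power2_eq_square using that s by (intro divide_left_mono mult_left_mono mult_pos_pos) auto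
    show "0 \<le> w x" using that by (simp add: w_def)
  qed
  have iw: "integrable halfline w" using inv_sqrt_cube_integral(1) by (simp add: w_def[abs_def])
  have K0: "0 \<le> K" using order_trans[OF norm_ge_zero le[of 0]] by simp
  have m: "F \<in> borel_measurable halfline" by (rule continuous_halfline_measurable[OF c])
  have b: "cmod (F x) \<le> K * w x" if "0 \<le> x" for x
    using le[OF that] mult_left_mono[OF w(1)[OF that] K0] by simp
  show "integrable halfline (\<lambda>x. cmod (F x))"
  proof (rule Bochner_Integration.integrable_bound[OF integrable_mult_right[OF iw, of K]])
    show "(\<lambda>x. cmod (F x)) \<in> borel_measurable halfline" using m by measurable
    have "norm (cmod (F x)) \<le> norm (K * w x)" if "0 \<le> x" for x
      using b[OF that] abs_ge_self[of "K * w x"] by simp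
    then show "AE x in halfline. norm (cmod (F x)) \<le> norm (K * w x)" by (intro AE_I2) simp
  qed
  have "integrable halfline (\<lambda>x. (cmod (F x))\<^sup>2)"
  proof (rule Bochner_Integration.integrable_bound[OF integrable_mult_right[OF iw, of "K\<^sup>2"]])
    show "(\<lambda>x. (cmod (F x))\<^sup>2) \<in> borel_measurable halfline" using m by measurable
    have "(cmod (F x))\<^sup>2 \<le> K\<^sup>2 * w x" if x: "0 \<le> x" for x
    proof -
      have "(cmod (F x))\<^sup>2 \<le> (K * w x)\<^sup>2" using b[OF x] by (intro power_mono) auto
      also have "\<dots> = K\<^sup>2 * (w x * w x)" by (simp add: power2_eq_square)
      also have "\<dots> \<le> K\<^sup>2 * (1 * w x)" using w[OF x] by (intro mult_left_mono mult_right_mono) auto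
      finally show ?thesis by simp
    qed
    then show "AE x in halfline. norm ((cmod (F x))\<^sup>2) \<le> norm (K\<^sup>2 * w x)"
      using w(3) by (intro AE_I2) (simp add: abs_mult)
  qed
  then show "F \<in> L2" using m by (simp add: L2_def)
qed

lemma schwartz_tower: "f \<in> schwartz \<Longrightarrow> tower UNIV (\<lambda>n. nth_deriv UNIV n f)"
  by (rule tower_smooth_on) (simp add: schwartz_def)

lemma schwartz_halfline:
  assumes f: "f \<in> schwartz"
  shows "integrable halfline (\<lambda>x. cmod (nth_deriv UNIV n f x))" "nth_deriv UNIV n f \<in> L2"
proof -
  have ex: "\<exists>K. \<forall>x. \<bar>x\<bar> ^ m * cmod (nth_deriv UNIV n f x) \<le> K" for m using f by (simp add: schwartz_def)
  obtain K0 where K0: "\<And>x. cmod (nth_deriv UNIV n f x) \<le> K0" using ex[of 0] by auto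
  obtain K2 where K2: "\<And>x. \<bar>x\<bar>\<^sup>2 * cmod (nth_deriv UNIV n f x) \<le> K2" using ex[of 2] by auto
  have le: "cmod (nth_deriv UNIV n f x) \<le> (2 * K0 + 2 * K2) / (1 + x)\<^sup>2" if x: "0 \<le> x" for x
  proof -
    have "(1 + x)\<^sup>2 \<le> 2 + 2 * \<bar>x\<bar>\<^sup>2" using sum_squares_bound[of 1 x] by (simp add: power2_sum)
    then have "(1 + x)\<^sup>2 * cmod (nth_deriv UNIV n f x) \<le> (2 + 2 * \<bar>x\<bar>\<^sup>2) * cmod (nth_deriv UNIV n f x)"
      by (intro mult_right_mono) auto
    also have "\<dots> \<le> 2 * K0 + 2 * K2" using K0[of x] K2[of x] by (simp add: algebra_simps)
    finally show ?thesis using x by (simp add: field_simps)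
  qed
  have "continuous_on {0..} (nth_deriv UNIV n f)"
    by (rule tower_continuous[OF tower_subset[OF schwartz_tower[OF f]]]) simp
  from inverse_square_integrable[OF this le]
  show "integrable halfline (\<lambda>x. cmod (nth_deriv UNIV n f x))" "nth_deriv UNIV n f \<in> L2" by simp_all
qed

text \<open>The reflected family with signs (-1)^n is a second tower over the same even function, so
  it coincides with the first; at 0 an odd derivative equals its own negative.\<close>

lemma even_odd_deriv_0:
  assumes T: "tower UNIV (\<lambda>n. nth_deriv UNIV n f)" and e: "even_fun f" and n: "odd n"
  shows "nth_deriv UNIV n f 0 = 0"
proof -
  define B where "B n x = (- 1) ^ n * nth_deriv UNIV n f (- x)" for n x
  have "(B n has_vector_derivative B (Suc n) x) (at x)" for n x
  proof -
    have "((nth_deriv UNIV n f \<circ> uminus) has_vector_derivative (- 1) *\<^sub>R nth_deriv UNIV (Suc n) f (- x)) (at x)"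
      by (rule vector_diff_chain_at) (use towerD[OF T, of "- x" n] in \<open>auto intro!: derivative_eq_intros simp: has_vector_derivative_def\<close>)
    then show ?thesis
      unfolding B_def o_def by (auto intro!: derivative_eq_intros)
  qed
  then have tB: "tower UNIV B" by (simp add: tower_def)
  have "f x = B 0 x" for x using e by (simp add: B_def nth_deriv_def even_fun_def)
  then have "nth_deriv UNIV n f 0 = B n 0" by (intro nth_deriv_tower[OF _ tB]) auto
  then show ?thesis using n by (simp add: B_def)
qed

lemma (in potential) schwartz_dtower:
  assumes "f \<in> schwartz" "even_fun f" shows "dtower (\<lambda>n. nth_deriv UNIV n f)"
  unfolding dtower_def
  using tower_subset[OF schwartz_tower[OF assms(1)]] schwartz_halfline(2)[OF assms(1)]
    even_odd_deriv_0[OF schwartz_tower[OF assms(1)] assms(2)] by simp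

section \<open>From the hypotheses on V to the locale \<open>potential\<close>\<close>

lemma tower_inverse_square:
  "tower {1<..} (\<lambda>k x. (- 1) ^ k * fact (k + 1) / x ^ (k + 2) :: real)"
  unfolding tower_def
proof (intro allI ballI)
  fix k and x :: real assume x: "x \<in> {1<..}"
  have "((\<lambda>x. inverse (x ^ (k + 2))) has_real_derivative
      - (inverse (x ^ (k + 2)) * (real (k + 2) * x ^ (k + 1)) * inverse (x ^ (k + 2)))) (at x)"
    by (rule DERIV_inverse') (use x DERIV_pow[of "k + 2" x] in simp_all)
  also have "inverse (x ^ (k + 2)) * (real (k + 2) * x ^ (k + 1)) * inverse (x ^ (k + 2)) = real (k + 2) / x ^ (k + 3)"
    using x by (simp add: field_simps power_add power2_eq_square power3_eq_cube)
  finally have "((\<lambda>x. (- 1) ^ k * fact (k + 1) * inverse (x ^ (k + 2))) has_real_derivative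
      (- 1) ^ k * fact (k + 1) * - (real (k + 2) / x ^ (k + 3))) (at x)"
    by (rule DERIV_cmult)
  also have "(- 1) ^ k * fact (k + 1) * - (real (k + 2) / x ^ (k + 3)) = (- 1) ^ Suc k * fact (Suc k + 1) / x ^ (Suc k + 2)"
  proof -
    have "fact (Suc k + 1) = real (k + 2) * fact (k + 1)" using fact_Suc[of "Suc k", where 'a = real] by simp
    moreover have "a * F * - (n / X) = - 1 * a * (n * F) / X" for a F n X :: real by simp
    moreover have "Suc k + 2 = k + 3" by simp
    ultimately show ?thesis by (simp only: power_Suc)
  qed
  finally have "((\<lambda>x. (- 1) ^ k * fact (k + 1) / x ^ (k + 2)) has_real_derivative (- 1) ^ Suc k * fact (Suc k + 1) / x ^ (Suc k + 2)) (at x)"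
    by (simp only: divide_inverse)
  then show "((\<lambda>x. (- 1) ^ k * fact (k + 1) / x ^ (k + 2)) has_vector_derivative (- 1) ^ Suc k * fact (Suc k + 1) / x ^ (Suc k + 2)) (at x within {1<..})"
    using has_real_derivative_iff_has_vector_derivative has_vector_derivative_at_within by blast
qed

text \<open>Beyond 1 the potential is the product of 1/x^2 and -(1 + r)/4; all derivatives of the
  first factor are O(1/x^2) and those of the second are bounded, so the product rule gives O(1/x^2)
  for every order. On [0,1] continuity suffices.\<close>

lemma perturbed_inverse_square_decay:
  fixes V r :: "real \<Rightarrow> real"
  assumes V_smooth: "smooth_on {0..} V" and \<alpha>: "0 < \<alpha>"
    and V_eq: "\<And>x. x \<ge> 1 \<Longrightarrow> V x = - (1/4) * (1 / x\<^sup>2) * (1 + r x)"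
    and r_smooth: "smooth_on {1..} r"
    and r_bound: "\<And>k x. x \<ge> 1 \<Longrightarrow> \<bar>nth_deriv {1..} k r x\<bar> \<le> c k * x powr (- \<alpha> - real k)"
  shows "\<exists>K. \<forall>x\<ge>0. \<bar>nth_deriv {0..} n V x\<bar> \<le> K / (1 + x)\<^sup>2"
proof -
  define W where "W k x = (- 1) ^ k * fact (k + 1) / x ^ (k + 2)" for k and x :: real
  define R where "R k x = (if k = 0 then - (1/4) else 0) + - (1/4) * nth_deriv {1..} k r x" for k x
  have tV: "tower {0..} (\<lambda>n. nth_deriv {0..} n V)" by (rule tower_smooth_on[OF V_smooth])
  have tr: "tower {1<..} (\<lambda>n. nth_deriv {1..} n r)"
    by (rule tower_subset[OF tower_smooth_on[OF r_smooth]]) auto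
  have tR: "tower {1<..} R"
    unfolding tower_def R_def
  proof (intro allI ballI)
    fix k and x :: real assume "x \<in> {1<..}"
    then show "((\<lambda>x. (if k = 0 then - (1/4) else 0) + - (1/4) * nth_deriv {1..} k r x) has_vector_derivative
        (if Suc k = 0 then - (1/4) else 0) + - (1/4) * nth_deriv {1..} (Suc k) r x) (at x within {1<..})"
      using towerD[OF tr] by (auto intro!: derivative_eq_intros)
  qed
  have tW: "tower {1<..} W" unfolding W_def[abs_def] by (rule tower_inverse_square)
  have tL: "tower {1<..} (\<lambda>n. leibniz n W R)"
    by (rule tower_leibniz[OF tW tR])
  have nt: "at x within {1<..} \<noteq> bot" if "x \<in> {1<..}" for x :: real
    using at_within_open[OF that open_greaterThan] by simp
  have eq0: "V y = leibniz 0 W R y" if "1 < y" for y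
    using that V_eq[of y] by (simp add: W_def R_def nth_deriv_def field_simps power2_eq_square)
  have eq: "nth_deriv {0..} n V x = leibniz n W R x" if x: "1 < x" for x
  proof -
    \<comment> \<open>Derivatives of V are one-sided at 0 and those of r at 1; on the open half-line
      beyond 1 both towers restrict, and derivatives are unique.\<close>
    have "nth_deriv {1<..} n V x = nth_deriv {0..} n V x"
      by (rule nth_deriv_tower[OF nt tower_subset[OF tV]]) (use x in \<open>auto simp: nth_deriv_def\<close>)
    moreover have "nth_deriv {1<..} n V x = leibniz n W R x"
      by (rule nth_deriv_tower[OF nt tL]) (use x eq0 in auto)
    ultimately show ?thesis by simp
  qed
  define b where "b = 1 + (\<Sum>i\<le>n. \<bar>c i\<bar>)"
  define Q where "Q = 2 ^ n * (fact (n + 1) * b)"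
  have Q0: "0 \<le> Q" by (simp add: Q_def b_def sum_nonneg)
  have far: "\<bar>nth_deriv {0..} n V x\<bar> \<le> 4 * Q / (1 + x)\<^sup>2" if x: "1 < x" for x
  proof -
    have "norm (leibniz n W R x) \<le> 2 ^ n * (fact (n + 1) / x\<^sup>2 * b)"
    proof (rule leibniz_bound)
      fix i assume i: "i \<le> n"
      have "norm (W i x) = fact (i + 1) / x ^ (i + 2)" using x by (simp add: W_def abs_mult power_abs)
      also have "\<dots> \<le> fact (n + 1) / x\<^sup>2"
        using x i by (intro frac_le fact_mono power_increasing) auto
      finally show "norm (W i x) \<le> fact (n + 1) / x\<^sup>2" .
      have "x powr (- \<alpha> - real i) \<le> x powr 0" using x \<alpha> by (intro powr_mono) auto
      then have p: "x powr (- \<alpha> - real i) \<le> 1" using x by simp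
      have "\<bar>nth_deriv {1..} i r x\<bar> \<le> c i * x powr (- \<alpha> - real i)" using x by (intro r_bound) simp
      also have "\<dots> \<le> \<bar>c i\<bar> * 1" using p by (intro mult_mono) auto
      also have "\<dots> \<le> (\<Sum>i\<le>n. \<bar>c i\<bar>)" using member_le_sum[of i "{..n}" "\<lambda>i. \<bar>c i\<bar>"] i by simp
      finally have s: "\<bar>nth_deriv {1..} i r x\<bar> \<le> (\<Sum>i\<le>n. \<bar>c i\<bar>)" .
      have "norm (R i x) \<le> 1/4 + 1/4 * \<bar>nth_deriv {1..} i r x\<bar>"
        unfolding R_def real_norm_def by (rule order_trans[OF abs_triangle_ineq]) (simp add: abs_mult)
      then show "norm (R i x) \<le> b" using s unfolding b_def by linarith
    qed
    also have "\<dots> = Q / x\<^sup>2" by (simp add: Q_def)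
    also have "\<dots> \<le> Q / ((1 + x) / 2)\<^sup>2" using x Q0 by (intro divide_left_mono power_mono mult_pos_pos) auto
    also have "\<dots> = 4 * Q / (1 + x)\<^sup>2" by (simp add: power_divide)
    finally show ?thesis using eq[OF x] by simp
  qed
  have "compact (nth_deriv {0..} n V ` {0..1})"
    by (rule compact_continuous_image[OF continuous_on_subset[OF tower_continuous[OF tV, of n]]]) auto
  then have "bounded (nth_deriv {0..} n V ` {0..1})" by (rule compact_imp_bounded)
  then obtain B where "\<forall>y\<in>nth_deriv {0..} n V ` {0..1}. norm y \<le> B" unfolding bounded_iff by blast
  then have B: "\<bar>nth_deriv {0..} n V x\<bar> \<le> B" if "x \<in> {0..1}" for x using that by simp
  have B0: "0 \<le> B" using B[of 0] by simp
  have "\<bar>nth_deriv {0..} n V x\<bar> \<le> (4 * B + 4 * Q) / (1 + x)\<^sup>2" if x: "0 \<le> x" for x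
  proof (cases "x \<le> 1")
    case True
    have "(1 + x)\<^sup>2 \<le> 2\<^sup>2" using x True by (intro power_mono) auto
    then have "B * (1 + x)\<^sup>2 \<le> B * 4" using B0 by (intro mult_left_mono) auto
    then have "B \<le> (4 * B + 4 * Q) / (1 + x)\<^sup>2" using x Q0 by (simp add: field_simps)
    then show ?thesis using B[of x] x True by simp
  next
    case False
    have "4 * Q / (1 + x)\<^sup>2 \<le> (4 * B + 4 * Q) / (1 + x)\<^sup>2" using B0 by (intro divide_right_mono) auto
    then show ?thesis using far[of x] False by linarith
  qed
  then show ?thesis by blast
qed

lemma perturbed_inverse_square_potential:
  fixes V r :: "real \<Rightarrow> real"
  assumes V_smooth: "smooth_on {0..} V" and \<alpha>: "0 < \<alpha>"
    and V_eq: "\<And>x. x \<ge> 1 \<Longrightarrow> V x = - (1/4) * (1 / x\<^sup>2) * (1 + r x)"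
    and r_smooth: "smooth_on {1..} r"
    and r_bound: "\<And>k x. x \<ge> 1 \<Longrightarrow> \<bar>nth_deriv {1..} k r x\<bar> \<le> c k * x powr (- \<alpha> - real k)"
    and V_odd: "\<And>j::nat. nth_deriv {0..} (2 * j + 1) V 0 = 0"
  shows "\<exists>K x1. potential (\<lambda>n. nth_deriv {0..} n V) K x1"
proof -
  have "\<exists>K. \<forall>n. \<forall>x\<ge>0. \<bar>nth_deriv {0..} n V x\<bar> \<le> K n / (1 + x)\<^sup>2"
    by (rule choice) (use perturbed_inverse_square_decay[OF V_smooth \<alpha> V_eq r_smooth r_bound] in blast)
  then obtain K where K: "\<And>n x. 0 \<le> x \<Longrightarrow> \<bar>nth_deriv {0..} n V x\<bar> \<le> K n / (1 + x)\<^sup>2" by blast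
  \<comment> \<open>Beyond this point x^\<alpha> is at least 16 |c 0| + 1, so |r| \<le> 1/16 and the
    deviation |x^2 V + 1/4| = |r|/4 is at most 1/64.\<close>
  define x1 where "x1 = max 1 ((16 * \<bar>c 0\<bar> + 1) powr (1 / \<alpha>))"
  have crit: "\<bar>x\<^sup>2 * V x + 1 / 4\<bar> \<le> 1 / 64" if x: "x1 \<le> x" for x
  proof -
    have x1: "1 \<le> x" "(16 * \<bar>c 0\<bar> + 1) powr (1 / \<alpha>) \<le> x" using x by (simp_all add: x1_def)
    have "((16 * \<bar>c 0\<bar> + 1) powr (1 / \<alpha>)) powr \<alpha> \<le> x powr \<alpha>" using x1 \<alpha> by (intro powr_mono2) auto
    then have big: "16 * \<bar>c 0\<bar> + 1 \<le> x powr \<alpha>" using \<alpha> by (simp add: powr_powr)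
    have "\<bar>r x\<bar> \<le> c 0 * x powr - \<alpha>" using r_bound[OF x1(1), of 0] by (simp add: nth_deriv_def)
    also have "\<dots> \<le> \<bar>c 0\<bar> * x powr - \<alpha>" by (intro mult_right_mono) auto
    also have "\<dots> = \<bar>c 0\<bar> / x powr \<alpha>" by (simp add: powr_minus divide_inverse)
    also have "\<dots> \<le> 1 / 16"
    proof -
      have "0 < x powr \<alpha>" using x1 by simp
      then show ?thesis using big by (simp add: field_simps)
    qed
    finally have "\<bar>r x\<bar> \<le> 1 / 16" .
    moreover have "x\<^sup>2 * V x + 1 / 4 = - (r x / 4)" using V_eq[OF x1(1)] x1(1) by (simp add: field_simps)
    ultimately show ?thesis by simp
  qed
  have "potential (\<lambda>n. nth_deriv {0..} n V) K x1"
  proof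
    show "tower {0..} (\<lambda>n. nth_deriv {0..} n V)" by (rule tower_smooth_on[OF V_smooth])
    show "nth_deriv {0..} n V 0 = 0" if "odd n" for n using that V_odd by (elim oddE) simp
    show "\<bar>x\<^sup>2 * nth_deriv {0..} 0 V x + 1 / 4\<bar> \<le> 1 / 64" if "x1 \<le> x" for x
      using crit[OF that] by (simp add: nth_deriv_def)
  qed (use K in \<open>auto simp: x1_def\<close>)
  then show ?thesis by blast
qed

section \<open>Assembly of the estimate\<close>

lemma sinc_multiplier:
  fixes t :: real
  defines "\<phi> \<equiv> \<lambda>l. if l = 0 then t else sin (t * sqrt l) / sqrt l"
  shows "\<phi> \<in> borel_measurable borel" "\<bar>\<phi> l\<bar> \<le> \<bar>t\<bar>" "l \<noteq> 0 \<Longrightarrow> \<bar>\<phi> l\<bar> \<le> 1 / sqrt \<bar>l\<bar>"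
proof -
  show "\<phi> \<in> borel_measurable borel" unfolding \<phi>_def by measurable
  have s: "\<bar>sqrt l\<bar> = sqrt \<bar>l\<bar>" by (cases "0 \<le> l") (auto simp: abs_if real_sqrt_minus)
  show "\<bar>\<phi> l\<bar> \<le> \<bar>t\<bar>"
  proof (cases "l = 0")
    case False
    have "\<bar>sin (t * sqrt l)\<bar> \<le> \<bar>t\<bar> * sqrt \<bar>l\<bar>" using abs_sin_x_le_abs_x[of "t * sqrt l"] by (simp add: abs_mult s)
    then show ?thesis using False by (simp add: \<phi>_def s field_simps)
  qed (simp add: \<phi>_def)
  show "\<bar>\<phi> l\<bar> \<le> 1 / sqrt \<bar>l\<bar>" if "l \<noteq> 0"
    using that by (simp add: \<phi>_def s divide_right_mono)
qed

lemma schwartz_sobolev: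
  assumes f: "f \<in> schwartz" and i: "i \<le> k"
  shows "L2_norm (nth_deriv UNIV i f) \<le> sobolev_norm k f"
proof -
  have T: "tower {0..} (\<lambda>n. nth_deriv UNIV n f)" by (rule tower_subset[OF schwartz_tower[OF f]]) simp
  have "sobolev_norm k f = sqrt (\<Sum>j\<le>k. (L2_norm (nth_deriv UNIV (0 + j) f))\<^sup>2)"
    by (rule sobolev_tower(2)[OF T]) (auto simp: nth_deriv_def[of _ 0] schwartz_halfline(2)[OF f])
  also have "\<dots> = L2_set (\<lambda>j. L2_norm (nth_deriv UNIV j f)) {..k}" by (simp add: L2_set_def)
  finally show ?thesis using member_le_L2_set[of "{..k}" i "\<lambda>j. L2_norm (nth_deriv UNIV j f)"] i by simp
qed

theorem lemma4p7:
  fixes V r :: "real \<Rightarrow> real" and \<alpha> :: real and c :: "nat \<Rightarrow> real"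
  assumes V_smooth: "smooth_on {0..} V"
    and \<alpha>_pos: "\<alpha> > 0"
    and V_eq: "\<And>x. x \<ge> 1 \<Longrightarrow> V x = - (1/4) * (1 / x\<^sup>2) * (1 + r x)"
    and r_smooth: "smooth_on {1..} r"
    and r_bound: "\<And>k x. x \<ge> 1 \<Longrightarrow> \<bar>nth_deriv {1..} k r x\<bar> \<le> c k * x powr (- \<alpha> - real k)"
    and no_neg_eigenvalue:
      "\<not> (\<exists>(E::real) (h::real \<Rightarrow> complex). E < 0 \<and> h \<in> L2 \<and> smooth_on {0..} h \<and>
           (\<exists>x\<ge>0. h x \<noteq> 0) \<and> nth_deriv {0..} 1 h 0 = 0 \<and>
           (\<forall>x\<ge>0. - nth_deriv {0..} 2 h x + complex_of_real (V x) * h x = complex_of_real E * h x))"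
    and V_odd_derivs: "\<And>j::nat. nth_deriv {0..} (2 * j + 1) V 0 = 0"
  shows "\<exists>C :: nat \<Rightarrow> real. (\<forall>k. C k > 0) \<and>
    (\<forall>f g u. f \<in> schwartz \<and> even_fun f \<and> g \<in> schwartz \<and> even_fun g \<and>
        wave_solution (schroedinger_op V) f g u \<longrightarrow>
      (\<forall>t\<ge>0. \<forall>k. \<exists>w. has_weak_deriv 1 (u t) w \<and> w \<in> sobolev k \<and>
        sobolev_norm k w \<le> C k * (sobolev_norm (1 + k) f + sobolev_norm k g + L1_norm g)))"
proof -
  define Vt where "Vt = (\<lambda>n. nth_deriv {0..} n V)"
  have Vt0: "Vt 0 = V" by (simp add: Vt_def nth_deriv_def)
  obtain K x1 where "potential Vt K x1"
    using perturbed_inverse_square_potential[OF V_smooth \<alpha>_pos V_eq r_smooth r_bound V_odd_derivs]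
    unfolding Vt_def by blast
  then interpret potential Vt K x1 .
  obtain a where a0: "\<And>n. 0 \<le> a n" and a: "\<And>E \<Phi> \<phi> p. schroedinger Vt K x1 E \<Longrightarrow> dtower \<Phi> \<Longrightarrow>
      \<phi> \<in> borel_measurable borel \<Longrightarrow> (\<forall>l. \<bar>\<phi> l\<bar> \<le> 1) \<Longrightarrow> p \<in> L2 \<Longrightarrow> (\<Phi> 0, p) \<in> spectral_integral E \<phi> \<Longrightarrow>
      \<exists>Z. tower {0..} Z \<and> L2_eq (Z 0) p \<and> (\<forall>n. Z n \<in> L2 \<and> L2_norm (Z n) \<le> a n * (\<Sum>i\<le>n. L2_norm (\<Phi> i)))"
    using cos_bound by blast
  obtain b where b0: "\<And>n. 0 \<le> b n" and b: "\<And>E \<Phi> \<phi> k p. schroedinger Vt K x1 E \<Longrightarrow> dtower \<Phi> \<Longrightarrow>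
      integrable halfline (\<lambda>x. cmod (\<Phi> 0 x)) \<Longrightarrow> \<phi> \<in> borel_measurable borel \<Longrightarrow> (\<forall>l. \<bar>\<phi> l\<bar> \<le> k) \<Longrightarrow>
      (\<forall>l. l \<noteq> 0 \<longrightarrow> \<bar>\<phi> l\<bar> \<le> 1 / sqrt \<bar>l\<bar>) \<Longrightarrow> p \<in> L2 \<Longrightarrow> (\<Phi> 0, p) \<in> spectral_integral E \<phi> \<Longrightarrow>
      \<exists>Z. tower {0..} Z \<and> L2_eq (Z 0) p \<and>
        (\<forall>n. Z n \<in> L2 \<and> (0 < n \<longrightarrow> L2_norm (Z n) \<le> b n * ((\<Sum>i<n. L2_norm (\<Phi> i)) + L1_norm (\<Phi> 0))))"
    using sin_bound by blast
  \<comment> \<open>For each derivative order 1 + j at most k + 2 norms of the data are summed, each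
    bounded by the total data norm; the leading 1 makes the constant positive.\<close>
  define C where "C k = 1 + (\<Sum>j\<le>k. (a (1 + j) + b (1 + j)) * (real k + 2))" for k
  have C_pos: "0 < C k" for k
  proof -
    have "0 \<le> (\<Sum>j\<le>k. (a (1 + j) + b (1 + j)) * (real k + 2))" using a0 b0 by (intro sum_nonneg) simp
    then show ?thesis by (simp add: C_def)
  qed
  have spectral: "\<exists>E. schroedinger Vt K x1 E \<and> h \<in> L2 \<and> (f, h) \<in> spectral_integral E \<phi>"
    if fo: "function_of_op (schroedinger_op V) \<phi> f h" for \<phi> f h
  proof -
    obtain E where E: "projection_valued_measure E" "schroedinger_op V = spectral_integral E (\<lambda>l. l)"
        "(f, h) \<in> spectral_integral E \<phi>"
      using fo unfolding function_of_op_def spectral_resolution_def by blast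
    have "schroedinger Vt K x1 E"
      using E by unfold_locales (simp_all add: Vt0)
    then show ?thesis using E(3) by (intro exI[of _ E]) (simp add: spectral_integral_def)
  qed
  have main: "\<exists>w. has_weak_deriv 1 (u t) w \<and> w \<in> sobolev k \<and>
        sobolev_norm k w \<le> C k * (sobolev_norm (1 + k) f + sobolev_norm k g + L1_norm g)"
    if f: "f \<in> schwartz" "even_fun f" and g: "g \<in> schwartz" "even_fun g"
      and u: "wave_solution (schroedinger_op V) f g u" and t: "0 \<le> t" for f g u t k
  proof -
    define \<Phi> where "\<Phi> = (\<lambda>n. nth_deriv UNIV n f)"
    define \<Psi> where "\<Psi> = (\<lambda>n. nth_deriv UNIV n g)"
    have 0: "\<Phi> 0 = f" "\<Psi> 0 = g" by (simp_all add: \<Phi>_def \<Psi>_def nth_deriv_def)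
    have D: "dtower \<Phi>" "dtower \<Psi>" unfolding \<Phi>_def \<Psi>_def using f g by (auto intro: schwartz_dtower)
    obtain p q where p: "function_of_op (schroedinger_op V) (\<lambda>l. cos (t * sqrt l)) f p"
      and q: "function_of_op (schroedinger_op V) (\<lambda>l. if l = 0 then t else sin (t * sqrt l) / sqrt l) g q"
      and pq: "L2_eq (u t) (\<lambda>x. p x + q x)"
      using u t unfolding wave_solution_def by blast
    obtain E where E: "schroedinger Vt K x1 E" "p \<in> L2" "(\<Phi> 0, p) \<in> spectral_integral E (\<lambda>l. cos (t * sqrt l))"
      using spectral[OF p] 0 by auto
    \<comment> \<open>The resolution for the sine part is obtained separately and need not be the
      same function as \<open>E\<close>; the constants do not depend on either.\<close>
    obtain E' where E': "schroedinger Vt K x1 E'" "q \<in> L2"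
        "(\<Psi> 0, q) \<in> spectral_integral E' (\<lambda>l. if l = 0 then t else sin (t * sqrt l) / sqrt l)"
      using spectral[OF q] 0 by auto
    obtain X where X: "tower {0..} X" "L2_eq (X 0) p" "\<And>n. X n \<in> L2"
        "\<And>n. L2_norm (X n) \<le> a n * (\<Sum>i\<le>n. L2_norm (\<Phi> i))"
      using a[OF E(1) D(1) _ _ E(2,3)] by auto
    have i1: "integrable halfline (\<lambda>x. cmod (\<Psi> 0 x))" unfolding \<Psi>_def by (rule schwartz_halfline(1)[OF g(1)])
    have m1: "\<forall>l. \<bar>if l = 0 then t else sin (t * sqrt l) / sqrt l\<bar> \<le> \<bar>t\<bar>"
      by (intro allI sinc_multiplier(2))
    have m2: "\<forall>l. l \<noteq> 0 \<longrightarrow> \<bar>if l = 0 then t else sin (t * sqrt l) / sqrt l\<bar> \<le> 1 / sqrt \<bar>l\<bar>"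
      by (intro allI impI sinc_multiplier(3))
    obtain Y where Y: "tower {0..} Y" "L2_eq (Y 0) q" "\<And>n. Y n \<in> L2"
        "\<And>n. 0 < n \<Longrightarrow> L2_norm (Y n) \<le> b n * ((\<Sum>i<n. L2_norm (\<Psi> i)) + L1_norm (\<Psi> 0))"
      using b[OF E'(1) D(2) i1 sinc_multiplier(1) m1 m2 E'(2,3)] by blast
    \<comment> \<open>A tower of classical derivatives of u(t). Its entry 1 is the gradient, so the
      norm in question involves orders from 1 on only, as \<open>sin_bound\<close> requires.\<close>
    define Z where "Z n x = X n x + Y n x" for n x
    have tZ: "tower {0..} Z" unfolding Z_def[abs_def] by (rule tower_add[OF X(1) Y(1)])
    have ZL: "Z n \<in> L2" for n unfolding Z_def[abs_def] by (intro L2_add X Y)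
    have uZ: "AE x in halfline. Z 0 x = u t x"
      using X(2) Y(2) pq unfolding L2_eq_def by eventually_elim (simp add: Z_def)
    have "has_weak_deriv 1 (u t) (Z (0 + 1))" by (rule has_weak_deriv_tower[OF tZ uZ])
    then have wd: "has_weak_deriv 1 (u t) (Z 1)" by simp
    have sob: "Z 1 \<in> sobolev k" "sobolev_norm k (Z 1) = sqrt (\<Sum>j\<le>k. (L2_norm (Z (1 + j)))\<^sup>2)"
      using sobolev_tower[OF tZ, of 1 "Z 1" k] ZL by auto
    define N where "N = sobolev_norm (1 + k) f + sobolev_norm k g + L1_norm g"
    have nf: "L2_norm (\<Phi> i) \<le> sobolev_norm (1 + k) f" if "i \<le> 1 + k" for i
      unfolding \<Phi>_def by (rule schwartz_sobolev[OF f(1) that])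
    have ng: "L2_norm (\<Psi> i) \<le> sobolev_norm k g" if "i \<le> k" for i
      unfolding \<Psi>_def by (rule schwartz_sobolev[OF g(1) that])
    have s0: "0 \<le> sobolev_norm (1 + k) f" "0 \<le> sobolev_norm k g" "0 \<le> L1_norm g"
      by (simp_all add: sobolev_norm_def sum_nonneg L1_norm_def)
    have N0: "0 \<le> N" using s0 by (simp add: N_def)
    have Zj: "L2_norm (Z (1 + j)) \<le> (a (1 + j) + b (1 + j)) * (real k + 2) * N" if j: "j \<le> k" for j
    proof -
      have "(\<Sum>i\<le>1+j. L2_norm (\<Phi> i)) \<le> (\<Sum>i\<le>1+j. N)"
      proof (rule sum_mono)
        fix i assume "i \<in> {..1+j}"
        then have "L2_norm (\<Phi> i) \<le> sobolev_norm (1 + k) f" using j by (intro nf) simp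
        then show "L2_norm (\<Phi> i) \<le> N" using s0 unfolding N_def by linarith
      qed
      also have "\<dots> = (real j + 2) * N" by simp
      also have "\<dots> \<le> (real k + 2) * N" using j by (intro mult_right_mono N0) simp
      finally have 1: "L2_norm (X (1 + j)) \<le> a (1 + j) * ((real k + 2) * N)"
        by (intro order_trans[OF X(4)] mult_left_mono a0)
      have "(\<Sum>i<1+j. L2_norm (\<Psi> i)) \<le> (\<Sum>i<1+j. N)"
      proof (rule sum_mono)
        fix i assume "i \<in> {..<1+j}"
        then have "L2_norm (\<Psi> i) \<le> sobolev_norm k g" using j by (intro ng) simp
        then show "L2_norm (\<Psi> i) \<le> N" using s0 unfolding N_def by linarith
      qed
      also have "\<dots> = (real j + 1) * N" by simp
      also have "\<dots> \<le> (real k + 1) * N" using j by (intro mult_right_mono N0) simp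
      finally have "(\<Sum>i<1+j. L2_norm (\<Psi> i)) + L1_norm (\<Psi> 0) \<le> (real k + 2) * N"
        using s0 by (simp add: 0 N_def algebra_simps)
      then have 2: "L2_norm (Y (1 + j)) \<le> b (1 + j) * ((real k + 2) * N)"
        by (intro order_trans[OF Y(4)] mult_left_mono b0) simp_all
      have "L2_norm (Z (1 + j)) \<le> L2_norm (X (1 + j)) + L2_norm (Y (1 + j))"
        unfolding Z_def[abs_def] by (rule L2_norm_triangle[OF X(3) Y(3)])
      then show ?thesis using 1 2 by (simp add: algebra_simps)
    qed
    have "sobolev_norm k (Z 1) = L2_set (\<lambda>j. L2_norm (Z (1 + j))) {..k}" unfolding L2_set_def by (rule sob(2))
    also have "\<dots> \<le> (\<Sum>j\<le>k. L2_norm (Z (1 + j)))" by (intro L2_set_le_sum L2_norm_nonneg)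
    also have "\<dots> \<le> (\<Sum>j\<le>k. (a (1 + j) + b (1 + j)) * (real k + 2) * N)" by (intro sum_mono Zj) simp
    also have "\<dots> = (C k - 1) * N" by (simp add: C_def sum_distrib_right)
    also have "\<dots> \<le> C k * N" using N0 by (simp add: algebra_simps)
    finally show ?thesis using wd sob(1) unfolding N_def by blast
  qed
  show ?thesis
    by (intro exI[of _ C] conjI allI impI C_pos) (use main in blast)
qed

end
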